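(* Let $\Omega\subseteq M$ be a p-symmetric slice domain and $f:\Omega\to\mathbb{A}$ a (left) generalized partial-slice monogenic function of type $(p,q)$. Then, for odd $q\in\mathbb{N}$, $$\Delta_{\mathbf{x}}^{\frac{q-1}{2}}f(\mathbf{x})=\gamma_q\,GCK\big[\Delta_{\mathbf{x}_p}^{\frac{q-1}{2}}f(\mathbf{x}_p)\big](\mathbf{x}),\qquad \gamma_q=(-1)^{\frac{q-1}{2}}\frac{(q-1)!!}{(q-2)!!},$$ where $\Delta_{\mathbf{x}_p}^{\frac{q-1}{2}}f(\mathbf{x}_p)$ denotes the function $\mathbf{x}_p\mapsto\Delta_{\mathbf{x}_p}^{\frac{q-1}{2}}(f|_{\Omega\cap\mathbb{R}^{p+1}})(\mathbf{x}_p)$ on $\Omega\cap\mathbb{R}^{p+1}$, and the identity holds where the right-hand side is defined. In particular $\Delta_{\mathbf{x}}^{\frac{q-1}{2}}f$ is monogenic and a generalized partial-slice function.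
   Context: Let $\mathbb{A}$ be a real alternative algebra (the associator $[a,b,c]=(ab)c-a(bc)$ is an alternating trilinear function) with unity $1$, of finite real dimension $d>1$, equipped with an anti-involution $a\mapsto a^c$ (real linear, $a^c=a$ for real $a$, $(a^c)^c=a$, $(ab)^c=b^ca^c$). Let $t(x)=x+x^c$, $n(x)=xx^c$, $\mathbb{S}_{\mathbb{A}}=\{x: t(x)=0,\ n(x)=1\}$ (assumed nonempty) and $Q_{\mathbb{A}}=\mathbb{R}\cup\{x: t(x)\in\mathbb{R},\ n(x)\in\mathbb{R},\ 4n(x)>t(x)^2\}$. Let $M$ be a real subspace with $\mathbb{R}\subsetneq M\subseteq Q_{\mathbb{A}}$ having a basis $(v_0,\dots,v_m)$, $m\ge1$, $v_0=1$, $v_s\in\mathbb{S}_{\mathbb{A}}$, $v_sv_t=-v_tv_s$ for distinct $s,t\ge1$; complete it to a basis of $\mathbb{A}$ with associated Euclidean norm. Identify $x=\sum x_sv_s\in M$ with $(x_0,\dots,x_m)\in\mathbb{R}^{m+1}$; differentiate componentwise. Fix $p\in\{0,\dots,m-1\}$, $q=m-p$; $\mathbf{x}=\mathbf{x}_p+\underline{\mathbf{x}}_q$ with $\mathbf{x}_p=\sum_{s=0}^px_sv_s\in\mathbb{R}^{p+1}$, $\underline{\mathbf{x}}_q=\sum_{s=p+1}^m x_sv_s$; $\mathbb{S}=\{\sum_{s=p+1}^m x_sv_s:\sum x_s^2=1\}$; $\underline{\mathbf{x}}_q=r\underline{\omega}$, $r=|\underline{\mathbf{x}}_q|$, $\underline{\omega}\in\mathbb{S}$.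 $D_{\mathbf{x}_p}f=\sum_{s=0}^p v_s\partial_{x_s}f$, $D_{\mathbf{x}}f=\sum_{s=0}^m v_s\partial_{x_s}f$, $\Delta_{\mathbf{x}_p}=\sum_{s=0}^p\partial_{x_s}^2$, $\Delta_{\mathbf{x}}=\sum_{s=0}^m\partial_{x_s}^2$; monogenic means $D_{\mathbf{x}}f=0$. $f:\Omega\to\mathbb{A}$ is left generalized partial-slice monogenic of type $(p,q)$ if for every $\underline{\omega}\in\mathbb{S}$ its restriction to $\Omega_{\underline{\omega}}=\Omega\cap(\mathbb{R}^{p+1}\oplus\underline{\omega}\mathbb{R})$ is $C^1$ and $(D_{\mathbf{x}_p}+\underline{\omega}\partial_r)f(\mathbf{x}_p+r\underline{\omega})=0$. A domain is a slice domain if $\Omega\cap\mathbb{R}^{p+1}\ne\emptyset$ and each $\Omega_{\underline{\omega}}$ is a domain in $\mathbb{R}^{p+2}$; p-symmetric if $\mathbf{x}_p+r\underline{\omega}\in\Omega$, $r>0$, implies $\mathbf{x}_p+r\underline{\eta}\in\Omega$ for all $\underline{\eta}\in\mathbb{S}$. A generalized partial-slice function is one of the form $F_1(\mathbf{x}_p,r)+\underline{\omega}F_2(\mathbf{x}_p,r)$ with $F_1$ even and $F_2$ odd in $r$. For a domain $\Omega_0\subseteq\mathbb{R}^{p+1}$ and real analytic $g:\Omega_0\to\mathbb{A}$, $GCK[g]$ (monogenic generalized CK-extension) is the sum of the unique series $\sum_k\underline{\mathbf{x}}_q^kA_k(\mathbf{x}_p)$ with $A_0=g$ that is monogenic on a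 p-symmetric slice domain containing $\Omega_0$; explicitly $GCK[g](\mathbf{x})=\sum_{k\ge0}\frac{\Gamma(\frac q2)(-1)^kr^{2k}}{2^{2k}k!\Gamma(k+\frac q2)}\Delta_{\mathbf{x}_p}^kg(\mathbf{x}_p)+\underline{\mathbf{x}}_q\sum_{k\ge0}\frac{\Gamma(\frac q2)(-1)^kr^{2k}}{2^{2k+1}k!\Gamma(k+\frac q2+1)}\Delta_{\mathbf{x}_p}^k(D_{\mathbf{x}_p}g(\mathbf{x}_p))$. Double factorials: $0!!=(-1)!!=1$.
   Formalization: The identity is asserted at points x of Ω where both GCK series converge and the whole segment from x_p to x lies in Ω; without the segment condition it fails, e.g. for a branch of a logarithm on a plane with hook-shaped cuts (p=0, q=1). *)

theory Defs
  imports "HOL-Analysis.Analysis"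
begin

text \<open>The algebra A is modelled as a finite-dimensional real vector space (a type of class
euclidean_space) with an explicit bilinear multiplication mul, unity one and anti-involution cj.
The algebra is not associative, so the type-class multiplication cannot be used.\<close>

definition assoc :: "('a::real_vector \<Rightarrow> 'a \<Rightarrow> 'a) \<Rightarrow> 'a \<Rightarrow> 'a \<Rightarrow> 'a \<Rightarrow> 'a" where
  "assoc mul a b c = mul (mul a b) c - mul a (mul b c)"

text \<open>Real alternative algebra with unity: bilinear multiplication, two-sided unit, and the
associator is an alternating trilinear map (trilinearity follows from bilinearity of mul;
alternating = vanishes whenever two of its arguments coincide).\<close>
definition alt_algebra :: "('a::real_vector \<Rightarrow> 'a \<Rightarrow> 'a) \<Rightarrow> 'a \<Rightarrow> bool" where
  "alt_algebra mul one \<longleftrightarrow> bilinear mul \<and> (\<forall>a. mul one a = a \<and> mul a one = a) \<and>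
     (\<forall>a b. assoc mul a a b = 0 \<and> assoc mul a b a = 0 \<and> assoc mul b a a = 0)"

definition anti_involution :: "('a::real_vector \<Rightarrow> 'a \<Rightarrow> 'a) \<Rightarrow> 'a \<Rightarrow> ('a \<Rightarrow> 'a) \<Rightarrow> bool" where
  "anti_involution mul one cj \<longleftrightarrow> linear cj \<and> (\<forall>c::real. cj (c *\<^sub>R one) = c *\<^sub>R one) \<and>
     (\<forall>a. cj (cj a) = a) \<and> (\<forall>a b. cj (mul a b) = mul (cj b) (cj a))"

definition trace_A :: "('a::real_vector \<Rightarrow> 'a) \<Rightarrow> 'a \<Rightarrow> 'a" where
  "trace_A cj x = x + cj x"

definition norm_A :: "('a::real_vector \<Rightarrow> 'a \<Rightarrow> 'a) \<Rightarrow> ('a \<Rightarrow> 'a) \<Rightarrow> 'a \<Rightarrow> 'a" where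
  "norm_A mul cj x = mul x (cj x)"

definition reals_A :: "'a::real_vector \<Rightarrow> 'a set" where
  "reals_A one = range (\<lambda>c::real. c *\<^sub>R one)"

definition sphere_A :: "('a::real_vector \<Rightarrow> 'a \<Rightarrow> 'a) \<Rightarrow> 'a \<Rightarrow> ('a \<Rightarrow> 'a) \<Rightarrow> 'a set" where
  "sphere_A mul one cj = {x. trace_A cj x = 0 \<and> norm_A mul cj x = one}"

definition quadratic_cone :: "('a::real_vector \<Rightarrow> 'a \<Rightarrow> 'a) \<Rightarrow> 'a \<Rightarrow> ('a \<Rightarrow> 'a) \<Rightarrow> 'a set" where
  "quadratic_cone mul one cj = reals_A one \<union>
     {x. \<exists>a b::real. trace_A cj x = a *\<^sub>R one \<and> norm_A mul cj x = b *\<^sub>R one \<and> 4 * b > a\<^sup>2}"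

definition adapted_basis ::
  "('a::real_vector \<Rightarrow> 'a \<Rightarrow> 'a) \<Rightarrow> 'a \<Rightarrow> ('a \<Rightarrow> 'a) \<Rightarrow> (nat \<Rightarrow> 'a) \<Rightarrow> nat \<Rightarrow> bool" where
  "adapted_basis mul one cj v m \<longleftrightarrow>
     v 0 = one \<and> (\<forall>s\<in>{1..m}. v s \<in> sphere_A mul one cj) \<and>
     (\<forall>s\<in>{1..m}. \<forall>t\<in>{1..m}. s \<noteq> t \<longrightarrow> mul (v s) (v t) = - mul (v t) (v s)) \<and>
     inj_on v {0..m} \<and> independent (v ` {0..m}) \<and>
     span (v ` {0..m}) \<subseteq> quadratic_cone mul one cj"

definition Mspace :: "(nat \<Rightarrow> 'a::real_vector) \<Rightarrow> nat \<Rightarrow> 'a set" where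
  "Mspace v m = span (v ` {0..m})"

definition Rp1 :: "(nat \<Rightarrow> 'a::real_vector) \<Rightarrow> nat \<Rightarrow> 'a set" where
  "Rp1 v p = span (v ` {0..p})"

definition coord :: "(nat \<Rightarrow> 'a::real_vector) \<Rightarrow> nat \<Rightarrow> 'a \<Rightarrow> nat \<Rightarrow> real" where
  "coord v m x = (THE c. (\<forall>s>m. c s = 0) \<and> x = (\<Sum>s\<le>m. c s *\<^sub>R v s))"

definition xpart :: "(nat \<Rightarrow> 'a::real_vector) \<Rightarrow> nat \<Rightarrow> nat \<Rightarrow> 'a \<Rightarrow> 'a" where
  "xpart v p m x = (\<Sum>s\<le>p. coord v m x s *\<^sub>R v s)"

definition xqpart :: "(nat \<Rightarrow> 'a::real_vector) \<Rightarrow> nat \<Rightarrow> nat \<Rightarrow> 'a \<Rightarrow> 'a" where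
  "xqpart v p m x = (\<Sum>s\<in>{p+1..m}. coord v m x s *\<^sub>R v s)"

definition rad :: "(nat \<Rightarrow> 'a::real_vector) \<Rightarrow> nat \<Rightarrow> nat \<Rightarrow> 'a \<Rightarrow> real" where
  "rad v p m x = sqrt (\<Sum>s\<in>{p+1..m}. (coord v m x s)\<^sup>2)"

definition sphereS :: "(nat \<Rightarrow> 'a::real_vector) \<Rightarrow> nat \<Rightarrow> nat \<Rightarrow> 'a set" where
  "sphereS v p m = {(\<Sum>s\<in>{p+1..m}. c s *\<^sub>R v s) | c. (\<Sum>s\<in>{p+1..m}. (c s)\<^sup>2) = 1}"

text \<open>Directional derivative along u; along u = v_s this is the partial derivative in the
coordinate x_s.\<close>
definition dd :: "'a::real_normed_vector \<Rightarrow> ('a \<Rightarrow> 'b::real_normed_vector) \<Rightarrow> 'a \<Rightarrow> 'b" where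
  "dd u f y = vector_derivative (\<lambda>t. f (y + t *\<^sub>R u)) (at 0)"

definition dd_exists :: "'a::real_normed_vector \<Rightarrow> ('a \<Rightarrow> 'b::real_normed_vector) \<Rightarrow> 'a \<Rightarrow> bool" where
  "dd_exists u f y \<longleftrightarrow> (\<lambda>t. f (y + t *\<^sub>R u)) differentiable (at 0)"

definition lap :: "(nat \<Rightarrow> 'a::real_normed_vector) \<Rightarrow> nat \<Rightarrow> ('a \<Rightarrow> 'a) \<Rightarrow> 'a \<Rightarrow> 'a" where
  "lap v n f = (\<lambda>y. \<Sum>s\<le>n. dd (v s) (dd (v s) f) y)"

definition dirac :: "('a::real_normed_vector \<Rightarrow> 'a \<Rightarrow> 'a) \<Rightarrow> (nat \<Rightarrow> 'a) \<Rightarrow> nat \<Rightarrow> ('a \<Rightarrow> 'a) \<Rightarrow> 'a \<Rightarrow> 'a" where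
  "dirac mul v n f = (\<lambda>y. \<Sum>s\<le>n. mul (v s) (dd (v s) f y))"

definition domain_in :: "'a::topological_space set \<Rightarrow> 'a set \<Rightarrow> bool" where
  "domain_in L U \<longleftrightarrow> U \<noteq> {} \<and> U \<subseteq> L \<and> openin (top_of_set L) U \<and> connected U"

definition slice_space :: "(nat \<Rightarrow> 'a::real_vector) \<Rightarrow> nat \<Rightarrow> 'a \<Rightarrow> 'a set" where
  "slice_space v p \<omega> = span (insert \<omega> (v ` {0..p}))"

definition slice_domain :: "(nat \<Rightarrow> 'a::real_normed_vector) \<Rightarrow> nat \<Rightarrow> nat \<Rightarrow> 'a set \<Rightarrow> bool" where
  "slice_domain v p m \<Omega> \<longleftrightarrow> domain_in (Mspace v m) \<Omega> \<and> \<Omega> \<inter> Rp1 v p \<noteq> {} \<and>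
     (\<forall>\<omega>\<in>sphereS v p m. domain_in (slice_space v p \<omega>) (\<Omega> \<inter> slice_space v p \<omega>))"

definition p_symmetric :: "(nat \<Rightarrow> 'a::real_vector) \<Rightarrow> nat \<Rightarrow> nat \<Rightarrow> 'a set \<Rightarrow> bool" where
  "p_symmetric v p m \<Omega> \<longleftrightarrow>
     (\<forall>xp\<in>Rp1 v p. \<forall>r::real. \<forall>\<omega>\<in>sphereS v p m. r > 0 \<longrightarrow> xp + r *\<^sub>R \<omega> \<in> \<Omega> \<longrightarrow>
        (\<forall>\<eta>\<in>sphereS v p m. xp + r *\<^sub>R \<eta> \<in> \<Omega>))"

definition gps_monogenic ::
  "('a::real_normed_vector \<Rightarrow> 'a \<Rightarrow> 'a) \<Rightarrow> (nat \<Rightarrow> 'a) \<Rightarrow> nat \<Rightarrow> nat \<Rightarrow> 'a set \<Rightarrow> ('a \<Rightarrow> 'a) \<Rightarrow> bool" where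
  "gps_monogenic mul v p m \<Omega> f \<longleftrightarrow>
     (\<forall>\<omega>\<in>sphereS v p m.
        let \<Omega>\<omega> = \<Omega> \<inter> slice_space v p \<omega> in
        continuous_on \<Omega>\<omega> f \<and>
        (\<forall>u\<in>insert \<omega> (v ` {0..p}). (\<forall>y\<in>\<Omega>\<omega>. dd_exists u f y) \<and> continuous_on \<Omega>\<omega> (dd u f)) \<and>
        (\<forall>y\<in>\<Omega>\<omega>. dirac mul v p f y + mul \<omega> (dd \<omega> f y) = 0))"

definition monogenic_on ::
  "('a::real_normed_vector \<Rightarrow> 'a \<Rightarrow> 'a) \<Rightarrow> (nat \<Rightarrow> 'a) \<Rightarrow> nat \<Rightarrow> 'a set \<Rightarrow> ('a \<Rightarrow> 'a) \<Rightarrow> bool" where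
  "monogenic_on mul v m \<Omega> h \<longleftrightarrow> continuous_on \<Omega> h \<and>
     (\<forall>s\<le>m. (\<forall>y\<in>\<Omega>. dd_exists (v s) h y) \<and> continuous_on \<Omega> (dd (v s) h)) \<and>
     (\<forall>y\<in>\<Omega>. dirac mul v m h y = 0)"

definition gps_function ::
  "('a::real_vector \<Rightarrow> 'a \<Rightarrow> 'a) \<Rightarrow> (nat \<Rightarrow> 'a) \<Rightarrow> nat \<Rightarrow> nat \<Rightarrow> 'a set \<Rightarrow> ('a \<Rightarrow> 'a) \<Rightarrow> bool" where
  "gps_function mul v p m \<Omega> h \<longleftrightarrow>
     (\<exists>F1 F2 :: 'a \<Rightarrow> real \<Rightarrow> 'a.
        (\<forall>xp r. F1 xp (- r) = F1 xp r) \<and> (\<forall>xp r. F2 xp (- r) = - F2 xp r) \<and>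
        (\<forall>xp\<in>Rp1 v p. \<forall>r::real. \<forall>\<omega>\<in>sphereS v p m. xp + r *\<^sub>R \<omega> \<in> \<Omega> \<longrightarrow>
            h (xp + r *\<^sub>R \<omega>) = F1 xp r + mul \<omega> (F2 xp r)))"

definition gck_c1 :: "nat \<Rightarrow> nat \<Rightarrow> real" where
  "gck_c1 q k = Gamma (real q / 2) * (-1) ^ k / (2 ^ (2 * k) * fact k * Gamma (real k + real q / 2))"

definition gck_c2 :: "nat \<Rightarrow> nat \<Rightarrow> real" where
  "gck_c2 q k = Gamma (real q / 2) * (-1) ^ k / (2 ^ (2 * k + 1) * fact k * Gamma (real k + real q / 2 + 1))"

definition gck_term1 :: "(nat \<Rightarrow> 'a::real_normed_vector) \<Rightarrow> nat \<Rightarrow> nat \<Rightarrow> nat \<Rightarrow> ('a \<Rightarrow> 'a) \<Rightarrow> 'a \<Rightarrow> nat \<Rightarrow> 'a" where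
  "gck_term1 v p q m g x k =
     (gck_c1 q k * rad v p m x ^ (2 * k)) *\<^sub>R ((lap v p ^^ k) g (xpart v p m x))"

definition gck_term2 :: "('a::real_normed_vector \<Rightarrow> 'a \<Rightarrow> 'a) \<Rightarrow> (nat \<Rightarrow> 'a) \<Rightarrow> nat \<Rightarrow> nat \<Rightarrow> nat \<Rightarrow> ('a \<Rightarrow> 'a) \<Rightarrow> 'a \<Rightarrow> nat \<Rightarrow> 'a" where
  "gck_term2 mul v p q m g x k =
     (gck_c2 q k * rad v p m x ^ (2 * k)) *\<^sub>R ((lap v p ^^ k) (dirac mul v p g) (xpart v p m x))"

definition GCK_defined :: "('a::real_normed_vector \<Rightarrow> 'a \<Rightarrow> 'a) \<Rightarrow> (nat \<Rightarrow> 'a) \<Rightarrow> nat \<Rightarrow> nat \<Rightarrow> nat \<Rightarrow> ('a \<Rightarrow> 'a) \<Rightarrow> 'a \<Rightarrow> bool" where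
  "GCK_defined mul v p q m g x \<longleftrightarrow> summable (gck_term1 v p q m g x) \<and> summable (gck_term2 mul v p q m g x)"

definition GCK :: "('a::real_normed_vector \<Rightarrow> 'a \<Rightarrow> 'a) \<Rightarrow> (nat \<Rightarrow> 'a) \<Rightarrow> nat \<Rightarrow> nat \<Rightarrow> nat \<Rightarrow> ('a \<Rightarrow> 'a) \<Rightarrow> 'a \<Rightarrow> 'a" where
  "GCK mul v p q m g x = (\<Sum>k. gck_term1 v p q m g x k) + mul (xqpart v p m x) (\<Sum>k. gck_term2 mul v p q m g x k)"

text \<open>Double factorial on integers: n!! = product of the k in {1..n} with k = n (mod 2);
in particular 0!! = (-1)!! = 1.\<close>
definition dfact :: "int \<Rightarrow> int" where
  "dfact n = (\<Prod>k\<in>{k\<in>{1..n}. even (n - k)}. k)"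

definition gamma_q :: "nat \<Rightarrow> real" where
  "gamma_q q = (-1) ^ ((q - 1) div 2) * real_of_int (dfact (int q - 1)) / real_of_int (dfact (int q - 2))"

end

theory Submission
  imports Defs "HOL-Complex_Analysis.Complex_Analysis"
begin

text \<open>By the left alternative law the left multiplications by the \<open>v\<^sub>s\<close> satisfy the Clifford relations,
  and nothing else about the product is used, so nonassociativity plays no role.  A \<open>C\<^sup>1\<close> solution of
  such a Dirac system is harmonic after averaging; a barrier argument bounds its gradient by its
  supremum, which yields smoothness, real analyticity along lines and the identity theorem.  Hence
  \<open>f = F\<^sub>1 + \<omega> F\<^sub>2\<close> with stem functions common to all \<open>\<omega>\<close>, \<open>F\<^sub>1\<close> even and \<open>F\<^sub>2\<close> odd in \<open>r\<close>.

  Put \<open>R = (1/r) \<partial>\<^sub>r\<close>, \<open>H\<^sub>1\<^sub>j = R\<^sup>j F\<^sub>1\<close> and \<open>H\<^sub>2\<^sub>j = R\<^sup>j (F\<^sub>2/r)\<close>, and write \<open>D\<close> for the Dirac operator of the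
  first \<open>p+1\<close> variables and \<open>D'\<close> for its conjugate.  Then \<open>D H\<^sub>1\<^sub>j = (2j+1) H\<^sub>2\<^sub>j + r\<^sup>2 H\<^sub>2\<^sub>,\<^sub>j\<^sub>+\<^sub>1\<close> and
  \<open>D' H\<^sub>2\<^sub>j = - H\<^sub>1\<^sub>,\<^sub>j\<^sub>+\<^sub>1\<close>, so the full Laplacian maps \<open>H\<^sub>1\<^sub>j + x\<^sub>q H\<^sub>2\<^sub>j\<close> to \<open>q - 1 - 2j\<close> times
  \<open>H\<^sub>1\<^sub>,\<^sub>j\<^sub>+\<^sub>1 + x\<^sub>q H\<^sub>2\<^sub>,\<^sub>j\<^sub>+\<^sub>1\<close>.  After \<open>k = (q-1)/2\<close> steps one arrives at a multiple of
  \<open>H\<^sub>1\<^sub>k + x\<^sub>q H\<^sub>2\<^sub>k\<close>, which is monogenic.  Its expansion in powers of \<open>r\<^sup>2/2\<close> is the series defining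
  \<open>GCK\<close>; near \<open>r = 0\<close> the sums agree, and they keep agreeing up to the boundary of convergence by
  analytic continuation along the segment and Abel's theorem.\<close>

section \<open>Directional derivatives\<close>

text \<open>The hypothesis provides one derivative inside each slice and nothing across slices,
  while the conclusion involves q - 1 derivatives in all m + 1 directions, also on r = 0, where
  \<omega> is undefined. Regularity has to come from the Dirac equation slice by slice and be handed
  to stem functions on one open set \<open>U\<close> of a model space in which the radius is a
  signed coordinate. There parity makes the singular operator (1/r) d/dr smooth: an even function
  has an odd derivative, and an odd smooth function is r times a smooth one. The constant
  \<open>gamma_q\<close> compares two Laplacians: the factors met in M are divided by the factors
  -(2j + 1) that the Laplacian in the first p + 1 variables produces on r = 0. The iteration ends in
  a monogenic function because D applied to H1_k contains (2k + 1) H2_k, which the q remaining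
  directions cancel exactly when 2k + 1 = q. The series in \<open>GCK\<close> sees only the germ of
  f at the foot point of x. Its sum is tied to f along a segment inside \<Omega>, and at the end
  point only convergence, not absolute convergence, is assumed.\<close>

definition has_dd ::
  "'a::real_normed_vector \<Rightarrow> ('a \<Rightarrow> 'b::real_normed_vector) \<Rightarrow> 'b \<Rightarrow> 'a \<Rightarrow> bool" where
  "has_dd u f d y \<longleftrightarrow> ((\<lambda>t. f (y + t *\<^sub>R u)) has_vector_derivative d) (at 0)"

lemma has_dd_imp_dd: "has_dd u f d y \<Longrightarrow> dd u f y = d"
  unfolding has_dd_def dd_def by (rule vector_derivative_at)

lemma has_dd_imp_exists: "has_dd u f d y \<Longrightarrow> dd_exists u f y"
  unfolding has_dd_def dd_exists_def by (rule differentiableI_vector)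

lemma dd_exists_has_dd: "dd_exists u f y \<Longrightarrow> has_dd u f (dd u f y) y"
  unfolding has_dd_def dd_exists_def dd_def by (simp add: vector_derivative_works)

text \<open>\<open>has_dd\<close> looks at the parameter value 0 only. Moving the base point along
  the line gives the derivative at any parameter, so that one-variable calculus applies along a
  whole line.\<close>

lemma has_dd_along:
  "has_dd u f d (y + s *\<^sub>R u) \<longleftrightarrow> ((\<lambda>t. f (y + t *\<^sub>R u)) has_vector_derivative d) (at s)"
proof
  assume "has_dd u f d (y + s *\<^sub>R u)"
  then have 1: "((\<lambda>t. f (y + s *\<^sub>R u + t *\<^sub>R u)) has_vector_derivative d) (at (s - s))"
    by (simp add: has_dd_def)
  have 2: "((\<lambda>t. t - s) has_vector_derivative 1) (at s)"
    by (auto intro!: derivative_eq_intros)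
  show "((\<lambda>t. f (y + t *\<^sub>R u)) has_vector_derivative d) (at s)"
    using vector_diff_chain_at[OF 2 1] by (simp add: o_def algebra_simps)
next
  assume "((\<lambda>t. f (y + t *\<^sub>R u)) has_vector_derivative d) (at s)"
  then have 1: "((\<lambda>t. f (y + t *\<^sub>R u)) has_vector_derivative d) (at (0 + s))" by simp
  have 2: "((\<lambda>t. t + s) has_vector_derivative 1) (at 0)"
    by (auto intro!: derivative_eq_intros)
  show "has_dd u f d (y + s *\<^sub>R u)"
    unfolding has_dd_def using vector_diff_chain_at[OF 2 1] by (simp add: o_def algebra_simps)
qed

text \<open>Agreement near \<open>y\<close> on the line in direction \<open>u\<close> suffices. This
  makes the calculus usable on \<Omega> and on its part in R^(p+1), which are open only relative to
  a subspace.\<close>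

lemma has_dd_transform:
  assumes "has_dd u f d y" and "\<forall>\<^sub>F t in nhds 0. f (y + t *\<^sub>R u) = g (y + t *\<^sub>R u)"
  shows "has_dd u g d y"
proof -
  have "((\<lambda>t. f (y + t *\<^sub>R u)) has_vector_derivative d) (at 0)
      \<longleftrightarrow> ((\<lambda>t. g (y + t *\<^sub>R u)) has_vector_derivative d) (at 0)"
  proof (rule has_vector_derivative_cong_ev)
    show "\<forall>\<^sub>F t in nhds 0. t \<in> UNIV \<longrightarrow> f (y + t *\<^sub>R u) = g (y + t *\<^sub>R u)"
      using assms(2) by simp
    show "f (y + 0 *\<^sub>R u) = g (y + 0 *\<^sub>R u)"
      using assms(2) by (rule eventually_nhds_x_imp_x)
  qed
  then show ?thesis using assms(1) by (simp add: has_dd_def)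
qed

lemma eventually_line:
  fixes y :: "'a::real_normed_vector"
  assumes "open U" "y \<in> U"
  shows "\<forall>\<^sub>F t in nhds 0. y + t *\<^sub>R u \<in> U"
proof -
  have "((\<lambda>t. y + t *\<^sub>R u) \<longlongrightarrow> y + 0 *\<^sub>R u) (nhds 0)"
    by (intro tendsto_intros filterlim_ident)
  then show ?thesis using topological_tendstoD[OF _ assms(1)] assms(2) by fastforce
qed

lemma has_dd_transform_open:
  assumes "open U" "y \<in> U" "\<And>x. x \<in> U \<Longrightarrow> f x = g x" "has_dd u f d y"
  shows "has_dd u g d y"
  using assms(4)
  by (rule has_dd_transform)
     (rule eventually_mono[OF eventually_line[OF assms(1,2)]], rule assms(3))

lemma dd_cong_open:
  assumes "open U" "y \<in> U" "\<And>x. x \<in> U \<Longrightarrow> f x = g x"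
  shows "dd u f y = dd u g y" "dd_exists u f y = dd_exists u g y"
proof -
  have *: "has_dd u f d y = has_dd u g d y" for d
    using has_dd_transform_open[OF assms(1,2)] assms(3) by metis
  show "dd_exists u f y = dd_exists u g y"
    using * has_dd_imp_exists dd_exists_has_dd by metis
  show "dd u f y = dd u g y"
    using * unfolding dd_def vector_derivative_def has_dd_def by simp
qed

lemma has_dd_const: "has_dd u (\<lambda>_. c) 0 y"
  unfolding has_dd_def by simp

lemma has_dd_add:
  "has_dd u f d y \<Longrightarrow> has_dd u g e y \<Longrightarrow> has_dd u (\<lambda>x. f x + g x) (d + e) y"
  unfolding has_dd_def by (rule has_vector_derivative_add)

lemma has_dd_diff:
  "has_dd u f d y \<Longrightarrow> has_dd u g e y \<Longrightarrow> has_dd u (\<lambda>x. f x - g x) (d - e) y"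
  unfolding has_dd_def by (rule has_vector_derivative_diff)

lemma has_dd_sum:
  "(\<And>i. i \<in> I \<Longrightarrow> has_dd u (f i) (d i) y) \<Longrightarrow> has_dd u (\<lambda>x. \<Sum>i\<in>I. f i x) (\<Sum>i\<in>I. d i) y"
  unfolding has_dd_def by (rule has_vector_derivative_sum)

lemma has_dd_bounded_linear:
  "bounded_linear L \<Longrightarrow> has_dd u f d y \<Longrightarrow> has_dd u (\<lambda>x. L (f x)) (L d) y"
  unfolding has_dd_def by (rule bounded_linear.has_vector_derivative)

lemma has_dd_bilinear:
  assumes "bounded_bilinear B" "has_dd u f d y" "has_dd u g e y"
  shows "has_dd u (\<lambda>x. B (f x) (g x)) (B (f y) e + B d (g y)) y"
  using bounded_bilinear.has_vector_derivative[OF assms(1) assms(2,3)[unfolded has_dd_def]]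
  unfolding has_dd_def by simp

lemmas has_dd_cmul = has_dd_bounded_linear[OF bounded_linear_scaleR_right]
lemmas has_dd_scaleR = has_dd_bilinear[OF bounded_bilinear_scaleR]

lemma has_dd_linear: "linear L \<Longrightarrow> has_dd u L (L u) y"
  unfolding has_dd_def
  by (auto simp: linear_add linear_scale intro!: derivative_eq_intros)

lemma has_dd_comp_linear:
  "linear A \<Longrightarrow> has_dd w (\<lambda>y. f (A y)) d y \<longleftrightarrow> has_dd (A w) f d (A y)"
  unfolding has_dd_def by (simp add: linear_add linear_scale)

lemma has_dd_translate: "has_dd w (\<lambda>y. f (y + c)) d y \<longleftrightarrow> has_dd w f d (y + c)"
  unfolding has_dd_def by (simp add: algebra_simps)

lemma has_dd_dir_scale:
  assumes "has_dd b f d y"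
  shows "has_dd (c *\<^sub>R b) f (c *\<^sub>R d) y"
proof -
  have 1: "((\<lambda>t. f (y + t *\<^sub>R b)) has_vector_derivative d) (at (0 * c))"
    using assms by (simp add: has_dd_def)
  have 2: "((\<lambda>t. t * c) has_vector_derivative c) (at 0)"
    by (auto intro!: derivative_eq_intros)
  show ?thesis
    using vector_diff_chain_at[OF 2 1] by (simp add: o_def has_dd_def)
qed

text \<open>The mean value inequality for \<open>f\<close> minus the linear function with slope
  \<open>d\<close>: a bound for the deviation of the derivative from \<open>d\<close> becomes a
  bound for the first-order remainder. The closed segment covers both signs of
  \<open>T\<close>.\<close>

lemma has_dd_mvt:
  assumes d: "\<And>t. t \<in> closed_segment 0 T \<Longrightarrow> has_dd u f (f' t) (y + t *\<^sub>R u)"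
    and B: "\<And>t. t \<in> closed_segment 0 T \<Longrightarrow> norm (f' t - d) \<le> B"
  shows "norm (f (y + T *\<^sub>R u) - f y - T *\<^sub>R d) \<le> B * \<bar>T\<bar>"
proof -
  define g where "g t = f (y + t *\<^sub>R u) - t *\<^sub>R d" for t
  have *: "(g has_derivative (\<lambda>h. h *\<^sub>R (f' t - d))) (at t within closed_segment 0 T)"
    if "t \<in> closed_segment 0 T" for t
  proof -
    have "((\<lambda>t. f (y + t *\<^sub>R u)) has_vector_derivative f' t) (at t)"
      using d[OF that] by (simp add: has_dd_along)
    then have "(g has_vector_derivative (f' t - d)) (at t)"
      unfolding g_def by (auto intro!: derivative_eq_intros)
    then show ?thesis
      unfolding has_vector_derivative_def by (rule has_derivative_at_withinI)
  qed
  have "norm (g T - g 0) \<le> B * norm (T - 0)"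
  proof (rule differentiable_bound[OF _ *])
    show "onorm (\<lambda>h. h *\<^sub>R (f' t - d)) \<le> B" if "t \<in> closed_segment 0 T" for t
      by (rule onorm_le) (use B[OF that] in \<open>simp add: mult.commute[of B] mult_left_mono\<close>)
  qed auto
  then show ?thesis by (simp add: g_def algebra_simps)
qed

lemma vector_derivative_bound:
  assumes "(f has_vector_derivative D) (at (0::real))"
    and "\<forall>\<^sub>F t in at 0. norm (f t - f 0) \<le> B * \<bar>t\<bar>"
  shows "norm D \<le> B"
proof -
  have "((\<lambda>t. (f t - f 0 - t *\<^sub>R D) /\<^sub>R norm t) \<longlongrightarrow> 0) (at 0)"
  proof (rule tendsto_norm_zero_cancel)
    have "norm ((f t - f 0 - t *\<^sub>R D) /\<^sub>R norm t) = norm (f t - f 0 - t *\<^sub>R D) / norm t" for t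
      by (simp add: divide_inverse_commute)
    moreover have "((\<lambda>t. norm (f (0 + t) - f 0 - t *\<^sub>R D) / norm t) \<longlongrightarrow> 0) (at 0)"
      using assms(1) unfolding has_vector_derivative_def has_derivative_at by blast
    ultimately show "((\<lambda>t. norm ((f t - f 0 - t *\<^sub>R D) /\<^sub>R norm t)) \<longlongrightarrow> 0) (at 0)"
      by simp
  qed
  then have "((\<lambda>t. norm ((f t - f 0 - t *\<^sub>R D) /\<^sub>R norm t)) \<longlongrightarrow> 0) (at 0)"
    by (rule tendsto_norm_zero)
  then have lim: "((\<lambda>t. B + norm ((f t - f 0 - t *\<^sub>R D) /\<^sub>R norm t)) \<longlongrightarrow> B + 0) (at 0)"
    by (intro tendsto_intros)
  have "\<forall>\<^sub>F t in at 0. norm D \<le> B + norm ((f t - f 0 - t *\<^sub>R D) /\<^sub>R norm t)"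
    using assms(2) eventually_neq_at_within[of 0]
  proof eventually_elim
    case (elim t)
    have "\<bar>t\<bar> * norm D = norm (t *\<^sub>R D)" by simp
    also have "\<dots> \<le> norm (f t - f 0) + norm (f t - f 0 - t *\<^sub>R D)"
      by (metis norm_minus_commute norm_triangle_sub add.commute)
    also have "\<dots> \<le> B * \<bar>t\<bar> + norm (f t - f 0 - t *\<^sub>R D)" using elim by simp
    finally have "norm D \<le> (B * \<bar>t\<bar> + norm (f t - f 0 - t *\<^sub>R D)) / \<bar>t\<bar>"
      using elim(2) by (simp add: pos_le_divide_eq mult.commute)
    also have "\<dots> = B + norm ((f t - f 0 - t *\<^sub>R D) /\<^sub>R norm t)"
      using elim(2) by (simp add: divide_inverse_commute distrib_left)
    finally show ?case .
  qed
  then show ?thesis using tendsto_lowerbound[OF lim] by simp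
qed

lemma has_dd_I_eps:
  assumes "\<And>e. e > 0 \<Longrightarrow> \<exists>\<tau>>0. \<forall>t. \<bar>t\<bar> < \<tau> \<longrightarrow> norm (f (y + t *\<^sub>R u) - f y - t *\<^sub>R d) \<le> e * \<bar>t\<bar>"
  shows "has_dd u f d y"
  unfolding has_dd_def has_vector_derivative_def has_derivative_at_alt
  using assms by (auto simp: bounded_linear_scaleR_left)

lemma has_dd_D_eps:
  assumes "has_dd u f d y" "e > 0"
  shows "\<exists>\<tau>>0. \<forall>t. \<bar>t\<bar> < \<tau> \<longrightarrow> norm (f (y + t *\<^sub>R u) - f y - t *\<^sub>R d) \<le> e * \<bar>t\<bar>"
  using assms unfolding has_dd_def has_vector_derivative_def has_derivative_at_alt
  by auto

lemma line_in_ball: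
  fixes y :: "'a::real_normed_vector"
  assumes "\<bar>t\<bar> * norm u < \<delta>"
  shows "y + t *\<^sub>R u \<in> ball y \<delta>"
  using assms by (simp add: dist_norm)

lemma line_in_ball2:
  fixes y :: "'a::real_normed_vector"
  assumes "\<tau> * (norm a + norm b) < \<delta>" "\<bar>s\<bar> \<le> \<tau>" "\<bar>t\<bar> \<le> \<tau>"
  shows "y + s *\<^sub>R a + t *\<^sub>R b \<in> ball y \<delta>"
proof -
  have "norm (s *\<^sub>R a + t *\<^sub>R b) \<le> \<bar>s\<bar> * norm a + \<bar>t\<bar> * norm b"
    by (metis norm_scaleR norm_triangle_ineq)
  also have "\<dots> \<le> \<tau> * norm a + \<tau> * norm b"
    using assms by (intro add_mono mult_right_mono) auto
  finally have "norm (s *\<^sub>R a + t *\<^sub>R b) < \<delta>" using assms(1) by (simp add: algebra_simps)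
  moreover have "dist y (y + s *\<^sub>R a + t *\<^sub>R b) = norm (s *\<^sub>R a + t *\<^sub>R b)"
    by (metis add.assoc dist_add_cancel dist_0_norm add.right_neutral)
  ultimately show ?thesis by simp
qed

text \<open>The theorem of Schwarz: one continuous mixed derivative forces the other one to exist.\<close>
lemma has_dd_commute:
  assumes U: "open U" "y \<in> U"
    and a: "\<And>x. x \<in> U \<Longrightarrow> has_dd a G (Ga x) x"
    and b: "\<And>x. x \<in> U \<Longrightarrow> has_dd b G (Gb x) x"
    and ba: "\<And>x. x \<in> U \<Longrightarrow> has_dd b Ga (Gba x) x"
    and cont: "continuous_on U Gba"
  shows "has_dd a Gb (Gba y) y"
proof (rule has_dd_I_eps)
  fix e :: real assume e: "e > 0"
  have "isCont Gba y" using cont U by (simp add: continuous_on_eq_continuous_at)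
  then obtain \<delta>1 where \<delta>1: "\<delta>1 > 0" "\<And>x. dist x y < \<delta>1 \<Longrightarrow> dist (Gba x) (Gba y) < e"
    using e unfolding continuous_at_eps_delta by blast
  obtain \<delta>2 where \<delta>2: "\<delta>2 > 0" "ball y \<delta>2 \<subseteq> U" using U openE by blast
  define \<delta> where "\<delta> = min \<delta>1 \<delta>2"
  have \<delta>: "\<delta> > 0" "ball y \<delta> \<subseteq> U" "\<And>x. x \<in> ball y \<delta> \<Longrightarrow> norm (Gba x - Gba y) \<le> e"
    using \<delta>1 \<delta>2 by (auto simp: \<delta>_def dist_norm norm_minus_commute less_imp_le)
  define \<tau> where "\<tau> = \<delta> / (norm a + norm b + 1)"
  have pos: "norm a + norm b + 1 > 0" by (smt (verit) norm_ge_zero)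
  have \<tau>: "\<tau> > 0" "\<tau> * (norm a + norm b) < \<delta>"
    using \<delta> pos by (auto simp: \<tau>_def field_simps)
  have inb: "y + s *\<^sub>R a + t *\<^sub>R b \<in> ball y \<delta>" if "\<bar>s\<bar> \<le> \<tau>" "\<bar>t\<bar> \<le> \<tau>" for s t
    using line_in_ball2[OF \<tau>(2) that] .
  have inb1: "y + s *\<^sub>R a \<in> ball y \<delta>" "y + s *\<^sub>R b \<in> ball y \<delta>" if "\<bar>s\<bar> \<le> \<tau>" for s
    using inb[of s 0] inb[of 0 s] that \<tau> by auto
  have "norm (Gb (y + s *\<^sub>R a) - Gb y - s *\<^sub>R Gba y) \<le> e * \<bar>s\<bar>" if s: "\<bar>s\<bar> < \<tau>" for s
  \<comment> \<open>The vector to be bounded is the derivative at t = 0 of the double difference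
    \<open>?L\<close>, so a bound of \<open>?L\<close> linear in t suffices. It comes from two mean
    value estimates, along \<open>a\<close> for \<open>\<psi>\<close> and along \<open>b\<close> for
    \<open>Ga\<close>.\<close>
  proof (rule vector_derivative_bound)
    let ?L = "\<lambda>t. G (y + s *\<^sub>R a + t *\<^sub>R b) - G (y + t *\<^sub>R b) - t *\<^sub>R (s *\<^sub>R Gba y)"
    have "y + s *\<^sub>R a \<in> U" using inb1[of s] s \<delta> by auto
    then show "(?L has_vector_derivative Gb (y + s *\<^sub>R a) - Gb y - s *\<^sub>R Gba y) (at 0)"
      using b[of "y + s *\<^sub>R a"] b[OF U(2)] unfolding has_dd_def
      by (auto intro!: derivative_eq_intros)
    have "norm (?L t - ?L 0) \<le> e * \<bar>s\<bar> * \<bar>t\<bar>" if t: "\<bar>t\<bar> < \<tau>" for t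
    proof -
      define \<psi> where "\<psi> x = G (x + t *\<^sub>R b) - G x" for x
      have "norm (\<psi> (y + s *\<^sub>R a) - \<psi> y - s *\<^sub>R (t *\<^sub>R Gba y)) \<le> (e * \<bar>t\<bar>) * \<bar>s\<bar>"
      proof (rule has_dd_mvt)
        fix s' assume "s' \<in> closed_segment 0 s"
        then have s': "\<bar>s'\<bar> \<le> \<tau>" using s by (auto simp: closed_segment_eq_real_ivl split: if_splits)
        show "has_dd a \<psi> (Ga (y + s' *\<^sub>R a + t *\<^sub>R b) - Ga (y + s' *\<^sub>R a)) (y + s' *\<^sub>R a)"
          unfolding \<psi>_def
          by (rule has_dd_diff) (use a inb[of s' t] inb1[of s'] s' t \<delta> in \<open>auto simp: has_dd_translate\<close>)
        show "norm (Ga (y + s' *\<^sub>R a + t *\<^sub>R b) - Ga (y + s' *\<^sub>R a) - t *\<^sub>R Gba y) \<le> e * \<bar>t\<bar>"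
        proof (rule has_dd_mvt)
          fix t' assume "t' \<in> closed_segment 0 t"
          then have t': "\<bar>t'\<bar> \<le> \<tau>" using t by (auto simp: closed_segment_eq_real_ivl split: if_splits)
          show "has_dd b Ga (Gba (y + s' *\<^sub>R a + t' *\<^sub>R b)) (y + s' *\<^sub>R a + t' *\<^sub>R b)"
            using ba inb[OF s' t'] \<delta> by auto
          show "norm (Gba (y + s' *\<^sub>R a + t' *\<^sub>R b) - Gba y) \<le> e"
            using inb[OF s' t'] \<delta> by auto
        qed
      qed
      then show ?thesis by (simp add: \<psi>_def algebra_simps)
    qed
    then show "\<forall>\<^sub>F t in at 0. norm (?L t - ?L 0) \<le> e * \<bar>s\<bar> * \<bar>t\<bar>"
      unfolding eventually_at using \<tau> by (intro exI[of _ \<tau>]) auto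
  qed
  then show "\<exists>\<tau>>0. \<forall>t. \<bar>t\<bar> < \<tau> \<longrightarrow> norm (Gb (y + t *\<^sub>R a) - Gb y - t *\<^sub>R Gba y) \<le> e * \<bar>t\<bar>"
    using \<tau> by blast
qed

text \<open>The step along \<open>u\<close> is differentiated at \<open>y\<close> alone; the step
  along \<open>w\<close> starts at a moving point and is controlled by continuity of
  \<open>Dw\<close>. The asymmetry suits an induction over basis vectors, which adds one direction
  at a time.\<close>

lemma has_dd_dir_add:
  assumes U: "open U" "y \<in> U"
    and u: "has_dd u g d y"
    and w: "\<And>x. x \<in> U \<Longrightarrow> has_dd w g (Dw x) x"
    and cont: "continuous_on U Dw"
  shows "has_dd (u + w) g (d + Dw y) y"
proof (rule has_dd_I_eps)
  fix e :: real assume e: "e > 0"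
  have "isCont Dw y" using cont U by (simp add: continuous_on_eq_continuous_at)
  then obtain \<delta>1 where \<delta>1: "\<delta>1 > 0" "\<And>x. dist x y < \<delta>1 \<Longrightarrow> dist (Dw x) (Dw y) < e/2"
    using e unfolding continuous_at_eps_delta by (metis half_gt_zero)
  obtain \<delta>2 where \<delta>2: "\<delta>2 > 0" "ball y \<delta>2 \<subseteq> U" using U openE by blast
  define \<delta> where "\<delta> = min \<delta>1 \<delta>2"
  have \<delta>: "\<delta> > 0" "ball y \<delta> \<subseteq> U" "\<And>x. x \<in> ball y \<delta> \<Longrightarrow> norm (Dw x - Dw y) \<le> e/2"
    using \<delta>1 \<delta>2 by (auto simp: \<delta>_def dist_norm norm_minus_commute less_imp_le)
  obtain \<tau>1 where \<tau>1: "\<tau>1 > 0"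
    "\<And>t. \<bar>t\<bar> < \<tau>1 \<Longrightarrow> norm (g (y + t *\<^sub>R u) - g y - t *\<^sub>R d) \<le> e/2 * \<bar>t\<bar>"
    using has_dd_D_eps[OF u, of "e/2"] e by auto
  define \<tau>2 where "\<tau>2 = \<delta> / (norm u + norm w + 1)"
  have pos: "norm u + norm w + 1 > 0" by (smt (verit) norm_ge_zero)
  have \<tau>2: "\<tau>2 > 0" "\<tau>2 * (norm u + norm w) < \<delta>"
    using \<delta> pos by (auto simp: \<tau>2_def field_simps)
  have "norm (g (y + t *\<^sub>R (u + w)) - g y - t *\<^sub>R (d + Dw y)) \<le> e * \<bar>t\<bar>"
    if t: "\<bar>t\<bar> < min \<tau>1 \<tau>2" for t
  proof -
    have "norm (g (y + t *\<^sub>R u + t *\<^sub>R w) - g (y + t *\<^sub>R u) - t *\<^sub>R Dw y) \<le> e/2 * \<bar>t\<bar>"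
    proof (rule has_dd_mvt)
      fix t' assume "t' \<in> closed_segment 0 t"
      then have t': "\<bar>t'\<bar> \<le> \<tau>2" using t by (auto simp: closed_segment_eq_real_ivl split: if_splits)
      have "y + t *\<^sub>R u + t' *\<^sub>R w \<in> ball y \<delta>"
        using line_in_ball2[OF \<tau>2(2) _ t'] t by simp
      then show "has_dd w g (Dw (y + t *\<^sub>R u + t' *\<^sub>R w)) (y + t *\<^sub>R u + t' *\<^sub>R w)"
          "norm (Dw (y + t *\<^sub>R u + t' *\<^sub>R w) - Dw y) \<le> e/2"
        using w \<delta> by auto
    qed
    moreover have "norm (g (y + t *\<^sub>R u) - g y - t *\<^sub>R d) \<le> e/2 * \<bar>t\<bar>" using \<tau>1 t by simp
    ultimately have "norm ((g (y + t *\<^sub>R u + t *\<^sub>R w) - g (y + t *\<^sub>R u) - t *\<^sub>R Dw y)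
        + (g (y + t *\<^sub>R u) - g y - t *\<^sub>R d)) \<le> e/2 * \<bar>t\<bar> + e/2 * \<bar>t\<bar>"
      by (rule norm_triangle_mono)
    then show ?thesis by (simp add: algebra_simps)
  qed
  then show "\<exists>\<tau>>0. \<forall>t. \<bar>t\<bar> < \<tau> \<longrightarrow> norm (g (y + t *\<^sub>R (u + w)) - g y - t *\<^sub>R (d + Dw y)) \<le> e * \<bar>t\<bar>"
    using \<tau>1 \<tau>2 by (intro exI[of _ "min \<tau>1 \<tau>2"]) auto
qed

section \<open>Continuous first partial derivatives\<close>

definition C1_on :: "'a::euclidean_space set \<Rightarrow> ('a \<Rightarrow> 'b::real_normed_vector) \<Rightarrow> bool" where
  "C1_on U g \<longleftrightarrow> continuous_on U g \<and>
     (\<forall>b\<in>Basis. continuous_on U (dd b g) \<and> (\<forall>y\<in>U. has_dd b g (dd b g y) y))"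

text \<open>The derivative along \<open>w\<close>, written through basis partial derivatives so that
  its iterates remain linear combinations of solutions of the same system.\<close>

definition grad_dir :: "'a::euclidean_space \<Rightarrow> ('a \<Rightarrow> 'b::real_normed_vector) \<Rightarrow> 'a \<Rightarrow> 'b" where
  "grad_dir w g y = (\<Sum>b\<in>Basis. (w \<bullet> b) *\<^sub>R dd b g y)"

lemma C1_on_has_dd_Basis: "C1_on U g \<Longrightarrow> b \<in> Basis \<Longrightarrow> y \<in> U \<Longrightarrow> has_dd b g (dd b g y) y"
  by (simp add: C1_on_def)

lemma C1_on_subset: "C1_on U g \<Longrightarrow> V \<subseteq> U \<Longrightarrow> C1_on V g"
  unfolding C1_on_def by (meson continuous_on_subset subsetD)

lemma C1_onI:
  assumes "continuous_on U g"
    and "\<And>b y. b \<in> Basis \<Longrightarrow> y \<in> U \<Longrightarrow> has_dd b g (g' b y) y"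
    and "\<And>b. b \<in> Basis \<Longrightarrow> continuous_on U (g' b)"
  shows "C1_on U g"
  unfolding C1_on_def
proof (intro conjI ballI)
  fix b :: 'a assume b: "b \<in> Basis"
  have *: "dd b g y = g' b y" if "y \<in> U" for y using assms(2)[OF b that] by (rule has_dd_imp_dd)
  show "continuous_on U (dd b g)" using assms(3)[OF b] * continuous_on_cong by metis
  show "has_dd b g (dd b g y) y" if "y \<in> U" for y using assms(2)[OF b that] *[OF that] by simp
qed (fact assms(1))

lemma C1_on_cong:
  assumes "open U" "\<And>x. x \<in> U \<Longrightarrow> f x = g x" "C1_on U f"
  shows "C1_on U g"
proof (rule C1_onI[where g' = "\<lambda>b. dd b f"])
  show "continuous_on U g"
    using assms unfolding C1_on_def by (metis continuous_on_cong)
next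
  fix b :: 'a and y assume *: "b \<in> Basis" "y \<in> U"
  show "has_dd b g (dd b f y) y"
    by (rule has_dd_transform_open[OF assms(1) *(2) assms(2) C1_on_has_dd_Basis[OF assms(3) *]])
qed (use assms in \<open>auto simp: C1_on_def\<close>)

lemma C1_on_has_dd:
  assumes "open U" "C1_on U g" "y \<in> U"
  shows "has_dd w g (grad_dir w g y) y"
proof -
  have "\<forall>y\<in>U. has_dd (\<Sum>b\<in>B. (w \<bullet> b) *\<^sub>R b) g (\<Sum>b\<in>B. (w \<bullet> b) *\<^sub>R dd b g y) y"
    if "B \<subseteq> Basis" for B
    using finite_subset[OF that finite_Basis] that
  proof (induction B rule: finite_induct)
    case empty
    then show ?case by (simp add: has_dd_def)
  next
    case (insert b B)
    have "has_dd ((w \<bullet> b) *\<^sub>R b + (\<Sum>b\<in>B. (w \<bullet> b) *\<^sub>R b)) g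
      ((w \<bullet> b) *\<^sub>R dd b g y + (\<Sum>b\<in>B. (w \<bullet> b) *\<^sub>R dd b g y)) y" if y: "y \<in> U" for y
    proof (rule has_dd_dir_add[OF assms(1) y])
      show "has_dd ((w \<bullet> b) *\<^sub>R b) g ((w \<bullet> b) *\<^sub>R dd b g y) y"
        using insert y assms(2) by (intro has_dd_dir_scale) (auto simp: C1_on_def)
      show "continuous_on U (\<lambda>x. \<Sum>b\<in>B. (w \<bullet> b) *\<^sub>R dd b g x)"
        using insert assms(2) by (intro continuous_intros) (auto simp: C1_on_def)
    qed (use insert in auto)
    then show ?case using insert by simp
  qed
  from this[of Basis] show ?thesis using assms(3) by (simp add: grad_dir_def euclidean_representation)
qed

section \<open>A maximum principle and a barrier estimate\<close>

text \<open>At the maximum the first derivative vanishes; a positive second derivative would make it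
  positive just to the right of 0 and the function larger than at 0.\<close>

lemma second_derivative_at_max:
  fixes \<phi> :: "real \<Rightarrow> real"
  assumes \<delta>: "\<delta> > 0"
    and 1: "\<And>t. \<bar>t\<bar> < \<delta> \<Longrightarrow> (\<phi> has_real_derivative \<phi>' t) (at t)"
    and 2: "(\<phi>' has_real_derivative c) (at 0)"
    and max: "\<And>t. \<bar>t\<bar> < \<delta> \<Longrightarrow> \<phi> t \<le> \<phi> 0"
  shows "c \<le> 0"
proof (rule ccontr)
  assume "\<not> c \<le> 0"
  then have c: "c > 0" by simp
  have 0: "\<phi>' 0 = 0"
    using DERIV_local_max[OF 1[of 0] \<delta>] max \<delta> by (simp add: abs_minus_commute)
  obtain d where d: "d > 0" "\<And>h. 0 < h \<Longrightarrow> h < d \<Longrightarrow> \<phi>' 0 < \<phi>' (0 + h)"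
    using DERIV_pos_inc_right[OF 2 c] by blast
  define T where "T = min d \<delta> / 2"
  have T: "0 < T" "T < d" "T < \<delta>" using d \<delta> by (auto simp: T_def min_def)
  have "\<exists>z. 0 < z \<and> z < T \<and> \<phi> T - \<phi> 0 = (T - 0) * \<phi>' z"
    by (rule MVT2) (use T 1 in auto)
  then obtain z where z: "0 < z" "z < T" "\<phi> T - \<phi> 0 = T * \<phi>' z" by auto
  have "\<phi>' z > 0" using d(2)[of z] z T 0 by simp
  then have "\<phi> T > \<phi> 0" using z T by (smt (verit) mult_pos_pos)
  then show False using max[of T] T by simp
qed

lemma has_dd_real_along:
  "has_dd u f d (y + s *\<^sub>R u) \<longleftrightarrow> ((\<lambda>t. f (y + t *\<^sub>R u)) has_real_derivative d) (at s)"
  for f :: "'a::real_normed_vector \<Rightarrow> real"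
  by (simp add: has_dd_along has_real_derivative_iff_has_vector_derivative)

lemma has_dd_real_mult:
  fixes f g :: "'a::real_normed_vector \<Rightarrow> real"
  shows "has_dd u f d y \<Longrightarrow> has_dd u g e y \<Longrightarrow> has_dd u (\<lambda>x. f x * g x) (f y * e + d * g y) y"
  by (rule has_dd_bilinear[OF bounded_bilinear_mult])

lemma has_dd_inner_left: "has_dd u (\<lambda>x. (x - a) \<bullet> e) (u \<bullet> e) y" for u :: "'a::real_inner"
proof -
  have "has_dd u (\<lambda>x. x \<bullet> e - a \<bullet> e) (u \<bullet> e - 0) y"
    by (intro has_dd_diff has_dd_const has_dd_linear linearI) (simp_all add: inner_add_left)
  then show ?thesis by (simp add: inner_diff_left)
qed

lemma has_dd_inner_self:
  "has_dd u (\<lambda>x. (x - a) \<bullet> (x - a)) (2 * ((y - a) \<bullet> u)) y" for u :: "'a::real_inner"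
proof -
  have "has_dd u (\<lambda>x. x - a) (u - 0) y"
    by (intro has_dd_diff has_dd_const has_dd_linear linear_id[unfolded id_def])
  from has_dd_bilinear[OF bounded_bilinear_inner this this]
  show ?thesis by (simp add: inner_commute)
qed

text \<open>Adding \<epsilon>|y|^2 makes the Laplacian strictly positive, which excludes an interior
  maximum.\<close>

lemma subharmonic_le_boundary:
  fixes u :: "'a::euclidean_space \<Rightarrow> real"
  assumes K: "compact K" "continuous_on K u" and V: "open V" "V \<subseteq> K"
    and bd: "\<And>y. y \<in> K - V \<Longrightarrow> u y \<le> 0"
    and u1: "\<And>y b. y \<in> V \<Longrightarrow> b \<in> Basis \<Longrightarrow> has_dd b u (u1 b y) y"
    and u2: "\<And>y b. y \<in> V \<Longrightarrow> b \<in> Basis \<Longrightarrow> has_dd b (u1 b) (u2 b y) y"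
    and sub: "\<And>y. y \<in> V \<Longrightarrow> (\<Sum>b\<in>Basis. u2 b y) \<ge> 0"
    and y0: "y0 \<in> K"
  shows "u y0 \<le> 0"
proof (rule ccontr)
  assume "\<not> u y0 \<le> 0"
  then have pos: "u y0 > 0" by simp
  obtain D where D: "\<And>y. y \<in> K \<Longrightarrow> norm y \<le> D"
    using compact_imp_bounded[OF K(1)] unfolding bounded_iff by blast
  \<comment> \<open>Small enough that \<epsilon> D^2 < u y0: the maximum of the perturbed function
    then lies where \<open>u\<close> is positive, hence in \<open>V\<close>.\<close>
  define \<epsilon> where "\<epsilon> = u y0 / (D\<^sup>2 + 1)"
  have D1: "D\<^sup>2 + 1 > 0" by (smt (verit) zero_le_power2)
  have \<epsilon>: "\<epsilon> > 0" "\<epsilon> * D\<^sup>2 < u y0"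
    using pos D1 by (auto simp: \<epsilon>_def field_simps)
  define w where "w y = u y + \<epsilon> * (y \<bullet> y)" for y
  have "continuous_on K w" unfolding w_def using K by (intro continuous_intros)
  then obtain z where z: "z \<in> K" "\<And>y. y \<in> K \<Longrightarrow> w y \<le> w z"
    using continuous_attains_sup[OF K(1)] y0 by (metis empty_iff)
  have "y0 \<bullet> y0 \<ge> 0" by simp
  then have "w z \<ge> u y0" using z(2)[OF y0] \<epsilon> unfolding w_def by (smt (verit) mult_nonneg_nonneg)
  moreover have "z \<bullet> z \<le> D\<^sup>2"
    using D[OF z(1)] by (simp add: dot_square_norm power_mono)
  ultimately have "u z > 0" using \<epsilon> mult_left_mono[of "z \<bullet> z" "D\<^sup>2" \<epsilon>] unfolding w_def by linarith
  then have zV: "z \<in> V" using bd z(1) by force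
  have "u2 b z + 2 * \<epsilon> \<le> 0" if b: "b \<in> Basis" for b
  proof -
    obtain \<delta>' where \<delta>': "\<delta>' > 0" "ball z \<delta>' \<subseteq> V" using V zV openE by blast
    have line: "z + t *\<^sub>R b \<in> V" if "\<bar>t\<bar> < \<delta>'" for t
      using line_in_ball[of t b \<delta>' z] that b \<delta>' by auto
    define w1 where "w1 y = u1 b y + \<epsilon> * (2 * ((y - 0) \<bullet> b))" for y
    have 1: "has_dd b w (w1 y) y" if "y \<in> V" for y
    proof -
      have "has_dd b (\<lambda>y. u y + \<epsilon> *\<^sub>R ((y - 0) \<bullet> (y - 0))) (u1 b y + \<epsilon> *\<^sub>R (2 * ((y - 0) \<bullet> b))) y"
        by (intro has_dd_add has_dd_cmul has_dd_inner_self u1 that b)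
      then show ?thesis by (simp add: w_def[abs_def] w1_def)
    qed
    have "has_dd b (\<lambda>y. u1 b y + (2 * \<epsilon>) *\<^sub>R ((y - 0) \<bullet> b)) (u2 b z + (2 * \<epsilon>) *\<^sub>R (b \<bullet> b)) z"
      by (intro has_dd_add has_dd_cmul has_dd_inner_left u2 zV b)
    then have 2: "has_dd b w1 (u2 b z + 2 * \<epsilon>) (z + 0 *\<^sub>R b)"
      using b by (simp add: w1_def[abs_def] mult_ac)
    show ?thesis
    proof (rule second_derivative_at_max[OF \<delta>'(1)])
      show "((\<lambda>t. w (z + t *\<^sub>R b)) has_real_derivative w1 (z + t *\<^sub>R b)) (at t)" if "\<bar>t\<bar> < \<delta>'" for t
        using 1[OF line[OF that]] by (simp add: has_dd_real_along)
      show "((\<lambda>t. w1 (z + t *\<^sub>R b)) has_real_derivative u2 b z + 2 * \<epsilon>) (at 0)"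
        using 2 by (simp only: has_dd_real_along)
      show "w (z + t *\<^sub>R b) \<le> w (z + 0 *\<^sub>R b)" if "\<bar>t\<bar> < \<delta>'" for t
        using z(2) line[OF that] V by auto
    qed
  qed
  then have "(\<Sum>b\<in>Basis. u2 b z + 2 * \<epsilon>) \<le> (\<Sum>b\<in>(Basis::'a set). 0)"
    by (intro sum_mono) auto
  then have "(\<Sum>b\<in>Basis. u2 b z) + DIM('a) * (2 * \<epsilon>) \<le> 0"
    by (simp add: sum.distrib)
  moreover have "DIM('a) * (2 * \<epsilon>) > 0" using \<epsilon> by simp
  ultimately show False using sub[OF zV] by linarith
qed

text \<open>On the half ball where \<open>s = (x - a) \<bullet> e\<close> is nonnegative, the odd part of \<open>u\<close> is compared
  with the harmonic polynomial \<open>(2 * M / R\<^sup>2) * (norm (x - a) ^ 2 + n * s * (R - s))\<close>, which is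
  nonnegative on the flat side and at least \<open>2 * M\<close> on the spherical one.\<close>
lemma harmonic_odd_part_bound:
  fixes u :: "'a::euclidean_space \<Rightarrow> real"
  assumes R: "R > 0" and cont: "continuous_on (cball a R) u"
    and u1: "\<And>y b. y \<in> ball a R \<Longrightarrow> b \<in> Basis \<Longrightarrow> has_dd b u (u1 b y) y"
    and u2: "\<And>y b. y \<in> ball a R \<Longrightarrow> b \<in> Basis \<Longrightarrow> has_dd b (u1 b) (u2 b y) y"
    and harm: "\<And>y. y \<in> ball a R \<Longrightarrow> (\<Sum>b\<in>Basis. u2 b y) = 0"
    and M: "\<And>y. y \<in> cball a R \<Longrightarrow> \<bar>u y\<bar> \<le> M"
    and e: "e \<in> Basis" and s: "0 \<le> s" "s \<le> R"
  shows "u (a + s *\<^sub>R e) - u (a - s *\<^sub>R e) \<le> 2 * M * DIM('a) * s / R"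
proof -
  define n where "n = real DIM('a)"
  have n: "n \<ge> 1" using DIM_positive[where 'a='a] by (simp add: n_def Suc_leI)
  define C where "C = 2 * M / R\<^sup>2"
  have M0: "M \<ge> 0" using M[of a] R by auto
  have C: "C \<ge> 0" using M0 by (simp add: C_def)
  \<comment> \<open>The map taking x to A x + c is the reflection in the hyperplane through
    \<open>a\<close> orthogonal to \<open>e\<close>, so \<open>u\<close> minus its reflection
    vanishes there.\<close>
  define A where "A x = x - (2 * (x \<bullet> e)) *\<^sub>R e" for x :: 'a
  have A: "linear A"
    by (rule linearI) (simp_all add: A_def inner_add_left algebra_simps)
  define c where "c = (2 * (a \<bullet> e)) *\<^sub>R e"
  have Ab: "A b = (if b = e then -1 else 1) *\<^sub>R b" if "b \<in> Basis" for b
    using that e by (auto simp: A_def inner_Basis algebra_simps scaleR_2)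
  have refl: "A x + c - a = A (x - a)" for x
    by (simp add: A_def c_def inner_diff_left algebra_simps)
  have "A x \<bullet> A x = x \<bullet> x" for x
    using e by (simp add: A_def inner_diff_left inner_diff_right inner_Basis inner_commute algebra_simps)
  then have normA: "norm (A x) = norm x" for x by (simp add: norm_eq_sqrt_inner)
  have "dist a (A x + c) = dist a x" for x
    using refl[of x] normA[of "x - a"] by (metis dist_commute dist_norm)
  then have in_ball: "A x + c \<in> ball a R \<longleftrightarrow> x \<in> ball a R" "A x + c \<in> cball a R \<longleftrightarrow> x \<in> cball a R" for x
    by simp_all
  define h where "h x = C *\<^sub>R ((x - a) \<bullet> (x - a) + n *\<^sub>R (((x - a) \<bullet> e) * (R - (x - a) \<bullet> e)))" for x
  define h1 where "h1 b x = C *\<^sub>R (2 * ((x - a) \<bullet> b) + n *\<^sub>R (((x - a) \<bullet> e) * (0 - b \<bullet> e) + (b \<bullet> e) * (R - (x - a) \<bullet> e)))" for b x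
  define h2 where "h2 b x = C *\<^sub>R (2 *\<^sub>R (b \<bullet> b) + n *\<^sub>R ((b \<bullet> e) *\<^sub>R (0 - b \<bullet> e) + (b \<bullet> e) *\<^sub>R (0 - b \<bullet> e)))" for b :: 'a and x :: 'a
  have dh1: "has_dd b h (h1 b x) x" for b x
    unfolding h_def h1_def
    by (intro has_dd_cmul has_dd_add has_dd_inner_self has_dd_real_mult has_dd_inner_left has_dd_diff has_dd_const)
  have dh2: "has_dd b (h1 b) (h2 b x) x" for b x
  proof -
    have "has_dd b (\<lambda>x. C *\<^sub>R (2 *\<^sub>R ((x - a) \<bullet> b) + n *\<^sub>R ((0 - b \<bullet> e) *\<^sub>R ((x - a) \<bullet> e) + (b \<bullet> e) *\<^sub>R (R - (x - a) \<bullet> e))))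
      (C *\<^sub>R (2 *\<^sub>R (b \<bullet> b) + n *\<^sub>R ((0 - b \<bullet> e) *\<^sub>R (b \<bullet> e) + (b \<bullet> e) *\<^sub>R (0 - b \<bullet> e)))) x"
      by (intro has_dd_cmul has_dd_add has_dd_inner_left has_dd_diff has_dd_const)
    then show ?thesis by (simp add: h1_def[abs_def] h2_def algebra_simps)
  qed
  \<comment> \<open>Every direction contributes 2C from the squared norm, and \<open>e\<close>
    contributes a further -2Cn from the quadratic term; n is the dimension, so the sum
    vanishes.\<close>
  have sum_h2: "(\<Sum>b\<in>Basis. h2 b x) = 0" for x
  proof -
    have "(\<Sum>b\<in>Basis. h2 b x) = (\<Sum>b\<in>Basis. C * 2 - (if b = e then C * 2 * n else 0))"
      using e by (intro sum.cong) (auto simp: h2_def inner_Basis algebra_simps)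
    also have "\<dots> = 0" using e by (simp add: sum_subtractf n_def)
    finally show ?thesis .
  qed
  define w where "w x = u x - u (A x + c) - h x" for x
  define w1 where "w1 b x = u1 b x - (if b = e then -1 else 1) *\<^sub>R u1 b (A x + c) - h1 b x" for b x
  define w2 where "w2 b x = u2 b x - u2 b (A x + c) - h2 b x" for b x
  define K where "K = cball a R \<inter> {x. (x - a) \<bullet> e \<ge> 0}"
  define V where "V = ball a R \<inter> {x. (x - a) \<bullet> e > 0}"
  have comp: "has_dd b (\<lambda>x. G (A x + c)) ((if b = e then -1 else 1) *\<^sub>R d) x"
    if "has_dd b G d (A x + c)" "b \<in> Basis" for b G x and d :: real
  proof -
    have "has_dd (A b) G ((if b = e then -1 else 1) *\<^sub>R d) (A x + c)"
      unfolding Ab[OF that(2)] by (rule has_dd_dir_scale[OF that(1)])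
    then have "has_dd (A b) (\<lambda>y. G (y + c)) ((if b = e then -1 else 1) *\<^sub>R d) (A x)"
      by (simp add: has_dd_translate)
    then show ?thesis using has_dd_comp_linear[OF A, of b "\<lambda>y. G (y + c)"] by simp
  qed
  have "w (a + s *\<^sub>R e) \<le> 0"
  proof (rule subharmonic_le_boundary[where K = K and V = V and u = w and ?u1.0 = w1 and ?u2.0 = w2])
    show "compact K" unfolding K_def
      by (intro compact_Int_closed compact_cball closed_Collect_le continuous_intros)
    have "continuous_on (cball a R) (\<lambda>x. u (A x + c))"
    proof (rule continuous_on_compose2[OF cont])
      show "continuous_on (cball a R) (\<lambda>x. A x + c)"
        using A by (intro continuous_on_add linear_continuous_on continuous_on_const)
          (simp add: linear_conv_bounded_linear)
    qed (use in_ball in auto)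
    then have "continuous_on (cball a R) w"
      unfolding w_def h_def using cont by (intro continuous_intros)
    then show "continuous_on K w" unfolding K_def using continuous_on_subset by blast
    show "open V" unfolding V_def
      by (intro open_Int open_ball open_Collect_less continuous_intros)
    show "V \<subseteq> K" by (auto simp: V_def K_def)
    show "a + s *\<^sub>R e \<in> K" using s e by (auto simp: K_def dist_norm inner_Basis)
    fix y
    {
      assume y: "y \<in> K - V"
      then have yK: "y \<in> cball a R" "(y - a) \<bullet> e \<ge> 0" by (auto simp: K_def)
      show "w y \<le> 0"
      proof (cases "(y - a) \<bullet> e = 0")
        case True
        then have "A y + c = y" by (simp add: A_def c_def inner_diff_left algebra_simps)
        moreover have "h y \<ge> 0" using True C by (simp add: h_def)
        ultimately show ?thesis by (simp add: w_def)
      next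
        case False
        then have nR: "norm (y - a) = R" using y by (auto simp: K_def V_def dist_norm norm_minus_commute)
        have "\<bar>(y - a) \<bullet> e\<bar> \<le> R" using Basis_le_norm[OF e, of "y - a"] nR by simp
        then have "((y - a) \<bullet> e) * (R - (y - a) \<bullet> e) \<ge> 0" using yK by simp
        then have "h y \<ge> C * R\<^sup>2"
          unfolding h_def using C n nR by (simp add: dot_square_norm mult_left_mono)
        then have "h y \<ge> 2 * M" using R by (simp add: C_def)
        moreover have "\<bar>u y\<bar> \<le> M" "\<bar>u (A y + c)\<bar> \<le> M" using M yK in_ball by auto
        ultimately show ?thesis by (simp add: w_def)
      qed
    }
    assume "y \<in> V"
    then have y: "y \<in> ball a R" "A y + c \<in> ball a R" by (auto simp: V_def in_ball simp del: mem_ball)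
    {
      fix b :: 'a assume b: "b \<in> Basis"
      show "has_dd b w (w1 b y) y"
        unfolding w_def w1_def by (intro has_dd_diff comp u1 dh1 y b)
      have "has_dd b (w1 b) (u2 b y - (if b = e then -1 else 1) *\<^sub>R ((if b = e then -1 else 1) *\<^sub>R u2 b (A y + c)) - h2 b y) y"
        unfolding w1_def by (intro has_dd_diff has_dd_cmul comp u2 dh2 y b)
      then show "has_dd b (w1 b) (w2 b y) y" by (simp add: w2_def split: if_splits)
    }
    show "0 \<le> (\<Sum>b\<in>Basis. w2 b y)"
      unfolding w2_def using harm[OF y(1)] harm[OF y(2)] sum_h2 by (simp add: sum_subtractf)
  qed
  moreover have "A (a + s *\<^sub>R e) + c = a - s *\<^sub>R e"
    using e by (simp add: A_def c_def inner_add_left inner_Basis algebra_simps)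
      (simp flip: scaleR_add_left)
  moreover have "h (a + s *\<^sub>R e) \<le> 2 * M * n * s / R"
  proof -
    have "h (a + s *\<^sub>R e) = C * (s\<^sup>2 + n * (s * (R - s)))"
      using e by (simp add: h_def inner_Basis power2_eq_square)
    also have "\<dots> \<le> C * (n * s * R)"
    proof (rule mult_left_mono[OF _ C])
      have "s\<^sup>2 * 1 \<le> s\<^sup>2 * n" using n by (intro mult_left_mono) auto
      then show "s\<^sup>2 + n * (s * (R - s)) \<le> n * s * R" by (simp add: algebra_simps power2_eq_square)
    qed
    also have "\<dots> = 2 * M * n * s / R" using R by (simp add: C_def power2_eq_square)
    finally show ?thesis .
  qed
  ultimately show ?thesis by (simp add: w_def n_def)
qed

section \<open>Steklov averages and generalized Dirac systems\<close>

lemma has_dd_integral: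
  fixes G :: "'a::euclidean_space \<Rightarrow> real \<Rightarrow> 'b::euclidean_space"
  assumes V: "open V" "y \<in> V"
    and d: "\<And>x t. x \<in> V \<Longrightarrow> t \<in> {0..1} \<Longrightarrow> has_dd u (\<lambda>x. G x t) (G' x t) x"
    and c: "continuous_on (V \<times> {0..1}) (\<lambda>(x,t). G x t)"
    and c': "continuous_on (V \<times> {0..1}) (\<lambda>(x,t). G' x t)"
  shows "has_dd u (\<lambda>x. integral {0..1} (G x)) (integral {0..1} (G' y)) y"
proof -
  obtain \<delta> where \<delta>: "\<delta> > 0" "ball y \<delta> \<subseteq> V" using V openE by blast
  define d where "d = \<delta> / (norm u + 1)"
  have "d > 0" using \<delta> by (auto simp: d_def add_nonneg_pos)
  have line: "y + \<tau> *\<^sub>R u \<in> V" if "\<tau> \<in> ball 0 d" for \<tau>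
  proof -
    have "\<bar>\<tau>\<bar> * norm u \<le> \<bar>\<tau>\<bar> * (norm u + 1)" by (simp add: mult_left_mono)
    also have "\<dots> < \<delta>" using that \<delta> by (simp add: d_def pos_less_divide_eq add_nonneg_pos)
    finally show ?thesis using line_in_ball \<delta> by blast
  qed
  have "((\<lambda>\<tau>. integral (cbox 0 1) (G (y + \<tau> *\<^sub>R u))) has_vector_derivative
      integral (cbox 0 1) (G' (y + 0 *\<^sub>R u))) (at 0 within ball 0 d)"
  proof (rule leibniz_rule_vector_derivative)
    fix \<tau> t :: real assume *: "\<tau> \<in> ball 0 d" "t \<in> cbox 0 1"
    show "((\<lambda>\<tau>. G (y + \<tau> *\<^sub>R u) t) has_vector_derivative G' (y + \<tau> *\<^sub>R u) t) (at \<tau> within ball 0 d)"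
      using d[OF line[OF *(1)], of t] * by (simp add: has_dd_along has_vector_derivative_at_within)
  next
    fix \<tau> :: real assume *: "\<tau> \<in> ball 0 d"
    have "continuous_on (cbox 0 1) (\<lambda>t. (\<lambda>(x,t). G x t) (y + \<tau> *\<^sub>R u, t))"
      by (rule continuous_on_compose2[OF c]) (use line[OF *] in \<open>auto intro!: continuous_intros\<close>)
    then show "G (y + \<tau> *\<^sub>R u) integrable_on cbox 0 1"
      by (intro integrable_continuous) simp
  next
    have "continuous_on (ball 0 d \<times> cbox 0 1) (\<lambda>z. (\<lambda>(x,t). G' x t) (y + fst z *\<^sub>R u, snd z))"
      by (rule continuous_on_compose2[OF c']) (use line in \<open>auto intro!: continuous_intros\<close>)
    then show "continuous_on (ball 0 d \<times> cbox 0 1) (\<lambda>(\<tau>, t). G' (y + \<tau> *\<^sub>R u) t)"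
      by (simp add: case_prod_unfold)
  qed (use \<open>d > 0\<close> in auto)
  then show ?thesis
    using \<open>d > 0\<close> by (simp add: has_dd_def at_within_open[of 0 "ball 0 d"])
qed

lemma continuous_on_integral01:
  fixes G :: "'a::euclidean_space \<Rightarrow> real \<Rightarrow> 'b::euclidean_space"
  assumes "continuous_on (V \<times> {0..1}) (\<lambda>(x,t). G x t)"
  shows "continuous_on V (\<lambda>x. integral {0..1} (G x))"
  using integral_continuous_on_param[of V 0 1 G] assms by simp

text \<open>The mean of \<open>g\<close> over the segment of length \<open>h\<close> from
  \<open>x\<close> in direction \<open>b\<close>. Such averages commute with constant coefficient
  operators, and their smoothing effect is explicit by the fundamental theorem of calculus.\<close>

definition stek :: "real \<Rightarrow> 'a::euclidean_space \<Rightarrow> ('a \<Rightarrow> 'b::euclidean_space) \<Rightarrow> 'a \<Rightarrow> 'b" where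
  "stek h b g x = integral {0..1} (\<lambda>t. g (x + (t * h) *\<^sub>R b))"

lemma stek_dom:
  assumes "b \<in> Basis" "h > 0" "x \<in> ball a (\<rho> - h)" "t \<in> {0..1}"
  shows "x + (t * h) *\<^sub>R b \<in> ball a \<rho>"
proof -
  have "dist a (x + (t * h) *\<^sub>R b) \<le> dist a x + dist x (x + (t * h) *\<^sub>R b)" by (rule dist_triangle)
  also have "dist x (x + (t * h) *\<^sub>R b) = t * h" using assms by (simp add: dist_norm)
  also have "dist a x + t * h \<le> dist a x + 1 * h" using assms by (intro add_left_mono mult_right_mono) auto
  also have "\<dots> < \<rho>" using assms by simp
  finally show ?thesis by simp
qed

lemma stek_cont_param:
  assumes "b \<in> Basis" "h > 0" "continuous_on (ball a \<rho>) g"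
  shows "continuous_on (ball a (\<rho> - h) \<times> {0..1}) (\<lambda>(x, t). g (x + (t * h) *\<^sub>R b))"
proof -
  have "continuous_on (ball a (\<rho> - h) \<times> {0..1}) (\<lambda>z. g (fst z + (snd z * h) *\<^sub>R b))"
    by (rule continuous_on_compose2[OF assms(3)])
       (use stek_dom[OF assms(1,2)] in \<open>auto intro!: continuous_intros simp del: mem_ball\<close>)
  then show ?thesis by (simp add: case_prod_unfold)
qed

lemma stek_cont_line:
  assumes "b \<in> Basis" "h > 0" "continuous_on (ball a \<rho>) g" "x \<in> ball a (\<rho> - h)"
  shows "continuous_on {0..1} (\<lambda>t. g (x + (t * h) *\<^sub>R b))"
  by (rule continuous_on_compose2[OF assms(3)])
     (use stek_dom[OF assms(1,2,4)] in \<open>auto intro!: continuous_intros simp del: mem_ball\<close>)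

lemma stek_continuous:
  "b \<in> Basis \<Longrightarrow> h > 0 \<Longrightarrow> continuous_on (ball a \<rho>) g \<Longrightarrow> continuous_on (ball a (\<rho> - h)) (stek h b g)"
  unfolding stek_def by (rule continuous_on_integral01[OF stek_cont_param])

lemma stek_has_dd:
  assumes "b \<in> Basis" "h > 0"
    and "\<And>x. x \<in> ball a \<rho> \<Longrightarrow> has_dd u g (g' x) x"
    and "continuous_on (ball a \<rho>) g" "continuous_on (ball a \<rho>) g'"
    and "x \<in> ball a (\<rho> - h)"
  shows "has_dd u (stek h b g) (stek h b g' x) x"
  unfolding stek_def
  by (rule has_dd_integral[OF open_ball assms(6)])
     (use assms stek_cont_param stek_dom[OF assms(1,2)] in \<open>auto simp: has_dd_translate simp del: mem_ball\<close>)

lemma stek_C1: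
  assumes b: "b \<in> Basis" "h > 0" and g: "C1_on (ball a \<rho>) g"
  shows "C1_on (ball a (\<rho> - h)) (stek h b g)"
    and "\<And>u x. u \<in> Basis \<Longrightarrow> x \<in> ball a (\<rho> - h) \<Longrightarrow> dd u (stek h b g) x = stek h b (dd u g) x"
proof -
  have *: "has_dd u (stek h b g) (stek h b (dd u g) x) x" if "u \<in> Basis" "x \<in> ball a (\<rho> - h)" for u x
    by (rule stek_has_dd[OF b _ _ _ that(2)]) (use g that in \<open>auto simp: C1_on_def\<close>)
  then show "\<And>u x. u \<in> Basis \<Longrightarrow> x \<in> ball a (\<rho> - h) \<Longrightarrow> dd u (stek h b g) x = stek h b (dd u g) x"
    using has_dd_imp_dd by blast
  show "C1_on (ball a (\<rho> - h)) (stek h b g)"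
    by (rule C1_onI[OF _ *]) (use g in \<open>auto simp: C1_on_def intro!: stek_continuous b\<close>)
qed

text \<open>Fundamental theorem of calculus along the segment. No derivative of \<open>g\<close> is
  left on the right, so averaging gains one order of differentiability in direction
  \<open>b\<close>.\<close>

lemma stek_dd_self:
  assumes b: "b \<in> Basis" "h > 0" and g: "C1_on (ball a \<rho>) g" and x: "x \<in> ball a (\<rho> - h)"
  shows "stek h b (dd b g) x = (1/h) *\<^sub>R (g (x + h *\<^sub>R b) - g x)"
proof -
  have "((\<lambda>t. dd b g (x + (t * h) *\<^sub>R b)) has_integral
      ((1/h) *\<^sub>R g (x + (1 * h) *\<^sub>R b) - (1/h) *\<^sub>R g (x + (0 * h) *\<^sub>R b))) {0..1}"
  proof (rule fundamental_theorem_of_calculus)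
    fix t :: real assume t: "t \<in> {0..1}"
    have "has_dd b g (dd b g (x + (t * h) *\<^sub>R b)) (x + (t * h) *\<^sub>R b)"
      using g b stek_dom[OF b x t] by (simp add: C1_on_def)
    then have 1: "((\<lambda>t. g (x + t *\<^sub>R b)) has_vector_derivative dd b g (x + (t * h) *\<^sub>R b)) (at (t * h))"
      by (simp add: has_dd_along)
    have 2: "((\<lambda>t. t * h) has_vector_derivative h) (at t)"
      by (auto intro!: derivative_eq_intros)
    have "((\<lambda>t. g (x + (t * h) *\<^sub>R b)) has_vector_derivative (h *\<^sub>R dd b g (x + (t * h) *\<^sub>R b))) (at t)"
      using vector_diff_chain_at[OF 2 1] by (simp add: o_def)
    then have "((\<lambda>t. (1/h) *\<^sub>R g (x + (t * h) *\<^sub>R b)) has_vector_derivative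
        (1/h) *\<^sub>R (h *\<^sub>R dd b g (x + (t * h) *\<^sub>R b))) (at t)"
      by (rule bounded_linear.has_vector_derivative[OF bounded_linear_scaleR_right])
    then show "((\<lambda>t. (1/h) *\<^sub>R g (x + (t * h) *\<^sub>R b)) has_vector_derivative
        dd b g (x + (t * h) *\<^sub>R b)) (at t within {0..1})"
      using b by (simp add: has_vector_derivative_at_within)
  qed simp
  then show ?thesis by (simp add: stek_def integral_unique algebra_simps)
qed

text \<open>The reference value \<open>c\<close> is free: c = 0 transports a supremum bound, and a
  value of \<open>g\<close> nearby measures the distance to the original function.\<close>

lemma stek_norm_le:
  assumes b: "b \<in> Basis" "h > 0" and g: "continuous_on (ball a \<rho>) g" and x: "x \<in> ball a (\<rho> - h)"
    and \<epsilon>: "\<And>t. t \<in> {0..1} \<Longrightarrow> norm (g (x + (t * h) *\<^sub>R b) - c) \<le> \<epsilon>"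
  shows "norm (stek h b g x - c) \<le> \<epsilon>"
proof -
  have cont: "continuous_on {0..1} (\<lambda>t. g (x + (t * h) *\<^sub>R b))"
    by (rule stek_cont_line[OF b g x])
  have "stek h b g x - c = integral {0..1} (\<lambda>t. g (x + (t * h) *\<^sub>R b) - c)"
    unfolding stek_def
    using integral_diff[OF integrable_continuous_interval[OF cont] integrable_const_ivl] by simp
  also have "norm \<dots> \<le> \<epsilon> * (1 - 0)"
    by (rule integral_bound) (use cont \<epsilon> in \<open>auto intro!: continuous_intros\<close>)
  finally show ?thesis by simp
qed

text \<open>\<open>E b\<close> plays the role of left multiplication by a basis vector and \<open>E' b\<close> that of multiplication by
  its conjugate, so that the Clifford relations factor the Laplacian.  Monogenic functions are constant
  in the directions outside \<open>I\<close>.\<close>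

locale dirac_system =
  fixes I :: "'a::euclidean_space set"
    and E E' :: "'a \<Rightarrow> 'b::euclidean_space \<Rightarrow> 'b"
  assumes I: "I \<subseteq> Basis"
    and linear_E: "\<And>b. b \<in> I \<Longrightarrow> linear (E b)"
    and linear_E': "\<And>b. b \<in> I \<Longrightarrow> linear (E' b)"
    and clifford: "\<And>a b x. a \<in> I \<Longrightarrow> b \<in> I \<Longrightarrow> E' a (E b x) + E' b (E a x) = (if a = b then 2 *\<^sub>R x else 0)"
begin

definition monog :: "'a set \<Rightarrow> ('a \<Rightarrow> 'b) \<Rightarrow> bool" where
  "monog U g \<longleftrightarrow> C1_on U g \<and>
     (\<forall>y\<in>U. (\<Sum>b\<in>I. E b (dd b g y)) = 0 \<and> (\<forall>b\<in>Basis - I. dd b g y = 0))"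

lemma finite_I [simp]: "finite I"
  by (rule finite_subset[OF I finite_Basis])

lemma bounded_linear_E: "b \<in> I \<Longrightarrow> bounded_linear (E b)"
  using linear_E linear_conv_bounded_linear by blast

lemma monog_subset: "monog U g \<Longrightarrow> V \<subseteq> U \<Longrightarrow> monog V g"
  unfolding monog_def using C1_on_subset by blast

lemma monogI:
  assumes "continuous_on U g"
    and d: "\<And>b y. b \<in> Basis \<Longrightarrow> y \<in> U \<Longrightarrow> has_dd b g (g' b y) y"
    and "\<And>b. b \<in> Basis \<Longrightarrow> continuous_on U (g' b)"
    and "\<And>y. y \<in> U \<Longrightarrow> (\<Sum>b\<in>I. E b (g' b y)) = 0"
    and "\<And>b y. b \<in> Basis - I \<Longrightarrow> y \<in> U \<Longrightarrow> g' b y = 0"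
  shows "monog U g"
proof -
  have "dd b g y = g' b y" if "b \<in> Basis" "y \<in> U" for b y
    using d[OF that] by (rule has_dd_imp_dd)
  moreover have "C1_on U g" using C1_onI[OF assms(1) d assms(3)] by blast
  ultimately show ?thesis unfolding monog_def using assms(4,5) I by (simp add: subset_eq)
qed

lemma monog_has_dd: "monog U g \<Longrightarrow> b \<in> Basis \<Longrightarrow> y \<in> U \<Longrightarrow> has_dd b g (dd b g y) y"
  by (simp add: monog_def C1_on_def)

text \<open>The operators \<open>E b\<close> do not depend on the point, so they pass under the
  integral.\<close>

lemma monog_stek:
  assumes b: "b \<in> Basis" "h > 0" and g: "monog (ball a \<rho>) g"
  shows "monog (ball a (\<rho> - h)) (stek h b g)"
proof -
  have C1: "C1_on (ball a \<rho>) g" using g by (simp add: monog_def)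
  have sub: "x \<in> ball a (\<rho> - h) \<Longrightarrow> t \<in> {0..1} \<Longrightarrow> x + (t * h) *\<^sub>R b \<in> ball a \<rho>" for x t
    by (rule stek_dom[OF b])
  have "(\<Sum>u\<in>I. E u (dd u (stek h b g) x)) = 0" if x: "x \<in> ball a (\<rho> - h)" for x
  proof -
    have int: "(\<lambda>t. dd u g (x + (t * h) *\<^sub>R b)) integrable_on {0..1}" if "u \<in> Basis" for u
      using C1 that by (intro integrable_continuous_interval stek_cont_line[OF b _ x]) (auto simp: C1_on_def)
    have "(\<Sum>u\<in>I. E u (dd u (stek h b g) x))
        = (\<Sum>u\<in>I. integral {0..1} (\<lambda>t. E u (dd u g (x + (t * h) *\<^sub>R b))))"
    proof (rule sum.cong)
      fix u assume u: "u \<in> I"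
      then have "u \<in> Basis" using I by blast
      then show "E u (dd u (stek h b g) x) = integral {0..1} (\<lambda>t. E u (dd u g (x + (t * h) *\<^sub>R b)))"
        using stek_C1(2)[OF b C1 _ x] integral_linear[OF int bounded_linear_E[OF u]]
        by (simp add: stek_def o_def)
    qed simp
    also have "\<dots> = integral {0..1} (\<lambda>t. \<Sum>u\<in>I. E u (dd u g (x + (t * h) *\<^sub>R b)))"
      using I integrable_linear[OF int bounded_linear_E] by (intro integral_sum[symmetric]) (auto simp: o_def)
    also have "\<dots> = integral {0..1} (\<lambda>t::real. 0)"
      using g sub[OF x] by (intro integral_cong) (auto simp: monog_def simp del: mem_ball)
    finally show ?thesis by simp
  qed
  moreover have "dd u (stek h b g) x = 0" if "x \<in> ball a (\<rho> - h)" "u \<in> Basis - I" for x u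
  proof -
    have "dd u (stek h b g) x = integral {0..1} (\<lambda>t. dd u g (x + (t * h) *\<^sub>R b))"
      using stek_C1(2)[OF b C1 _ that(1), of u] that(2) by (simp add: stek_def)
    also have "\<dots> = integral {0..1} (\<lambda>t::real. 0)"
      using g sub[OF that(1)] that(2) by (intro integral_cong) (simp add: monog_def del: mem_ball)
    finally have "dd u (stek h b g) x = integral {0..1} (\<lambda>t::real. 0)" .
    then show ?thesis by simp
  qed
  ultimately show ?thesis
    unfolding monog_def using stek_C1(1)[OF b C1] by blast
qed

text \<open>Applying the conjugate operator, built from \<open>E'\<close>, to the Dirac equation and
  symmetrizing in the two indices leaves the pure second derivatives, by the Clifford relations;
  directions outside \<open>I\<close> contribute zero. Second derivatives are assumed, since at this
  stage they are available for averages only.\<close>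

lemma monog_harmonic:
  assumes U: "open U" "y \<in> U" and g: "monog U g" and C2: "\<And>b. b \<in> Basis \<Longrightarrow> C1_on U (dd b g)"
  shows "(\<Sum>b\<in>Basis. dd b (dd b g) y) = 0"
proof -
  define P where "P a b = dd a (dd b g) y" for a b
  have 1: "has_dd a (dd b g) (P a b) y" if "a \<in> Basis" "b \<in> Basis" for a b
    unfolding P_def using C2[OF that(2)] that(1) U by (simp add: C1_on_def)
  have sym: "P a b = P b a" if "a \<in> Basis" "b \<in> Basis" for a b
  proof -
    have "has_dd a (dd b g) (dd b (dd a g) y) y"
      by (rule has_dd_commute[OF U, where G = g and Ga = "dd a g"])
         (use g C2 that in \<open>auto simp: monog_def C1_on_def\<close>)
    then show ?thesis using 1[OF that] has_dd_imp_dd unfolding P_def by blast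
  qed
  have D: "(\<Sum>b\<in>I. E b (P a b)) = 0" if a: "a \<in> Basis" for a
  proof -
    have "has_dd a (\<lambda>x. \<Sum>b\<in>I. E b (dd b g x)) (\<Sum>b\<in>I. E b (P a b)) y"
      using I by (intro has_dd_sum has_dd_bounded_linear[OF bounded_linear_E] 1 a) auto
    moreover have "has_dd a (\<lambda>x. \<Sum>b\<in>I. E b (dd b g x)) 0 y"
      by (rule has_dd_transform_open[OF U, of "\<lambda>_. 0"]) (use g in \<open>auto simp: monog_def has_dd_const\<close>)
    ultimately show ?thesis using has_dd_imp_dd by metis
  qed
  have "2 *\<^sub>R (\<Sum>a\<in>I. P a a) = (\<Sum>a\<in>I. \<Sum>b\<in>I. if a = b then 2 *\<^sub>R P a b else 0)"
    by (simp add: scaleR_sum_right)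
  also have "\<dots> = (\<Sum>a\<in>I. \<Sum>b\<in>I. E' a (E b (P a b)) + E' b (E a (P a b)))"
    by (intro sum.cong refl) (simp add: clifford)
  also have "\<dots> = (\<Sum>a\<in>I. \<Sum>b\<in>I. E' a (E b (P a b))) + (\<Sum>a\<in>I. \<Sum>b\<in>I. E' b (E a (P a b)))"
    by (simp add: sum.distrib)
  also have "(\<Sum>a\<in>I. \<Sum>b\<in>I. E' b (E a (P a b))) = (\<Sum>b\<in>I. \<Sum>a\<in>I. E' b (E a (P b a)))"
    using I by (subst sum.swap) (intro sum.cong refl, metis sym subsetD)
  also have "(\<Sum>a\<in>I. \<Sum>b\<in>I. E' a (E b (P a b))) = (\<Sum>a\<in>I. E' a (\<Sum>b\<in>I. E b (P a b)))"
    using linear_E' by (intro sum.cong refl) (simp add: linear_sum)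
  also have "\<dots> = 0"
  proof (intro sum.neutral ballI)
    fix a assume a: "a \<in> I"
    then have "a \<in> Basis" using I by blast
    then show "E' a (\<Sum>b\<in>I. E b (P a b)) = 0" using D linear_0[OF linear_E'[OF a]] by simp
  qed
  finally have "(\<Sum>a\<in>I. P a a) = 0" by simp
  moreover have "P b b = 0" if b: "b \<in> Basis - I" for b
  proof -
    have "has_dd b (dd b g) 0 y"
      by (rule has_dd_transform_open[OF U, of "\<lambda>_. 0"]) (use g b in \<open>auto simp: monog_def has_dd_const\<close>)
    then show ?thesis using has_dd_imp_dd unfolding P_def by blast
  qed
  ultimately show ?thesis
    unfolding P_def[symmetric] using I by (simp add: sum.subset_diff[OF I])
qed

text \<open>One average per direction in \<open>L\<close> makes the derivative in each of these
  directions continuously differentiable; if \<open>L\<close> enumerates the basis, the result is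
  C^2. Each average costs \<open>h\<close> of the radius. The last clause controls the size and the
  distance to \<open>g\<close> at once.\<close>

lemma monog_stek_iterated:
  fixes h :: real
  assumes h: "h > 0" and L: "set L \<subseteq> Basis" and g: "monog (ball a \<rho>) g"
  shows "monog (ball a (\<rho> - length L * h)) (foldr (stek h) L g) \<and>
    (\<forall>u\<in>set L. C1_on (ball a (\<rho> - length L * h)) (dd u (foldr (stek h) L g))) \<and>
    (\<forall>x\<in>ball a (\<rho> - length L * h). \<forall>c \<epsilon>. (\<forall>z\<in>cball x (length L * h). norm (g z - c) \<le> \<epsilon>) \<longrightarrow>
       norm (foldr (stek h) L g x - c) \<le> \<epsilon>)"
  using L
proof (induction L)
  case Nil
  then show ?case using g by simp
next
  case (Cons b L)
  define \<rho>' where "\<rho>' = \<rho> - length L * h"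
  define gL where "gL = foldr (stek h) L g"
  have b: "b \<in> Basis" using Cons by simp
  have IH: "monog (ball a \<rho>') gL" "\<And>u. u \<in> set L \<Longrightarrow> C1_on (ball a \<rho>') (dd u gL)"
    "\<And>x c \<epsilon>. x \<in> ball a \<rho>' \<Longrightarrow> (\<And>z. z \<in> cball x (length L * h) \<Longrightarrow> norm (g z - c) \<le> \<epsilon>) \<Longrightarrow>
       norm (gL x - c) \<le> \<epsilon>"
    using Cons unfolding \<rho>'_def gL_def by auto
  have \<rho>'': "\<rho> - length (b # L) * h = \<rho>' - h" by (simp add: \<rho>'_def algebra_simps)
  have C1: "C1_on (ball a \<rho>') gL" using IH(1) by (simp add: monog_def)
  have "C1_on (ball a (\<rho>' - h)) (dd u (stek h b gL))" if u: "u \<in> set (b # L)" for u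
  proof -
    have uB: "u \<in> Basis" using Cons u by auto
    show ?thesis
    proof (cases "u = b")
      \<comment> \<open>For an earlier direction the derivative is the average of a continuously
        differentiable function; for the new direction, in the other case, it is a difference
        quotient.\<close>
      case False
      then have uL: "u \<in> set L" using u by simp
      show ?thesis
        by (rule C1_on_cong[OF open_ball _ stek_C1(1)[OF b h IH(2)[OF uL]]])
           (simp add: stek_C1(2)[OF b h C1 uB] del: mem_ball)
    next
      case True
      have sub1: "x \<in> ball a (\<rho>' - h) \<Longrightarrow> x + h *\<^sub>R b \<in> ball a \<rho>'" for x
        using stek_dom[OF b h, of x a \<rho>' 1] by simp
      have sub2: "ball a (\<rho>' - h) \<subseteq> ball a \<rho>'" using h by (intro subset_ball) simp
      have "C1_on (ball a (\<rho>' - h)) (\<lambda>x. (1/h) *\<^sub>R (gL (x + h *\<^sub>R b) - gL x))"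
      proof (rule C1_onI[where g' = "\<lambda>u x. (1/h) *\<^sub>R (dd u gL (x + h *\<^sub>R b) - dd u gL x)"])
        have *: "continuous_on (ball a (\<rho>' - h)) (\<lambda>x. (1/h) *\<^sub>R (F (x + h *\<^sub>R b) - F x))"
          if F: "continuous_on (ball a \<rho>') F" for F :: "'a \<Rightarrow> 'b"
          by (intro continuous_intros continuous_on_compose2[OF F] continuous_on_subset[OF F sub2])
             (use sub1 in \<open>auto simp del: mem_ball\<close>)
        show "continuous_on (ball a (\<rho>' - h)) (\<lambda>x. (1/h) *\<^sub>R (gL (x + h *\<^sub>R b) - gL x))"
          using C1 by (intro *) (simp add: C1_on_def)
        fix v :: 'a assume v: "v \<in> Basis"
        then show "continuous_on (ball a (\<rho>' - h)) (\<lambda>x. (1/h) *\<^sub>R (dd v gL (x + h *\<^sub>R b) - dd v gL x))"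
          using C1 by (intro *) (simp add: C1_on_def)
        fix y assume y: "y \<in> ball a (\<rho>' - h)"
        show "has_dd v (\<lambda>x. (1/h) *\<^sub>R (gL (x + h *\<^sub>R b) - gL x))
          ((1/h) *\<^sub>R (dd v gL (y + h *\<^sub>R b) - dd v gL y)) y"
          by (intro has_dd_cmul has_dd_diff has_dd_translate[THEN iffD2] C1_on_has_dd_Basis[OF C1 v]
              sub1 y subsetD[OF sub2])
      qed
      then show ?thesis
        by (rule C1_on_cong[OF open_ball, rotated])
           (use True stek_C1(2)[OF b h C1 b] stek_dd_self[OF b h C1] in \<open>auto simp del: mem_ball\<close>)
    qed
  qed
  moreover have "monog (ball a (\<rho>' - h)) (stek h b gL)" by (rule monog_stek[OF b h IH(1)])
  moreover have "norm (stek h b gL x - c) \<le> \<epsilon>"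
    if x: "x \<in> ball a (\<rho>' - h)" and c: "\<forall>z\<in>cball x (length (b # L) * h). norm (g z - c) \<le> \<epsilon>" for x c \<epsilon>
  proof (rule stek_norm_le[OF b h _ x])
    show "continuous_on (ball a \<rho>') gL" using C1 by (simp add: C1_on_def)
    fix t :: real assume t: "t \<in> {0..1}"
    show "norm (gL (x + (t * h) *\<^sub>R b) - c) \<le> \<epsilon>"
    proof (rule IH(3)[OF stek_dom[OF b h x t]])
      fix z assume "z \<in> cball (x + (t * h) *\<^sub>R b) (length L * h)"
      then have "dist x z \<le> dist x (x + (t * h) *\<^sub>R b) + length L * h"
        by (smt (verit) dist_triangle mem_cball)
      also have "dist x (x + (t * h) *\<^sub>R b) = t * h" using t h b by (simp add: dist_norm)
      also have "t * h + length L * h \<le> length (b # L) * h"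
        using t h by (simp add: algebra_simps mult_left_le)
      finally show "norm (g z - c) \<le> \<epsilon>" using c by simp
    qed
  qed
  ultimately show ?case unfolding \<rho>'' gL_def by simp
qed

end

section \<open>Gradient bound and differentiability of monogenic functions\<close>

context dirac_system
begin

lemma monog_continuous: "monog U g \<Longrightarrow> continuous_on U g"
  by (simp add: monog_def C1_on_def)

lemma monog_C1: "monog U g \<Longrightarrow> C1_on U g"
  by (simp add: monog_def)

text \<open>The harmonic estimate needs scalar functions with second derivatives. It is applied to
  the averages \<open>gL\<close> paired with a unit vector; these are within \<eta>/2 of
  \<open>g\<close> at both points, and \<eta> is arbitrary.\<close>

lemma monog_odd_part_bound:
  fixes M s r :: real
  assumes g: "monog (ball a R) g" and M: "\<And>x. x \<in> ball a R \<Longrightarrow> norm (g x) \<le> M"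
    and e: "e \<in> Basis" and r: "0 < r" "r < R" and s: "0 \<le> s" "s \<le> r"
  shows "norm (g (a + s *\<^sub>R e) - g (a - s *\<^sub>R e)) \<le> 2 * M * DIM('a) * s / r"
proof (rule field_le_epsilon)
  fix \<eta> :: real assume \<eta>: "\<eta> > 0"
  define x1 x2 where "x1 = a + s *\<^sub>R e" and "x2 = a - s *\<^sub>R e"
  have x_cball: "x1 \<in> cball a r" "x2 \<in> cball a r" using s e by (auto simp: x1_def x2_def dist_norm)
  then have x_in: "x1 \<in> ball a R" "x2 \<in> ball a R" using r by auto
  have near: "\<exists>\<delta>>0. \<forall>z. dist z x < \<delta> \<longrightarrow> norm (g z - g x) < \<eta>/2" if "x \<in> ball a R" for x
  proof -
    have "isCont g x"
      using monog_continuous[OF g] that by (simp add: continuous_on_eq_continuous_at)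
    then show ?thesis using \<eta> unfolding continuous_at_eps_delta dist_norm by (metis half_gt_zero)
  qed
  obtain \<delta>1 where \<delta>1: "\<delta>1 > 0" "\<And>z. dist z x1 < \<delta>1 \<Longrightarrow> norm (g z - g x1) < \<eta>/2"
    using near[OF x_in(1)] by blast
  obtain \<delta>2 where \<delta>2: "\<delta>2 > 0" "\<And>z. dist z x2 < \<delta>2 \<Longrightarrow> norm (g z - g x2) < \<eta>/2"
    using near[OF x_in(2)] by blast
  obtain L :: "'a list" where L: "set L = Basis" using finite_list[OF finite_Basis] by blast
  define N where "N = real (length L)"
  define m where "m = min (min \<delta>1 \<delta>2) (R - r)"
  have m: "m > 0" "m \<le> \<delta>1" "m \<le> \<delta>2" "m \<le> R - r" using \<delta>1 \<delta>2 r by (auto simp: m_def)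
  \<comment> \<open>All \<open>N\<close> averages together move points by less than
    \<open>m\<close>, hence within the continuity radii at \<open>x1\<close> and \<open>x2\<close>
    and inside the ball of radius \<open>R\<close>.\<close>
  define h where "h = m / (N + 1)"
  have N: "N \<ge> 0" by (simp add: N_def)
  have h: "h > 0" "N * h < m" using m N by (auto simp: h_def field_simps)
  define gL where "gL = foldr (stek h) L g"
  have gL: "monog (ball a (R - N * h)) gL"
    "\<And>u. u \<in> Basis \<Longrightarrow> C1_on (ball a (R - N * h)) (dd u gL)"
    "\<And>x c \<epsilon>. x \<in> ball a (R - N * h) \<Longrightarrow> (\<And>z. z \<in> cball x (N * h) \<Longrightarrow> norm (g z - c) \<le> \<epsilon>) \<Longrightarrow>
       norm (gL x - c) \<le> \<epsilon>"
    using monog_stek_iterated[OF h(1) equalityD1[OF L] g] unfolding N_def gL_def L by auto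
  have sub: "cball a r \<subseteq> ball a (R - N * h)" using h m by auto
  have "norm (gL x1 - g x1) \<le> \<eta>/2"
    by (rule gL(3)[OF subsetD[OF sub x_cball(1)] less_imp_le[OF \<delta>1(2)]])
       (use h m in \<open>auto simp: dist_commute\<close>)
  moreover have "norm (gL x2 - g x2) \<le> \<eta>/2"
    by (rule gL(3)[OF subsetD[OF sub x_cball(2)] less_imp_le[OF \<delta>2(2)]])
       (use h m in \<open>auto simp: dist_commute\<close>)
  ultimately have close: "norm (gL x1 - g x1) \<le> \<eta>/2" "norm (gL x2 - g x2) \<le> \<eta>/2" by auto
  define z where "z = gL x1 - gL x2"
  \<comment> \<open>Pairing with the direction of \<open>z\<close> makes the scalar difference equal
    to the norm of \<open>z\<close>; sgn 0 = 0 covers the degenerate case.\<close>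
  define u where "u x = sgn z \<bullet> gL x" for x
  have "u x1 - u x2 \<le> 2 * M * DIM('a) * s / r"
    unfolding x1_def x2_def
  proof (rule harmonic_odd_part_bound[where ?u1.0 = "\<lambda>b y. sgn z \<bullet> dd b gL y"
        and ?u2.0 = "\<lambda>b y. sgn z \<bullet> dd b (dd b gL) y"])
    show "continuous_on (cball a r) u"
      unfolding u_def using continuous_on_subset[OF monog_continuous[OF gL(1)] sub]
      by (intro continuous_intros)
    fix y assume "y \<in> ball a r"
    then have y: "y \<in> ball a (R - N * h)" using sub ball_subset_cball by blast
    show "(\<Sum>b\<in>Basis. sgn z \<bullet> dd b (dd b gL) y) = 0"
      using monog_harmonic[OF open_ball y gL(1,2)] by (simp flip: inner_sum_right)
    fix b :: 'a assume b: "b \<in> Basis"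
    show "has_dd b u (sgn z \<bullet> dd b gL y) y"
      unfolding u_def using monog_has_dd[OF gL(1) b y]
      by (rule has_dd_bounded_linear[OF bounded_linear_inner_right])
    show "has_dd b (\<lambda>y. sgn z \<bullet> dd b gL y) (sgn z \<bullet> dd b (dd b gL) y) y"
      using C1_on_has_dd_Basis[OF gL(2)[OF b] b y]
      by (rule has_dd_bounded_linear[OF bounded_linear_inner_right])
  next
    fix y assume y: "y \<in> cball a r"
    have "norm (gL y - 0) \<le> M"
    proof (rule gL(3)[OF subsetD[OF sub y]])
      fix w assume w: "w \<in> cball y (N * h)"
      have "dist a w \<le> dist a y + dist y w" by (rule dist_triangle)
      then have "w \<in> ball a R" using w y h m by auto
      then show "norm (g w - 0) \<le> M" using M by simp
    qed
    moreover have "norm (sgn z) \<le> 1" by (simp add: norm_sgn)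
    ultimately have "norm (sgn z) * norm (gL y) \<le> 1 * M"
      by (intro mult_mono) auto
    moreover have "\<bar>u y\<bar> \<le> norm (sgn z) * norm (gL y)"
      unfolding u_def by (rule Cauchy_Schwarz_ineq2)
    ultimately show "\<bar>u y\<bar> \<le> M" by simp
  qed (use r s e in auto)
  moreover have "u x1 - u x2 = norm z"
  proof -
    have "u x1 - u x2 = sgn z \<bullet> z"
      unfolding u_def inner_diff_right[symmetric] z_def[symmetric] ..
    also have "\<dots> = norm z"
      by (cases "z = 0") (simp_all add: sgn_div_norm dot_square_norm power2_eq_square)
    finally show ?thesis .
  qed
  moreover have "norm (g x1 - g x2) \<le> norm z + \<eta>"
  proof -
    have "g x1 - g x2 = z - (gL x1 - g x1) + (gL x2 - g x2)" by (simp add: z_def)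
    also have "norm \<dots> \<le> norm z + norm (gL x1 - g x1) + norm (gL x2 - g x2)"
      by (smt (verit) norm_triangle_ineq norm_triangle_ineq4)
    finally show ?thesis using close by simp
  qed
  ultimately show "norm (g (a + s *\<^sub>R e) - g (a - s *\<^sub>R e)) \<le> 2 * M * DIM('a) * s / r + \<eta>"
    by (simp add: x1_def x2_def)
qed

text \<open>The odd difference g(a + t e) - g(a - t e) has derivative 2 dd e g a at t = 0. The inner
  radius required by the odd part bound is taken as R/2, which accounts for the 2 in the
  constant.\<close>

lemma monog_dd_bound:
  fixes M :: real
  assumes R: "R > 0" and g: "monog (ball a R) g" and M: "\<And>x. x \<in> ball a R \<Longrightarrow> norm (g x) \<le> M"
    and e: "e \<in> Basis"
  shows "norm (dd e g a) \<le> 2 * DIM('a) * M / R"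
proof -
  define F where "F t = g (a + t *\<^sub>R e) - g (a + t *\<^sub>R (- 1 *\<^sub>R e))" for t
  have d: "has_dd e g (dd e g a) a" using monog_has_dd[OF g e] R by simp
  have "(F has_vector_derivative (dd e g a - (- 1) *\<^sub>R dd e g a)) (at 0)"
    unfolding F_def using d has_dd_dir_scale[OF d, of "-1"] unfolding has_dd_def
    by (rule has_vector_derivative_diff)
  then have "norm (dd e g a - (- 1) *\<^sub>R dd e g a) \<le> 4 * M * DIM('a) / R"
  proof (rule vector_derivative_bound)
    have "norm (F t - F 0) \<le> 4 * M * DIM('a) / R * \<bar>t\<bar>" if t: "\<bar>t\<bar> < R/2" for t
    proof -
      have *: "norm (g (a + s *\<^sub>R e) - g (a - s *\<^sub>R e)) \<le> 2 * M * DIM('a) * s / (R/2)"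
        if "0 \<le> s" "s \<le> R/2" for s :: real
        by (rule monog_odd_part_bound[OF g M e]) (use that R in auto)
      have "norm (F t) = norm (g (a + \<bar>t\<bar> *\<^sub>R e) - g (a - \<bar>t\<bar> *\<^sub>R e))"
        by (simp add: F_def abs_if norm_minus_commute)
      also have "\<dots> \<le> 2 * M * DIM('a) * \<bar>t\<bar> / (R/2)" using t by (intro *) auto
      finally show ?thesis by (simp add: F_def)
    qed
    then show "\<forall>\<^sub>F t in at 0. norm (F t - F 0) \<le> 4 * M * DIM('a) / R * \<bar>t\<bar>"
      unfolding eventually_at using R by (intro exI[of _ "R/2"]) auto
  qed
  then have "norm (2 *\<^sub>R dd e g a) \<le> 4 * M * DIM('a) / R" by (simp add: scaleR_2)
  moreover have "4 * M * DIM('a) / R = 2 * (2 * DIM('a) * M / R)" by simp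
  ultimately have "2 * norm (dd e g a) \<le> 2 * (2 * DIM('a) * M / R)" by simp
  then show ?thesis by simp
qed

lemma monog_diff:
  assumes "monog U f" "monog U g"
  shows "monog U (\<lambda>x. f x - g x)"
proof (rule monogI[where g' = "\<lambda>b y. dd b f y - dd b g y"])
  fix y assume y: "y \<in> U"
  show "has_dd b (\<lambda>x. f x - g x) (dd b f y - dd b g y) y" if "b \<in> Basis" for b
    by (intro has_dd_diff monog_has_dd[OF assms(1) that y] monog_has_dd[OF assms(2) that y])
  have "(\<Sum>b\<in>I. E b (dd b f y - dd b g y)) = (\<Sum>b\<in>I. E b (dd b f y)) - (\<Sum>b\<in>I. E b (dd b g y))"
    unfolding sum_subtractf[symmetric] using linear_E by (intro sum.cong refl) (simp add: linear_diff)
  then show "(\<Sum>b\<in>I. E b (dd b f y - dd b g y)) = 0" using assms y by (simp add: monog_def)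
qed (use assms in \<open>auto simp: monog_def C1_on_def intro!: continuous_intros\<close>)

lemma monog_add:
  assumes "monog U f" "monog U g"
  shows "monog U (\<lambda>x. f x + g x)"
proof (rule monogI[where g' = "\<lambda>b y. dd b f y + dd b g y"])
  fix y assume y: "y \<in> U"
  show "has_dd b (\<lambda>x. f x + g x) (dd b f y + dd b g y) y" if "b \<in> Basis" for b
    by (intro has_dd_add monog_has_dd[OF assms(1) that y] monog_has_dd[OF assms(2) that y])
  have "(\<Sum>b\<in>I. E b (dd b f y + dd b g y)) = (\<Sum>b\<in>I. E b (dd b f y)) + (\<Sum>b\<in>I. E b (dd b g y))"
    unfolding sum.distrib[symmetric] using linear_E by (intro sum.cong refl) (simp add: linear_add)
  then show "(\<Sum>b\<in>I. E b (dd b f y + dd b g y)) = 0" using assms y by (simp add: monog_def)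
qed (use assms in \<open>auto simp: monog_def C1_on_def intro!: continuous_intros\<close>)

lemma monog_cmul:
  assumes "monog U f"
  shows "monog U (\<lambda>x. c *\<^sub>R f x)"
proof (rule monogI[where g' = "\<lambda>b y. c *\<^sub>R dd b f y"])
  fix y assume y: "y \<in> U"
  show "has_dd b (\<lambda>x. c *\<^sub>R f x) (c *\<^sub>R dd b f y) y" if "b \<in> Basis" for b
    by (intro has_dd_cmul monog_has_dd[OF assms that y])
  have "(\<Sum>b\<in>I. E b (c *\<^sub>R dd b f y)) = c *\<^sub>R (\<Sum>b\<in>I. E b (dd b f y))"
    unfolding scaleR_sum_right using linear_E by (intro sum.cong refl) (simp add: linear_scale)
  then show "(\<Sum>b\<in>I. E b (c *\<^sub>R dd b f y)) = 0" using assms y by (simp add: monog_def)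
qed (use assms in \<open>auto simp: monog_def C1_on_def intro!: continuous_intros\<close>)

lemma monog_zero: "monog U (\<lambda>x. 0)"
proof (rule monogI[where g' = "\<lambda>b y. 0"])
  show "(\<Sum>b\<in>I. E b 0) = 0" using linear_0[OF linear_E] by simp
qed (auto simp: has_dd_const)

lemma monog_sum:
  assumes "finite J" "\<And>j. j \<in> J \<Longrightarrow> monog U (f j)"
  shows "monog U (\<lambda>x. \<Sum>j\<in>J. f j x)"
  using assms by (induction J rule: finite_induct) (auto simp: monog_zero monog_add)

lemma monog_translate:
  assumes "monog U g" "\<And>y. y \<in> V \<Longrightarrow> y + c \<in> U"
  shows "monog V (\<lambda>y. g (y + c))"
proof (rule monogI[where g' = "\<lambda>b y. dd b g (y + c)"])
  have *: "continuous_on V (\<lambda>y. F (y + c))" if "continuous_on U F" for F :: "'a \<Rightarrow> 'b"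
    by (rule continuous_on_compose2[OF that]) (use assms(2) in \<open>auto intro!: continuous_intros\<close>)
  show "continuous_on V (\<lambda>y. g (y + c))" using assms(1) by (intro *) (simp add: monog_def C1_on_def)
  fix b :: 'a assume b: "b \<in> Basis"
  show "continuous_on V (\<lambda>y. dd b g (y + c))"
    using assms(1) b by (intro *) (simp add: monog_def C1_on_def)
  show "has_dd b (\<lambda>y. g (y + c)) (dd b g (y + c)) y" if "y \<in> V" for y
    using monog_has_dd[OF assms(1) b assms(2)[OF that]] by (simp add: has_dd_translate)
qed (use assms in \<open>auto simp: monog_def\<close>)

text \<open>The difference quotients of \<open>g\<close> in direction \<open>e\<close> are monogenic and converge uniformly, so by
  the gradient bound their derivatives converge uniformly as well.\<close>
lemma monog_dd_differentiable_local:
  assumes U: "open U" "y0 \<in> U" and g: "monog U g" and b: "b \<in> Basis" and e: "e \<in> Basis"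
  obtains \<rho> L where "\<rho> > 0" "ball y0 \<rho> \<subseteq> U" "continuous_on (ball y0 \<rho>) L"
    "\<And>y. y \<in> ball y0 \<rho> \<Longrightarrow> has_dd e (dd b g) (L y) y"
proof -
  obtain \<delta>0 where \<delta>0: "\<delta>0 > 0" "ball y0 \<delta>0 \<subseteq> U" using U openE by blast
  \<comment> \<open>Room for three radii: the points considered, the balls around them used for
    gradient bounds, and a shift by at most \<delta>.\<close>
  define \<delta> where "\<delta> = \<delta>0 / 4"
  have \<delta>: "\<delta> > 0" using \<delta>0 by (simp add: \<delta>_def)
  have sub3: "cball y0 (3 * \<delta>) \<subseteq> U" using \<delta>0 by (auto simp: \<delta>_def)
  define q where "q t y = (1/t) *\<^sub>R (g (y + t *\<^sub>R e) - g y)" for t y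
  define p where "p t y = (1/t) *\<^sub>R (dd b g (y + t *\<^sub>R e) - dd b g y)" for t y
  \<comment> \<open>On a ball of radius \<delta> the gradient bound for a function bounded by 2
    \<epsilon>' is K \<epsilon>'.\<close>
  define K where "K = 2 * DIM('a) * 2 / \<delta>"
  have K: "K \<ge> 0" using \<delta> by (simp add: K_def)
  have shift: "y + t *\<^sub>R e \<in> cball y0 (3 * \<delta>)" if "y \<in> ball y0 (2 * \<delta>)" "\<bar>t\<bar> \<le> \<delta>" for y t
  proof -
    have "dist y0 (y + t *\<^sub>R e) \<le> dist y0 y + dist y (y + t *\<^sub>R e)" by (rule dist_triangle)
    also have "dist y (y + t *\<^sub>R e) = \<bar>t\<bar>" using e by (simp add: dist_norm)
    finally show ?thesis using that by auto
  qed
  have sub2: "ball y0 (2 * \<delta>) \<subseteq> U" using sub3 \<delta> by (force simp: subset_eq)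
  have mono_q: "monog (ball y0 (2 * \<delta>)) (q t)" if "\<bar>t\<bar> \<le> \<delta>" for t
    unfolding q_def
    by (intro monog_cmul monog_diff monog_translate[OF g] monog_subset[OF g sub2])
       (use shift that sub3 in blast)
  have dd_q: "dd b (q t) y = p t y" if "\<bar>t\<bar> \<le> \<delta>" "y \<in> ball y0 (2 * \<delta>)" for t y
  proof -
    have "y + t *\<^sub>R e \<in> U" "y \<in> U" using shift that sub2 sub3 by blast+
    then have "has_dd b (q t) (p t y) y"
      unfolding q_def p_def
      by (intro has_dd_cmul has_dd_diff has_dd_translate[THEN iffD2] monog_has_dd[OF g b])
    then show ?thesis by (rule has_dd_imp_dd)
  qed
  have q_lim: "\<exists>\<tau>>0. \<tau> \<le> \<delta> \<and> (\<forall>t y. 0 < \<bar>t\<bar> \<and> \<bar>t\<bar> < \<tau> \<and> y \<in> ball y0 (2 * \<delta>) \<longrightarrow>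
      norm (q t y - dd e g y) \<le> \<epsilon>)" if \<epsilon>: "\<epsilon> > 0" for \<epsilon>
  proof -
    have "continuous_on (cball y0 (3 * \<delta>)) (dd e g)"
      using g e by (intro continuous_on_subset[OF _ sub3]) (simp add: monog_def C1_on_def)
    then have "uniformly_continuous_on (cball y0 (3 * \<delta>)) (dd e g)"
      by (rule compact_uniformly_continuous) simp
    then obtain \<tau>0 where \<tau>0: "\<tau>0 > 0" "\<And>x x'. x \<in> cball y0 (3 * \<delta>) \<Longrightarrow> x' \<in> cball y0 (3 * \<delta>) \<Longrightarrow>
        dist x' x < \<tau>0 \<Longrightarrow> dist (dd e g x') (dd e g x) < \<epsilon>"
      unfolding uniformly_continuous_on_def using \<epsilon> by meson
    have "norm (q t y - dd e g y) \<le> \<epsilon>"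
      if t: "0 < \<bar>t\<bar>" "\<bar>t\<bar> < min \<tau>0 \<delta>" and y: "y \<in> ball y0 (2 * \<delta>)" for t y
    proof -
      have "norm (g (y + t *\<^sub>R e) - g y - t *\<^sub>R dd e g y) \<le> \<epsilon> * \<bar>t\<bar>"
      proof (rule has_dd_mvt)
        fix t' assume "t' \<in> closed_segment 0 t"
        then have t': "\<bar>t'\<bar> \<le> \<bar>t\<bar>" by (auto simp: closed_segment_eq_real_ivl split: if_splits)
        have in3: "y + t' *\<^sub>R e \<in> cball y0 (3 * \<delta>)" "y \<in> cball y0 (3 * \<delta>)"
          using shift[OF y, of t'] shift[OF y, of 0] t t' \<delta> by auto
        show "has_dd e g (dd e g (y + t' *\<^sub>R e)) (y + t' *\<^sub>R e)"
          using monog_has_dd[OF g e] in3 sub3 by blast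
        have "dist (y + t' *\<^sub>R e) y < \<tau>0" using t t' e by (simp add: dist_norm)
        then show "norm (dd e g (y + t' *\<^sub>R e) - dd e g y) \<le> \<epsilon>"
          using \<tau>0(2)[OF in3(2,1)] by (simp add: dist_norm)
      qed
      moreover have "q t y - dd e g y = (1/t) *\<^sub>R (g (y + t *\<^sub>R e) - g y - t *\<^sub>R dd e g y)"
        using t by (simp add: q_def algebra_simps)
      ultimately have "norm (q t y - dd e g y) \<le> (1/\<bar>t\<bar>) * (\<epsilon> * \<bar>t\<bar>)"
        by (simp only: norm_scaleR abs_divide abs_one) (intro mult_left_mono; simp)
      then show ?thesis using t by simp
    qed
    then show ?thesis using \<tau>0 \<delta> by (intro exI[of _ "min \<tau>0 \<delta>"]) auto
  qed
  have p_cauchy: "\<exists>\<tau>>0. \<tau> \<le> \<delta> \<and> (\<forall>t t' y. 0 < \<bar>t\<bar> \<and> \<bar>t\<bar> < \<tau> \<and> 0 < \<bar>t'\<bar> \<and> \<bar>t'\<bar> < \<tau> \<and> y \<in> ball y0 \<delta> \<longrightarrow>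
      norm (p t y - p t' y) \<le> \<epsilon>)" if \<epsilon>: "\<epsilon> > 0" for \<epsilon>
  proof -
    define \<epsilon>' where "\<epsilon>' = \<epsilon> / (K + 1)"
    have \<epsilon>': "\<epsilon>' > 0" "K * \<epsilon>' \<le> \<epsilon>" using \<epsilon> K by (auto simp: \<epsilon>'_def field_simps)
    obtain \<tau> where \<tau>: "\<tau> > 0" "\<tau> \<le> \<delta>" "\<And>t y. 0 < \<bar>t\<bar> \<Longrightarrow> \<bar>t\<bar> < \<tau> \<Longrightarrow> y \<in> ball y0 (2 * \<delta>) \<Longrightarrow>
      norm (q t y - dd e g y) \<le> \<epsilon>'"
      using q_lim[OF \<epsilon>'(1)] by blast
    have "norm (p t y - p t' y) \<le> \<epsilon>"
      if t: "0 < \<bar>t\<bar>" "\<bar>t\<bar> < \<tau>" "0 < \<bar>t'\<bar>" "\<bar>t'\<bar> < \<tau>" and y: "y \<in> ball y0 \<delta>" for t t' y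
    proof -
      have sub: "ball y \<delta> \<subseteq> ball y0 (2 * \<delta>)"
      proof
        fix x assume "x \<in> ball y \<delta>"
        moreover have "dist y0 x \<le> dist y0 y + dist y x" by (rule dist_triangle)
        ultimately show "x \<in> ball y0 (2 * \<delta>)" using y by auto
      qed
      have y2: "y \<in> ball y0 (2 * \<delta>)" using sub \<delta> by (simp add: subset_eq)
      have mon: "monog (ball y0 (2 * \<delta>)) (\<lambda>y. q t y - q t' y)"
        using t \<tau> by (intro monog_diff mono_q) auto
      have "norm (dd b (\<lambda>y. q t y - q t' y) y) \<le> 2 * DIM('a) * (2 * \<epsilon>') / \<delta>"
      proof (rule monog_dd_bound[OF \<delta> monog_subset[OF mon sub] _ b])
        fix x assume "x \<in> ball y \<delta>"
        then have x: "x \<in> ball y0 (2 * \<delta>)" using sub by blast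
        have "norm ((q t x - dd e g x) - (q t' x - dd e g x)) \<le> \<epsilon>' + \<epsilon>'"
          using \<tau>(3)[OF t(1,2) x] \<tau>(3)[OF t(3,4) x] norm_triangle_ineq4 by (smt (verit))
        then show "norm (q t x - q t' x) \<le> 2 * \<epsilon>'" by simp
      qed
      moreover have "dd b (\<lambda>y. q t y - q t' y) y = p t y - p t' y"
      proof (rule has_dd_imp_dd)
        have "has_dd b (q s) (p s y) y" if "\<bar>s\<bar> < \<tau>" for s
          using monog_has_dd[OF mono_q b y2, of s] dd_q[OF _ y2, of s] that \<tau>(2) by simp
        then show "has_dd b (\<lambda>y. q t y - q t' y) (p t y - p t' y) y"
          using t by (intro has_dd_diff) auto
      qed
      ultimately show ?thesis using \<epsilon>' by (simp add: K_def mult_ac)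
    qed
    then show ?thesis using \<tau> by blast
  qed
  \<comment> \<open>A null sequence of positive steps below \<delta>. It serves to produce the limit
    \<open>L\<close> pointwise; uniformity in \<open>y\<close> and in the step comes from
    \<open>p_cauchy\<close>.\<close>
  define s where "s k = \<delta> / (real k + 2)" for k
  have s: "0 < s k" "s k < \<delta>" for k
    using \<delta> by (auto simp: s_def field_simps add_pos_nonneg)
  have s_nz: "s k \<noteq> 0" for k using s(1)[of k] by simp
  have s_lim: "\<forall>\<^sub>F k in sequentially. \<bar>s k\<bar> < \<tau>" if "\<tau> > 0" for \<tau>
  proof -
    have "s \<longlonglongrightarrow> 0" unfolding s_def by real_asymp
    then have "\<forall>\<^sub>F k in sequentially. dist (s k) 0 < \<tau>" using that by (rule tendstoD)
    then show ?thesis by simp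
  qed
  have "\<exists>l. (\<lambda>k. p (s k) y) \<longlonglongrightarrow> l" if y: "y \<in> ball y0 \<delta>" for y
  proof -
    have "Cauchy (\<lambda>k. p (s k) y)"
    proof (rule metric_CauchyI)
      fix \<epsilon> :: real assume "\<epsilon> > 0"
      then obtain \<tau> where \<tau>: "\<tau> > 0" "\<And>t t' y. 0 < \<bar>t\<bar> \<Longrightarrow> \<bar>t\<bar> < \<tau> \<Longrightarrow> 0 < \<bar>t'\<bar> \<Longrightarrow> \<bar>t'\<bar> < \<tau> \<Longrightarrow> y \<in> ball y0 \<delta> \<Longrightarrow>
        norm (p t y - p t' y) \<le> \<epsilon>/2"
        using p_cauchy[of "\<epsilon>/2"] by (metis half_gt_zero)
      obtain N where "\<And>k. k \<ge> N \<Longrightarrow> \<bar>s k\<bar> < \<tau>" using s_lim[OF \<tau>(1)] unfolding eventually_sequentially by blast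
      then have "dist (p (s k) y) (p (s l) y) \<le> \<epsilon>/2" if "k \<ge> N" "l \<ge> N" for k l
        unfolding dist_norm using that s y by (intro \<tau>(2)) (auto simp: s_nz)
      then show "\<exists>N. \<forall>m\<ge>N. \<forall>n\<ge>N. dist (p (s m) y) (p (s n) y) < \<epsilon>"
        using \<open>\<epsilon> > 0\<close> by (smt (verit, best) field_sum_of_halves)
    qed
    then show ?thesis using Cauchy_convergent_iff convergent_def by blast
  qed
  then obtain L where L: "\<And>y. y \<in> ball y0 \<delta> \<Longrightarrow> (\<lambda>k. p (s k) y) \<longlonglongrightarrow> L y" by metis
  have pL: "\<exists>\<tau>>0. \<tau> \<le> \<delta> \<and> (\<forall>t y. 0 < \<bar>t\<bar> \<and> \<bar>t\<bar> < \<tau> \<and> y \<in> ball y0 \<delta> \<longrightarrow> norm (p t y - L y) \<le> \<epsilon>)"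
    if \<epsilon>: "\<epsilon> > 0" for \<epsilon>
  proof -
    obtain \<tau> where \<tau>: "\<tau> > 0" "\<tau> \<le> \<delta>" "\<And>t t' y. 0 < \<bar>t\<bar> \<Longrightarrow> \<bar>t\<bar> < \<tau> \<Longrightarrow> 0 < \<bar>t'\<bar> \<Longrightarrow> \<bar>t'\<bar> < \<tau> \<Longrightarrow> y \<in> ball y0 \<delta> \<Longrightarrow>
        norm (p t y - p t' y) \<le> \<epsilon>"
      using p_cauchy[OF \<epsilon>] by blast
    have "norm (p t y - L y) \<le> \<epsilon>" if t: "0 < \<bar>t\<bar>" "\<bar>t\<bar> < \<tau>" and y: "y \<in> ball y0 \<delta>" for t y
    proof (rule tendsto_upperbound)
      show "(\<lambda>k. norm (p t y - p (s k) y)) \<longlonglongrightarrow> norm (p t y - L y)"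
        by (intro tendsto_intros L[OF y])
      show "\<forall>\<^sub>F k in sequentially. norm (p t y - p (s k) y) \<le> \<epsilon>"
        using s_lim[OF \<tau>(1)] by eventually_elim (use \<tau>(3) t y s in \<open>auto simp: s_nz\<close>)
    qed simp
    then show ?thesis using \<tau> by blast
  qed
  have "continuous_on (ball y0 \<delta>) L"
  proof (rule uniform_limit_theorem)
    have "continuous_on (ball y0 \<delta>) (p (s k))" for k
    proof -
      have c: "continuous_on U (dd b g)" using g b by (simp add: monog_def C1_on_def)
      have sub: "ball y0 \<delta> \<subseteq> ball y0 (2 * \<delta>)" using \<delta> by (intro subset_ball) simp
      show ?thesis unfolding p_def
      proof (intro continuous_intros continuous_on_compose2[OF c] continuous_on_subset[OF c])
        show "(\<lambda>y. y + s k *\<^sub>R e) ` ball y0 \<delta> \<subseteq> U"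
          using shift[of _ "s k"] s[of k] sub sub3 by (auto simp: subset_eq simp del: mem_ball mem_cball)
      qed (use sub sub2 in auto)
    qed
    then show "\<forall>\<^sub>F k in sequentially. continuous_on (ball y0 \<delta>) (p (s k))" by simp
    show "uniform_limit (ball y0 \<delta>) (\<lambda>k. p (s k)) L sequentially"
    proof (rule uniform_limitI)
      fix \<epsilon> :: real assume \<epsilon>: "\<epsilon> > 0"
      then obtain \<tau> where \<tau>: "\<tau> > 0" "\<And>t y. 0 < \<bar>t\<bar> \<Longrightarrow> \<bar>t\<bar> < \<tau> \<Longrightarrow> y \<in> ball y0 \<delta> \<Longrightarrow> norm (p t y - L y) \<le> \<epsilon>/2"
        using pL[of "\<epsilon>/2"] by (metis half_gt_zero)
      show "\<forall>\<^sub>F k in sequentially. \<forall>y\<in>ball y0 \<delta>. dist (p (s k) y) (L y) < \<epsilon>"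
        using s_lim[OF \<tau>(1)]
      proof eventually_elim
        case (elim k)
        have "norm (p (s k) y - L y) \<le> \<epsilon>/2" if "y \<in> ball y0 \<delta>" for y
          using \<tau>(2)[of "s k" y] that elim s[of k] by simp
        then show ?case using \<epsilon> by (force simp: dist_norm)
      qed
    qed
  qed simp
  moreover have "has_dd e (dd b g) (L y) y" if y: "y \<in> ball y0 \<delta>" for y
  proof (rule has_dd_I_eps)
    fix \<epsilon> :: real assume "\<epsilon> > 0"
    then obtain \<tau> where \<tau>: "\<tau> > 0" "\<And>t y. 0 < \<bar>t\<bar> \<Longrightarrow> \<bar>t\<bar> < \<tau> \<Longrightarrow> y \<in> ball y0 \<delta> \<Longrightarrow> norm (p t y - L y) \<le> \<epsilon>"
      using pL by metis
    have "norm (dd b g (y + t *\<^sub>R e) - dd b g y - t *\<^sub>R L y) \<le> \<epsilon> * \<bar>t\<bar>" if "\<bar>t\<bar> < \<tau>" for t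
    proof (cases "t = 0")
      case False
      then have "dd b g (y + t *\<^sub>R e) - dd b g y - t *\<^sub>R L y = t *\<^sub>R (p t y - L y)"
        by (simp add: p_def algebra_simps)
      then show ?thesis using \<tau>(2)[of t y] that y False by (simp add: mult.commute mult_right_mono)
    qed simp
    then show "\<exists>\<tau>>0. \<forall>t. \<bar>t\<bar> < \<tau> \<longrightarrow> norm (dd b g (y + t *\<^sub>R e) - dd b g y - t *\<^sub>R L y) \<le> \<epsilon> * \<bar>t\<bar>"
      using \<tau>(1) by blast
  qed
  moreover have "ball y0 \<delta> \<subseteq> U" using sub2 subset_ball[of \<delta> "2 * \<delta>" y0] \<delta> by auto
  ultimately show thesis using that \<delta> by blast
qed

lemma monog_dd_C1:
  assumes U: "open U" and g: "monog U g" and b: "b \<in> Basis"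
  shows "C1_on U (dd b g)"
  unfolding C1_on_def
proof (intro conjI ballI)
  show "continuous_on U (dd b g)" using g b by (simp add: monog_def C1_on_def)
  fix e :: 'a assume e: "e \<in> Basis"
  {
    fix y assume "y \<in> U"
    then show "has_dd e (dd b g) (dd e (dd b g) y) y"
      using monog_dd_differentiable_local[OF U _ g b e, of y] has_dd_imp_dd by (metis centre_in_ball)
  }
  show "continuous_on U (dd e (dd b g))"
  proof (rule continuous_at_imp_continuous_on, rule ballI)
    fix y assume "y \<in> U"
    then obtain \<rho> L where L: "\<rho> > 0" "continuous_on (ball y \<rho>) L"
      "\<And>x. x \<in> ball y \<rho> \<Longrightarrow> has_dd e (dd b g) (L x) x"
      using monog_dd_differentiable_local[OF U _ g b e, of y] by metis
    then have "continuous_on (ball y \<rho>) (dd e (dd b g))"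
      using has_dd_imp_dd continuous_on_cong by (metis (no_types, lifting))
    then show "isCont (dd e (dd b g)) y" using L(1) by (simp add: continuous_on_eq_continuous_at)
  qed
qed

lemma monog_dd_commute:
  assumes U: "open U" and g: "monog U g" and b: "a \<in> Basis" "b \<in> Basis" and y: "y \<in> U"
  shows "dd a (dd b g) y = dd b (dd a g) y"
proof (rule has_dd_imp_dd)
  show "has_dd a (dd b g) (dd b (dd a g) y) y"
    by (rule has_dd_commute[OF U y, where G = g and Ga = "dd a g"])
       (use g monog_dd_C1[OF U g] b in \<open>auto simp: monog_def C1_on_def\<close>)
qed

text \<open>The coefficients are constant, so differentiating the system and exchanging derivatives
  gives the same system for the derivative. Iteration yields derivatives of all orders.\<close>

lemma monog_dd:
  assumes U: "open U" and g: "monog U g" and b: "b \<in> Basis"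
  shows "monog U (dd b g)"
  unfolding monog_def
proof (intro conjI ballI)
  show "C1_on U (dd b g)" by (rule monog_dd_C1[OF U g b])
  fix y assume y: "y \<in> U"
  have d: "has_dd b (dd u g) (dd b (dd u g) y) y" if "u \<in> Basis" for u
    using monog_dd_C1[OF U g that] b y by (simp add: C1_on_def)
  have "(\<Sum>u\<in>I. E u (dd u (dd b g) y)) = (\<Sum>u\<in>I. E u (dd b (dd u g) y))"
    using I by (intro sum.cong refl) (simp add: monog_dd_commute[OF U g _ b y] subset_eq)
  also have "\<dots> = 0"
  proof -
    have "has_dd b (\<lambda>x. \<Sum>u\<in>I. E u (dd u g x)) (\<Sum>u\<in>I. E u (dd b (dd u g) y)) y"
      using I by (intro has_dd_sum has_dd_bounded_linear[OF bounded_linear_E] d) auto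
    moreover have "has_dd b (\<lambda>x. \<Sum>u\<in>I. E u (dd u g x)) 0 y"
      by (rule has_dd_transform_open[OF U y, of "\<lambda>_. 0"]) (use g in \<open>auto simp: monog_def has_dd_const\<close>)
    ultimately show ?thesis using has_dd_imp_dd by metis
  qed
  finally show "(\<Sum>u\<in>I. E u (dd u (dd b g) y)) = 0" .
  fix u assume u: "u \<in> Basis - I"
  have "has_dd b (dd u g) 0 y"
    by (rule has_dd_transform_open[OF U y, of "\<lambda>_. 0"]) (use g u in \<open>auto simp: monog_def has_dd_const\<close>)
  then show "dd u (dd b g) y = 0"
    using monog_dd_commute[OF U g _ b y, of u] u has_dd_imp_dd by (metis DiffD1)
qed

end

section \<open>Real analyticity along lines and the identity theorem\<close>

text \<open>Scalar functions of one real variable suffice: vector-valued functions are restricted to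
  lines and paired with fixed vectors.\<close>

definition real_analytic_at :: "(real \<Rightarrow> real) \<Rightarrow> real \<Rightarrow> bool" where
  "real_analytic_at \<phi> t0 \<longleftrightarrow>
     (\<exists>\<epsilon>>0. \<exists>c. \<forall>t. \<bar>t - t0\<bar> < \<epsilon> \<longrightarrow> (\<lambda>n. c n * (t - t0) ^ n) sums \<phi> t)"

lemma real_analytic_isolated_zeros:
  assumes "real_analytic_at \<phi> a" and nz: "\<not> (\<forall>\<^sub>F t in nhds a. \<phi> t = 0)"
  shows "\<forall>\<^sub>F t in at a. \<phi> t \<noteq> 0"
proof -
  obtain \<epsilon> c where \<epsilon>: "\<epsilon> > 0" and c: "\<And>t. \<bar>t - a\<bar> < \<epsilon> \<Longrightarrow> (\<lambda>n. c n * (t - a) ^ n) sums \<phi> t"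
    using assms(1) unfolding real_analytic_at_def by blast
  have "\<exists>m. c m \<noteq> 0"
  proof (rule ccontr)
    assume "\<nexists>m. c m \<noteq> 0"
    then have c0: "c m = 0" for m by blast
    have "\<phi> t = 0" if "\<bar>t - a\<bar> < \<epsilon>" for t
      using c[OF that] c0 sums_unique by fastforce
    then have "\<forall>\<^sub>F t in nhds a. \<phi> t = 0"
      unfolding eventually_nhds_metric using \<epsilon> by (auto simp: dist_real_def)
    then show False using nz by simp
  qed
  then obtain m where m: "c m \<noteq> 0" by blast
  show ?thesis
  proof (cases "\<phi> a = 0")
    case True
    have "c 0 = \<phi> a" using c[of a] \<epsilon> sums_unique[of "\<lambda>n. c n * 0 ^ n"] by (simp add: powser_zero)
    then have "m > 0" using m True by (metis gr0I)
    then obtain s where s: "0 < s" "\<And>z. z \<in> cball a s - {a} \<Longrightarrow> \<phi> z \<noteq> 0"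
      using powser_0_nonzero[OF \<epsilon>, of a c \<phi> m] c True m by (metis real_norm_def)
    then show ?thesis
      unfolding eventually_at by (intro exI[of _ s]) (auto simp: dist_commute)
  next
    case False
    have 0: "c 0 = \<phi> a" using c[of a] \<epsilon> sums_unique[of "\<lambda>n. c n * 0 ^ n"] by (simp add: powser_zero)
    have "((\<lambda>x. \<phi> (a + x)) \<longlongrightarrow> c 0) (at 0)"
      by (rule powser_limit_0[OF \<epsilon>]) (use c[of "a + x" for x] in auto)
    then have "(\<phi> \<longlongrightarrow> \<phi> a) (at a)" using 0 by (simp add: LIM_offset_zero_iff[of a])
    then show ?thesis using False tendsto_imp_eventually_ne by blast
  qed
qed

text \<open>Vanishing near a point is a locally constant property along \<open>J\<close>: if it
  holds at \<open>a\<close> it holds nearby, and if it fails at \<open>a\<close> the isolation of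
  zeros excludes it in a whole neighbourhood.\<close>

lemma real_analytic_identity:
  assumes J: "connected J" "t1 \<in> J" "t \<in> J"
    and ra: "\<And>t. t \<in> J \<Longrightarrow> real_analytic_at \<phi> t"
    and 0: "\<forall>\<^sub>F t in nhds t1. \<phi> t = 0"
  shows "\<forall>\<^sub>F t in nhds t. \<phi> t = 0"
proof (rule connected_induction_simple[OF J(1,2,3), where P = "\<lambda>t. \<forall>\<^sub>F s in nhds t. \<phi> s = 0"])
  show "\<forall>\<^sub>F s in nhds t1. \<phi> s = 0" by (rule 0)
  fix a assume a: "a \<in> J"
  show "\<exists>T. openin (top_of_set J) T \<and> a \<in> T \<and>
     (\<forall>x\<in>T. \<forall>y\<in>T. (\<forall>\<^sub>F s in nhds x. \<phi> s = 0) \<longrightarrow> (\<forall>\<^sub>F s in nhds y. \<phi> s = 0))"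
  proof (cases "\<forall>\<^sub>F s in nhds a. \<phi> s = 0")
    case True
    then obtain S where S: "open S" "a \<in> S" "\<forall>x\<in>S. \<phi> x = 0" unfolding eventually_nhds by blast
    then have "\<forall>y\<in>S. \<forall>\<^sub>F s in nhds y. \<phi> s = 0" unfolding eventually_nhds by blast
    then show ?thesis using S a by (intro exI[of _ "J \<inter> S"]) (auto simp: openin_open_Int)
  next
    case False
    then have "\<forall>\<^sub>F s in at a. \<phi> s \<noteq> 0" using real_analytic_isolated_zeros ra a by blast
    then obtain S where S: "open S" "a \<in> S" "\<forall>x\<in>S. x \<noteq> a \<longrightarrow> \<phi> x \<noteq> 0"
      unfolding eventually_at_topological by blast
    have "\<not> (\<forall>\<^sub>F s in nhds x. \<phi> s = 0)" if "x \<in> S" for x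
    proof (cases "x = a")
      case True
      then show ?thesis using False by simp
    next
      case False
      then show ?thesis using S that eventually_nhds_x_imp_x by blast
    qed
    then show ?thesis using S a by (intro exI[of _ "J \<inter> S"]) (auto simp: openin_open_Int)
  qed
qed

text \<open>One term of the exponential series at n. It turns the N^N produced by iterated gradient
  bounds into a factorial.\<close>

lemma power_le_exp_fact: "real n ^ n \<le> exp 1 ^ n * fact n"
proof -
  have "real n ^ n /\<^sub>R fact n \<le> exp (real n)"
  proof -
    have "(\<Sum>k\<in>{n}. real n ^ k /\<^sub>R fact k) \<le> (\<Sum>k. real n ^ k /\<^sub>R fact k)"
      by (rule sum_le_suminf) (use summable_exp[of "real n"] in auto)
    then show ?thesis by (simp add: exp_def)
  qed
  also have "exp (real n) = exp 1 ^ n" by (simp flip: exp_of_nat_mult)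
  finally show ?thesis by (simp add: field_simps)
qed

context dirac_system
begin

lemma monog_grad_dir:
  assumes "open U" "monog U g"
  shows "monog U (grad_dir w g)"
  unfolding grad_dir_def[abs_def]
  by (intro monog_sum monog_cmul monog_dd assms) auto

lemma monog_grad_dir_power: "open U \<Longrightarrow> monog U g \<Longrightarrow> monog U ((grad_dir w ^^ k) g)"
  by (induction k) (auto intro: monog_grad_dir)

lemma monog_has_dd_dir: "open U \<Longrightarrow> monog U g \<Longrightarrow> y \<in> U \<Longrightarrow> has_dd w g (grad_dir w g y) y"
  by (intro C1_on_has_dd monog_C1)

lemma monog_grad_dir_bound:
  fixes M :: real
  assumes R: "R > 0" and g: "monog (ball a R) g" and M: "\<And>x. x \<in> ball a R \<Longrightarrow> norm (g x) \<le> M"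
  shows "norm (grad_dir w g a) \<le> 2 * DIM('a) * DIM('a) * norm w / R * M"
proof -
  have M0: "M \<ge> 0" using M[of a] R norm_ge_zero order_trans by (metis centre_in_ball)
  have "norm (grad_dir w g a) \<le> (\<Sum>b\<in>(Basis::'a set). norm w * (2 * DIM('a) * M / R))"
    unfolding grad_dir_def
  proof (intro sum_norm_le)
    fix b :: 'a assume b: "b \<in> Basis"
    have "\<bar>w \<bullet> b\<bar> \<le> norm w" using Basis_le_norm[OF b] .
    then show "norm ((w \<bullet> b) *\<^sub>R dd b g a) \<le> norm w * (2 * DIM('a) * M / R)"
      unfolding norm_scaleR real_norm_def
      by (rule mult_mono[OF _ monog_dd_bound[OF R g M b]]) auto
  qed
  also have "\<dots> = 2 * DIM('a) * DIM('a) * norm w / R * M" by simp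
  finally show ?thesis .
qed

text \<open>Each application of the gradient bound consumes a radius \<delta>, which stays free
  until the order of differentiation is known.\<close>

lemma monog_grad_dir_power_bound:
  fixes M \<delta> :: real
  assumes g: "monog (ball a R) g" and M: "\<And>x. x \<in> ball a R \<Longrightarrow> norm (g x) \<le> M" and \<delta>: "\<delta> > 0"
  shows "x \<in> ball a (R - j * \<delta>) \<Longrightarrow>
    norm ((grad_dir w ^^ j) g x) \<le> (2 * DIM('a) * DIM('a) * norm w / \<delta>) ^ j * M"
proof (induction j arbitrary: x)
  case 0
  then show ?case using M by simp
next
  case (Suc j)
  let ?K = "2 * DIM('a) * DIM('a) * norm w / \<delta>"
  have sub: "ball x \<delta> \<subseteq> ball a (R - j * \<delta>)"
  proof
    fix z assume "z \<in> ball x \<delta>"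
    moreover have "dist a z \<le> dist a x + dist x z" by (rule dist_triangle)
    ultimately show "z \<in> ball a (R - j * \<delta>)" using Suc.prems by (simp add: algebra_simps)
  qed
  have "ball x \<delta> \<subseteq> ball a R" using sub \<delta> subset_ball[of "R - j * \<delta>" R a] by auto
  then have m: "monog (ball x \<delta>) ((grad_dir w ^^ j) g)"
    using monog_grad_dir_power[OF open_ball g] monog_subset by blast
  have "norm (grad_dir w ((grad_dir w ^^ j) g) x) \<le> ?K * (?K ^ j * M)"
    by (rule monog_grad_dir_bound[OF \<delta> m]) (use Suc.IH sub in blast)
  then show ?case by (simp add: mult.assoc)
qed

text \<open>Taylor's formula with remainder. The iterated gradient bounds give derivatives of size
  at most M c^N N!, so the remainder of order \<open>N\<close> is at most M |\<beta>| 2^(-N) on the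
  chosen interval.\<close>

lemma monog_line_sums:
  assumes U: "open U" "y \<in> U" and g: "monog U g"
  obtains \<epsilon> where "\<epsilon> > 0"
    "\<And>t. \<bar>t\<bar> < \<epsilon> \<Longrightarrow> (\<lambda>k. ((grad_dir w ^^ k) g y \<bullet> \<beta> / fact k) * t ^ k) sums (g (y + t *\<^sub>R w) \<bullet> \<beta>)"
proof -
  obtain R0 where R0: "R0 > 0" "ball y R0 \<subseteq> U" using U openE by blast
  define R where "R = R0 / 2"
  have R: "R > 0" "cball y R \<subseteq> U" using R0 by (auto simp: R_def)
  have "compact (g ` cball y R)"
    by (rule compact_continuous_image[OF continuous_on_subset[OF monog_continuous[OF g] R(2)] compact_cball])
  then have "bounded (g ` cball y R)" by (rule compact_imp_bounded)
  then obtain M where M: "\<And>x. x \<in> cball y R \<Longrightarrow> norm (g x) \<le> M"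
    unfolding bounded_iff by (auto simp del: mem_cball)
  have M0: "M \<ge> 0" using M[of y] R norm_ge_zero order_trans by (metis centre_in_cball less_imp_le)
  define K where "K = 2 * DIM('a) * DIM('a) * norm w"
  have K: "K \<ge> 0" by (simp add: K_def)
  define c where "c = 2 * K / R * exp 1"
  have c: "c \<ge> 0" using K R by (simp add: c_def)
  \<comment> \<open>The first bound keeps the line inside the ball of radius R/2, the second makes c
    |t| at most 1/2.\<close>
  define \<epsilon> where "\<epsilon> = min (R / (2 * (norm w + 1))) (1 / (2 * (c + 1)))"
  have w1: "norm w + 1 > 0" by (smt (verit) norm_ge_zero)
  have \<epsilon>: "\<epsilon> > 0" using R c w1 by (simp add: \<epsilon>_def)
  have gR: "monog (ball y R) g" using monog_subset[OF g] R(2) ball_subset_cball by blast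
  have line: "y + s *\<^sub>R w \<in> ball y (R/2)" if "\<bar>s\<bar> < \<epsilon>" for s
  proof -
    have "\<bar>s\<bar> * norm w \<le> \<bar>s\<bar> * (norm w + 1)" by (simp add: mult_left_mono)
    also have "\<bar>s\<bar> < R / (2 * (norm w + 1))" using that by (simp add: \<epsilon>_def)
    then have "\<bar>s\<bar> * (norm w + 1) < R / 2" using w1 by (simp add: field_simps)
    finally show ?thesis by (rule line_in_ball)
  qed
  have sums: "(\<lambda>k. ((grad_dir w ^^ k) g y \<bullet> \<beta> / fact k) * t ^ k) sums (g (y + t *\<^sub>R w) \<bullet> \<beta>)"
    if t: "\<bar>t\<bar> < \<epsilon>" for t
  proof -
    define D where "D k s = (grad_dir w ^^ k) g (y + s *\<^sub>R w) \<bullet> \<beta>" for k s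
    have ct: "c * \<bar>t\<bar> \<le> 1/2"
    proof -
      have "c * \<bar>t\<bar> \<le> (c + 1) * \<bar>t\<bar>" by (simp add: mult_right_mono)
      also have "\<bar>t\<bar> \<le> 1 / (2 * (c + 1))" using t by (simp add: \<epsilon>_def)
      then have "(c + 1) * \<bar>t\<bar> \<le> 1/2" using c by (simp add: field_simps)
      finally show ?thesis .
    qed
    have deriv: "(D k has_real_derivative D (Suc k) s) (at s)" if "\<bar>s\<bar> \<le> \<bar>t\<bar>" for k s
    proof -
      have "y + s *\<^sub>R w \<in> ball y R" using line[of s] that t R by auto
      then have "has_dd w ((grad_dir w ^^ k) g) ((grad_dir w ^^ Suc k) g (y + s *\<^sub>R w)) (y + s *\<^sub>R w)"
        using monog_has_dd_dir[OF open_ball monog_grad_dir_power[OF open_ball gR]] by simp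
      then have "has_dd w (\<lambda>x. (grad_dir w ^^ k) g x \<bullet> \<beta>) ((grad_dir w ^^ Suc k) g (y + s *\<^sub>R w) \<bullet> \<beta>) (y + s *\<^sub>R w)"
        by (rule has_dd_bounded_linear[OF bounded_linear_inner_left])
      then show ?thesis unfolding D_def has_dd_real_along .
    qed
    have err: "norm ((\<Sum>k<N. (D k 0 / fact k) * t ^ k) - D 0 t) \<le> (1/2) ^ N * (M * norm \<beta>)"
      if N: "N \<ge> 1" for N
    proof -
      obtain t' where t': "\<bar>t'\<bar> \<le> \<bar>t\<bar>"
        "D 0 t = (\<Sum>k<N. (D k 0 / fact k) * t ^ k) + D N t' / fact N * t ^ N"
        using Maclaurin_bi_le[of D "D 0" N t] deriv by auto
      \<comment> \<open>\<open>N\<close> losses of radius \<delta> use up exactly R/2 and leave the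
        ball that contains the line.\<close>
      define \<delta> where "\<delta> = R / (2 * N)"
      have \<delta>: "\<delta> > 0" "R - N * \<delta> = R/2" using R N by (auto simp: \<delta>_def)
      have "norm ((grad_dir w ^^ N) g (y + t' *\<^sub>R w)) \<le> (K / \<delta>) ^ N * M"
        unfolding K_def
        by (rule monog_grad_dir_power_bound[OF gR _ \<delta>(1)])
           (use M line[of t'] t' t in \<open>auto simp: \<delta>(2)\<close>)
      also have "(K / \<delta>) ^ N = (2 * K / R) ^ N * real N ^ N"
        using N R by (simp add: \<delta>_def power_mult_distrib[symmetric] mult_ac)
      also have "\<dots> \<le> (2 * K / R) ^ N * (exp 1 ^ N * fact N)"
        using K R by (intro mult_left_mono power_le_exp_fact) auto
      also have "\<dots> = c ^ N * fact N" by (simp only: c_def power_mult_distrib mult.assoc)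
      finally have "norm ((grad_dir w ^^ N) g (y + t' *\<^sub>R w)) \<le> c ^ N * fact N * M"
        using M0 by (simp add: mult_right_mono)
      then have "norm ((grad_dir w ^^ N) g (y + t' *\<^sub>R w)) * norm \<beta> \<le> c ^ N * fact N * M * norm \<beta>"
        by (simp add: mult_right_mono)
      moreover have "\<bar>D N t'\<bar> \<le> norm ((grad_dir w ^^ N) g (y + t' *\<^sub>R w)) * norm \<beta>"
        unfolding D_def by (rule Cauchy_Schwarz_ineq2)
      ultimately have "\<bar>D N t'\<bar> / fact N \<le> c ^ N * M * norm \<beta>" by (simp add: field_simps)
      then have "\<bar>D N t'\<bar> / fact N * \<bar>t\<bar> ^ N \<le> c ^ N * M * norm \<beta> * \<bar>t\<bar> ^ N"
        by (rule mult_right_mono) simp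
      also have "\<dots> = (c * \<bar>t\<bar>) ^ N * (M * norm \<beta>)" by (simp add: power_mult_distrib)
      also have "\<dots> \<le> (1/2) ^ N * (M * norm \<beta>)"
        using ct c M0 by (intro mult_right_mono power_mono) auto
      finally have "\<bar>D N t' / fact N * t ^ N\<bar> \<le> (1/2) ^ N * (M * norm \<beta>)"
        by (simp add: abs_mult power_abs)
      then show ?thesis using t'(2) by simp
    qed
    have lim: "(\<lambda>N. (1/2) ^ N * (M * norm \<beta>)) \<longlonglongrightarrow> 0 * (M * norm \<beta>)"
      by (intro tendsto_intros LIMSEQ_power_zero) simp
    have "(\<lambda>N. (\<Sum>k<N. (D k 0 / fact k) * t ^ k) - D 0 t) \<longlonglongrightarrow> 0"
    proof (rule Lim_null_comparison)
      show "\<forall>\<^sub>F N in sequentially. norm ((\<Sum>k<N. (D k 0 / fact k) * t ^ k) - D 0 t)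
          \<le> (1/2) ^ N * (M * norm \<beta>)"
        using err by (rule eventually_sequentiallyI)
      show "(\<lambda>N. (1/2) ^ N * (M * norm \<beta>)) \<longlonglongrightarrow> 0" using lim by simp
    qed
    then have "(\<lambda>k. (D k 0 / fact k) * t ^ k) sums D 0 t"
      unfolding sums_def by (rule LIM_zero_cancel)
    then show ?thesis by (simp add: D_def)
  qed
  show thesis using that \<epsilon> sums by blast
qed

lemma monog_real_analytic:
  assumes U: "open U" "y + t0 *\<^sub>R w \<in> U" and g: "monog U g"
  shows "real_analytic_at (\<lambda>t. g (y + t *\<^sub>R w) \<bullet> \<beta>) t0"
proof -
  obtain \<epsilon> where \<epsilon>: "\<epsilon> > 0"
    "\<And>t. \<bar>t\<bar> < \<epsilon> \<Longrightarrow> (\<lambda>k. ((grad_dir w ^^ k) g (y + t0 *\<^sub>R w) \<bullet> \<beta> / fact k) * t ^ k) sums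
       (g (y + t0 *\<^sub>R w + t *\<^sub>R w) \<bullet> \<beta>)"
    using monog_line_sums[OF U g] by blast
  have "(\<lambda>k. ((grad_dir w ^^ k) g (y + t0 *\<^sub>R w) \<bullet> \<beta> / fact k) * (t - t0) ^ k) sums
      (g (y + t *\<^sub>R w) \<bullet> \<beta>)" if "\<bar>t - t0\<bar> < \<epsilon>" for t
    using \<epsilon>(2)[OF that] by (simp add: algebra_simps)
  then show ?thesis unfolding real_analytic_at_def using \<epsilon>(1)
    by (intro exI[of _ \<epsilon>] conjI exI[of _ "\<lambda>k. (grad_dir w ^^ k) g (y + t0 *\<^sub>R w) \<bullet> \<beta> / fact k"]) auto
qed

lemma monog_zero_segment:
  assumes U: "open U" "closed_segment z x \<subseteq> U" and g: "monog U g"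
    and 0: "\<And>\<beta>. \<forall>\<^sub>F t in nhds 0. g (z + t *\<^sub>R (x - z)) \<bullet> \<beta> = 0"
  shows "g x = 0"
proof -
  have "\<forall>\<^sub>F t in nhds 1. g (z + t *\<^sub>R (x - z)) \<bullet> \<beta> = 0" for \<beta>
  proof (rule real_analytic_identity[where J = "{0..1}" and ?t1.0 = 0])
    fix t :: real assume "t \<in> {0..1}"
    then have "z + t *\<^sub>R (x - z) \<in> closed_segment z x"
      unfolding in_segment by (auto intro!: exI[of _ t] simp: algebra_simps)
    then show "real_analytic_at (\<lambda>t. g (z + t *\<^sub>R (x - z)) \<bullet> \<beta>) t"
      using U by (intro monog_real_analytic[OF U(1) _ g]) auto
  qed (use 0 in auto)
  then have "g (z + 1 *\<^sub>R (x - z)) \<bullet> \<beta> = 0" for \<beta> using eventually_nhds_x_imp_x by blast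
  then show ?thesis by (metis add_diff_cancel_left' diff_add_cancel inner_eq_zero_iff scaleR_one)
qed

text \<open>Within a ball a zero germ at one point reaches every other point along a segment, by
  analyticity on lines; connectedness of \<open>U\<close> chains the balls.\<close>

lemma monog_zero_connected:
  assumes U: "open U" "connected U" and g: "monog U g"
    and z: "z \<in> U" "\<forall>\<^sub>F x in nhds z. g x = 0" and x: "x \<in> U"
  shows "g x = 0"
proof -
  have "\<forall>\<^sub>F x in nhds x. g x = 0"
  proof (rule connected_induction_simple[OF U(2) z(1) x, where P = "\<lambda>x. \<forall>\<^sub>F x in nhds x. g x = 0"])
    show "\<forall>\<^sub>F x in nhds z. g x = 0" by (rule z(2))
    fix a assume a: "a \<in> U"
    obtain R where R: "R > 0" "ball a R \<subseteq> U" using U(1) a openE by blast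
    have spread: "\<forall>\<^sub>F x in nhds y. g x = 0" if x: "x \<in> ball a R" and y: "y \<in> ball a R" and zero: "\<forall>\<^sub>F x in nhds x. g x = 0" for x y
    proof -
      have "g v = 0" if v: "v \<in> ball a R" for v
      proof (rule monog_zero_segment[OF open_ball closed_segment_subset[OF x v] monog_subset[OF g R(2)]])
        fix \<beta>
        obtain S where S: "open S" "x \<in> S" "\<forall>x\<in>S. g x = 0"
          using zero unfolding eventually_nhds by blast
        show "\<forall>\<^sub>F t in nhds 0. g (x + t *\<^sub>R (v - x)) \<bullet> \<beta> = 0"
          using eventually_line[OF S(1,2), of "v - x"] by eventually_elim (use S(3) in simp)
      qed simp
      then show ?thesis unfolding eventually_nhds using y open_ball by blast
    qed
    have "\<forall>x\<in>ball a R. \<forall>y\<in>ball a R.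
        (\<forall>\<^sub>F s in nhds x. g s = 0) \<longrightarrow> (\<forall>\<^sub>F s in nhds y. g s = 0)"
      by (intro ballI impI) (rule spread)
    moreover have "openin (top_of_set U) (ball a R)" "a \<in> ball a R"
      using R by (simp_all add: open_subset)
    ultimately show "\<exists>T. openin (top_of_set U) T \<and> a \<in> T \<and>
       (\<forall>x\<in>T. \<forall>y\<in>T. (\<forall>\<^sub>F s in nhds x. g s = 0) \<longrightarrow> (\<forall>\<^sub>F s in nhds y. g s = 0))"
      by iprover
  qed
  then show ?thesis by (rule eventually_nhds_x_imp_x)
qed

text \<open>Derivatives along the hyperplane vanish together with \<open>g\<close>, so the Dirac
  equation reduces to E e (dd e g y) = 0, and \<open>E e\<close> is injective.\<close>

lemma monog_dd_zero_on_hyperplane: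
  assumes U: "open U" and g: "monog U g" and e: "e \<in> I" "\<And>x. E e x = 0 \<Longrightarrow> x = 0"
    and 0: "\<And>y. y \<in> U \<Longrightarrow> y \<bullet> e = 0 \<Longrightarrow> g y = 0" and y: "y \<in> U" "y \<bullet> e = 0"
  shows "dd e g y = 0"
proof -
  have eB: "e \<in> Basis" using e I by blast
  have "dd b g y = 0" if b: "b \<in> Basis" "b \<noteq> e" for b
  proof (rule has_dd_imp_dd, rule has_dd_transform[OF has_dd_const])
    show "\<forall>\<^sub>F t in nhds 0. 0 = g (y + t *\<^sub>R b)"
      using eventually_line[OF U y(1), of b]
      by eventually_elim (use 0 y b eB in \<open>simp add: inner_add_left inner_Basis\<close>)
  qed
  then have "(\<Sum>b\<in>I. E b (dd b g y)) = (\<Sum>b\<in>I. if b = e then E e (dd e g y) else 0)"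
    using I linear_E linear_0 by (intro sum.cong refl) (auto simp: subset_eq)
  then have "E e (dd e g y) = 0" using g y(1) e(1) by (simp add: monog_def)
  then show ?thesis by (rule e(2))
qed

text \<open>Uniqueness for the Cauchy problem. Every iterated normal derivative solves the same
  system, hence vanishes on the hyperplane; the Taylor series on normal lines are then zero, and
  normal lines fill a ball around \<open>z\<close>.\<close>

lemma monog_zero_of_hyperplane:
  assumes U: "open U" "connected U" and g: "monog U g" and e: "e \<in> I" "\<And>x. E e x = 0 \<Longrightarrow> x = 0"
    and 0: "\<And>y. y \<in> U \<Longrightarrow> y \<bullet> e = 0 \<Longrightarrow> g y = 0" and z: "z \<in> U" "z \<bullet> e = 0" and x: "x \<in> U"
  shows "g x = 0"
proof (rule monog_zero_connected[OF U g z(1) _ x])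
  have eB: "e \<in> Basis" using e I by blast
  have gd: "grad_dir e F y = dd e F y" for F :: "'a \<Rightarrow> 'b" and y
  proof -
    have "grad_dir e F y = (\<Sum>b\<in>Basis. if b = e then dd e F y else 0)"
      unfolding grad_dir_def using eB by (intro sum.cong refl) (auto simp: inner_Basis)
    then show ?thesis using eB by simp
  qed
  have van: "(grad_dir e ^^ k) g y = 0" if "y \<in> U" "y \<bullet> e = 0" for k y
    using that
  proof (induction k arbitrary: y)
    case (Suc k)
    have "dd e ((grad_dir e ^^ k) g) y = 0"
      by (rule monog_dd_zero_on_hyperplane[OF U(1) monog_grad_dir_power[OF U(1) g] e(1)])
         (fact e(2) Suc.IH Suc.prems)+
    then show ?case by (simp only: funpow.simps o_apply gd[of "(grad_dir e ^^ k) g"])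
  qed (use 0 in simp)
  obtain R where R: "R > 0" "ball z R \<subseteq> U" using U(1) z(1) openE by blast
  have "g v = 0" if v: "v \<in> ball z R" for v
  proof -
    \<comment> \<open>The orthogonal projection of \<open>v\<close> to the hyperplane. Since
      \<open>z\<close> lies on the hyperplane, the projection is no farther from \<open>z\<close>
      than \<open>v\<close>.\<close>
    define v' where "v' = v - (v \<bullet> e) *\<^sub>R e"
    have v'e: "v' \<bullet> e = 0" using eB by (simp add: v'_def inner_diff_left inner_Basis)
    have "norm (v - z) ^ 2 = norm (v' - z) ^ 2 + (v \<bullet> e)\<^sup>2"
      unfolding power2_norm_eq_inner using eB z(2)
      by (simp add: v'_def inner_diff_left inner_diff_right inner_Basis inner_commute power2_eq_square algebra_simps)
    then have "norm (v' - z) ^ 2 \<le> norm (v - z) ^ 2" by simp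
    then have "norm (v' - z) \<le> norm (v - z)" using norm_ge_zero power2_le_imp_le by blast
    then have v': "v' \<in> ball z R" using v by (simp add: dist_norm norm_minus_commute)
    show ?thesis
    proof (rule monog_zero_segment[OF open_ball closed_segment_subset[OF v' v] monog_subset[OF g R(2)]])
      fix \<beta>
      have v'U: "v' \<in> U" using v' R by blast
      obtain \<epsilon> where \<epsilon>: "\<epsilon> > 0" "\<And>t. \<bar>t\<bar> < \<epsilon> \<Longrightarrow>
          (\<lambda>k. ((grad_dir e ^^ k) g v' \<bullet> \<beta> / fact k) * t ^ k) sums (g (v' + t *\<^sub>R e) \<bullet> \<beta>)"
        using monog_line_sums[OF U(1) v'U g] by blast
      have *: "g (v' + t *\<^sub>R e) \<bullet> \<beta> = 0" if "\<bar>t\<bar> < \<epsilon>" for t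
        using \<epsilon>(2)[OF that] van[OF v'U v'e] sums_unique by fastforce
      have "\<forall>\<^sub>F t in nhds 0. \<bar>t * (v \<bullet> e)\<bar> < \<epsilon>"
      proof -
        have "((\<lambda>t. \<bar>t * (v \<bullet> e)\<bar>) \<longlongrightarrow> \<bar>0 * (v \<bullet> e)\<bar>) (nhds 0)"
          by (intro tendsto_intros filterlim_ident)
        then show ?thesis using \<epsilon>(1) order_tendstoD(2) by fastforce
      qed
      then show "\<forall>\<^sub>F t in nhds 0. g (v' + t *\<^sub>R (v - v')) \<bullet> \<beta> = 0"
        by eventually_elim (use * in \<open>simp add: v'_def\<close>)
    qed simp
  qed
  then show "\<forall>\<^sub>F x in nhds z. g x = 0"
    unfolding eventually_nhds using R centre_in_ball open_ball by blast
qed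

end

section \<open>Smooth functions and division of odd functions\<close>

text \<open>\<open>dd\<close> is a total operator, so the existence of each derivative is recorded
  by \<open>has_dd\<close> at every level.\<close>

fun Ck_on :: "nat \<Rightarrow> 'a::euclidean_space set \<Rightarrow> ('a \<Rightarrow> 'b::real_normed_vector) \<Rightarrow> bool" where
  "Ck_on 0 U f \<longleftrightarrow> continuous_on U f"
| "Ck_on (Suc n) U f \<longleftrightarrow> continuous_on U f \<and>
     (\<forall>b\<in>Basis. (\<forall>y\<in>U. has_dd b f (dd b f y) y) \<and> Ck_on n U (dd b f))"

definition smooth_on :: "'a::euclidean_space set \<Rightarrow> ('a \<Rightarrow> 'b::real_normed_vector) \<Rightarrow> bool" where
  "smooth_on U f \<longleftrightarrow> (\<forall>n. Ck_on n U f)"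

lemma Ck_on_continuous: "Ck_on n U f \<Longrightarrow> continuous_on U f"
  by (cases n) auto

lemma Ck_on_SucD: "Ck_on (Suc n) U f \<Longrightarrow> Ck_on n U f"
  by (induction n arbitrary: f) auto

lemma Ck_on_subset: "Ck_on n U f \<Longrightarrow> V \<subseteq> U \<Longrightarrow> Ck_on n V f"
  by (induction n arbitrary: f) (auto intro: continuous_on_subset)

lemma Ck_on_cong:
  assumes U: "open U"
  shows "(\<And>x. x \<in> U \<Longrightarrow> f x = g x) \<Longrightarrow> Ck_on n U f \<Longrightarrow> Ck_on n U g"
proof (induction n arbitrary: f g)
  case 0
  then show ?case using continuous_on_cong by fastforce
next
  case (Suc n)
  have "continuous_on U g" using Suc.prems continuous_on_cong by fastforce
  moreover have "has_dd b g (dd b g y) y" if b: "b \<in> Basis" and y: "y \<in> U" for b y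
  proof -
    have *: "has_dd b f (dd b f y) y" using Suc.prems(2) b y by simp
    have "has_dd b g (dd b f y) y" by (rule has_dd_transform_open[OF U y Suc.prems(1) *])
    then show ?thesis using has_dd_imp_dd by metis
  qed
  moreover have "Ck_on n U (dd b g)" if b: "b \<in> Basis" for b
  proof (rule Suc.IH)
    show "dd b f x = dd b g x" if "x \<in> U" for x
      by (rule dd_cong_open(1)[OF U that Suc.prems(1)])
    show "Ck_on n U (dd b f)" using Suc.prems(2) b by simp
  qed
  ultimately show ?case by simp
qed

lemma Ck_on_SucI:
  assumes U: "open U" and c: "continuous_on U f"
    and d: "\<And>b y. b \<in> Basis \<Longrightarrow> y \<in> U \<Longrightarrow> has_dd b f (f' b y) y"
    and f': "\<And>b. b \<in> Basis \<Longrightarrow> Ck_on n U (f' b)"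
  shows "Ck_on (Suc n) U f"
proof -
  have *: "f' b y = dd b f y" if "b \<in> Basis" "y \<in> U" for b y
    using d[OF that] has_dd_imp_dd by metis
  have "Ck_on n U (dd b f)" if b: "b \<in> Basis" for b
    by (rule Ck_on_cong[OF U *[OF b] f'[OF b]])
  then show ?thesis using c d * by simp
qed

lemma Ck_on_local:
  assumes "\<And>y. y \<in> U \<Longrightarrow> \<exists>V. open V \<and> y \<in> V \<and> Ck_on n V f"
  shows "Ck_on n U f"
  using assms
proof (induction n arbitrary: f)
  case 0
  show ?case unfolding Ck_on.simps
  proof (rule continuous_at_imp_continuous_on, rule ballI)
    fix y assume "y \<in> U"
    then show "isCont f y" using 0 continuous_on_eq_continuous_at by fastforce
  qed
next
  case (Suc n)
  have "continuous_on U f"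
  proof (rule continuous_at_imp_continuous_on, rule ballI)
    fix y assume "y \<in> U"
    then show "isCont f y" using Suc.prems continuous_on_eq_continuous_at by fastforce
  qed
  moreover have "has_dd b f (dd b f y) y" if "b \<in> Basis" "y \<in> U" for b y
    using Suc.prems[OF that(2)] that(1) by auto
  moreover have "Ck_on n U (dd b f)" if "b \<in> Basis" for b
  proof (rule Suc.IH)
    fix y assume "y \<in> U"
    then show "\<exists>V. open V \<and> y \<in> V \<and> Ck_on n V (dd b f)" using Suc.prems[of y] that by auto
  qed
  ultimately show ?case by simp
qed

lemma Ck_on_const: "Ck_on n U (\<lambda>x. c)"
proof (induction n arbitrary: c)
  case (Suc n)
  have *: "dd b (\<lambda>x. c) = (\<lambda>x. 0)" for b :: 'a
    using has_dd_imp_dd[OF has_dd_const] by blast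
  then show ?case using Suc has_dd_const by (auto simp: *)
qed auto

lemma Ck_on_add:
  assumes U: "open U"
  shows "Ck_on n U f \<Longrightarrow> Ck_on n U g \<Longrightarrow> Ck_on n U (\<lambda>x. f x + g x)"
proof (induction n arbitrary: f g)
  case (Suc n)
  show ?case
    by (rule Ck_on_SucI[OF U, where f' = "\<lambda>b y. dd b f y + dd b g y"])
       (use Suc in \<open>auto intro!: continuous_intros has_dd_add\<close>)
qed (auto intro: continuous_intros)

lemma Ck_on_bounded_linear:
  assumes U: "open U" and L: "bounded_linear L"
  shows "Ck_on n U f \<Longrightarrow> Ck_on n U (\<lambda>x. L (f x))"
proof (induction n arbitrary: f)
  case 0
  then show ?case using bounded_linear.continuous_on[OF L] by auto
next
  case (Suc n)
  show ?case
    by (rule Ck_on_SucI[OF U, where f' = "\<lambda>b y. L (dd b f y)"])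
       (use Suc in \<open>auto intro!: bounded_linear.continuous_on[OF L] has_dd_bounded_linear[OF L]\<close>)
qed

lemma Ck_on_scaleR:
  assumes U: "open U"
  shows "Ck_on n U f \<Longrightarrow> Ck_on n U g \<Longrightarrow> Ck_on n U (\<lambda>x. f x *\<^sub>R g x)"
proof (induction n arbitrary: f g)
  case (Suc n)
  have fg: "Ck_on n U f" "Ck_on n U g" using Suc.prems Ck_on_SucD by blast+
  show ?case
  proof (rule Ck_on_SucI[OF U, where f' = "\<lambda>b y. f y *\<^sub>R dd b g y + dd b f y *\<^sub>R g y"])
    fix b :: 'a assume b: "b \<in> Basis"
    show "Ck_on n U (\<lambda>y. f y *\<^sub>R dd b g y + dd b f y *\<^sub>R g y)"
      using Suc.prems b by (intro Ck_on_add[OF U] Suc.IH fg) auto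
  qed (use Suc.prems in \<open>auto intro!: continuous_intros has_dd_scaleR\<close>)
qed (auto intro: continuous_intros)

lemma Ck_on_inverse_inner:
  assumes U: "open U" "\<And>x. x \<in> U \<Longrightarrow> x \<bullet> e \<noteq> 0"
  shows "Ck_on n U (\<lambda>x. inverse (x \<bullet> e))"
proof (induction n)
  case 0
  then show ?case using U by (auto intro!: continuous_intros)
next
  case (Suc n)
  show ?case
  proof (rule Ck_on_SucI[OF U(1), where f' = "\<lambda>b y. (- (b \<bullet> e)) *\<^sub>R (inverse (y \<bullet> e) *\<^sub>R inverse (y \<bullet> e))"])
    show "continuous_on U (\<lambda>x. inverse (x \<bullet> e))" using U by (auto intro!: continuous_intros)
    fix b :: 'a
    show "Ck_on n U (\<lambda>y. (- (b \<bullet> e)) *\<^sub>R (inverse (y \<bullet> e) *\<^sub>R inverse (y \<bullet> e)))"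
      by (intro Ck_on_scaleR[OF U(1)] Ck_on_const Suc)
    fix y assume "y \<in> U"
    then have "y \<bullet> e \<noteq> 0" using U by blast
    then have "((\<lambda>t. inverse ((y + t *\<^sub>R b) \<bullet> e)) has_real_derivative
        - (inverse (y \<bullet> e) * (b \<bullet> e) * inverse (y \<bullet> e))) (at 0)"
      by (auto intro!: derivative_eq_intros simp: inner_add_left)
    then have "has_dd b (\<lambda>x. inverse (x \<bullet> e)) (- (inverse (y \<bullet> e) * (b \<bullet> e) * inverse (y \<bullet> e))) (y + 0 *\<^sub>R b)"
      unfolding has_dd_real_along .
    then show "has_dd b (\<lambda>x. inverse (x \<bullet> e)) ((- (b \<bullet> e)) *\<^sub>R (inverse (y \<bullet> e) *\<^sub>R inverse (y \<bullet> e))) y"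
      by (simp add: mult_ac)
  qed
qed

text \<open>The inner map multiplies the e-coordinate of y by t. Differentiation in direction
  \<open>e\<close> therefore produces a further factor t and in the other directions none; the
  general power \<open>a\<close> keeps the induction closed.\<close>

lemma Ck_on_ray_average:
  fixes L :: "'a::euclidean_space \<Rightarrow> 'b::euclidean_space"
  assumes e: "e \<in> Basis" and U: "open U"
    and star: "\<And>y t. y \<in> U \<Longrightarrow> t \<in> {0..1} \<Longrightarrow> y + ((t - 1) * (y \<bullet> e)) *\<^sub>R e \<in> U"
  shows "Ck_on n U L \<Longrightarrow>
    Ck_on n U (\<lambda>y. integral {0..1} (\<lambda>t. t ^ a *\<^sub>R L (y + ((t - 1) * (y \<bullet> e)) *\<^sub>R e)))"
proof (induction n arbitrary: a L)
  case (0 a L)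
  have "continuous_on (U \<times> {0..1}) (\<lambda>z. snd z ^ a *\<^sub>R L (fst z + ((snd z - 1) * (fst z \<bullet> e)) *\<^sub>R e))"
    by (intro continuous_intros continuous_on_compose2[OF Ck_on_continuous[OF 0]]) (use star in auto)
  then show ?case unfolding Ck_on.simps
    by (intro continuous_on_integral01) (simp add: case_prod_unfold)
next
  case (Suc n a L)
  have cont: "continuous_on (U \<times> {0..1}) (\<lambda>(y,t). t ^ a *\<^sub>R F (y + ((t - 1) * (y \<bullet> e)) *\<^sub>R e))"
    if F: "continuous_on U F" for F :: "'a \<Rightarrow> 'b" and a
  proof -
    have "continuous_on (U \<times> {0..1}) (\<lambda>z. snd z ^ a *\<^sub>R F (fst z + ((snd z - 1) * (fst z \<bullet> e)) *\<^sub>R e))"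
      by (intro continuous_intros continuous_on_compose2[OF F]) (use star in auto)
    then show ?thesis by (simp add: case_prod_unfold)
  qed
  define a' where "a' b = (if b = e then Suc a else a)" for b
  show ?case
  proof (rule Ck_on_SucI[OF U, where f' = "\<lambda>b y. integral {0..1} (\<lambda>t. t ^ a' b *\<^sub>R dd b L (y + ((t - 1) * (y \<bullet> e)) *\<^sub>R e))"])
    show "continuous_on U (\<lambda>y. integral {0..1} (\<lambda>t. t ^ a *\<^sub>R L (y + ((t - 1) * (y \<bullet> e)) *\<^sub>R e)))"
      by (intro continuous_on_integral01 cont Ck_on_continuous[OF Suc.prems])
    fix b :: 'a assume b: "b \<in> Basis"
    show "Ck_on n U (\<lambda>y. integral {0..1} (\<lambda>t. t ^ a' b *\<^sub>R dd b L (y + ((t - 1) * (y \<bullet> e)) *\<^sub>R e)))"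
      by (rule Suc.IH) (use Suc.prems b in simp)
    fix y assume y: "y \<in> U"
    show "has_dd b (\<lambda>y. integral {0..1} (\<lambda>t. t ^ a *\<^sub>R L (y + ((t - 1) * (y \<bullet> e)) *\<^sub>R e)))
      (integral {0..1} (\<lambda>t. t ^ a' b *\<^sub>R dd b L (y + ((t - 1) * (y \<bullet> e)) *\<^sub>R e))) y"
    proof (rule has_dd_integral[OF U y])
      fix x t assume x: "x \<in> U" and t: "t \<in> {0..1::real}"
      define A where "A z = z + ((t - 1) * (z \<bullet> e)) *\<^sub>R e" for z :: 'a
      have A: "linear A" by (rule linearI) (simp_all add: A_def inner_add_left algebra_simps)
      have Ab: "A b = (if b = e then t else 1) *\<^sub>R b"
        using b e by (auto simp: A_def inner_Basis algebra_simps)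
      have "has_dd b L (dd b L (A x)) (A x)" using Suc.prems b star[OF x t] by (simp add: A_def)
      then have "has_dd (A b) L ((if b = e then t else 1) *\<^sub>R dd b L (A x)) (A x)"
        unfolding Ab by (rule has_dd_dir_scale)
      then have "has_dd b (\<lambda>x. L (A x)) ((if b = e then t else 1) *\<^sub>R dd b L (A x)) x"
        using has_dd_comp_linear[OF A] by blast
      then have "has_dd b (\<lambda>x. t ^ a *\<^sub>R L (A x)) (t ^ a *\<^sub>R ((if b = e then t else 1) *\<^sub>R dd b L (A x))) x"
        by (rule has_dd_cmul)
      moreover have "t ^ a *\<^sub>R ((if b = e then t else 1) *\<^sub>R dd b L (A x)) = t ^ a' b *\<^sub>R dd b L (A x)"
        by (simp add: a'_def)
      ultimately show "has_dd b (\<lambda>x. t ^ a *\<^sub>R L (x + ((t - 1) * (x \<bullet> e)) *\<^sub>R e))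
        (t ^ a' b *\<^sub>R dd b L (x + ((t - 1) * (x \<bullet> e)) *\<^sub>R e)) x"
        by (simp only: A_def)
    next
      show "continuous_on (U \<times> {0..1}) (\<lambda>(x, t). t ^ a *\<^sub>R L (x + ((t - 1) * (x \<bullet> e)) *\<^sub>R e))"
        by (rule cont) (use Suc.prems in simp)
      show "continuous_on (U \<times> {0..1}) (\<lambda>(x, t). t ^ a' b *\<^sub>R dd b L (x + ((t - 1) * (x \<bullet> e)) *\<^sub>R e))"
        by (rule cont) (use Suc.prems b Ck_on_continuous in auto)
    qed
  qed
qed

lemma smooth_on_continuous: "smooth_on U f \<Longrightarrow> continuous_on U f"
  unfolding smooth_on_def using Ck_on_continuous by blast

lemma smooth_on_has_dd: "smooth_on U f \<Longrightarrow> b \<in> Basis \<Longrightarrow> y \<in> U \<Longrightarrow> has_dd b f (dd b f y) y"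
  unfolding smooth_on_def by (metis Ck_on.simps(2))

lemma smooth_on_dd: "smooth_on U f \<Longrightarrow> b \<in> Basis \<Longrightarrow> smooth_on U (dd b f)"
  unfolding smooth_on_def by (metis Ck_on.simps(2))

lemma smooth_on_add: "open U \<Longrightarrow> smooth_on U f \<Longrightarrow> smooth_on U g \<Longrightarrow> smooth_on U (\<lambda>x. f x + g x)"
  unfolding smooth_on_def by (blast intro: Ck_on_add)

lemma smooth_on_bounded_linear:
  "open U \<Longrightarrow> bounded_linear L \<Longrightarrow> smooth_on U f \<Longrightarrow> smooth_on U (\<lambda>x. L (f x))"
  unfolding smooth_on_def by (blast intro: Ck_on_bounded_linear)

lemma smooth_on_const: "smooth_on U (\<lambda>x. c)"
  unfolding smooth_on_def by (blast intro: Ck_on_const)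

lemma smooth_on_sum:
  assumes "open U" "finite J" "\<And>j. j \<in> J \<Longrightarrow> smooth_on U (f j)"
  shows "smooth_on U (\<lambda>x. \<Sum>j\<in>J. f j x)"
  using assms(2,3) by (induction J rule: finite_induct) (auto intro: smooth_on_add smooth_on_const assms(1))

lemma smooth_on_commute:
  assumes U: "open U" "y \<in> U" and f: "smooth_on U f" and a: "a \<in> Basis" "b \<in> Basis"
  shows "dd a (dd b f) y = dd b (dd a f) y"
proof (rule has_dd_imp_dd, rule has_dd_commute[OF U, where G = f and Ga = "dd a f"])
  show "has_dd b (dd a f) (dd b (dd a f) x) x" if "x \<in> U" for x
    by (rule smooth_on_has_dd[OF smooth_on_dd[OF f a(1)] a(2) that])
  show "continuous_on U (dd b (dd a f))"
    by (intro smooth_on_continuous smooth_on_dd f a)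
qed (use smooth_on_has_dd[OF f] a in auto)

lemma (in dirac_system) monog_smooth:
  assumes "open U"
  shows "monog U g \<Longrightarrow> smooth_on U g"
proof -
  have "monog U g \<Longrightarrow> Ck_on n U g" for n
  proof (induction n arbitrary: g)
    case (Suc n)
    then show ?case using monog_continuous monog_has_dd monog_dd[OF assms] by auto
  qed (use monog_continuous in auto)
  then show "monog U g \<Longrightarrow> smooth_on U g" unfolding smooth_on_def by blast
qed

section \<open>Parity with respect to a coordinate hyperplane\<close>

locale symmetric_open =
  fixes e :: "'a::euclidean_space" and U :: "'a set"
  assumes e: "e \<in> Basis" and open_U: "open U"
    and sym_U: "\<And>y. y \<in> U \<Longrightarrow> y - (2 * (y \<bullet> e)) *\<^sub>R e \<in> U"
begin

definition refl :: "'a \<Rightarrow> 'a" where "refl y = y - (2 * (y \<bullet> e)) *\<^sub>R e"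

lemma refl_in: "y \<in> U \<Longrightarrow> refl y \<in> U"
  using sym_U by (simp add: refl_def)

lemma linear_refl: "linear refl"
  by (rule linearI) (simp_all add: refl_def inner_add_left algebra_simps)

lemma ee [simp]: "e \<bullet> e = 1"
  using e by (simp add: inner_Basis)

lemma refl_Basis: "b \<in> Basis \<Longrightarrow> refl b = (if b = e then - 1 else 1) *\<^sub>R b"
  using e by (auto simp: refl_def inner_Basis algebra_simps scaleR_2)

lemma refl_inner [simp]: "refl y \<bullet> e = - (y \<bullet> e)"
  by (simp add: refl_def inner_diff_left)

lemma refl_refl [simp]: "refl (refl y) = y"
  by (simp add: refl_def inner_diff_left)

lemma refl_fix: "y \<bullet> e = 0 \<Longrightarrow> refl y = y"
  by (simp add: refl_def)

definition evenf :: "('a \<Rightarrow> 'b::real_normed_vector) \<Rightarrow> bool" where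
  "evenf G \<longleftrightarrow> (\<forall>y\<in>U. G (refl y) = G y)"

definition oddf :: "('a \<Rightarrow> 'b::real_normed_vector) \<Rightarrow> bool" where
  "oddf G \<longleftrightarrow> (\<forall>y\<in>U. G (refl y) = - G y)"

lemma has_dd_refl:
  assumes b: "b \<in> Basis" and d: "has_dd b G d (refl y)"
  shows "has_dd b (\<lambda>x. G (refl x)) ((if b = e then - 1 else 1) *\<^sub>R d) y"
  unfolding has_dd_comp_linear[OF linear_refl] refl_Basis[OF b] by (rule has_dd_dir_scale[OF d])

lemma smooth_refl:
  assumes "smooth_on U G" shows "smooth_on U (\<lambda>x. G (refl x))"
proof -
  have "Ck_on n U G \<Longrightarrow> Ck_on n U (\<lambda>x. G (refl x))" for n
  proof (induction n arbitrary: G)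
    case (0 G)
    then show ?case unfolding Ck_on.simps
      by (intro continuous_on_compose2[OF 0[unfolded Ck_on.simps]] linear_continuous_on)
         (use linear_refl refl_in in \<open>auto simp: linear_conv_bounded_linear\<close>)
  next
    case (Suc n G)
    show ?case
    proof (rule Ck_on_SucI[OF open_U, where f' = "\<lambda>b y. (if b = e then - 1 else 1) *\<^sub>R dd b G (refl y)"])
      show "continuous_on U (\<lambda>x. G (refl x))"
        using Suc.prems by (intro continuous_on_compose2[OF Ck_on_continuous[OF Suc.prems]] linear_continuous_on)
         (use linear_refl refl_in in \<open>auto simp: linear_conv_bounded_linear\<close>)
      fix b :: 'a assume b: "b \<in> Basis"
      show "Ck_on n U (\<lambda>y. (if b = e then - 1 else 1) *\<^sub>R dd b G (refl y))"
        using Suc.prems b by (intro Ck_on_bounded_linear[OF open_U bounded_linear_scaleR_right] Suc.IH) simp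
      show "has_dd b (\<lambda>x. G (refl x)) ((if b = e then - 1 else 1) *\<^sub>R dd b G (refl y)) y" if "y \<in> U" for y
        using Suc.prems b refl_in[OF that] by (intro has_dd_refl) auto
    qed
  qed
  then show ?thesis using assms unfolding smooth_on_def by blast
qed

lemma evenf_dd:
  assumes G: "smooth_on U G" "evenf G" and b: "b \<in> Basis"
  shows "b = e \<Longrightarrow> oddf (dd b G)" "b \<noteq> e \<Longrightarrow> evenf (dd b G)"
proof -
  have "dd b G y = (if b = e then - 1 else 1) *\<^sub>R dd b G (refl y)" if y: "y \<in> U" for y
  proof (rule has_dd_imp_dd, rule has_dd_transform_open[OF open_U y])
    show "has_dd b (\<lambda>x. G (refl x)) ((if b = e then - 1 else 1) *\<^sub>R dd b G (refl y)) y"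
      by (intro has_dd_refl b smooth_on_has_dd[OF G(1)] refl_in y)
    show "G (refl x) = G x" if "x \<in> U" for x using G(2) that by (simp add: evenf_def)
  qed
  then show "b = e \<Longrightarrow> oddf (dd b G)" "b \<noteq> e \<Longrightarrow> evenf (dd b G)"
    unfolding oddf_def evenf_def by auto
qed

text \<open>Off the hyperplane the scalar factor cancels; a point on it is a limit of points y + t
  e, where continuity decides.\<close>

lemma divide_unique:
  fixes K K' :: "'a \<Rightarrow> 'b::real_normed_vector"
  assumes K: "continuous_on U K" "continuous_on U K'"
    and eq: "\<And>y. y \<in> U \<Longrightarrow> (y \<bullet> e) *\<^sub>R K y = (y \<bullet> e) *\<^sub>R K' y" and y: "y \<in> U"
  shows "K y = K' y"
proof (cases "y \<bullet> e = 0")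
  case False
  then show ?thesis using eq[OF y] by simp
next
  case True
  have "isCont (\<lambda>x. K x - K' x) y"
    using K y open_U by (simp add: continuous_on_eq_continuous_at)
  moreover have "((\<lambda>t. y + t *\<^sub>R e) \<longlongrightarrow> y + 0 *\<^sub>R e) (at 0)" by (intro tendsto_intros)
  ultimately have "((\<lambda>t. K (y + t *\<^sub>R e) - K' (y + t *\<^sub>R e)) \<longlongrightarrow> K y - K' y) (at 0)"
    using isCont_tendsto_compose[where f = "\<lambda>t. y + t *\<^sub>R e"] by fastforce
  moreover have "\<forall>\<^sub>F t in at 0. K (y + t *\<^sub>R e) - K' (y + t *\<^sub>R e) = 0"
    using eventually_neq_at_within[of "0::real" 0 UNIV]
      eventually_nhds_conv_at[THEN iffD1, OF eventually_line[OF open_U y, of e], THEN conjunct1]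
  proof eventually_elim
    case (elim t)
    then show ?case using eq[of "y + t *\<^sub>R e"] True by (simp add: inner_add_left)
  qed
  ultimately have "((\<lambda>t. 0) \<longlongrightarrow> K y - K' y) (at (0::real))"
    using tendsto_cong by fastforce
  then have "K y - K' y = 0" using tendsto_unique[OF _ _ tendsto_const] by (metis at_neq_bot)
  then show ?thesis by simp
qed

text \<open>Hadamard's lemma with parity. \<open>L\<close> vanishes on the hyperplane, so near it
  the quotient is the average of \<open>dd e L\<close> over the normal segment from the hyperplane
  to the point, and this formula inherits all derivatives.\<close>

lemma odd_divide:
  fixes L :: "'a \<Rightarrow> 'b::euclidean_space"
  assumes L: "smooth_on U L" "oddf L"
  shows "\<exists>K. smooth_on U K \<and> evenf K \<and> (\<forall>y\<in>U. L y = (y \<bullet> e) *\<^sub>R K y)"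
proof -
  have L0: "L y = 0" if "y \<in> U" "y \<bullet> e = 0" for y
  proof -
    have "L y = - L y" using L(2) that refl_fix[of y] unfolding oddf_def by metis
    then have "L y + L y = 0" by (metis add.right_inverse)
    then show ?thesis by (simp flip: scaleR_2)
  qed
  define K where "K y = (if y \<bullet> e = 0 then dd e L y else inverse (y \<bullet> e) *\<^sub>R L y)" for y
  have "Ck_on n U K" for n
  proof (rule Ck_on_local)
    fix y assume y: "y \<in> U"
    show "\<exists>V. open V \<and> y \<in> V \<and> Ck_on n V K"
    proof (cases "y \<bullet> e = 0")
      case False
      define V where "V = U \<inter> {x. x \<bullet> e \<noteq> 0}"
      have V: "open V" "y \<in> V" "V \<subseteq> U"
        using open_U y False by (auto simp: V_def intro!: open_Int open_Collect_neq continuous_intros)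
      have "Ck_on n V (\<lambda>x. inverse (x \<bullet> e) *\<^sub>R L x)"
        by (intro Ck_on_scaleR Ck_on_inverse_inner V Ck_on_subset[OF _ V(3)])
           (use L in \<open>auto simp: V_def smooth_on_def\<close>)
      then have "Ck_on n V K" by (rule Ck_on_cong[OF V(1), rotated]) (simp add: K_def V_def)
      then show ?thesis using V by blast
    next
      case True
      obtain \<rho> where \<rho>: "\<rho> > 0" "ball y \<rho> \<subseteq> U" using open_U y openE by blast
      \<comment> \<open>The point lies on the segment from \<open>x\<close> to its mirror image, and
        the ball is symmetric because its centre is on the hyperplane.\<close>
      have star: "x + ((t - 1) * (x \<bullet> e)) *\<^sub>R e \<in> ball y \<rho>" if x: "x \<in> ball y \<rho>" and t: "t \<in> {0..1}" for x t
      proof -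
        have "refl x \<in> ball y \<rho>"
        proof -
          have "refl x - y = refl (x - y)" using True by (simp add: refl_def inner_diff_left algebra_simps)
          moreover have "norm (refl z) = norm z" for z
            by (simp add: norm_eq_sqrt_inner refl_def inner_diff_left inner_diff_right inner_commute algebra_simps)
          ultimately show ?thesis using x by (simp add: dist_norm norm_minus_commute[of y])
        qed
        then have "(1 - (1 - t)/2) *\<^sub>R x + ((1 - t)/2) *\<^sub>R refl x \<in> ball y \<rho>"
          using x t by (intro convexD[OF convex_ball]) auto
        moreover have "(1 - (1 - t)/2) *\<^sub>R x + ((1 - t)/2) *\<^sub>R refl x = x + ((t - 1) * (x \<bullet> e)) *\<^sub>R e"
          by (simp add: refl_def algebra_simps flip: scaleR_add_left) (simp add: field_simps)
        ultimately show ?thesis by metis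
      qed
      have "Ck_on n (ball y \<rho>) (\<lambda>x. integral {0..1} (\<lambda>t. t ^ 0 *\<^sub>R dd e L (x + ((t - 1) * (x \<bullet> e)) *\<^sub>R e)))"
        by (rule Ck_on_ray_average[OF e open_ball star])
           (use Ck_on_subset[OF _ \<rho>(2)] smooth_on_dd[OF L(1) e] in \<open>auto simp: smooth_on_def\<close>)
      moreover have "integral {0..1} (\<lambda>t. t ^ 0 *\<^sub>R dd e L (x + ((t - 1) * (x \<bullet> e)) *\<^sub>R e)) = K x"
        if x: "x \<in> ball y \<rho>" for x
      proof (cases "x \<bullet> e = 0")
        case True
        then show ?thesis by (simp add: K_def)
      next
        case False
        define r where "r = x \<bullet> e"
        have "((\<lambda>t. dd e L (x + ((t - 1) * r) *\<^sub>R e)) has_integral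
          (inverse r *\<^sub>R L (x + ((1 - 1) * r) *\<^sub>R e) - inverse r *\<^sub>R L (x + ((0 - 1) * r) *\<^sub>R e))) {0..1}"
        proof (rule fundamental_theorem_of_calculus)
          fix t :: real assume t: "t \<in> {0..1}"
          have "has_dd e L (dd e L (x + ((t - 1) * r) *\<^sub>R e)) (x + ((t - 1) * r) *\<^sub>R e)"
            by (rule smooth_on_has_dd[OF L(1) e]) (use star[OF x t] \<rho> in \<open>auto simp: r_def\<close>)
          then have 1: "((\<lambda>t. L (x + t *\<^sub>R e)) has_vector_derivative dd e L (x + ((t - 1) * r) *\<^sub>R e)) (at ((t - 1) * r))"
            by (simp add: has_dd_along)
          have 2: "((\<lambda>t. (t - 1) * r) has_vector_derivative r) (at t)"
            by (auto intro!: derivative_eq_intros)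
          have "((\<lambda>t. L (x + ((t - 1) * r) *\<^sub>R e)) has_vector_derivative (r *\<^sub>R dd e L (x + ((t - 1) * r) *\<^sub>R e))) (at t)"
            using vector_diff_chain_at[OF 2 1] by (simp add: o_def)
          then have "((\<lambda>t. inverse r *\<^sub>R L (x + ((t - 1) * r) *\<^sub>R e)) has_vector_derivative
              inverse r *\<^sub>R (r *\<^sub>R dd e L (x + ((t - 1) * r) *\<^sub>R e))) (at t)"
            by (rule bounded_linear.has_vector_derivative[OF bounded_linear_scaleR_right])
          then show "((\<lambda>t. inverse r *\<^sub>R L (x + ((t - 1) * r) *\<^sub>R e)) has_vector_derivative
              dd e L (x + ((t - 1) * r) *\<^sub>R e)) (at t within {0..1})"
            using False by (simp add: has_vector_derivative_at_within r_def)
        qed simp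
        moreover have "L (x + ((0 - 1) * r) *\<^sub>R e) = 0"
          by (rule L0) (use star[OF x, of 0] \<rho> in \<open>auto simp: r_def inner_diff_left\<close>)
        ultimately show ?thesis using False by (simp add: K_def r_def integral_unique)
      qed
      ultimately have "Ck_on n (ball y \<rho>) K" using Ck_on_cong[OF open_ball] by (metis (no_types, lifting))
      then show ?thesis using \<rho>(1) by (metis centre_in_ball open_ball)
    qed
  qed
  then have "smooth_on U K" by (simp add: smooth_on_def)
  moreover have "evenf K"
    unfolding evenf_def
  proof
    fix y assume y: "y \<in> U"
    show "K (refl y) = K y"
      using L(2) y refl_fix[of y] by (auto simp: K_def oddf_def)
  qed
  moreover have "L y = (y \<bullet> e) *\<^sub>R K y" if "y \<in> U" for y
    using L0[OF that] by (simp add: K_def)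
  ultimately show ?thesis by blast
qed

end

section \<open>Iterated radial derivatives of axial functions\<close>

text \<open>In the variable s = t^2/2 the relation says that \<open>K (Suc j)\<close> is the
  s-derivative of \<open>K j\<close>, so this is Taylor's formula in s with a remainder of order
  s^N. Integrating the estimate for \<open>K (Suc i)\<close> supplies the additional t^2 in each
  induction step. The expansion is asymptotic; no convergence is asserted.\<close>

lemma radial_taylor:
  fixes K :: "nat \<Rightarrow> 'a::euclidean_space \<Rightarrow> 'b::real_normed_vector"
  assumes e: "e \<in> Basis" and U: "open U" "y0 \<in> U" "y0 \<bullet> e = 0"
    and cont: "\<And>j. continuous_on U (K j)"
    and d: "\<And>j y. y \<in> U \<Longrightarrow> has_dd e (K j) ((y \<bullet> e) *\<^sub>R K (Suc j) y) y"
  shows "\<exists>C \<tau>. \<tau> > 0 \<and> (\<forall>t. \<bar>t\<bar> < \<tau> \<longrightarrow>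
    norm (K i (y0 + t *\<^sub>R e) - (\<Sum>j<N. ((t\<^sup>2 / 2) ^ j / fact j) *\<^sub>R K (i + j) y0)) \<le> C * \<bar>t\<bar> ^ (2 * N))"
proof (induction N arbitrary: i)
  case 0
  have "isCont (K i) y0" using cont U by (simp add: continuous_on_eq_continuous_at)
  then obtain \<delta> where \<delta>: "\<delta> > 0" "\<And>y. dist y y0 < \<delta> \<Longrightarrow> dist (K i y) (K i y0) < 1"
    unfolding continuous_at_eps_delta by (meson zero_less_one)
  have "norm (K i (y0 + t *\<^sub>R e)) \<le> norm (K i y0) + 1" if "\<bar>t\<bar> < \<delta>" for t
  proof -
    have "dist (K i (y0 + t *\<^sub>R e)) (K i y0) < 1" by (rule \<delta>(2)) (use that e in \<open>simp add: dist_norm\<close>)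
    then show ?thesis unfolding dist_norm by (smt (verit) norm_triangle_sub)
  qed
  then show ?case using \<delta>(1) by (intro exI[of _ "norm (K i y0) + 1"] exI[of _ \<delta>]) simp
next
  case (Suc N)
  obtain C \<tau> where C: "\<tau> > 0" "\<And>t. \<bar>t\<bar> < \<tau> \<Longrightarrow>
    norm (K (Suc i) (y0 + t *\<^sub>R e) - (\<Sum>j<N. ((t\<^sup>2 / 2) ^ j / fact j) *\<^sub>R K (Suc i + j) y0)) \<le> C * \<bar>t\<bar> ^ (2 * N)"
    using Suc by blast
  obtain \<delta> where \<delta>: "\<delta> > 0" "ball y0 \<delta> \<subseteq> U" using U openE by blast
  have in_U: "y0 + t *\<^sub>R e \<in> U" if "\<bar>t\<bar> < \<delta>" for t
    using line_in_ball[of t e \<delta> y0] that e \<delta> by auto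
  define f where "f t = K i (y0 + t *\<^sub>R e) - (\<Sum>j<Suc N. ((t\<^sup>2 / 2) ^ j / fact j) *\<^sub>R K (i + j) y0)" for t
  define f' where "f' t = t *\<^sub>R (K (Suc i) (y0 + t *\<^sub>R e) - (\<Sum>j<N. ((t\<^sup>2 / 2) ^ j / fact j) *\<^sub>R K (Suc i + j) y0))" for t
  have df: "(f has_vector_derivative f' t) (at t)" if t: "\<bar>t\<bar> < \<delta>" for t
  proof -
    have "has_dd e (K i) (((y0 + t *\<^sub>R e) \<bullet> e) *\<^sub>R K (Suc i) (y0 + t *\<^sub>R e)) (y0 + t *\<^sub>R e)"
      by (rule d[OF in_U[OF t]])
    then have 1: "((\<lambda>t. K i (y0 + t *\<^sub>R e)) has_vector_derivative t *\<^sub>R K (Suc i) (y0 + t *\<^sub>R e)) (at t)"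
      using U(3) e by (simp add: has_dd_along inner_add_left)
    have p: "((\<lambda>t. ((t\<^sup>2 / 2) ^ Suc j / fact (Suc j)) *\<^sub>R c) has_vector_derivative
        (t * ((t\<^sup>2 / 2) ^ j / fact j)) *\<^sub>R c) (at t)" for j and c :: 'b
    proof -
      have "((\<lambda>t. (t\<^sup>2 / 2) ^ Suc j / fact (Suc j)) has_real_derivative
          (real (Suc j) * ((t\<^sup>2 / 2) ^ j * t)) / fact (Suc j)) (at t)"
        by (auto intro!: derivative_eq_intros simp del: power_Suc fact_Suc)
      moreover have "(real (Suc j) * ((t\<^sup>2 / 2) ^ j * t)) / fact (Suc j) = t * ((t\<^sup>2 / 2) ^ j / fact j)"
        by (simp add: field_simps del: of_nat_Suc)
      ultimately have "((\<lambda>t. (t\<^sup>2 / 2) ^ Suc j / fact (Suc j)) has_vector_derivative t * ((t\<^sup>2 / 2) ^ j / fact j)) (at t)"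
        by (simp only: has_real_derivative_iff_has_vector_derivative)
      then show ?thesis
        by (rule bounded_linear.has_vector_derivative[OF bounded_linear_scaleR_left])
    qed
    have 2: "((\<lambda>t. (\<Sum>j<Suc N. ((t\<^sup>2 / 2) ^ j / fact j) *\<^sub>R K (i + j) y0)) has_vector_derivative
       0 + (\<Sum>j<N. (t * ((t\<^sup>2 / 2) ^ j / fact j)) *\<^sub>R K (i + Suc j) y0)) (at t)"
      unfolding sum.lessThan_Suc_shift
      by (intro has_vector_derivative_add has_vector_derivative_sum p) simp
    show ?thesis
      using has_vector_derivative_diff[OF 1 2]
      by (simp add: f_def[abs_def] f'_def scaleR_diff_right scaleR_sum_right)
  qed
  have "norm (f t) \<le> \<bar>C\<bar> * \<bar>t\<bar> ^ (2 * Suc N)" if t: "\<bar>t\<bar> < min \<tau> \<delta>" for t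
  proof -
    have seg: "\<bar>s\<bar> \<le> \<bar>t\<bar>" if "s \<in> closed_segment 0 t" for s
      using that by (auto simp: closed_segment_eq_real_ivl split: if_splits)
    have "norm (f t - f 0) \<le> (\<bar>C\<bar> * \<bar>t\<bar> ^ (2 * N + 1)) * norm (t - 0)"
    proof (rule differentiable_bound)
      fix s assume s: "s \<in> closed_segment 0 t"
      have st: "\<bar>s\<bar> \<le> \<bar>t\<bar>" by (rule seg[OF s])
      then have "(f has_vector_derivative f' s) (at s within closed_segment 0 t)"
        using df[of s] t by (simp add: has_vector_derivative_at_within)
      then show "(f has_derivative (\<lambda>h. h *\<^sub>R f' s)) (at s within closed_segment 0 t)"
        unfolding has_vector_derivative_def .
      have "norm (f' s) \<le> \<bar>s\<bar> * (C * \<bar>s\<bar> ^ (2 * N))"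
        unfolding f'_def norm_scaleR real_norm_def using C(2)[of s] st t by (intro mult_left_mono) auto
      also have "\<dots> \<le> \<bar>t\<bar> * (\<bar>C\<bar> * \<bar>t\<bar> ^ (2 * N))"
      proof -
        have "C * \<bar>s\<bar> ^ (2 * N) \<le> \<bar>C\<bar> * \<bar>s\<bar> ^ (2 * N)" by (simp add: mult_right_mono)
        also have "\<dots> \<le> \<bar>C\<bar> * \<bar>t\<bar> ^ (2 * N)" using st by (intro mult_left_mono power_mono) auto
        finally have "\<bar>s\<bar> * (C * \<bar>s\<bar> ^ (2 * N)) \<le> \<bar>s\<bar> * (\<bar>C\<bar> * \<bar>t\<bar> ^ (2 * N))"
          by (rule mult_left_mono) simp
        also have "\<dots> \<le> \<bar>t\<bar> * (\<bar>C\<bar> * \<bar>t\<bar> ^ (2 * N))" using st by (rule mult_right_mono) simp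
        finally show ?thesis .
      qed
      finally have *: "norm (f' s) \<le> \<bar>C\<bar> * \<bar>t\<bar> ^ (2 * N + 1)" by (simp add: mult_ac)
      show "onorm (\<lambda>h. h *\<^sub>R f' s) \<le> \<bar>C\<bar> * \<bar>t\<bar> ^ (2 * N + 1)"
        by (rule onorm_le) (use * in \<open>simp add: mult.commute[of _ "norm (f' s)"] mult_right_mono\<close>)
    qed auto
    moreover have "f 0 = 0"
    proof -
      have "(\<Sum>j<Suc N. ((0\<^sup>2 / 2) ^ j / fact j) *\<^sub>R K (i + j) y0) = K i y0"
        unfolding sum.lessThan_Suc_shift by simp
      then show ?thesis by (simp add: f_def)
    qed
    ultimately show ?thesis by (simp add: mult_ac)
  qed
  then show ?case
    unfolding f_def using C(1) \<delta>(1) by (intro exI[of _ "\<bar>C\<bar>"] exI[of _ "min \<tau> \<delta>"]) auto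
qed

text \<open>\<open>DF1\<close> and \<open>DF2\<close> form the generalized Cauchy-Riemann system of
  the stem functions. The Clifford relations occur in both orders because the Laplacian is factored
  as \<open>T'\<close> after \<open>T\<close> on the family of \<open>F1\<close> and as
  \<open>T\<close> after \<open>T'\<close> on that of \<open>F2\<close>.\<close>

locale axial_system = symmetric_open e U for e :: "'a::euclidean_space" and U +
  fixes P :: "'a set" and T T' :: "'a \<Rightarrow> 'b::euclidean_space \<Rightarrow> 'b" and F1 F2 :: "'a \<Rightarrow> 'b"
  assumes P: "P \<subseteq> Basis" "e \<notin> P"
    and bl_T: "\<And>b. b \<in> P \<Longrightarrow> bounded_linear (T b)"
    and bl_T': "\<And>b. b \<in> P \<Longrightarrow> bounded_linear (T' b)"
    and clifford: "\<And>a b x. a \<in> P \<Longrightarrow> b \<in> P \<Longrightarrow> T' a (T b x) + T' b (T a x) = (if a = b then 2 *\<^sub>R x else 0)"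
    and clifford': "\<And>a b x. a \<in> P \<Longrightarrow> b \<in> P \<Longrightarrow> T a (T' b x) + T b (T' a x) = (if a = b then 2 *\<^sub>R x else 0)"
    and F1: "smooth_on U F1" "evenf F1" and F2: "smooth_on U F2" "oddf F2"
    and DF1: "\<And>y. y \<in> U \<Longrightarrow> (\<Sum>b\<in>P. T b (dd b F1 y)) = dd e F2 y"
    and DF2: "\<And>y. y \<in> U \<Longrightarrow> (\<Sum>b\<in>P. T' b (dd b F2 y)) = - dd e F1 y"
begin

text \<open>Division by the signed radius. The choice is harmless: on \<open>U\<close> the values
  are forced, by continuity also where the radius is 0.\<close>

definition quot :: "('a \<Rightarrow> 'b) \<Rightarrow> 'a \<Rightarrow> 'b" where
  "quot L = (SOME K. smooth_on U K \<and> evenf K \<and> (\<forall>y\<in>U. L y = (y \<bullet> e) *\<^sub>R K y))"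

lemma quot:
  assumes "smooth_on U L" "oddf L"
  shows "smooth_on U (quot L)" "evenf (quot L)" "\<And>y. y \<in> U \<Longrightarrow> L y = (y \<bullet> e) *\<^sub>R quot L y"
  using someI_ex[OF odd_divide[OF assms]] unfolding quot_def by blast+

definition H1 :: "nat \<Rightarrow> 'a \<Rightarrow> 'b" where "H1 j = ((\<lambda>G. quot (dd e G)) ^^ j) F1"
definition H2 :: "nat \<Rightarrow> 'a \<Rightarrow> 'b" where "H2 j = ((\<lambda>G. quot (dd e G)) ^^ j) (quot F2)"

lemma H1_0: "H1 0 = F1" and H2_0: "y \<in> U \<Longrightarrow> F2 y = (y \<bullet> e) *\<^sub>R H2 0 y"
  using quot(3)[OF F2] by (simp_all add: H1_def H2_def)

lemma quot_iter:
  assumes "smooth_on U G" "evenf G"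
  shows "smooth_on U (((\<lambda>G. quot (dd e G)) ^^ j) G) \<and> evenf (((\<lambda>G. quot (dd e G)) ^^ j) G)"
proof (induction j)
  case (Suc j)
  then show ?case using quot(1,2)[OF smooth_on_dd[OF _ e] evenf_dd(1)[OF _ _ e]] by simp
qed (use assms in simp)

lemma smooth_H1: "smooth_on U (H1 j)" and even_H1: "evenf (H1 j)"
  using quot_iter[OF F1] by (simp_all add: H1_def)

lemma smooth_H2: "smooth_on U (H2 j)" and even_H2: "evenf (H2 j)"
  using quot_iter[OF quot(1,2)[OF F2]] by (simp_all add: H2_def)

lemma dd_H1: "y \<in> U \<Longrightarrow> dd e (H1 j) y = (y \<bullet> e) *\<^sub>R H1 (Suc j) y"
  using quot(3)[OF smooth_on_dd[OF smooth_H1 e] evenf_dd(1)[OF smooth_H1 even_H1 e]]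
  by (simp add: H1_def)

lemma dd_H2: "y \<in> U \<Longrightarrow> dd e (H2 j) y = (y \<bullet> e) *\<^sub>R H2 (Suc j) y"
  using quot(3)[OF smooth_on_dd[OF smooth_H2 e] evenf_dd(1)[OF smooth_H2 even_H2 e]]
  by (simp add: H2_def)

lemma has_dd_H1: "y \<in> U \<Longrightarrow> has_dd e (H1 j) ((y \<bullet> e) *\<^sub>R H1 (Suc j) y) y"
  using smooth_on_has_dd[OF smooth_H1 e] dd_H1 by metis

lemma has_dd_H2: "y \<in> U \<Longrightarrow> has_dd e (H2 j) ((y \<bullet> e) *\<^sub>R H2 (Suc j) y) y"
  using smooth_on_has_dd[OF smooth_H2 e] dd_H2 by metis

definition opD :: "('a \<Rightarrow> 'b \<Rightarrow> 'b) \<Rightarrow> ('a \<Rightarrow> 'b) \<Rightarrow> 'a \<Rightarrow> 'b" where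
  "opD S G y = (\<Sum>b\<in>P. S b (dd b G y))"

lemma P_Basis: "b \<in> P \<Longrightarrow> b \<in> Basis" and P_ne: "b \<in> P \<Longrightarrow> b \<noteq> e" and finite_P: "finite P"
  using P finite_subset[OF P(1) finite_Basis] by blast+

lemma inner_P: "b \<in> P \<Longrightarrow> b \<bullet> e = 0"
  using P_Basis P_ne e by (simp add: inner_Basis)

lemma opD_cong: "(\<And>x. x \<in> U \<Longrightarrow> G x = G' x) \<Longrightarrow> y \<in> U \<Longrightarrow> opD S G y = opD S G' y"
  unfolding opD_def using dd_cong_open(1)[OF open_U, of y G G'] by simp

lemma has_dd_opD:
  assumes S: "\<And>b. b \<in> P \<Longrightarrow> bounded_linear (S b)" and G: "smooth_on U G" and a: "a \<in> Basis" and y: "y \<in> U"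
  shows "has_dd a (opD S G) (opD S (dd a G) y) y"
proof -
  have "has_dd a (\<lambda>y. \<Sum>b\<in>P. S b (dd b G y)) (\<Sum>b\<in>P. S b (dd a (dd b G) y)) y"
    by (rule has_dd_sum, rule has_dd_bounded_linear[OF S], assumption,
        rule smooth_on_has_dd[OF smooth_on_dd[OF G P_Basis] a y])
  also have "(\<Sum>b\<in>P. S b (dd a (dd b G) y)) = opD S (dd a G) y"
    unfolding opD_def by (intro sum.cong refl) (simp add: smooth_on_commute[OF open_U y G a P_Basis])
  finally show ?thesis by (simp add: opD_def[abs_def])
qed

lemma smooth_opD:
  assumes "\<And>b. b \<in> P \<Longrightarrow> bounded_linear (S b)" "smooth_on U G"
  shows "smooth_on U (opD S G)"
  unfolding opD_def[abs_def]
  by (rule smooth_on_sum[OF open_U finite_P], rule smooth_on_bounded_linear[OF open_U assms(1)],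
      assumption, rule smooth_on_dd[OF assms(2) P_Basis])

lemma has_dd_radius_mult:
  assumes b: "b \<in> P" and K: "smooth_on U K" and y: "y \<in> U"
  shows "has_dd b (\<lambda>y. (y \<bullet> e) ^ n *\<^sub>R K y) ((y \<bullet> e) ^ n *\<^sub>R dd b K y) y"
proof -
  have "has_dd b (\<lambda>x. (x \<bullet> e) ^ n) 0 y"
    by (rule has_dd_transform[OF has_dd_const[of _ "(y \<bullet> e) ^ n"]]) (simp add: inner_add_left inner_P[OF b])
  from has_dd_scaleR[OF this smooth_on_has_dd[OF K P_Basis[OF b] y]] show ?thesis by simp
qed

text \<open>The directions in \<open>P\<close> are orthogonal to \<open>e\<close>, so powers of the
  radius behave as constants.\<close>

lemma opD_radius_mult:
  assumes S: "\<And>b. b \<in> P \<Longrightarrow> bounded_linear (S b)" and K: "smooth_on U K" and y: "y \<in> U"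
  shows "opD S (\<lambda>y. (y \<bullet> e) ^ n *\<^sub>R K y) y = (y \<bullet> e) ^ n *\<^sub>R opD S K y"
  unfolding opD_def scaleR_sum_right
proof (intro sum.cong refl)
  fix b assume b: "b \<in> P"
  have "dd b (\<lambda>y. (y \<bullet> e) ^ n *\<^sub>R K y) y = (y \<bullet> e) ^ n *\<^sub>R dd b K y"
    by (rule has_dd_imp_dd[OF has_dd_radius_mult[OF b K y]])
  then show "S b (dd b (\<lambda>y. (y \<bullet> e) ^ n *\<^sub>R K y) y) = (y \<bullet> e) ^ n *\<^sub>R S b (dd b K y)"
    using linear_scale[OF bounded_linear.linear[OF S[OF b]]] by simp
qed

lemma opD_radial:
  assumes S: "\<And>b. b \<in> P \<Longrightarrow> bounded_linear (S b)" and G: "smooth_on U G" and K: "smooth_on U K"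
    and GK: "\<And>y. y \<in> U \<Longrightarrow> dd e G y = (y \<bullet> e) *\<^sub>R K y" and y: "y \<in> U"
  shows "has_dd e (opD S G) ((y \<bullet> e) *\<^sub>R opD S K y) y"
proof -
  have "opD S (dd e G) y = opD S (\<lambda>y. (y \<bullet> e) ^ 1 *\<^sub>R K y) y"
    by (rule opD_cong) (use GK y in auto)
  also have "\<dots> = (y \<bullet> e) *\<^sub>R opD S K y"
    using opD_radius_mult[OF S K y, where n = 1] by simp
  finally have "opD S (dd e G) y = (y \<bullet> e) *\<^sub>R opD S K y" .
  moreover have "has_dd e (opD S G) (opD S (dd e G) y) y" by (rule has_dd_opD[OF S G e y])
  ultimately show ?thesis by simp
qed

text \<open>At j = 0 a factor r is cancelled from \<open>DF2\<close>. Afterwards the identity for j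
  is differentiated along \<open>e\<close>; both sides acquire a factor r, and cancelling it gives
  the identity for j + 1.\<close>

lemma D'_H2: "y \<in> U \<Longrightarrow> opD T' (H2 j) y = - H1 (Suc j) y"
proof (induction j arbitrary: y)
  case 0
  have c: "continuous_on U (opD T' (H2 0))"
    by (rule smooth_on_continuous[OF smooth_opD[OF bl_T' smooth_H2]])
  have c': "continuous_on U (\<lambda>y. - H1 (Suc 0) y)"
    using smooth_on_continuous[OF smooth_H1] by (rule continuous_on_minus)
  have "(y \<bullet> e) *\<^sub>R opD T' (H2 0) y = (y \<bullet> e) *\<^sub>R - H1 (Suc 0) y" if y: "y \<in> U" for y
  proof -
    have "(y \<bullet> e) *\<^sub>R opD T' (H2 0) y = opD T' (\<lambda>y. (y \<bullet> e) ^ 1 *\<^sub>R H2 0 y) y"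
      using opD_radius_mult[OF bl_T' smooth_H2 y, where n = 1] by simp
    also have "\<dots> = opD T' F2 y" by (rule opD_cong) (use H2_0 y in auto)
    also have "\<dots> = (y \<bullet> e) *\<^sub>R - H1 (Suc 0) y"
      using DF2[OF y] dd_H1[OF y, of 0] by (simp add: opD_def H1_0)
    finally show ?thesis .
  qed
  then show ?case by (rule divide_unique[OF c c' _ 0])
next
  case (Suc j)
  have c: "continuous_on U (opD T' (H2 (Suc j)))"
    by (rule smooth_on_continuous[OF smooth_opD[OF bl_T' smooth_H2]])
  have c': "continuous_on U (\<lambda>y. - H1 (Suc (Suc j)) y)"
    using smooth_on_continuous[OF smooth_H1] by (rule continuous_on_minus)
  have "(y \<bullet> e) *\<^sub>R opD T' (H2 (Suc j)) y = (y \<bullet> e) *\<^sub>R - H1 (Suc (Suc j)) y" if y: "y \<in> U" for y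
  proof -
    have "has_dd e (opD T' (H2 j)) ((y \<bullet> e) *\<^sub>R opD T' (H2 (Suc j)) y) y"
      by (rule opD_radial[OF bl_T' smooth_H2 smooth_H2 dd_H2 y])
    moreover have "has_dd e (opD T' (H2 j)) (- ((y \<bullet> e) *\<^sub>R H1 (Suc (Suc j)) y)) y"
      by (rule has_dd_transform_open[OF open_U y _ has_dd_bounded_linear[OF bounded_linear_minus[OF bounded_linear_ident] has_dd_H1[OF y]]])
         (simp add: Suc.IH)
    ultimately show ?thesis using has_dd_imp_dd by (metis scaleR_minus_right)
  qed
  then show ?case by (rule divide_unique[OF c c' _ Suc.prems])
qed

text \<open>The product rule for F2 = r H2_0 gives the start. Differentiating r^2 H2_(j+1) along
  \<open>e\<close> yields an additional 2 r H2_(j+1), which raises 2j + 1 to 2j + 3 after division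
  by r.\<close>

lemma D_H1: "y \<in> U \<Longrightarrow> opD T (H1 j) y = real (2 * j + 1) *\<^sub>R H2 j y + (y \<bullet> e)\<^sup>2 *\<^sub>R H2 (Suc j) y"
proof (induction j arbitrary: y)
  case 0
  have "has_dd e (\<lambda>y. y \<bullet> e) 1 y"
    using has_dd_inner_left[of e 0 e y] by simp
  from has_dd_scaleR[OF this has_dd_H2[OF 0, of 0]]
  have "has_dd e (\<lambda>y. (y \<bullet> e) *\<^sub>R H2 0 y) ((y \<bullet> e)\<^sup>2 *\<^sub>R H2 1 y + H2 0 y) y"
    by (simp add: power2_eq_square)
  then have "has_dd e F2 ((y \<bullet> e)\<^sup>2 *\<^sub>R H2 1 y + H2 0 y) y"
    by (rule has_dd_transform_open[OF open_U 0, rotated]) (simp add: H2_0)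
  then show ?case using DF1[OF 0] has_dd_imp_dd by (fastforce simp: opD_def H1_0)
next
  case (Suc j)
  let ?rhs = "\<lambda>y. real (2 * Suc j + 1) *\<^sub>R H2 (Suc j) y + (y \<bullet> e)\<^sup>2 *\<^sub>R H2 (Suc (Suc j)) y"
  have c: "continuous_on U (opD T (H1 (Suc j)))"
    by (rule smooth_on_continuous[OF smooth_opD[OF bl_T smooth_H1]])
  have c': "continuous_on U ?rhs"
    by (intro continuous_intros smooth_on_continuous[OF smooth_H2])
  have "(y \<bullet> e) *\<^sub>R opD T (H1 (Suc j)) y = (y \<bullet> e) *\<^sub>R ?rhs y" if y: "y \<in> U" for y
  proof -
    have 1: "has_dd e (opD T (H1 j)) ((y \<bullet> e) *\<^sub>R opD T (H1 (Suc j)) y) y"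
      by (rule opD_radial[OF bl_T smooth_H1 smooth_H1 dd_H1 y])
    have "has_dd e (\<lambda>y. y \<bullet> e) 1 y"
      using has_dd_inner_left[of e 0 e y] by simp
    from has_dd_real_mult[OF this this] have "has_dd e (\<lambda>y. (y \<bullet> e)\<^sup>2) (2 * (y \<bullet> e)) y"
      by (simp add: power2_eq_square)
    from has_dd_scaleR[OF this has_dd_H2[OF y, of "Suc j"]]
    have "has_dd e (\<lambda>y. real (2 * j + 1) *\<^sub>R H2 j y + (y \<bullet> e)\<^sup>2 *\<^sub>R H2 (Suc j) y)
      (real (2 * j + 1) *\<^sub>R ((y \<bullet> e) *\<^sub>R H2 (Suc j) y) +
       ((y \<bullet> e)\<^sup>2 *\<^sub>R ((y \<bullet> e) *\<^sub>R H2 (Suc (Suc j)) y) + (2 * (y \<bullet> e)) *\<^sub>R H2 (Suc j) y)) y"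
      by (intro has_dd_add has_dd_cmul has_dd_H2 y)
    then have 2: "has_dd e (opD T (H1 j))
      (real (2 * j + 1) *\<^sub>R ((y \<bullet> e) *\<^sub>R H2 (Suc j) y) +
       ((y \<bullet> e)\<^sup>2 *\<^sub>R ((y \<bullet> e) *\<^sub>R H2 (Suc (Suc j)) y) + (2 * (y \<bullet> e)) *\<^sub>R H2 (Suc j) y)) y"
      by (rule has_dd_transform_open[OF open_U y, rotated]) (simp add: Suc.IH)
    have "(y \<bullet> e) *\<^sub>R opD T (H1 (Suc j)) y = real (2 * j + 1) *\<^sub>R ((y \<bullet> e) *\<^sub>R H2 (Suc j) y) +
       ((y \<bullet> e)\<^sup>2 *\<^sub>R ((y \<bullet> e) *\<^sub>R H2 (Suc (Suc j)) y) + (2 * (y \<bullet> e)) *\<^sub>R H2 (Suc j) y)"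
      using has_dd_imp_dd[OF 1] has_dd_imp_dd[OF 2] by simp
    then show ?thesis by (simp add: algebra_simps) (simp flip: scaleR_add_left)
  qed
  then show ?case by (rule divide_unique[OF c c' _ Suc.prems])
qed

lemma opD_opD:
  assumes S: "\<And>b. b \<in> P \<Longrightarrow> bounded_linear (S b)" and S': "\<And>b. b \<in> P \<Longrightarrow> bounded_linear (S' b)"
    and cl: "\<And>a b x. a \<in> P \<Longrightarrow> b \<in> P \<Longrightarrow> S' a (S b x) + S' b (S a x) = (if a = b then 2 *\<^sub>R x else 0)"
    and G: "smooth_on U G" and y: "y \<in> U"
  shows "opD S' (opD S G) y = (\<Sum>b\<in>P. dd b (dd b G) y)"
proof -
  define Q where "Q a b = dd a (dd b G) y" for a b
  have sym: "Q a b = Q b a" if "a \<in> P" "b \<in> P" for a b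
    unfolding Q_def using smooth_on_commute[OF open_U y G] P_Basis that by blast
  have lin: "linear (S' a)" if "a \<in> P" for a using S'[OF that] bounded_linear.linear by blast
  have "opD S' (opD S G) y = (\<Sum>a\<in>P. S' a (\<Sum>b\<in>P. S b (Q a b)))"
    unfolding opD_def[of S' "opD S G"]
  proof (intro sum.cong refl)
    fix a assume a: "a \<in> P"
    have "dd a (opD S G) y = opD S (dd a G) y"
      by (rule has_dd_imp_dd[OF has_dd_opD[OF S G P_Basis[OF a] y]])
    also have "\<dots> = (\<Sum>b\<in>P. S b (Q a b))"
      unfolding opD_def using sym a by (intro sum.cong refl) (simp add: Q_def)
    finally show "S' a (dd a (opD S G) y) = S' a (\<Sum>b\<in>P. S b (Q a b))" by simp
  qed
  also have "\<dots> = (\<Sum>a\<in>P. \<Sum>b\<in>P. S' a (S b (Q a b)))"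
    by (intro sum.cong refl) (simp add: linear_sum[OF lin])
  finally have 1: "opD S' (opD S G) y = (\<Sum>a\<in>P. \<Sum>b\<in>P. S' a (S b (Q a b)))" .
  also have "\<dots> = (\<Sum>b\<in>P. \<Sum>a\<in>P. S' b (S a (Q a b)))"
    by (intro sum.cong refl) (simp add: sym)
  also have "\<dots> = (\<Sum>a\<in>P. \<Sum>b\<in>P. S' b (S a (Q a b)))" by (rule sum.swap)
  finally have 2: "opD S' (opD S G) y = (\<Sum>a\<in>P. \<Sum>b\<in>P. S' b (S a (Q a b)))" .
  have "2 *\<^sub>R opD S' (opD S G) y = (\<Sum>a\<in>P. \<Sum>b\<in>P. S' a (S b (Q a b)) + S' b (S a (Q a b)))"
    unfolding scaleR_2 sum.distrib using 1 2 by simp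
  also have "\<dots> = (\<Sum>a\<in>P. \<Sum>b\<in>P. if a = b then 2 *\<^sub>R Q a b else 0)"
    by (intro sum.cong refl) (simp add: cl)
  also have "\<dots> = 2 *\<^sub>R (\<Sum>a\<in>P. Q a a)" by (simp add: finite_P scaleR_sum_right)
  finally show ?thesis by (simp add: Q_def)
qed

text \<open>Factored into \<open>opD T'\<close> and \<open>opD T\<close>, the Laplacian in the first
  p + 1 variables is expressed by radial derivatives alone. At radius 0 it becomes a pure index
  shift with factor -(2j + 1).\<close>

lemma lap_H1:
  assumes y: "y \<in> U"
  shows "(\<Sum>b\<in>P. dd b (dd b (H1 j)) y) = - (real (2 * j + 1) *\<^sub>R H1 (Suc j) y + (y \<bullet> e)\<^sup>2 *\<^sub>R H1 (Suc (Suc j)) y)"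
proof -
  have "(\<Sum>b\<in>P. dd b (dd b (H1 j)) y) = opD T' (opD T (H1 j)) y"
    by (rule opD_opD[OF bl_T bl_T' clifford smooth_H1 y, symmetric])
  also have "\<dots> = opD T' (\<lambda>y. real (2 * j + 1) *\<^sub>R H2 j y + (y \<bullet> e)\<^sup>2 *\<^sub>R H2 (Suc j) y) y"
    by (rule opD_cong) (use D_H1 y in auto)
  also have "\<dots> = real (2 * j + 1) *\<^sub>R opD T' (H2 j) y + (y \<bullet> e)\<^sup>2 *\<^sub>R opD T' (H2 (Suc j)) y"
    unfolding opD_def scaleR_sum_right sum.distrib[symmetric]
  proof (intro sum.cong refl)
    fix b assume b: "b \<in> P"
    have "has_dd b (\<lambda>y. real (2 * j + 1) *\<^sub>R H2 j y + (y \<bullet> e)\<^sup>2 *\<^sub>R H2 (Suc j) y)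
        (real (2 * j + 1) *\<^sub>R dd b (H2 j) y + (y \<bullet> e)\<^sup>2 *\<^sub>R dd b (H2 (Suc j)) y) y"
      by (intro has_dd_add has_dd_cmul has_dd_radius_mult smooth_on_has_dd[OF smooth_H2 P_Basis[OF b] y] smooth_H2 b y)
    from has_dd_imp_dd[OF this]
    show "T' b (dd b (\<lambda>y. real (2 * j + 1) *\<^sub>R H2 j y + (y \<bullet> e)\<^sup>2 *\<^sub>R H2 (Suc j) y) y) =
      real (2 * j + 1) *\<^sub>R T' b (dd b (H2 j) y) + (y \<bullet> e)\<^sup>2 *\<^sub>R T' b (dd b (H2 (Suc j)) y)"
      using bounded_linear.linear[OF bl_T'[OF b]] by (simp add: linear_add linear_scale)
  qed
  finally show ?thesis using D'_H2[OF y] by simp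
qed

lemma lap_H2:
  assumes y: "y \<in> U"
  shows "(\<Sum>b\<in>P. dd b (dd b (H2 j)) y) =
    - (real (2 * j + 3) *\<^sub>R H2 (Suc j) y + (y \<bullet> e)\<^sup>2 *\<^sub>R H2 (Suc (Suc j)) y)"
proof -
  have "(\<Sum>b\<in>P. dd b (dd b (H2 j)) y) = opD T (opD T' (H2 j)) y"
    by (rule opD_opD[OF bl_T' bl_T clifford' smooth_H2 y, symmetric])
  also have "\<dots> = opD T (\<lambda>y. - H1 (Suc j) y) y"
    by (rule opD_cong) (use D'_H2 y in auto)
  also have "\<dots> = - opD T (H1 (Suc j)) y"
    unfolding opD_def sum_negf[symmetric]
  proof (intro sum.cong refl)
    fix b assume b: "b \<in> P"
    have "has_dd b (\<lambda>y. - H1 (Suc j) y) (- dd b (H1 (Suc j)) y) y"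
      by (intro has_dd_bounded_linear[OF bounded_linear_minus[OF bounded_linear_ident]]
          smooth_on_has_dd[OF smooth_H1 P_Basis[OF b] y])
    from has_dd_imp_dd[OF this] show "T b (dd b (\<lambda>y. - H1 (Suc j) y) y) = - T b (dd b (H1 (Suc j)) y)"
      using bounded_linear.linear[OF bl_T[OF b]] by (simp add: linear_neg)
  qed
  finally show ?thesis using D_H1[OF y, of "Suc j"] by (simp add: numeral_3_eq_3)
qed

end

section \<open>The representation formula\<close>

text \<open>The vectors \<open>v s\<close> need not be orthonormal for the inner product of the
  type. Standard basis vectors \<open>b s\<close> carry the coordinates instead, and
  \<open>\<xi> s\<close> is a linear extension to the whole algebra of the s-th coordinate on
  M.\<close>

locale gps_setup =
  fixes mul :: "'a::euclidean_space \<Rightarrow> 'a \<Rightarrow> 'a" and one :: 'a and cj :: "'a \<Rightarrow> 'a"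
    and v :: "nat \<Rightarrow> 'a" and m p q :: nat and \<Omega> :: "'a set" and f :: "'a \<Rightarrow> 'a"
    and b :: "nat \<Rightarrow> 'a" and \<xi> :: "nat \<Rightarrow> 'a \<Rightarrow> real"
  assumes alt: "alt_algebra mul one" and basis: "adapted_basis mul one cj v m"
    and pm: "p < m" and q: "q = m - p"
    and slice: "slice_domain v p m \<Omega>" and psym: "p_symmetric v p m \<Omega>"
    and gps: "gps_monogenic mul v p m \<Omega> f"
    and b_inj: "inj_on b {..m}" and b_Basis: "\<And>s. s \<le> m \<Longrightarrow> b s \<in> Basis"
    and \<xi>_linear: "\<And>s. linear (\<xi> s)"
    and \<xi>_v: "\<And>s t. s \<le> m \<Longrightarrow> t \<le> m \<Longrightarrow> \<xi> s (v t) = (if s = t then 1 else 0)"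
begin

section \<open>Clifford relations in the alternative algebra\<close>

lemma bb: "bounded_bilinear mul"
  using alt bilinear_conv_bounded_bilinear unfolding alt_algebra_def by blast

sublocale mul: bounded_bilinear mul by (rule bb)

lemmas [simp] = mul.zero_left mul.zero_right

lemma one_mul [simp]: "mul one x = x"
  using alt by (simp add: alt_algebra_def)

lemma v0: "v 0 = one"
  using basis by (simp add: adapted_basis_def)

lemma left_alt: "mul a (mul a x) = mul (mul a a) x"
  using alt by (simp add: alt_algebra_def assoc_def)

text \<open>Polarization of the left alternative law, from its instance at a + c.\<close>

lemma left_alt2: "mul a (mul c x) + mul c (mul a x) = mul (mul a c + mul c a) x"
  using left_alt[of "a + c" x] left_alt[of a x] left_alt[of c x]
  by (simp add: mul.add_left mul.add_right algebra_simps)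

lemma v_sq: "s \<in> {1..m} \<Longrightarrow> mul (v s) (v s) = - one"
proof -
  assume "s \<in> {1..m}"
  then have "v s + cj (v s) = 0" "mul (v s) (cj (v s)) = one"
    using basis by (simp_all add: adapted_basis_def sphere_A_def trace_A_def norm_A_def)
  then have "cj (v s) = - v s" "mul (v s) (cj (v s)) = one" by (simp_all add: eq_neg_iff_add_eq_0 add.commute)
  then show ?thesis by (simp add: mul.minus_right) (metis minus_minus)
qed

lemma clifford_v:
  assumes "s \<in> {1..m}" "t \<in> {1..m}"
  shows "mul (v s) (mul (v t) x) + mul (v t) (mul (v s) x) = (if s = t then - 2 else 0) *\<^sub>R x"
proof (cases "s = t")
  case True
  then show ?thesis using left_alt2[of "v s" "v t" x] v_sq[OF assms(1)]
    by (simp add: mul.add_left mul.minus_left scaleR_2)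
next
  case False
  then have "mul (v s) (v t) = - mul (v t) (v s)" using basis assms unfolding adapted_basis_def by blast
  then show ?thesis using left_alt2[of "v s" "v t" x] False by simp
qed

lemma clifford_v_sum:
  assumes "s \<in> {1..m}"
  shows "mul (v s) (mul (\<Sum>t\<in>{1..m}. c t *\<^sub>R v t) x) + mul (\<Sum>t\<in>{1..m}. c t *\<^sub>R v t) (mul (v s) x)
     = (- 2 * c s) *\<^sub>R x"
proof -
  have "mul (v s) (mul (\<Sum>t\<in>{1..m}. c t *\<^sub>R v t) x) + mul (\<Sum>t\<in>{1..m}. c t *\<^sub>R v t) (mul (v s) x)
     = (\<Sum>t\<in>{1..m}. c t *\<^sub>R (mul (v s) (mul (v t) x) + mul (v t) (mul (v s) x)))"
    by (simp add: mul.sum_left mul.sum_right mul.scaleR_left mul.scaleR_right sum.distrib scaleR_add_right)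
  also have "\<dots> = (\<Sum>t\<in>{1..m}. if s = t then (- 2 * c s) *\<^sub>R x else 0)"
    by (intro sum.cong refl) (use clifford_v[OF assms] in simp)
  also have "\<dots> = (- 2 * c s) *\<^sub>R x" using assms by simp
  finally show ?thesis .
qed

text \<open>What is available are anticommutators with the basis vectors, so the square is doubled
  and rewritten as a sum of these.\<close>

lemma mul_sum_sq:
  "mul (\<Sum>t\<in>{1..m}. c t *\<^sub>R v t) (mul (\<Sum>t\<in>{1..m}. c t *\<^sub>R v t) x) = (- (\<Sum>t\<in>{1..m}. (c t)\<^sup>2)) *\<^sub>R x"
proof -
  define w where "w = (\<Sum>t\<in>{1..m}. c t *\<^sub>R v t)"
  have "2 *\<^sub>R mul w (mul w x) = mul w (mul w x) + mul w (mul w x)" by (simp add: scaleR_2)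
  also have "\<dots> = mul (\<Sum>s\<in>{1..m}. c s *\<^sub>R v s) (mul w x) + mul w (mul (\<Sum>s\<in>{1..m}. c s *\<^sub>R v s) x)"
    by (simp add: w_def)
  also have "\<dots> = (\<Sum>s\<in>{1..m}. c s *\<^sub>R (mul (v s) (mul w x) + mul w (mul (v s) x)))"
    by (simp only: mul.sum_left mul.sum_right mul.scaleR_left mul.scaleR_right sum.distrib scaleR_add_right)
  also have "\<dots> = (\<Sum>s\<in>{1..m}. c s *\<^sub>R ((- 2 * c s) *\<^sub>R x))"
    unfolding w_def by (intro sum.cong refl) (simp only: clifford_v_sum)
  also have "\<dots> = (\<Sum>s\<in>{1..m}. - 2 * (c s)\<^sup>2) *\<^sub>R x"
    unfolding scaleR_sum_left by (intro sum.cong refl) (simp add: power2_eq_square)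
  also have "(\<Sum>s\<in>{1..m}. - 2 * (c s)\<^sup>2) = 2 * (- (\<Sum>s\<in>{1..m}. (c s)\<^sup>2))"
    by (simp add: sum_distrib_left sum_negf)
  finally have "2 *\<^sub>R mul w (mul w x) = 2 *\<^sub>R ((- (\<Sum>s\<in>{1..m}. (c s)\<^sup>2)) *\<^sub>R x)"
    by (simp only: scaleR_scaleR)
  then have "mul w (mul w x) = (- (\<Sum>s\<in>{1..m}. (c s)\<^sup>2)) *\<^sub>R x"
    unfolding scaleR_cancel_left by simp
  then show ?thesis unfolding w_def .
qed

definition S :: "'a set" where "S = sphereS v p m"

lemma S_repr:
  assumes "\<omega> \<in> S"
  obtains c where "\<omega> = (\<Sum>t\<in>{1..m}. c t *\<^sub>R v t)" "(\<Sum>t\<in>{1..m}. (c t)\<^sup>2) = 1" "\<And>t. t \<le> p \<Longrightarrow> c t = 0"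
    "\<omega> = (\<Sum>t\<in>{p+1..m}. c t *\<^sub>R v t)" "(\<Sum>t\<in>{p+1..m}. (c t)\<^sup>2) = 1"
proof -
  obtain c where c: "\<omega> = (\<Sum>s\<in>{p+1..m}. c s *\<^sub>R v s)" "(\<Sum>s\<in>{p+1..m}. (c s)\<^sup>2) = 1"
    using assms by (auto simp: S_def sphereS_def)
  define c' where "c' t = (if t \<le> p then 0 else c t)" for t
  have "(\<Sum>t\<in>{p+1..m}. c' t *\<^sub>R v t) = (\<Sum>t\<in>{1..m}. c' t *\<^sub>R v t)"
    by (rule sum.mono_neutral_left) (auto simp: c'_def)
  moreover have "(\<Sum>t\<in>{p+1..m}. (c' t)\<^sup>2) = (\<Sum>t\<in>{1..m}. (c' t)\<^sup>2)"
    by (rule sum.mono_neutral_left) (auto simp: c'_def)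
  moreover have "(\<Sum>s\<in>{p+1..m}. c s *\<^sub>R v s) = (\<Sum>t\<in>{p+1..m}. c' t *\<^sub>R v t)"
    "(\<Sum>s\<in>{p+1..m}. (c s)\<^sup>2) = (\<Sum>t\<in>{p+1..m}. (c' t)\<^sup>2)"
    by (intro sum.cong; simp add: c'_def)+
  moreover have "t \<le> p \<Longrightarrow> c' t = 0" for t by (simp add: c'_def)
  ultimately show ?thesis using that[of c'] c by metis
qed

lemma S_sq: "\<omega> \<in> S \<Longrightarrow> mul \<omega> (mul \<omega> x) = - x"
proof -
  assume "\<omega> \<in> S"
  then obtain c where "\<omega> = (\<Sum>t\<in>{1..m}. c t *\<^sub>R v t)" "(\<Sum>t\<in>{1..m}. (c t)\<^sup>2) = 1"
    by (rule S_repr)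
  then show ?thesis using mul_sum_sq[of c x] by simp
qed

lemma S_anticommute: "\<omega> \<in> S \<Longrightarrow> s \<in> {1..p} \<Longrightarrow> mul (v s) (mul \<omega> x) = - mul \<omega> (mul (v s) x)"
proof -
  assume \<omega>: "\<omega> \<in> S" and s: "s \<in> {1..p}"
  from S_repr[OF \<omega>] obtain c where
    c: "\<omega> = (\<Sum>t\<in>{1..m}. c t *\<^sub>R v t)" "\<And>t. t \<le> p \<Longrightarrow> c t = 0" by blast
  have "mul (v s) (mul \<omega> x) + mul \<omega> (mul (v s) x) = 0"
    using clifford_v_sum[of s c x] s pm c(2)[of s] unfolding c(1) by simp
  then show ?thesis by (simp add: eq_neg_iff_add_eq_0)
qed

lemma S_uminus: "\<omega> \<in> S \<Longrightarrow> - \<omega> \<in> S"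
  unfolding S_def sphereS_def
  by clarify (rule_tac x = "\<lambda>s. - c s" in exI, simp add: sum_negf)

section \<open>The model space of the slices\<close>

definition e :: 'a where "e = b (p + 1)"
definition \<omega>0 :: 'a where "\<omega>0 = v (p + 1)"

lemma \<omega>0_S: "\<omega>0 \<in> S"
proof -
  have "(\<Sum>s\<in>{p+1..m}. (if s = p + 1 then 1 else 0) *\<^sub>R v s) = (\<Sum>s\<in>{p+1..m}. if s = p + 1 then v s else 0)"
    by (intro sum.cong) auto
  then have "(\<Sum>s\<in>{p+1..m}. (if s = p + 1 then 1 else 0) *\<^sub>R v s) = \<omega>0"
    using pm by (simp add: \<omega>0_def)
  moreover have "(\<Sum>s\<in>{p+1..m}. (if s = p + 1 then 1 else 0 :: real)\<^sup>2) = 1"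
  proof -
    have "(\<Sum>s\<in>{p+1..m}. (if s = p + 1 then 1 else 0 :: real)\<^sup>2) = (\<Sum>s\<in>{p+1..m}. if s = p + 1 then 1 else 0)"
      by (intro sum.cong) auto
    then show ?thesis using pm by simp
  qed
  ultimately show ?thesis unfolding S_def sphereS_def mem_Collect_eq
    by (intro exI[of _ "\<lambda>s. if s = p + 1 then 1 else 0"]) simp
qed

lemma b_inner: "s \<le> m \<Longrightarrow> t \<le> m \<Longrightarrow> b s \<bullet> b t = (if s = t then 1 else 0)"
  using b_Basis b_inj by (auto simp: inner_Basis inj_on_def)

lemma e_Basis: "e \<in> Basis" and b_e: "s \<le> p \<Longrightarrow> b s \<bullet> e = 0" and ee: "e \<bullet> e = 1" and eb: "s \<le> p \<Longrightarrow> e \<bullet> b s = 0"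
  using b_Basis[of "p + 1"] pm b_inner[of s "p + 1"] b_inner[of "p + 1" s] by (simp_all add: e_def b_inner)

lemma b_ne_e [simp]: "s \<le> p \<Longrightarrow> b s \<noteq> e" "s \<le> p \<Longrightarrow> e \<noteq> b s"
  using b_e[of s] ee by auto

text \<open>The orthonormal \<open>b 0, \<dots>, b p\<close> and \<open>e\<close> span a model of the slices: \<open>A \<omega>\<close> maps it onto the slice of \<open>\<omega>\<close>,
  with \<open>e\<close> going to \<open>\<omega>\<close>, and \<open>U\<close> below is the common preimage of all slices of \<open>\<Omega>\<close>.  It contains the
  remaining directions of the ambient space as free variables.\<close>

definition A :: "'a \<Rightarrow> 'a \<Rightarrow> 'a" where
  "A \<omega> y = (\<Sum>s\<le>p. (y \<bullet> b s) *\<^sub>R v s) + (y \<bullet> e) *\<^sub>R \<omega>"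

lemma linear_A: "linear (A \<omega>)"
  by (rule linearI)
     (simp_all add: A_def inner_add_left scaleR_add_left sum.distrib scaleR_sum_right scaleR_add_right)

lemma A_b: "s \<le> p \<Longrightarrow> A \<omega> (b s) = v s"
proof -
  assume s: "s \<le> p"
  have "(\<Sum>t\<le>p. (b s \<bullet> b t) *\<^sub>R v t) = (\<Sum>t\<le>p. if t = s then v s else 0)"
    using s pm by (intro sum.cong) (auto simp: b_inner)
  then show ?thesis using s by (simp add: A_def b_e)
qed

lemma A_e: "A \<omega> e = \<omega>"
  by (simp add: A_def ee eb)

lemma A_other: "\<beta> \<in> Basis \<Longrightarrow> \<beta> \<notin> b ` {..p} \<Longrightarrow> \<beta> \<noteq> e \<Longrightarrow> A \<omega> \<beta> = 0"
proof -
  assume \<beta>: "\<beta> \<in> Basis" "\<beta> \<notin> b ` {..p}" "\<beta> \<noteq> e"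
  have "\<beta> \<bullet> b s = 0" if "s \<le> p" for s
    using \<beta> that pm b_Basis[of s] by (subst inner_Basis) auto
  then show ?thesis using \<beta> e_Basis by (simp add: A_def inner_Basis)
qed

lemma v_M: "s \<le> m \<Longrightarrow> v s \<in> Mspace v m"
  by (auto simp: Mspace_def intro: span_base)

lemma S_M: "\<omega> \<in> S \<Longrightarrow> \<omega> \<in> Mspace v m"
  by (auto simp: S_def sphereS_def Mspace_def intro!: span_sum span_scale intro: span_base)

lemma A_M: "\<omega> \<in> S \<Longrightarrow> A \<omega> y \<in> Mspace v m"
proof -
  assume "\<omega> \<in> S"
  then have \<omega>: "\<omega> \<in> span (v ` {0..m})" using S_M by (simp add: Mspace_def)
  have vs: "v s \<in> span (v ` {0..m})" if "s \<le> p" for s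
    using v_M[of s] that pm by (simp add: Mspace_def)
  show ?thesis unfolding A_def Mspace_def
    by (intro span_add span_sum span_scale) (use vs \<omega> in auto)
qed

lemma A_slice: "A \<omega> y \<in> slice_space v p \<omega>"
  unfolding A_def slice_space_def by (intro span_add span_sum span_scale span_base) auto

definition U :: "'a set" where "U = {y. A \<omega>0 y \<in> \<Omega>}"

text \<open>\<open>p_symmetric\<close> speaks of positive radii. A negative radius is handled by
  replacing \<omega> and \<eta> by their negatives, and at radius 0 the two points coincide.\<close>

lemma A_swap:
  assumes "\<omega> \<in> S" "\<eta> \<in> S" "A \<omega> y \<in> \<Omega>" shows "A \<eta> y \<in> \<Omega>"
proof -
  define xp where "xp = (\<Sum>s\<le>p. (y \<bullet> b s) *\<^sub>R v s)"
  have xp: "xp \<in> Rp1 v p" unfolding xp_def Rp1_def by (intro span_sum span_scale span_base) auto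
  have ps: "xp + r *\<^sub>R \<eta>' \<in> \<Omega>" if "r > 0" "\<omega>' \<in> S" "xp + r *\<^sub>R \<omega>' \<in> \<Omega>" "\<eta>' \<in> S" for r \<omega>' \<eta>'
    using psym xp that unfolding p_symmetric_def S_def by blast
  consider "y \<bullet> e = 0" | "y \<bullet> e > 0" | "- (y \<bullet> e) > 0" by linarith
  then show ?thesis
  proof cases
    case 1
    then show ?thesis using assms by (simp add: A_def)
  next
    case 2
    then show ?thesis using ps[OF 2 assms(1) _ assms(2)] assms(3) by (simp add: A_def xp_def)
  next
    case 3
    then show ?thesis using ps[OF 3 S_uminus[OF assms(1)] _ S_uminus[OF assms(2)]] assms(3)
      by (simp add: A_def xp_def)
  qed
qed

lemma in_U: "\<omega> \<in> S \<Longrightarrow> y \<in> U \<longleftrightarrow> A \<omega> y \<in> \<Omega>"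
  using A_swap[of \<omega>0 \<omega> y] A_swap[of \<omega> \<omega>0 y] \<omega>0_S by (simp add: U_def) blast

lemma \<Omega>_open: "openin (top_of_set (Mspace v m)) \<Omega>" and \<Omega>_sub: "\<Omega> \<subseteq> Mspace v m"
  using slice by (simp_all add: slice_domain_def domain_in_def)

lemma open_U: "open U"
proof -
  obtain W where W: "open W" "\<Omega> = Mspace v m \<inter> W" using \<Omega>_open openin_open by metis
  have "A \<omega>0 y \<in> \<Omega> \<longleftrightarrow> A \<omega>0 y \<in> W" for y using A_M[OF \<omega>0_S] W(2) by blast
  then have "U = A \<omega>0 -` W" by (auto simp: U_def)
  moreover have "continuous_on UNIV (A \<omega>0)"
    by (rule linear_continuous_on[OF linear_A[unfolded linear_conv_bounded_linear]])
  ultimately show ?thesis using W(1) open_vimage by metis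
qed

lemma \<xi>_lin: "\<xi> s (x + y) = \<xi> s x + \<xi> s y" "\<xi> s (c *\<^sub>R x) = c * \<xi> s x" "\<xi> s 0 = 0"
  "\<xi> s (sum h J) = (\<Sum>j\<in>J. \<xi> s (h j))"
  using linear_add[OF \<xi>_linear] linear_scale[OF \<xi>_linear] linear_0[OF \<xi>_linear] linear_sum[OF \<xi>_linear]
  by simp_all

lemma M_expand: "x \<in> Mspace v m \<Longrightarrow> x = (\<Sum>s\<le>m. \<xi> s x *\<^sub>R v s)"
proof -
  assume "x \<in> Mspace v m"
  then have x: "x \<in> span (v ` {0..m})" by (simp add: Mspace_def)
  have 2: "linear (\<lambda>x. \<Sum>s\<le>m. \<xi> s x *\<^sub>R v s)"
    by (rule linearI) (simp_all add: \<xi>_lin scaleR_add_left sum.distrib scaleR_sum_right)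
  have "(\<lambda>x. x) x = (\<lambda>x. \<Sum>s\<le>m. \<xi> s x *\<^sub>R v s) x"
  proof (rule linear_eq_on_span[OF linear_id[unfolded id_def] 2 _ x])
    fix z assume "z \<in> v ` {0..m}"
    then obtain t where t: "t \<le> m" "z = v t" by auto
    have "(\<Sum>s\<le>m. \<xi> s (v t) *\<^sub>R v s) = (\<Sum>s\<le>m. if s = t then v t else 0)"
      using t by (intro sum.cong) (auto simp: \<xi>_v)
    then show "z = (\<Sum>s\<le>m. \<xi> s z *\<^sub>R v s)" using t by simp
  qed
  then show ?thesis .
qed

lemma \<xi>_sum: "t \<le> m \<Longrightarrow> J \<subseteq> {..m} \<Longrightarrow> \<xi> t (\<Sum>s\<in>J. c s *\<^sub>R v s) = (if t \<in> J then c t else 0)"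
proof -
  assume t: "t \<le> m" and J: "J \<subseteq> {..m}"
  have "\<xi> t (\<Sum>s\<in>J. c s *\<^sub>R v s) = (\<Sum>s\<in>J. if s = t then c t else 0)"
    unfolding \<xi>_lin using t J by (intro sum.cong) (auto simp: \<xi>_v)
  then show ?thesis using finite_subset[OF J] by simp
qed

text \<open>\<open>B\<close> is a right inverse of \<open>A \<omega>0\<close> on the slice, so
  \<open>U\<close> contains a connected copy of the slice; each y in \<open>U\<close> is joined to
  its point B (A \<omega>0 y) there by a segment on which \<open>A \<omega>0\<close> is
  constant.\<close>

lemma connected_U: "connected U"
proof -
  obtain c where c: "\<omega>0 = (\<Sum>t\<in>{p+1..m}. c t *\<^sub>R v t)" "(\<Sum>t\<in>{p+1..m}. (c t)\<^sup>2) = 1"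
    using S_repr[OF \<omega>0_S] by metis
  define Sl where "Sl = \<Omega> \<inter> slice_space v p \<omega>0"
  \<comment> \<open>The coefficient of \<open>e\<close> is the coordinate inner product with
    \<omega>0: it is 1 at \<omega>0 and 0 on R^(p+1).\<close>
  define B where "B x = (\<Sum>s\<le>p. \<xi> s x *\<^sub>R b s) + (\<Sum>t\<in>{p+1..m}. c t * \<xi> t x) *\<^sub>R e" for x
  have linB: "linear B"
    by (rule linearI) (simp_all add: B_def \<xi>_lin sum.distrib algebra_simps sum_distrib_left scaleR_sum_right)
  have \<xi>_S: "\<xi> t \<omega>0 = (if t \<le> p then 0 else c t)" if "t \<le> m" for t
    using \<xi>_sum[OF that, of "{p+1..m}" c] that by (auto simp: c(1))
  have AB: "A \<omega>0 (B x) = x" if x: "x \<in> slice_space v p \<omega>0" for x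
  proof -
    have lin2: "linear (\<lambda>x. A \<omega>0 (B x))"
      using linear_compose[OF linB linear_A] by (simp add: o_def)
    have "(\<lambda>x. A \<omega>0 (B x)) x = (\<lambda>x. x) x"
    proof (rule linear_eq_on_span[OF lin2 linear_id[unfolded id_def] _ x[unfolded slice_space_def]])
      fix z assume "z \<in> insert \<omega>0 (v ` {0..p})"
      then consider "z = \<omega>0" | s where "s \<le> p" "z = v s" by auto
      then show "A \<omega>0 (B z) = z"
      proof cases
        case 1
        have "(\<Sum>s\<le>p. \<xi> s \<omega>0 *\<^sub>R b s) = 0" using pm by (intro sum.neutral) (simp add: \<xi>_S)
        moreover have "(\<Sum>t\<in>{p+1..m}. c t * \<xi> t \<omega>0) = (\<Sum>t\<in>{p+1..m}. (c t)\<^sup>2)"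
          by (intro sum.cong) (auto simp: \<xi>_S power2_eq_square)
        ultimately have "B \<omega>0 = e" using c(2) by (simp add: B_def)
        then show ?thesis using 1 A_e by simp
      next
        case 2
        have "(\<Sum>t\<le>p. \<xi> t (v s) *\<^sub>R b t) = (\<Sum>t\<le>p. if t = s then b s else 0)"
          using 2 pm by (intro sum.cong) (auto simp: \<xi>_v)
        moreover have "(\<Sum>t\<in>{p+1..m}. c t * \<xi> t (v s)) = 0"
          using 2 pm by (intro sum.neutral) (auto simp: \<xi>_v)
        ultimately have "B (v s) = b s" using 2 by (simp add: B_def)
        then show ?thesis using 2 A_b by simp
      qed
    qed
    then show ?thesis .
  qed
  have "connected Sl" using slice \<omega>0_S by (simp add: slice_domain_def domain_in_def Sl_def S_def)
  then have conn: "connected (B ` Sl)"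
    by (rule connected_continuous_image[rotated])
       (rule linear_continuous_on[OF linB[unfolded linear_conv_bounded_linear]])
  have sub: "B ` Sl \<subseteq> U" using AB by (auto simp: Sl_def U_def)
  have cc: "connected_component U y (B (A \<omega>0 y))" if y: "y \<in> U" for y
    unfolding connected_component_def
  proof (intro exI[of _ "closed_segment y (B (A \<omega>0 y))"] conjI)
    show "closed_segment y (B (A \<omega>0 y)) \<subseteq> U"
    proof
      fix z assume "z \<in> closed_segment y (B (A \<omega>0 y))"
      then obtain u where "z = (1 - u) *\<^sub>R y + u *\<^sub>R B (A \<omega>0 y)" by (auto simp: in_segment)
      then have "A \<omega>0 z = (1 - u) *\<^sub>R A \<omega>0 y + u *\<^sub>R A \<omega>0 (B (A \<omega>0 y))"
        using linear_add[OF linear_A] linear_scale[OF linear_A] by simp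
      also have "\<dots> = A \<omega>0 y" by (simp add: AB[OF A_slice] flip: scaleR_add_left)
      finally show "z \<in> U" using y by (simp add: U_def)
    qed
  qed auto
  have cc2: "connected_component U (B (A \<omega>0 y)) (B (A \<omega>0 z))" if "y \<in> U" "z \<in> U" for y z
    unfolding connected_component_def
    using conn sub that A_slice by (intro exI[of _ "B ` Sl"]) (auto simp: Sl_def U_def)
  show ?thesis unfolding connected_iff_connected_component
  proof (intro ballI)
    fix y z assume "y \<in> U" "z \<in> U"
    from cc[OF this(1)] connected_component_trans[OF cc2[OF this] connected_component_sym[OF cc[OF this(2)]]]
    show "connected_component U y z" by (rule connected_component_trans)
  qed
qed

sublocale sym: symmetric_open e U
proof
  fix y assume "y \<in> U"
  then have y: "A \<omega>0 y \<in> \<Omega>" by (simp add: U_def)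
  have "A (- \<omega>0) (y - (2 * (y \<bullet> e)) *\<^sub>R e) = A \<omega>0 y"
    by (simp add: A_def inner_diff_left ee eb)
  then show "y - (2 * (y \<bullet> e)) *\<^sub>R e \<in> U" using y in_U[OF S_uminus[OF \<omega>0_S]] by simp
qed (use e_Basis open_U in auto)

section \<open>Dirac systems of the slices\<close>

definition \<iota> :: "'a \<Rightarrow> nat" where "\<iota> = inv_into {..m} b"

lemma \<iota>_b: "s \<le> m \<Longrightarrow> \<iota> (b s) = s"
  unfolding \<iota>_def using b_inj by (intro inv_into_f_f) auto

text \<open>Left multiplication by the conjugate: the direction \<open>b 0\<close> stands for the
  unit, which is kept, and the other generators change sign.\<close>

definition cl :: "('a \<Rightarrow> 'a) \<Rightarrow> 'a \<Rightarrow> 'a \<Rightarrow> 'a" where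
  "cl w \<beta> x = (if \<beta> = b 0 then x else - mul (w \<beta>) x)"

lemma linear_mul: "bounded_linear (mul a)" by (rule mul.bounded_linear_right)

lemma linear_cl: "bounded_linear (cl w \<beta>)"
  unfolding cl_def[abs_def]
  by (cases "\<beta> = b 0") (simp_all add: bounded_linear_ident bounded_linear_minus[OF linear_mul])

lemma clifford_cl:
  assumes w0: "w (b 0) = one"
    and w: "\<And>\<beta> \<beta>' x. \<beta> \<in> J \<Longrightarrow> \<beta>' \<in> J \<Longrightarrow> \<beta> \<noteq> b 0 \<Longrightarrow> \<beta>' \<noteq> b 0 \<Longrightarrow>
      mul (w \<beta>) (mul (w \<beta>') x) + mul (w \<beta>') (mul (w \<beta>) x) = (if \<beta> = \<beta>' then - 2 else 0) *\<^sub>R x"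
    and J: "\<beta> \<in> J" "\<beta>' \<in> J"
  shows "cl w \<beta> (mul (w \<beta>') x) + cl w \<beta>' (mul (w \<beta>) x) = (if \<beta> = \<beta>' then 2 *\<^sub>R x else 0)"
    "mul (w \<beta>) (cl w \<beta>' x) + mul (w \<beta>') (cl w \<beta> x) = (if \<beta> = \<beta>' then 2 *\<^sub>R x else 0)"
proof -
  have *: "- mul (w \<beta>) (mul (w \<beta>') x) - mul (w \<beta>') (mul (w \<beta>) x) = (if \<beta> = \<beta>' then 2 *\<^sub>R x else 0)"
    if "\<beta> \<noteq> b 0" "\<beta>' \<noteq> b 0"
  proof -
    have "- mul (w \<beta>) (mul (w \<beta>') x) - mul (w \<beta>') (mul (w \<beta>) x)
        = - (mul (w \<beta>) (mul (w \<beta>') x) + mul (w \<beta>') (mul (w \<beta>) x))" by simp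
    also have "\<dots> = - ((if \<beta> = \<beta>' then - 2 else 0) *\<^sub>R x)" by (simp only: w[OF J that])
    finally show ?thesis by simp
  qed
  show "cl w \<beta> (mul (w \<beta>') x) + cl w \<beta>' (mul (w \<beta>) x) = (if \<beta> = \<beta>' then 2 *\<^sub>R x else 0)"
    using * w0 by (auto simp: cl_def scaleR_2)
  show "mul (w \<beta>) (cl w \<beta>' x) + mul (w \<beta>') (cl w \<beta> x) = (if \<beta> = \<beta>' then 2 *\<^sub>R x else 0)"
    using * w0 by (auto simp: cl_def scaleR_2 mul.minus_right)
qed

lemma dirac_system_cl:
  assumes "J \<subseteq> Basis" "w (b 0) = one"
    and "\<And>\<beta> \<beta>' x. \<beta> \<in> J \<Longrightarrow> \<beta>' \<in> J \<Longrightarrow> \<beta> \<noteq> b 0 \<Longrightarrow> \<beta>' \<noteq> b 0 \<Longrightarrow>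
      mul (w \<beta>) (mul (w \<beta>') x) + mul (w \<beta>') (mul (w \<beta>) x) = (if \<beta> = \<beta>' then - 2 else 0) *\<^sub>R x"
  shows "dirac_system J (\<lambda>\<beta>. mul (w \<beta>)) (cl w)"
proof (rule dirac_system.intro)
  show "cl w \<beta> (mul (w \<beta>') x) + cl w \<beta>' (mul (w \<beta>) x) = (if \<beta> = \<beta>' then 2 *\<^sub>R x else 0)"
    if "\<beta> \<in> J" "\<beta>' \<in> J" for \<beta> \<beta>' x
    by (rule clifford_cl(1)[OF assms(2,3) that])
  show "linear (mul (w \<beta>))" for \<beta> by (rule bounded_linear.linear[OF linear_mul])
  show "linear (cl w \<beta>)" for \<beta> by (rule bounded_linear.linear[OF linear_cl])
qed (fact assms(1))

definition Pb :: "'a set" where "Pb = b ` {..p}"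
definition ws :: "'a \<Rightarrow> 'a \<Rightarrow> 'a" where "ws \<omega> \<beta> = (if \<beta> = e then \<omega> else v (\<iota> \<beta>))"

lemma Pb_sub: "Pb \<subseteq> Basis" "e \<notin> Pb"
proof -
  show "Pb \<subseteq> Basis" using pm by (auto simp: Pb_def intro: b_Basis)
  show "e \<notin> Pb" by (auto simp: Pb_def)
qed

lemma ws_b: "s \<le> p \<Longrightarrow> ws \<omega> (b s) = v s"
  using pm Pb_sub by (auto simp: ws_def \<iota>_b Pb_def)

lemma ws_e: "ws \<omega> e = \<omega>" by (simp add: ws_def)

lemma clifford_ws:
  assumes \<omega>: "\<omega> \<in> S" and J: "\<beta> \<in> insert e Pb" "\<beta>' \<in> insert e Pb" "\<beta> \<noteq> b 0" "\<beta>' \<noteq> b 0"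
  shows "mul (ws \<omega> \<beta>) (mul (ws \<omega> \<beta>') x) + mul (ws \<omega> \<beta>') (mul (ws \<omega> \<beta>) x) = (if \<beta> = \<beta>' then - 2 else 0) *\<^sub>R x"
proof -
  have cases: "\<beta> = e \<or> (\<exists>s\<in>{1..p}. \<beta> = b s)" if "\<beta> \<in> insert e Pb" "\<beta> \<noteq> b 0" for \<beta>
  proof -
    have "\<exists>s\<in>{1..p}. \<beta> = b s" if "\<beta> = b s" "s \<le> p" for s
      using that \<open>\<beta> \<noteq> b 0\<close> by (cases s) auto
    then show ?thesis using that by (auto simp: Pb_def)
  qed
  have vv: "mul (v s) (mul \<omega> x) + mul \<omega> (mul (v s) x) = 0" if "s \<in> {1..p}" for s
    using S_anticommute[OF \<omega> that] by simp
  have inj: "b s = b t \<longleftrightarrow> s = t" if "s \<in> {1..p}" "t \<in> {1..p}" for s t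
    using b_inj that pm by (auto simp: inj_on_def)
  have ne: "b s \<noteq> e" if "s \<in> {1..p}" for s using that Pb_sub by (auto simp: Pb_def)
  from cases[OF J(1,3)] cases[OF J(2,4)] show ?thesis
  proof (elim disjE bexE)
    assume "\<beta> = e" "\<beta>' = e"
    then show ?thesis using S_sq[OF \<omega>] by (simp add: ws_e scaleR_2)
  next
    fix s assume "\<beta> = e" and s: "s \<in> {1..p}" "\<beta>' = b s"
    then show ?thesis using vv[OF s(1)] ne[OF s(1)] by (simp add: ws_e ws_b add.commute)
  next
    fix s assume "\<beta>' = e" and s: "s \<in> {1..p}" "\<beta> = b s"
    then show ?thesis using vv[OF s(1)] ne[OF s(1)] by (simp add: ws_e ws_b add.commute)
  next
    fix s t assume "s \<in> {1..p}" "\<beta> = b s" "t \<in> {1..p}" "\<beta>' = b t"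
    then show ?thesis using clifford_v[of s t x] pm inj[of s t] by (simp add: ws_b)
  qed
qed

lemma ds: "\<omega> \<in> S \<Longrightarrow> dirac_system (insert e Pb) (\<lambda>\<beta>. mul (ws \<omega> \<beta>)) (cl (ws \<omega>))"
  by (rule dirac_system_cl) (use Pb_sub e_Basis clifford_ws ws_b v0 in auto)

lemma sum_Pb: "(\<Sum>\<beta>\<in>Pb. h \<beta>) = (\<Sum>s\<le>p. h (b s))"
proof -
  have "inj_on b {..p}" using b_inj pm by (auto intro: inj_on_subset)
  then show ?thesis unfolding Pb_def by (simp add: sum.reindex)
qed

lemma finite_Pb [simp]: "finite Pb" by (simp add: Pb_def)

text \<open>Composition with \<open>A \<omega>\<close> transports the equation from the slice to the
  fixed set \<open>U\<close>. Basis directions outside the model are mapped to 0, so the composite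
  is constant along them.\<close>

lemma monog_slice:
  assumes \<omega>: "\<omega> \<in> S"
  shows "dirac_system.monog (insert e Pb) (\<lambda>\<beta>. mul (ws \<omega> \<beta>)) U (\<lambda>y. f (A \<omega> y))"
proof -
  interpret ds: dirac_system "insert e Pb" "\<lambda>\<beta>. mul (ws \<omega> \<beta>)" "cl (ws \<omega>)" by (rule ds[OF \<omega>])
  define \<Omega>\<omega> where "\<Omega>\<omega> = \<Omega> \<inter> slice_space v p \<omega>"
  have gpsw: "continuous_on \<Omega>\<omega> f" "\<And>u y. u \<in> insert \<omega> (v ` {0..p}) \<Longrightarrow> y \<in> \<Omega>\<omega> \<Longrightarrow> dd_exists u f y"
    "\<And>u. u \<in> insert \<omega> (v ` {0..p}) \<Longrightarrow> continuous_on \<Omega>\<omega> (dd u f)"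
    "\<And>y. y \<in> \<Omega>\<omega> \<Longrightarrow> dirac mul v p f y + mul \<omega> (dd \<omega> f y) = 0"
    using gps \<omega> unfolding gps_monogenic_def S_def Let_def \<Omega>\<omega>_def by blast+
  have AU: "A \<omega> y \<in> \<Omega>\<omega>" if "y \<in> U" for y using that in_U[OF \<omega>] A_slice by (simp add: \<Omega>\<omega>_def)
  have contA: "continuous_on U (\<lambda>y. F (A \<omega> y))" if "continuous_on \<Omega>\<omega> F" for F :: "'a \<Rightarrow> 'a"
  proof (rule continuous_on_compose2[OF that])
    show "continuous_on U (A \<omega>)"
      by (rule linear_continuous_on[OF linear_A[unfolded linear_conv_bounded_linear]])
  qed (use AU in auto)
  have A_cases: "A \<omega> \<beta> \<in> insert \<omega> (v ` {0..p}) \<or> A \<omega> \<beta> = 0" if \<beta>: "\<beta> \<in> Basis" for \<beta>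
  proof (cases "\<beta> = e \<or> \<beta> \<in> b ` {..p}")
    case True
    then show ?thesis using A_e A_b by fastforce
  next
    case False
    then show ?thesis using A_other[OF \<beta>] by blast
  qed
  \<comment> \<open>In the direction 0 every function has derivative 0, which takes care of the
    directions annihilated by \<open>A \<omega>\<close>.\<close>
  have dd0: "has_dd 0 F 0 y" "dd 0 F y = 0" for F :: "'a \<Rightarrow> 'a" and y :: 'a
    using has_dd_imp_dd[of 0 F 0 y] by (simp_all add: has_dd_def)
  show ?thesis
  proof (rule ds.monogI[where g' = "\<lambda>\<beta> y. dd (A \<omega> \<beta>) f (A \<omega> y)"])
    show "continuous_on U (\<lambda>y. f (A \<omega> y))" by (rule contA[OF gpsw(1)])
    fix \<beta> :: 'a assume \<beta>: "\<beta> \<in> Basis"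
    show "continuous_on U (\<lambda>y. dd (A \<omega> \<beta>) f (A \<omega> y))"
    proof (cases "A \<omega> \<beta> = 0")
      case True
      then show ?thesis by (simp add: dd0)
    next
      case False
      then show ?thesis using A_cases[OF \<beta>] gpsw(3) by (intro contA) auto
    qed
    fix y assume y: "y \<in> U"
    have "has_dd (A \<omega> \<beta>) f (dd (A \<omega> \<beta>) f (A \<omega> y)) (A \<omega> y)"
    proof (cases "A \<omega> \<beta> = 0")
      case True
      then show ?thesis by (simp add: dd0)
    next
      case False
      then show ?thesis using A_cases[OF \<beta>] gpsw(2) AU[OF y] by (intro dd_exists_has_dd) auto
    qed
    then show "has_dd \<beta> (\<lambda>y. f (A \<omega> y)) (dd (A \<omega> \<beta>) f (A \<omega> y)) y"
      by (simp add: has_dd_comp_linear[OF linear_A])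
  next
    fix y assume y: "y \<in> U"
    have "(\<Sum>\<beta>\<in>insert e Pb. mul (ws \<omega> \<beta>) (dd (A \<omega> \<beta>) f (A \<omega> y)))
      = mul \<omega> (dd \<omega> f (A \<omega> y)) + (\<Sum>s\<le>p. mul (v s) (dd (v s) f (A \<omega> y)))"
      using Pb_sub by (simp add: sum_Pb ws_e A_e ws_b A_b)
    also have "\<dots> = 0" using gpsw(4)[OF AU[OF y]] by (simp add: dirac_def add.commute)
    finally show "(\<Sum>\<beta>\<in>insert e Pb. mul (ws \<omega> \<beta>) (dd (A \<omega> \<beta>) f (A \<omega> y))) = 0" .
    fix \<beta> :: 'a assume "\<beta> \<in> Basis - insert e Pb"
    then have "A \<omega> \<beta> = 0" using A_other by (simp add: Pb_def)
    then show "dd (A \<omega> \<beta>) f (A \<omega> y) = 0" by (simp add: dd0)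
  qed
qed

definition g0 :: "'a \<Rightarrow> 'a" where "g0 y = f (A \<omega>0 y)"
text \<open>The reflection of y corresponds to -\<omega>0, so \<open>F1\<close> is the even part of
  f on the slice of \<omega>0, and \<open>F2\<close> is the odd part multiplied from the left by
  -\<omega>0, the inverse of \<omega>0.\<close>

definition F1 :: "'a \<Rightarrow> 'a" where "F1 y = (1/2) *\<^sub>R (g0 y + g0 (sym.refl y))"
definition F2 :: "'a \<Rightarrow> 'a" where "F2 y = (1/2) *\<^sub>R mul \<omega>0 (g0 (sym.refl y) + (- 1) *\<^sub>R g0 y)"

lemma smooth_g0: "smooth_on U g0"
proof -
  interpret ds: dirac_system "insert e Pb" "\<lambda>\<beta>. mul (ws \<omega>0 \<beta>)" "cl (ws \<omega>0)" by (rule ds[OF \<omega>0_S])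
  show ?thesis unfolding g0_def[abs_def] by (rule ds.monog_smooth[OF open_U monog_slice[OF \<omega>0_S]])
qed

lemma smooth_F1: "smooth_on U F1" and smooth_F2: "smooth_on U F2"
  unfolding F1_def[abs_def] F2_def[abs_def]
  by (intro smooth_on_bounded_linear[OF open_U bounded_linear_scaleR_right] smooth_on_add[OF open_U]
      smooth_on_bounded_linear[OF open_U linear_mul] smooth_g0 sym.smooth_refl)+

lemma even_F1: "sym.evenf F1" and odd_F2: "sym.oddf F2"
  by (auto simp: sym.evenf_def sym.oddf_def F1_def F2_def mul.add_right mul.minus_right mul.diff_right algebra_simps)

lemma D_g0: "y \<in> U \<Longrightarrow> (\<Sum>s\<le>p. mul (v s) (dd (b s) g0 y)) = - mul \<omega>0 (dd e g0 y)"
proof -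
  assume y: "y \<in> U"
  interpret ds: dirac_system "insert e Pb" "\<lambda>\<beta>. mul (ws \<omega>0 \<beta>)" "cl (ws \<omega>0)" by (rule ds[OF \<omega>0_S])
  have "(\<Sum>\<beta>\<in>insert e Pb. mul (ws \<omega>0 \<beta>) (dd \<beta> g0 y)) = 0"
    using monog_slice[OF \<omega>0_S] y unfolding ds.monog_def g0_def[abs_def] by blast
  then show ?thesis using Pb_sub by (simp add: sum_Pb ws_e ws_b add_eq_0_iff)
qed

lemma dd_F:
  assumes "\<beta> \<in> Basis" "y \<in> U"
  shows "dd \<beta> F1 y = (1/2) *\<^sub>R (dd \<beta> g0 y + (if \<beta> = e then - 1 else 1) *\<^sub>R dd \<beta> g0 (sym.refl y))"
    "dd \<beta> F2 y = (1/2) *\<^sub>R mul \<omega>0 ((if \<beta> = e then - 1 else 1) *\<^sub>R dd \<beta> g0 (sym.refl y) + (- 1) *\<^sub>R dd \<beta> g0 y)"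
  unfolding F1_def[abs_def] F2_def[abs_def]
  by (rule has_dd_imp_dd, intro has_dd_cmul has_dd_add has_dd_bounded_linear[OF linear_mul]
      sym.has_dd_refl smooth_on_has_dd[OF smooth_g0] sym.refl_in assms)+

text \<open>The slice equation is used at y and at its mirror image; the e-derivative changes sign
  under reflection, which assembles the derivative of \<open>F2\<close>.\<close>

lemma DF1: "y \<in> U \<Longrightarrow> (\<Sum>s\<le>p. mul (v s) (dd (b s) F1 y)) = dd e F2 y"
proof -
  assume y: "y \<in> U"
  have bs: "b s \<in> Basis" "b s \<noteq> e" if "s \<le> p" for s using Pb_sub that by (auto simp: Pb_def)
  have "(\<Sum>s\<le>p. mul (v s) (dd (b s) F1 y))
     = (1/2) *\<^sub>R ((\<Sum>s\<le>p. mul (v s) (dd (b s) g0 y)) + (\<Sum>s\<le>p. mul (v s) (dd (b s) g0 (sym.refl y))))"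
    unfolding sum.distrib[symmetric] scaleR_sum_right
    by (intro sum.cong refl) (simp add: dd_F[OF bs(1) y] bs mul.add_right mul.scaleR_right)
  also have "\<dots> = dd e F2 y"
    by (simp add: D_g0[OF y] D_g0[OF sym.refl_in[OF y]] dd_F[OF e_Basis y] mul.add_right mul.diff_right mul.minus_right algebra_simps)
  finally show ?thesis .
qed

text \<open>Moving \<omega> to the left past v_s replaces v_s by its conjugate: the unit commutes
  with \<omega>, the other generators anticommute with it.\<close>

lemma cl_anticommute: "\<omega> \<in> S \<Longrightarrow> s \<le> p \<Longrightarrow> mul (v s) (mul \<omega> x) = mul \<omega> (cl (ws \<omega>0) (b s) x)"
proof (cases "s = 0")
  case True
  then show ?thesis by (simp add: v0 cl_def)
next
  case False
  assume \<omega>: "\<omega> \<in> S" and s: "s \<le> p"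
  have "b s \<noteq> b 0" using b_inj False s pm by (auto simp: inj_on_def)
  then show ?thesis using S_anticommute[OF \<omega>, of s x] False s by (simp add: cl_def ws_b mul.minus_right)
qed

lemma cl_inverse: "\<omega> \<in> S \<Longrightarrow> s \<le> p \<Longrightarrow> cl (ws \<omega>0) (b s) (mul \<omega> x) = mul \<omega> (mul (v s) x)"
proof (cases "s = 0")
  case True
  then show ?thesis by (simp add: v0 cl_def)
next
  case False
  assume \<omega>: "\<omega> \<in> S" and s: "s \<le> p"
  have "b s \<noteq> b 0" using b_inj False s pm by (auto simp: inj_on_def)
  then show ?thesis using S_anticommute[OF \<omega>, of s x] False s by (simp add: cl_def ws_b mul.minus_right)
qed

lemma DF2: "y \<in> U \<Longrightarrow> (\<Sum>s\<le>p. cl (ws \<omega>0) (b s) (dd (b s) F2 y)) = - dd e F1 y"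
proof -
  assume y: "y \<in> U"
  have bs: "b s \<in> Basis" "b s \<noteq> e" if "s \<le> p" for s using Pb_sub that by (auto simp: Pb_def)
  have "(\<Sum>s\<le>p. cl (ws \<omega>0) (b s) (dd (b s) F2 y))
     = (\<Sum>s\<le>p. mul \<omega>0 (mul (v s) ((1/2) *\<^sub>R (dd (b s) g0 (sym.refl y) + (- 1) *\<^sub>R dd (b s) g0 y))))"
  proof (intro sum.cong refl)
    fix s assume "s \<in> {..p}"
    then have s: "s \<le> p" by simp
    have "dd (b s) F2 y = mul \<omega>0 ((1/2) *\<^sub>R (dd (b s) g0 (sym.refl y) + (- 1) *\<^sub>R dd (b s) g0 y))"
      using bs[OF s] by (simp add: dd_F[OF bs(1)[OF s] y] mul.scaleR_right)
    then show "cl (ws \<omega>0) (b s) (dd (b s) F2 y)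
        = mul \<omega>0 (mul (v s) ((1/2) *\<^sub>R (dd (b s) g0 (sym.refl y) + (- 1) *\<^sub>R dd (b s) g0 y)))"
      using cl_inverse[OF \<omega>0_S s] by simp
  qed
  also have "\<dots> = mul \<omega>0 ((1/2) *\<^sub>R ((\<Sum>s\<le>p. mul (v s) (dd (b s) g0 (sym.refl y))) - (\<Sum>s\<le>p. mul (v s) (dd (b s) g0 y))))"
    unfolding sum_subtractf[symmetric] scaleR_sum_right mul.sum_right
    by (intro sum.cong refl) (simp add: mul.diff_right mul.scaleR_right)
  also have "\<dots> = - dd e F1 y"
    unfolding D_g0[OF y] D_g0[OF sym.refl_in[OF y]]
    by (simp add: dd_F[OF e_Basis y] mul.scaleR_right mul.diff_right mul.minus_right mul.add_right S_sq[OF \<omega>0_S] algebra_simps)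
  finally show ?thesis .
qed

sublocale ax: axial_system e U Pb "\<lambda>\<beta>. mul (ws \<omega>0 \<beta>)" "cl (ws \<omega>0)" F1 F2
proof (intro axial_system.intro axial_system_axioms.intro)
  show "symmetric_open e U" by (rule sym.symmetric_open_axioms)
  show "Pb \<subseteq> Basis" "e \<notin> Pb" by (fact Pb_sub)+
  show "\<And>\<beta>. bounded_linear (mul (ws \<omega>0 \<beta>))" by (rule linear_mul)
  show "\<And>\<beta>. bounded_linear (cl (ws \<omega>0) \<beta>)" by (rule linear_cl)
  have w0: "ws \<omega>0 (b 0) = one" using ws_b v0 by simp
  fix \<beta> \<beta>' x assume "\<beta> \<in> Pb" "\<beta>' \<in> Pb"
  then have "\<beta> \<in> insert e Pb" "\<beta>' \<in> insert e Pb" by auto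
  from clifford_cl[OF w0 clifford_ws[OF \<omega>0_S] this]
  show "cl (ws \<omega>0) \<beta> (mul (ws \<omega>0 \<beta>') x) + cl (ws \<omega>0) \<beta>' (mul (ws \<omega>0 \<beta>) x) = (if \<beta> = \<beta>' then 2 *\<^sub>R x else 0)"
    "mul (ws \<omega>0 \<beta>) (cl (ws \<omega>0) \<beta>' x) + mul (ws \<omega>0 \<beta>') (cl (ws \<omega>0) \<beta> x) = (if \<beta> = \<beta>' then 2 *\<^sub>R x else 0)"
    by blast+
next
  show "smooth_on U F1" "smooth_on U F2" "sym.evenf F1" "sym.oddf F2"
    by (fact smooth_F1 smooth_F2 even_F1 odd_F2)+
  fix y assume y: "y \<in> U"
  show "(\<Sum>\<beta>\<in>Pb. mul (ws \<omega>0 \<beta>) (dd \<beta> F1 y)) = dd e F2 y"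
    using DF1[OF y] by (simp add: sum_Pb ws_b)
  show "(\<Sum>\<beta>\<in>Pb. cl (ws \<omega>0) \<beta> (dd \<beta> F2 y)) = - dd e F1 y"
    using DF2[OF y] by (simp add: sum_Pb)
qed

text \<open>The difference of both sides is monogenic on the slice of \<open>\<eta>\<close> and vanishes on the hyperplane.\<close>
lemma representation_formula:
  assumes \<eta>: "\<eta> \<in> S" and y: "y \<in> U"
  shows "f (A \<eta> y) = F1 y + mul \<eta> (F2 y)"
proof -
  interpret ds: dirac_system "insert e Pb" "\<lambda>\<beta>. mul (ws \<eta> \<beta>)" "cl (ws \<eta>)" by (rule ds[OF \<eta>])
  have other: "dd \<beta> g0 z = 0" if "\<beta> \<in> Basis - insert e Pb" "z \<in> U" for \<beta> z
  proof -
    interpret ds0: dirac_system "insert e Pb" "\<lambda>\<beta>. mul (ws \<omega>0 \<beta>)" "cl (ws \<omega>0)" by (rule ds[OF \<omega>0_S])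
    show ?thesis using monog_slice[OF \<omega>0_S] that unfolding ds0.monog_def g0_def[abs_def] by blast
  qed
  have "ds.monog U (\<lambda>y. F1 y + mul \<eta> (F2 y))"
  proof (rule ds.monogI[where g' = "\<lambda>\<beta> y. dd \<beta> F1 y + mul \<eta> (dd \<beta> F2 y)"])
    show "continuous_on U (\<lambda>y. F1 y + mul \<eta> (F2 y))"
      by (intro continuous_intros smooth_on_continuous[OF smooth_F1] smooth_on_continuous[OF smooth_F2]
          bounded_linear.continuous_on[OF linear_mul])
    fix \<beta> :: 'a assume \<beta>: "\<beta> \<in> Basis"
    show "continuous_on U (\<lambda>y. dd \<beta> F1 y + mul \<eta> (dd \<beta> F2 y))"
      by (intro continuous_intros smooth_on_continuous[OF smooth_on_dd[OF smooth_F1 \<beta>]]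
          smooth_on_continuous[OF smooth_on_dd[OF smooth_F2 \<beta>]] bounded_linear.continuous_on[OF linear_mul])
    show "has_dd \<beta> (\<lambda>y. F1 y + mul \<eta> (F2 y)) (dd \<beta> F1 y + mul \<eta> (dd \<beta> F2 y)) y" if "y \<in> U" for y
      by (intro has_dd_add has_dd_bounded_linear[OF linear_mul] smooth_on_has_dd[OF smooth_F1 \<beta> that]
          smooth_on_has_dd[OF smooth_F2 \<beta> that])
  next
    fix y assume y: "y \<in> U"
    have "(\<Sum>s\<le>p. mul (v s) (dd (b s) F1 y + mul \<eta> (dd (b s) F2 y)))
      = (\<Sum>s\<le>p. mul (v s) (dd (b s) F1 y)) + mul \<eta> (\<Sum>s\<le>p. cl (ws \<omega>0) (b s) (dd (b s) F2 y))"
      unfolding mul.sum_right sum.distrib[symmetric]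
      by (intro sum.cong refl) (simp add: mul.add_right cl_anticommute[OF \<eta>])
    also have "\<dots> = dd e F2 y - mul \<eta> (dd e F1 y)" by (simp add: DF1[OF y] DF2[OF y] mul.minus_right)
    finally have "(\<Sum>s\<le>p. mul (v s) (dd (b s) F1 y + mul \<eta> (dd (b s) F2 y))) = dd e F2 y - mul \<eta> (dd e F1 y)" .
    then show "(\<Sum>\<beta>\<in>insert e Pb. mul (ws \<eta> \<beta>) (dd \<beta> F1 y + mul \<eta> (dd \<beta> F2 y))) = 0"
      using Pb_sub by (simp add: sum_Pb ws_e ws_b) (simp add: mul.add_right S_sq[OF \<eta>])
    fix \<beta> :: 'a assume \<beta>: "\<beta> \<in> Basis - insert e Pb"
    then show "dd \<beta> F1 y + mul \<eta> (dd \<beta> F2 y) = 0"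
      using y sym.refl_in[OF y] by (simp add: dd_F other mul.zero_right)
  qed
  then have k: "ds.monog U (\<lambda>y. f (A \<eta> y) - (F1 y + mul \<eta> (F2 y)))"
    by (rule ds.monog_diff[OF monog_slice[OF \<eta>]])
  \<comment> \<open>A slice domain meets R^(p+1). The model point \<open>z\<close> of such an
    \<open>x0\<close> puts the hyperplane y \<bullet> e = 0 in contact with the connected set
    \<open>U\<close>, as the uniqueness theorem requires.\<close>
  obtain x0 where x0: "x0 \<in> \<Omega>" "x0 \<in> Rp1 v p" using slice by (auto simp: slice_domain_def)
  define z where "z = (\<Sum>s\<le>p. \<xi> s x0 *\<^sub>R b s)"
  have zb: "z \<bullet> b s = \<xi> s x0" if "s \<le> p" for s
  proof -
    have "z \<bullet> b s = (\<Sum>t\<le>p. if t = s then \<xi> s x0 else 0)"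
      unfolding z_def inner_sum_left using that pm by (intro sum.cong) (auto simp: b_inner)
    then show ?thesis using that by simp
  qed
  have ze: "z \<bullet> e = 0" unfolding z_def inner_sum_left by (intro sum.neutral) (simp add: b_e)
  have "A \<omega>0 z = x0"
  proof -
    have x0s: "x0 \<in> span (v ` {0..p})" using x0 by (simp add: Rp1_def)
    have lin: "linear (\<lambda>x. \<Sum>s\<le>p. \<xi> s x *\<^sub>R v s)"
      by (rule linearI) (simp_all add: \<xi>_lin scaleR_add_left sum.distrib scaleR_sum_right)
    have "(\<lambda>x. \<Sum>s\<le>p. \<xi> s x *\<^sub>R v s) x0 = (\<lambda>x. x) x0"
    proof (rule linear_eq_on_span[OF lin linear_id[unfolded id_def] _ x0s])
      fix w assume "w \<in> v ` {0..p}"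
      then obtain t where t: "t \<le> p" "w = v t" by auto
      have "(\<Sum>s\<le>p. \<xi> s (v t) *\<^sub>R v s) = (\<Sum>s\<le>p. if s = t then v t else 0)"
        using t pm by (intro sum.cong) (auto simp: \<xi>_v)
      then show "(\<Sum>s\<le>p. \<xi> s w *\<^sub>R v s) = w" using t by simp
    qed
    then show ?thesis by (simp add: A_def ze zb)
  qed
  then have zU: "z \<in> U" using x0 by (simp add: U_def)
  have "f (A \<eta> y) - (F1 y + mul \<eta> (F2 y)) = 0"
  proof (rule ds.monog_zero_of_hyperplane[OF open_U connected_U k _ _ _ zU ze y])
    show "x = 0" if "mul (ws \<eta> e) x = 0" for x
      using S_sq[OF \<eta>, of x] that by (simp add: ws_e mul.zero_right)
    \<comment> \<open>On the hyperplane y is its own mirror image, so F1 = g0 and F2 = 0, and the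
      maps \<open>A \<eta>\<close> all agree.\<close>
    show "f (A \<eta> y) - (F1 y + mul \<eta> (F2 y)) = 0" if "y \<in> U" "y \<bullet> e = 0" for y
      using that sym.refl_fix[of y]
      by (simp add: F1_def F2_def g0_def A_def mul.zero_right flip: scaleR_2)
  qed simp
  then show ?thesis by simp
qed

end

section \<open>Powers of the Laplacian\<close>

text \<open>\<open>Z\<close> has to be stable under small steps in the directions
  \<open>v s\<close>, as sets open relative to a subspace containing them are. Iterated Laplacians
  can thus be computed inside \<Omega> and inside its part in R^(p+1).\<close>

lemma lap_eq_on:
  assumes Z: "\<And>x s. x \<in> Z \<Longrightarrow> s \<le> n \<Longrightarrow> \<forall>\<^sub>F t in nhds 0. x + t *\<^sub>R v s \<in> Z"
    and F: "\<And>x. x \<in> Z \<Longrightarrow> F x = G x"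
    and G1: "\<And>x s. x \<in> Z \<Longrightarrow> s \<le> n \<Longrightarrow> has_dd (v s) G (G1 s x) x"
    and G2: "\<And>x s. x \<in> Z \<Longrightarrow> s \<le> n \<Longrightarrow> has_dd (v s) (G1 s) (G2 s x) x"
    and x: "x \<in> Z"
  shows "lap v n F x = (\<Sum>s\<le>n. G2 s x)"
  unfolding lap_def
proof (intro sum.cong refl)
  fix s assume "s \<in> {..n}"
  then have s: "s \<le> n" by simp
  have 1: "dd (v s) F z = G1 s z" if z: "z \<in> Z" for z
  proof (rule has_dd_imp_dd, rule has_dd_transform[OF G1[OF z s]])
    show "\<forall>\<^sub>F t in nhds 0. G (z + t *\<^sub>R v s) = F (z + t *\<^sub>R v s)"
      using Z[OF z s] by eventually_elim (simp add: F)
  qed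
  show "dd (v s) (dd (v s) F) x = G2 s x"
  proof (rule has_dd_imp_dd, rule has_dd_transform[OF G2[OF x s]])
    show "\<forall>\<^sub>F t in nhds 0. G1 s (x + t *\<^sub>R v s) = dd (v s) F (x + t *\<^sub>R v s)"
      using Z[OF x s] by eventually_elim (simp add: 1)
  qed
qed

context gps_setup
begin

definition rd :: "'a \<Rightarrow> real" where "rd x = sqrt (\<Sum>s\<in>{p+1..m}. (\<xi> s x)\<^sup>2)"
text \<open>The model point of x: its e-coordinate is the nonnegative radius, whatever the direction
  \<omega> of the q-part.\<close>

definition B :: "'a \<Rightarrow> 'a" where "B x = (\<Sum>s\<le>p. \<xi> s x *\<^sub>R b s) + rd x *\<^sub>R e"
definition X :: "'a \<Rightarrow> 'a" where "X x = (\<Sum>s\<in>{p+1..m}. \<xi> s x *\<^sub>R v s)"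

lemma coord_eq: assumes "x \<in> Mspace v m" shows "coord v m x = (\<lambda>s. if s \<le> m then \<xi> s x else 0)"
  unfolding coord_def
proof (rule the_equality)
  have "(\<Sum>s\<le>m. \<xi> s x *\<^sub>R v s) = (\<Sum>s\<le>m. (if s \<le> m then \<xi> s x else 0) *\<^sub>R v s)"
    by (intro sum.cong) auto
  then show "(\<forall>s>m. (if s \<le> m then \<xi> s x else 0) = 0) \<and> x = (\<Sum>s\<le>m. (if s \<le> m then \<xi> s x else 0) *\<^sub>R v s)"
    using M_expand[OF assms] by simp
  fix c assume c: "(\<forall>s>m. c s = 0) \<and> x = (\<Sum>s\<le>m. c s *\<^sub>R v s)"
  show "c = (\<lambda>s. if s \<le> m then \<xi> s x else 0)"
  proof
    fix s
    show "c s = (if s \<le> m then \<xi> s x else 0)"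
      using c \<xi>_sum[of s "{..m}" c] by auto
  qed
qed

lemma parts_eq:
  assumes "x \<in> Mspace v m"
  shows "xpart v p m x = (\<Sum>s\<le>p. \<xi> s x *\<^sub>R v s)" "xqpart v p m x = X x" "rad v p m x = rd x"
  unfolding xpart_def xqpart_def rad_def rd_def X_def coord_eq[OF assms] using pm
  by (auto intro!: sum.cong arg_cong[where f = sqrt])

lemma rd_nonneg: "rd x \<ge> 0" by (simp add: rd_def sum_nonneg)

lemma rd_sq: "(rd x)\<^sup>2 = (\<Sum>s\<in>{p+1..m}. (\<xi> s x)\<^sup>2)" by (simp add: rd_def sum_nonneg)

lemma B_b: "s \<le> p \<Longrightarrow> B x \<bullet> b s = \<xi> s x"
proof -
  assume s: "s \<le> p"
  have "(\<Sum>t\<le>p. \<xi> t x *\<^sub>R b t) \<bullet> b s = (\<Sum>t\<le>p. if t = s then \<xi> s x else 0)"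
    unfolding inner_sum_left using s pm by (intro sum.cong) (auto simp: b_inner)
  then show ?thesis using s by (simp add: B_def inner_add_left eb)
qed

lemma B_e: "B x \<bullet> e = rd x"
proof -
  have "(\<Sum>t\<le>p. \<xi> t x *\<^sub>R b t) \<bullet> e = 0"
    unfolding inner_sum_left by (intro sum.neutral) (simp add: b_e)
  then show ?thesis by (simp add: B_def inner_add_left ee)
qed

lemma M_split: "x \<in> Mspace v m \<Longrightarrow> x = (\<Sum>s\<le>p. \<xi> s x *\<^sub>R v s) + X x"
proof -
  assume "x \<in> Mspace v m"
  then have "x = (\<Sum>s\<le>m. \<xi> s x *\<^sub>R v s)" by (rule M_expand)
  also have "{..m} = {..p} \<union> {p+1..m}" using pm by auto
  also have "(\<Sum>s\<in>{..p} \<union> {p+1..m}. \<xi> s x *\<^sub>R v s) = (\<Sum>s\<le>p. \<xi> s x *\<^sub>R v s) + X x"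
    unfolding X_def by (rule sum.union_disjoint) auto
  finally show ?thesis .
qed

lemma rd_0_iff: "rd x = 0 \<longleftrightarrow> (\<forall>s\<in>{p+1..m}. \<xi> s x = 0)"
  unfolding rd_def by (simp add: sum_nonneg_eq_0_iff)

text \<open>Polar coordinates. At radius 0 any direction is admissible, and \<omega>0 is
  taken.\<close>

lemma X_direction: "\<exists>\<omega>\<in>S. X x = rd x *\<^sub>R \<omega>"
proof (cases "rd x = 0")
  case True
  then have "X x = 0" unfolding X_def rd_0_iff by (intro sum.neutral) simp
  then show ?thesis using \<omega>0_S True by auto
next
  case False
  define \<omega> where "\<omega> = (\<Sum>s\<in>{p+1..m}. (\<xi> s x / rd x) *\<^sub>R v s)"
  have "(\<Sum>s\<in>{p+1..m}. (\<xi> s x / rd x)\<^sup>2) = (\<Sum>s\<in>{p+1..m}. (\<xi> s x)\<^sup>2) / (rd x)\<^sup>2"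
    by (simp add: power_divide sum_divide_distrib)
  also have "\<dots> = 1" using False unfolding rd_sq[symmetric] by simp
  finally have "\<omega> \<in> S" unfolding S_def sphereS_def \<omega>_def mem_Collect_eq
    by (intro exI[of _ "\<lambda>s. \<xi> s x / rd x"] conjI refl)
  moreover have "X x = rd x *\<^sub>R \<omega>"
    using False by (simp add: X_def \<omega>_def scaleR_sum_right)
  ultimately show ?thesis by blast
qed

lemma A_B: "x \<in> Mspace v m \<Longrightarrow> X x = rd x *\<^sub>R \<omega> \<Longrightarrow> A \<omega> (B x) = x"
  using M_split[of x] by (simp add: A_def B_b B_e)

lemma B_in_U: "x \<in> \<Omega> \<Longrightarrow> B x \<in> U"
  using X_direction[of x] A_B in_U \<Omega>_sub by (metis subsetD)

lemma X_X: "mul (X x) (mul (X x) z) = - ((rd x)\<^sup>2 *\<^sub>R z)"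
proof -
  obtain \<omega> where \<omega>: "\<omega> \<in> S" "X x = rd x *\<^sub>R \<omega>" using X_direction by blast
  then show ?thesis by (simp add: mul.scaleR_left mul.scaleR_right S_sq power2_eq_square)
qed

lemma v_X: "s \<le> p \<Longrightarrow> mul (v s) (mul (X x) z) = mul (X x) (cl (ws \<omega>0) (b s) z)"
proof -
  assume s: "s \<le> p"
  obtain \<omega> where \<omega>: "\<omega> \<in> S" "X x = rd x *\<^sub>R \<omega>" using X_direction by blast
  then show ?thesis using cl_anticommute[OF \<omega>(1) s] by (simp add: mul.scaleR_left mul.scaleR_right)
qed

lemma f_eq: "x \<in> \<Omega> \<Longrightarrow> f x = ax.H1 0 (B x) + mul (X x) (ax.H2 0 (B x))"
proof -
  assume x: "x \<in> \<Omega>"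
  obtain \<omega> where \<omega>: "\<omega> \<in> S" "X x = rd x *\<^sub>R \<omega>" using X_direction by blast
  have "f (A \<omega> (B x)) = F1 (B x) + mul \<omega> (F2 (B x))"
    by (rule representation_formula[OF \<omega>(1) B_in_U[OF x]])
  moreover have "A \<omega> (B x) = x" using A_B \<omega> x \<Omega>_sub by blast
  moreover have "F2 (B x) = rd x *\<^sub>R ax.H2 0 (B x)" using ax.H2_0[OF B_in_U[OF x]] by (simp add: B_e)
  ultimately show ?thesis using \<omega> by (simp add: ax.H1_0 mul.scaleR_left mul.scaleR_right)
qed

lemma line_\<Omega>: "x \<in> \<Omega> \<Longrightarrow> s \<le> m \<Longrightarrow> \<forall>\<^sub>F t in nhds 0. x + t *\<^sub>R v s \<in> \<Omega>"
proof -
  assume x: "x \<in> \<Omega>" and s: "s \<le> m"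
  obtain W where W: "open W" "\<Omega> = Mspace v m \<inter> W" using \<Omega>_open openin_open by metis
  have M: "x + t *\<^sub>R v s \<in> Mspace v m" for t
    using x \<Omega>_sub v_M[OF s] unfolding Mspace_def by (intro span_add span_scale) auto
  have "x \<in> W" using x W by blast
  from eventually_line[OF W(1) this] show ?thesis
    by eventually_elim (use M W(2) in blast)
qed

lemma \<xi>_line: "s \<le> m \<Longrightarrow> t \<le> m \<Longrightarrow> \<xi> t (x + c *\<^sub>R v s) = \<xi> t x + (if t = s then c else 0)"
  by (simp add: \<xi>_lin \<xi>_v)

lemma B_line_low: "s \<le> p \<Longrightarrow> B (x + t *\<^sub>R v s) = B x + t *\<^sub>R b s"
proof -
  assume s: "s \<le> p"
  have "rd (x + t *\<^sub>R v s) = rd x"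
    unfolding rd_def using s pm by (intro arg_cong[where f = sqrt] sum.cong) (auto simp: \<xi>_line)
  moreover have "(\<Sum>r\<le>p. \<xi> r (x + t *\<^sub>R v s) *\<^sub>R b r) = (\<Sum>r\<le>p. \<xi> r x *\<^sub>R b r + (if r = s then t *\<^sub>R b s else 0))"
    using s pm by (intro sum.cong) (auto simp: \<xi>_line algebra_simps)
  ultimately show ?thesis using s by (simp add: B_def sum.distrib)
qed

lemma has_dd_B_low:
  "s \<le> p \<Longrightarrow> has_dd (b s) K d (B x) \<Longrightarrow> has_dd (v s) (\<lambda>x. K (B x)) d x"
  by (simp add: has_dd_def B_line_low)

lemma rd_line_high:
  "s \<in> {p+1..m} \<Longrightarrow> rd (x + t *\<^sub>R v s) = sqrt ((rd x)\<^sup>2 + 2 * t * \<xi> s x + t\<^sup>2)"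
proof -
  assume s: "s \<in> {p+1..m}"
  have "(\<Sum>r\<in>{p+1..m}. (\<xi> r (x + t *\<^sub>R v s))\<^sup>2)
      = (\<Sum>r\<in>{p+1..m}. (\<xi> r x)\<^sup>2 + (if r = s then 2 * t * \<xi> s x + t\<^sup>2 else 0))"
    using s by (intro sum.cong) (auto simp: \<xi>_line power2_sum algebra_simps)
  also have "\<dots> = (rd x)\<^sup>2 + (2 * t * \<xi> s x + t\<^sup>2)" using s by (simp add: sum.distrib rd_sq)
  finally show ?thesis by (simp add: rd_def add.assoc)
qed

lemma B_line_high:
  "s \<in> {p+1..m} \<Longrightarrow> B (x + t *\<^sub>R v s) = B x + (sqrt ((rd x)\<^sup>2 + 2 * t * \<xi> s x + t\<^sup>2) - rd x) *\<^sub>R e"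
proof -
  assume s: "s \<in> {p+1..m}"
  have "(\<Sum>r\<le>p. \<xi> r (x + t *\<^sub>R v s) *\<^sub>R b r) = (\<Sum>r\<le>p. \<xi> r x *\<^sub>R b r)"
    using s pm by (intro sum.cong) (auto simp: \<xi>_line)
  then show ?thesis using rd_line_high[OF s] by (simp add: B_def algebra_simps)
qed

text \<open>For r > 0 the radius has derivative \<xi> s x / r along v_s, and the factor r in the
  derivative of \<open>K\<close> cancels the denominator. At r = 0 the model point moves by |t| e,
  and evenness of \<open>K\<close> replaces |t| by t.\<close>

lemma has_dd_B_high:
  assumes s: "s \<in> {p+1..m}" and x: "x \<in> \<Omega>" and even: "sym.evenf K"
    and d: "has_dd e K ((B x \<bullet> e) *\<^sub>R d) (B x)"
  shows "has_dd (v s) (\<lambda>x. K (B x)) (\<xi> s x *\<^sub>R d) x"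
proof (cases "rd x = 0")
  case False
  define \<phi> where "\<phi> t = sqrt ((rd x)\<^sup>2 + 2 * t * \<xi> s x + t\<^sup>2) - rd x" for t
  have r: "(rd x)\<^sup>2 > 0" using False by simp
  have "(\<phi> has_real_derivative (2 * \<xi> s x) / (2 * sqrt ((rd x)\<^sup>2))) (at 0)"
    unfolding \<phi>_def using r by (auto intro!: derivative_eq_intros simp: field_simps)
  then have 1: "(\<phi> has_vector_derivative \<xi> s x / rd x) (at 0)"
    using rd_nonneg[of x] by (simp add: has_real_derivative_iff_has_vector_derivative)
  have "\<phi> 0 = 0" using rd_nonneg[of x] by (simp add: \<phi>_def)
  then have 2: "((\<lambda>t. K (B x + t *\<^sub>R e)) has_vector_derivative rd x *\<^sub>R d) (at (\<phi> 0))"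
    using d by (simp add: has_dd_def B_e)
  have "((\<lambda>t. K (B x + \<phi> t *\<^sub>R e)) has_vector_derivative (\<xi> s x / rd x) *\<^sub>R (rd x *\<^sub>R d)) (at 0)"
    using vector_diff_chain_at[OF 1 2] by (simp add: o_def)
  then show ?thesis using False by (simp add: has_dd_def B_line_high[OF s] \<phi>_def)
next
  case True
  then have \<xi>0: "\<xi> s x = 0" using s by (simp add: rd_0_iff)
  have "has_dd e K 0 (B x)" using d True by (simp add: B_e)
  then have d0: "((\<lambda>t. K (B x + t *\<^sub>R e)) has_vector_derivative 0) (at 0)" by (simp add: has_dd_def)
  have ev: "\<forall>\<^sub>F t in nhds 0. K (B x + t *\<^sub>R e) = K (B (x + t *\<^sub>R v s))"
    using eventually_line[OF open_U B_in_U[OF x], of e]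
  proof eventually_elim
    case (elim t)
    have "B (x + t *\<^sub>R v s) = B x + \<bar>t\<bar> *\<^sub>R e" using True \<xi>0 by (simp add: B_line_high[OF s])
    moreover have "sym.refl (B x + t *\<^sub>R e) = B x - t *\<^sub>R e"
      using True by (simp add: sym.refl_def inner_add_left B_e algebra_simps) (simp flip: scaleR_add_left)
    ultimately show ?case using even elim by (cases "t \<ge> 0") (auto simp: sym.evenf_def)
  qed
  have "((\<lambda>t. K (B x + t *\<^sub>R e)) has_vector_derivative 0) (at 0) \<longleftrightarrow>
      ((\<lambda>t. K (B (x + t *\<^sub>R v s))) has_vector_derivative 0) (at 0)"
    by (rule has_vector_derivative_cong_ev) (use ev in auto)
  then show ?thesis using d0 \<xi>0 by (simp add: has_dd_def)
qed

lemma linear_X: "linear X"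
  by (rule linearI) (simp_all add: X_def \<xi>_lin scaleR_add_left sum.distrib scaleR_sum_right)

lemma X_v: "s \<le> m \<Longrightarrow> X (v s) = (if s \<le> p then 0 else v s)"
proof -
  assume s: "s \<le> m"
  have "X (v s) = (\<Sum>t\<in>{p+1..m}. if t = s then v s else 0)"
    unfolding X_def using s by (intro sum.cong) (auto simp: \<xi>_v)
  then show ?thesis using s by simp
qed

lemma continuous_B: "continuous_on Z B"
  unfolding B_def rd_def
  by (intro continuous_intros linear_continuous_on \<xi>_linear[unfolded linear_conv_bounded_linear])

lemma continuous_KB: "continuous_on U K \<Longrightarrow> continuous_on \<Omega> (\<lambda>x. K (B x))"
  by (rule continuous_on_compose2[OF _ continuous_B]) (auto intro: B_in_U)

lemma continuous_mul: "continuous_on Z F \<Longrightarrow> continuous_on Z G \<Longrightarrow> continuous_on Z (\<lambda>x. mul (F x) (G x))"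
  by (rule mul.continuous_on)

lemma continuous_X: "continuous_on Z X"
  by (rule linear_continuous_on[OF linear_X[unfolded linear_conv_bounded_linear]])

text \<open>The function with stem components H1_j and r H2_j; writing \<open>X x\<close> for r
  \<omega> avoids a choice of \<omega>.\<close>

definition \<Phi> :: "nat \<Rightarrow> 'a \<Rightarrow> 'a" where
  "\<Phi> j x = ax.H1 j (B x) + mul (X x) (ax.H2 j (B x))"

lemma has_dd_low:
  assumes s: "s \<le> p" and x: "x \<in> \<Omega>" and G: "smooth_on U G1" "smooth_on U G2"
  shows "has_dd (v s) (\<lambda>x. G1 (B x) + mul (X x) (G2 (B x)))
    (dd (b s) G1 (B x) + mul (X x) (dd (b s) G2 (B x))) x"
proof -
  have bs: "b s \<in> Basis" using s pm by (intro b_Basis) simp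
  have "has_dd (v s) (\<lambda>x. G1 (B x)) (dd (b s) G1 (B x)) x" "has_dd (v s) (\<lambda>x. G2 (B x)) (dd (b s) G2 (B x)) x"
    by (intro has_dd_B_low s smooth_on_has_dd[OF _ bs B_in_U[OF x]] G)+
  moreover have "has_dd (v s) X 0 x" using has_dd_linear[OF linear_X, of "v s"] X_v[of s] s pm by simp
  ultimately have "has_dd (v s) (\<lambda>x. G1 (B x) + mul (X x) (G2 (B x)))
    (dd (b s) G1 (B x) + (mul (X x) (dd (b s) G2 (B x)) + mul 0 (G2 (B x)))) x"
    by (intro has_dd_add has_dd_bilinear[OF bb])
  then show ?thesis by simp
qed

lemma has_dd_high:
  assumes s: "s \<in> {p+1..m}" and x: "x \<in> \<Omega>"
  shows "has_dd (v s) (\<Phi> j) (\<xi> s x *\<^sub>R \<Phi> (Suc j) x + mul (v s) (ax.H2 j (B x))) x"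
proof -
  have "has_dd (v s) (\<lambda>x. ax.H1 j (B x)) (\<xi> s x *\<^sub>R ax.H1 (Suc j) (B x)) x"
    "has_dd (v s) (\<lambda>x. ax.H2 j (B x)) (\<xi> s x *\<^sub>R ax.H2 (Suc j) (B x)) x"
    by (intro has_dd_B_high s x ax.even_H1 ax.even_H2 ax.has_dd_H1 ax.has_dd_H2 B_in_U)+
  moreover have "has_dd (v s) X (v s) x" using has_dd_linear[OF linear_X, of "v s"] X_v[of s] s by simp
  ultimately have "has_dd (v s) (\<lambda>x. ax.H1 j (B x) + mul (X x) (ax.H2 j (B x)))
    (\<xi> s x *\<^sub>R ax.H1 (Suc j) (B x) +
     (mul (X x) (\<xi> s x *\<^sub>R ax.H2 (Suc j) (B x)) + mul (v s) (ax.H2 j (B x)))) x"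
    by (intro has_dd_add has_dd_bilinear[OF bb])
  then show ?thesis by (simp add: \<Phi>_def[abs_def] mul.scaleR_right algebra_simps)
qed

lemma has_dd_high_H2:
  assumes s: "s \<in> {p+1..m}" and x: "x \<in> \<Omega>"
  shows "has_dd (v s) (\<lambda>x. mul (v s) (ax.H2 j (B x))) (mul (v s) (\<xi> s x *\<^sub>R ax.H2 (Suc j) (B x))) x"
  by (intro has_dd_bounded_linear[OF linear_mul] has_dd_B_high s x ax.even_H2 ax.has_dd_H2 B_in_U)

text \<open>Closed forms of the first and second derivatives of \<open>\<Phi> j\<close> along \<open>v s\<close>; they contain no division by \<open>r\<close>,
  hence stay valid on \<open>r = 0\<close>.\<close>

definition \<Phi>1 :: "nat \<Rightarrow> nat \<Rightarrow> 'a \<Rightarrow> 'a" where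
  "\<Phi>1 j s x = (if s \<le> p then dd (b s) (ax.H1 j) (B x) + mul (X x) (dd (b s) (ax.H2 j) (B x))
     else \<xi> s x *\<^sub>R \<Phi> (Suc j) x + mul (v s) (ax.H2 j (B x)))"

definition \<Phi>2 :: "nat \<Rightarrow> nat \<Rightarrow> 'a \<Rightarrow> 'a" where
  "\<Phi>2 j s x = (if s \<le> p then dd (b s) (dd (b s) (ax.H1 j)) (B x) + mul (X x) (dd (b s) (dd (b s) (ax.H2 j)) (B x))
     else (\<xi> s x)\<^sup>2 *\<^sub>R \<Phi> (Suc (Suc j)) x + 2 *\<^sub>R mul (\<xi> s x *\<^sub>R v s) (ax.H2 (Suc j) (B x)) + \<Phi> (Suc j) x)"

lemma has_dd_\<Phi>: "x \<in> \<Omega> \<Longrightarrow> s \<le> m \<Longrightarrow> has_dd (v s) (\<Phi> j) (\<Phi>1 j s x) x"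
  using has_dd_low[of s x "ax.H1 j" "ax.H2 j"] has_dd_high[of s x j] ax.smooth_H1 ax.smooth_H2
  by (cases "s \<le> p") (auto simp: \<Phi>1_def \<Phi>_def[abs_def])

lemma has_dd_\<Phi>1: "x \<in> \<Omega> \<Longrightarrow> s \<le> m \<Longrightarrow> has_dd (v s) (\<Phi>1 j s) (\<Phi>2 j s x) x"
proof (cases "s \<le> p")
  case True
  assume x: "x \<in> \<Omega>"
  have bs: "b s \<in> Basis" using True pm by (intro b_Basis) simp
  from has_dd_low[OF True x smooth_on_dd[OF ax.smooth_H1 bs] smooth_on_dd[OF ax.smooth_H2 bs]]
  show ?thesis using True by (simp add: \<Phi>1_def[abs_def] \<Phi>2_def)
next
  case False
  assume x: "x \<in> \<Omega>" and sm: "s \<le> m"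
  then have s: "s \<in> {p+1..m}" using False by simp
  have "has_dd (v s) (\<xi> s) 1 x" using has_dd_linear[OF \<xi>_linear[of s], of "v s" x] \<xi>_v[of s s] sm by simp
  from has_dd_add[OF has_dd_scaleR[OF this has_dd_high[OF s x, of "Suc j"]] has_dd_high_H2[OF s x, of j]]
  have "has_dd (v s) (\<Phi>1 j s) (\<xi> s x *\<^sub>R (\<xi> s x *\<^sub>R \<Phi> (Suc (Suc j)) x + mul (v s) (ax.H2 (Suc j) (B x)))
      + 1 *\<^sub>R \<Phi> (Suc j) x + mul (v s) (\<xi> s x *\<^sub>R ax.H2 (Suc j) (B x))) x"
    using False by (simp add: \<Phi>1_def[abs_def])
  also have "\<xi> s x *\<^sub>R (\<xi> s x *\<^sub>R \<Phi> (Suc (Suc j)) x + mul (v s) (ax.H2 (Suc j) (B x)))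
      + 1 *\<^sub>R \<Phi> (Suc j) x + mul (v s) (\<xi> s x *\<^sub>R ax.H2 (Suc j) (B x))
    = (\<xi> s x)\<^sup>2 *\<^sub>R \<Phi> (Suc (Suc j)) x + (mul (\<xi> s x *\<^sub>R v s) (ax.H2 (Suc j) (B x))
      + mul (\<xi> s x *\<^sub>R v s) (ax.H2 (Suc j) (B x))) + \<Phi> (Suc j) x"
    by (simp add: mul.scaleR_right mul.scaleR_left power2_eq_square algebra_simps)
  also have "\<dots> = \<Phi>2 j s x" using False unfolding \<Phi>2_def scaleR_2[symmetric] by simp
  finally show ?thesis .
qed

lemma sum_split: "(\<Sum>s\<le>m. h s) = (\<Sum>s\<le>p. h s) + (\<Sum>s\<in>{p+1..m}. h s)" for h :: "nat \<Rightarrow> 'b::comm_monoid_add"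
proof -
  have "{..m} = {..p} \<union> {p+1..m}" using pm by auto
  then show ?thesis by (simp add: sum.union_disjoint ivl_disj_int)
qed

lemma lap_Hsum:
  assumes "x \<in> \<Omega>"
  shows "(\<Sum>s\<le>p. dd (b s) (dd (b s) (ax.H1 j)) (B x)) =
      - (real (2 * j + 1) *\<^sub>R ax.H1 (Suc j) (B x) + (rd x)\<^sup>2 *\<^sub>R ax.H1 (Suc (Suc j)) (B x))"
    "(\<Sum>s\<le>p. dd (b s) (dd (b s) (ax.H2 j)) (B x)) =
      - (real (2 * j + 3) *\<^sub>R ax.H2 (Suc j) (B x) + (rd x)\<^sup>2 *\<^sub>R ax.H2 (Suc (Suc j)) (B x))"
  using ax.lap_H1[OF B_in_U[OF assms], of j] ax.lap_H2[OF B_in_U[OF assms], of j]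
  by (simp_all add: sum_Pb B_e)

text \<open>The first p + 1 directions give -(2j + 1) \<Phi>_(j+1) - 2 X H2_(j+1) - r^2
  \<Phi>_(j+2), the -2 stemming from the coefficient 2j + 3 in \<open>lap_H2\<close>. The other q
  directions give r^2 \<Phi>_(j+2) + 2 X H2_(j+1) + q \<Phi>_(j+1).\<close>

lemma sum_\<Phi>2:
  assumes x: "x \<in> \<Omega>"
  shows "(\<Sum>s\<le>m. \<Phi>2 j s x) = (real q - 1 - 2 * real j) *\<^sub>R \<Phi> (Suc j) x"
proof -
  have "(\<Sum>s\<le>p. \<Phi>2 j s x) = (\<Sum>s\<le>p. dd (b s) (dd (b s) (ax.H1 j)) (B x))
      + mul (X x) (\<Sum>s\<le>p. dd (b s) (dd (b s) (ax.H2 j)) (B x))"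
    unfolding mul.sum_right sum.distrib[symmetric] by (intro sum.cong) (auto simp: \<Phi>2_def)
  also have "\<dots> = - (real (2 * j + 1) *\<^sub>R \<Phi> (Suc j) x) - 2 *\<^sub>R mul (X x) (ax.H2 (Suc j) (B x))
      - (rd x)\<^sup>2 *\<^sub>R \<Phi> (Suc (Suc j)) x"
    unfolding lap_Hsum[OF x] \<Phi>_def
    using scaleR_left_distrib[of 1 2 "mul (X x) (ax.H2 (Suc j) (B x))"]
    by (simp add: mul.minus_right mul.diff_right mul.add_right mul.scaleR_right algebra_simps)
  finally have low: "(\<Sum>s\<le>p. \<Phi>2 j s x) = \<dots>" .
  have "(\<Sum>s\<in>{p+1..m}. \<Phi>2 j s x) = (\<Sum>s\<in>{p+1..m}. (\<xi> s x)\<^sup>2 *\<^sub>R \<Phi> (Suc (Suc j)) x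
      + 2 *\<^sub>R mul (\<xi> s x *\<^sub>R v s) (ax.H2 (Suc j) (B x)) + \<Phi> (Suc j) x)"
    by (intro sum.cong) (auto simp: \<Phi>2_def)
  also have "\<dots> = (\<Sum>s\<in>{p+1..m}. (\<xi> s x)\<^sup>2) *\<^sub>R \<Phi> (Suc (Suc j)) x
      + 2 *\<^sub>R mul (X x) (ax.H2 (Suc j) (B x)) + real q *\<^sub>R \<Phi> (Suc j) x"
    using pm q by (simp add: sum.distrib scaleR_sum_left scaleR_sum_right mul.sum_left X_def sum_constant_scaleR)
  finally have high: "(\<Sum>s\<in>{p+1..m}. \<Phi>2 j s x) = \<dots>" .
  show ?thesis unfolding sum_split low high rd_sq[symmetric]
    by (simp add: algebra_simps)
qed

text \<open>For q = 2k + 1 the factors are 2k, 2k - 2, and so on: positive for i < k, and zero at i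
  = k.\<close>

definition C :: "nat \<Rightarrow> real" where "C j = (\<Prod>i<j. real q - 1 - 2 * real i)"

lemma lap_power: "x \<in> \<Omega> \<Longrightarrow> (lap v m ^^ j) f x = C j *\<^sub>R \<Phi> j x"
proof (induction j arbitrary: x)
  case 0
  then show ?case using f_eq by (simp add: C_def \<Phi>_def)
next
  case (Suc j)
  have "lap v m ((lap v m ^^ j) f) x = (\<Sum>s\<le>m. C j *\<^sub>R \<Phi>2 j s x)"
  proof (rule lap_eq_on[where Z = \<Omega> and G = "\<lambda>x. C j *\<^sub>R \<Phi> j x" and ?G1.0 = "\<lambda>s x. C j *\<^sub>R \<Phi>1 j s x"])
    show "has_dd (v s) (\<lambda>x. C j *\<^sub>R \<Phi> j x) (C j *\<^sub>R \<Phi>1 j s x) x" if "x \<in> \<Omega>" "s \<le> m" for x s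
      by (intro has_dd_cmul has_dd_\<Phi> that)
    show "has_dd (v s) (\<lambda>x. C j *\<^sub>R \<Phi>1 j s x) (C j *\<^sub>R \<Phi>2 j s x) x" if "x \<in> \<Omega>" "s \<le> m" for x s
      by (intro has_dd_cmul has_dd_\<Phi>1 that)
  qed (use line_\<Omega> Suc in auto)
  also have "\<dots> = C (Suc j) *\<^sub>R \<Phi> (Suc j) x"
    unfolding scaleR_sum_right[symmetric] sum_\<Phi>2[OF Suc.prems] by (simp add: C_def)
  finally show ?case by simp
qed

lemma smooth_H_dd:
  "s \<le> p \<Longrightarrow> continuous_on U (dd (b s) (ax.H1 j))" "s \<le> p \<Longrightarrow> continuous_on U (dd (b s) (ax.H2 j))"
  using pm by (auto intro!: smooth_on_continuous smooth_on_dd ax.smooth_H1 ax.smooth_H2 b_Basis)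

lemma continuous_\<Phi>: "continuous_on \<Omega> (\<Phi> j)"
  unfolding \<Phi>_def[abs_def]
  by (intro continuous_intros continuous_mul continuous_X continuous_KB
      smooth_on_continuous[OF ax.smooth_H1] smooth_on_continuous[OF ax.smooth_H2])

lemma continuous_\<Phi>1: "continuous_on \<Omega> (\<Phi>1 j s)"
proof (cases "s \<le> p")
  case True
  have "continuous_on \<Omega> (\<lambda>x. dd (b s) (ax.H1 j) (B x) + mul (X x) (dd (b s) (ax.H2 j) (B x)))"
    by (intro continuous_on_add continuous_mul continuous_X continuous_KB smooth_H_dd True)
  then show ?thesis using True by (simp add: \<Phi>1_def[abs_def])
next
  case False
  have "continuous_on \<Omega> (\<lambda>x. \<xi> s x *\<^sub>R \<Phi> (Suc j) x + mul (v s) (ax.H2 j (B x)))"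
    by (intro continuous_on_add continuous_on_scaleR continuous_\<Phi> bounded_linear.continuous_on[OF linear_mul]
        continuous_KB smooth_on_continuous[OF ax.smooth_H2]
        linear_continuous_on \<xi>_linear[unfolded linear_conv_bounded_linear])
  then show ?thesis using False by (simp add: \<Phi>1_def[abs_def])
qed

text \<open>The terms X H1_(j+1) and r^2 H2_(j+1) cancel for every j. What remains is (2j + 1 - q)
  H2_j, where -q comes from v_s (v_s z) = -z in q directions.\<close>

lemma dirac_\<Phi>:
  assumes x: "x \<in> \<Omega>" and j: "2 * j + 1 = q"
  shows "(\<Sum>s\<le>m. mul (v s) (\<Phi>1 j s x)) = 0"
proof -
  have U: "B x \<in> U" by (rule B_in_U[OF x])
  have "(\<Sum>s\<le>p. mul (v s) (\<Phi>1 j s x)) = (\<Sum>s\<le>p. mul (v s) (dd (b s) (ax.H1 j) (B x)))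
      + mul (X x) (\<Sum>s\<le>p. cl (ws \<omega>0) (b s) (dd (b s) (ax.H2 j) (B x)))"
    unfolding mul.sum_right sum.distrib[symmetric]
    by (intro sum.cong) (auto simp: \<Phi>1_def mul.add_right v_X)
  also have "(\<Sum>s\<le>p. mul (v s) (dd (b s) (ax.H1 j) (B x))) = ax.opD (\<lambda>\<beta>. mul (ws \<omega>0 \<beta>)) (ax.H1 j) (B x)"
    by (simp add: ax.opD_def sum_Pb ws_b)
  also have "(\<Sum>s\<le>p. cl (ws \<omega>0) (b s) (dd (b s) (ax.H2 j) (B x))) = ax.opD (cl (ws \<omega>0)) (ax.H2 j) (B x)"
    by (simp add: ax.opD_def sum_Pb)
  also have "ax.opD (\<lambda>\<beta>. mul (ws \<omega>0 \<beta>)) (ax.H1 j) (B x) + mul (X x) (ax.opD (cl (ws \<omega>0)) (ax.H2 j) (B x))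
      = real q *\<^sub>R ax.H2 j (B x) + (rd x)\<^sup>2 *\<^sub>R ax.H2 (Suc j) (B x) - mul (X x) (ax.H1 (Suc j) (B x))"
    using ax.D_H1[OF U, of j] ax.D'_H2[OF U, of j] j by (simp add: B_e mul.minus_right)
  finally have low: "(\<Sum>s\<le>p. mul (v s) (\<Phi>1 j s x)) = \<dots>" .
  have "(\<Sum>s\<in>{p+1..m}. mul (v s) (\<Phi>1 j s x))
      = (\<Sum>s\<in>{p+1..m}. mul (\<xi> s x *\<^sub>R v s) (\<Phi> (Suc j) x) - ax.H2 j (B x))"
  proof (intro sum.cong refl)
    fix s assume s: "s \<in> {p+1..m}"
    have "mul (v s) (mul (v s) (ax.H2 j (B x))) = - ax.H2 j (B x)"
      using left_alt v_sq[of s] s by (simp add: mul.minus_left)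
    then show "mul (v s) (\<Phi>1 j s x) = mul (\<xi> s x *\<^sub>R v s) (\<Phi> (Suc j) x) - ax.H2 j (B x)"
      using s by (simp add: \<Phi>1_def mul.add_right mul.scaleR_right mul.scaleR_left)
  qed
  also have "\<dots> = mul (X x) (\<Phi> (Suc j) x) - real q *\<^sub>R ax.H2 j (B x)"
    using pm q by (simp add: sum_subtractf mul.sum_left X_def sum_constant_scaleR)
  also have "mul (X x) (\<Phi> (Suc j) x) = mul (X x) (ax.H1 (Suc j) (B x)) - (rd x)\<^sup>2 *\<^sub>R ax.H2 (Suc j) (B x)"
    by (simp add: \<Phi>_def mul.add_right X_X)
  finally have high: "(\<Sum>s\<in>{p+1..m}. mul (v s) (\<Phi>1 j s x)) = \<dots> - real q *\<^sub>R ax.H2 j (B x)" .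
  show ?thesis unfolding sum_split low high by simp
qed

lemma has_dd_lap_power:
  assumes x: "x \<in> \<Omega>" and s: "s \<le> m"
  shows "has_dd (v s) ((lap v m ^^ j) f) (C j *\<^sub>R \<Phi>1 j s x) x"
proof (rule has_dd_transform[OF has_dd_cmul[OF has_dd_\<Phi>[OF x s]]])
  show "\<forall>\<^sub>F t in nhds 0. C j *\<^sub>R \<Phi> j (x + t *\<^sub>R v s) = (lap v m ^^ j) f (x + t *\<^sub>R v s)"
    using line_\<Omega>[OF x s] by eventually_elim (simp add: lap_power)
qed

lemma monogenic_lap_power:
  assumes j: "2 * j + 1 = q"
  shows "monogenic_on mul v m \<Omega> ((lap v m ^^ j) f)"
  unfolding monogenic_on_def
proof (intro conjI allI impI ballI)
  have "continuous_on \<Omega> (\<lambda>x. C j *\<^sub>R \<Phi> j x)" by (intro continuous_intros continuous_\<Phi>)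
  then show "continuous_on \<Omega> ((lap v m ^^ j) f)" using lap_power continuous_on_cong by metis
  fix s assume s: "s \<le> m"
  show "dd_exists (v s) ((lap v m ^^ j) f) y" if "y \<in> \<Omega>" for y
    by (rule has_dd_imp_exists[OF has_dd_lap_power[OF that s]])
  have "continuous_on \<Omega> (\<lambda>x. C j *\<^sub>R \<Phi>1 j s x)" by (intro continuous_intros continuous_\<Phi>1)
  then show "continuous_on \<Omega> (dd (v s) ((lap v m ^^ j) f))"
    using has_dd_imp_dd[OF has_dd_lap_power[OF _ s]] by (simp cong: continuous_on_cong)
next
  fix y assume y: "y \<in> \<Omega>"
  have "dirac mul v m ((lap v m ^^ j) f) y = (\<Sum>s\<le>m. C j *\<^sub>R mul (v s) (\<Phi>1 j s y))"
    unfolding dirac_def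
    by (intro sum.cong refl) (simp add: has_dd_imp_dd[OF has_dd_lap_power[OF y]] mul.scaleR_right)
  then show "dirac mul v m ((lap v m ^^ j) f) y = 0"
    by (simp add: scaleR_sum_right[symmetric] dirac_\<Phi>[OF y j])
qed

lemma Rp1_\<xi>: "xp \<in> Rp1 v p \<Longrightarrow> s \<in> {p+1..m} \<Longrightarrow> \<xi> s xp = 0"
proof -
  assume xp: "xp \<in> Rp1 v p" and s: "s \<in> {p+1..m}"
  have "linear (\<lambda>x::'a. 0::real)" by (rule linearI) auto
  from linear_eq_on_span[OF \<xi>_linear[of s] this _ xp[unfolded Rp1_def]]
  show ?thesis using s by (fastforce simp: \<xi>_v)
qed

lemma slice_coords:
  assumes xp: "xp \<in> Rp1 v p" and \<omega>: "\<omega> \<in> S"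
  shows "B (xp + r *\<^sub>R \<omega>) = B xp + \<bar>r\<bar> *\<^sub>R e" "X (xp + r *\<^sub>R \<omega>) = r *\<^sub>R \<omega>" "rd xp = 0" "X xp = 0"
    "rd (xp + r *\<^sub>R \<omega>) = \<bar>r\<bar>"
proof -
  obtain c where c: "\<omega> = (\<Sum>t\<in>{p+1..m}. c t *\<^sub>R v t)" "(\<Sum>t\<in>{p+1..m}. (c t)\<^sup>2) = 1"
    using S_repr[OF \<omega>] by metis
  have \<xi>\<omega>: "\<xi> s \<omega> = (if s \<le> p then 0 else c s)" if "s \<le> m" for s
    using \<xi>_sum[OF that, of "{p+1..m}" c] that by (auto simp: c(1))
  have high: "\<xi> s (xp + r *\<^sub>R \<omega>) = r * c s" if "s \<in> {p+1..m}" for s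
    using Rp1_\<xi>[OF xp that] that by (simp add: \<xi>_lin \<xi>\<omega>)
  show X0: "X xp = 0" unfolding X_def using Rp1_\<xi>[OF xp] by (intro sum.neutral) simp
  show rd0: "rd xp = 0" using Rp1_\<xi>[OF xp] by (simp add: rd_0_iff)
  have "X \<omega> = \<omega>" unfolding X_def by (subst (2) c(1)) (intro sum.cong, auto simp: \<xi>\<omega>)
  then show "X (xp + r *\<^sub>R \<omega>) = r *\<^sub>R \<omega>"
    using X0 linear_add[OF linear_X] linear_scale[OF linear_X] by simp
  have "(\<Sum>s\<in>{p+1..m}. (\<xi> s (xp + r *\<^sub>R \<omega>))\<^sup>2) = (\<Sum>s\<in>{p+1..m}. r\<^sup>2 * (c s)\<^sup>2)"
    by (intro sum.cong) (auto simp: high power_mult_distrib)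
  also have "\<dots> = r\<^sup>2" using c(2) by (simp add: sum_distrib_left[symmetric])
  finally show rdr: "rd (xp + r *\<^sub>R \<omega>) = \<bar>r\<bar>" by (simp add: rd_def)
  have "(\<Sum>s\<le>p. \<xi> s (xp + r *\<^sub>R \<omega>) *\<^sub>R b s) = (\<Sum>s\<le>p. \<xi> s xp *\<^sub>R b s)"
    using pm by (intro sum.cong) (auto simp: \<xi>_lin \<xi>\<omega>)
  then show "B (xp + r *\<^sub>R \<omega>) = B xp + \<bar>r\<bar> *\<^sub>R e" using rdr rd0 by (simp add: B_def)
qed

lemma gps_function_lap_power: "gps_function mul v p m \<Omega> ((lap v m ^^ j) f)"
  unfolding gps_function_def
proof (intro exI conjI allI ballI impI)
  \<comment> \<open>The absolute value makes the parities hold for all xp and r, also for arguments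
    outside \<Omega>.\<close>
  let ?F1 = "\<lambda>xp r. C j *\<^sub>R ax.H1 j (B xp + \<bar>r\<bar> *\<^sub>R e)"
  let ?F2 = "\<lambda>xp r. r *\<^sub>R C j *\<^sub>R ax.H2 j (B xp + \<bar>r\<bar> *\<^sub>R e)"
  show "?F1 xp (- r) = ?F1 xp r" "?F2 xp (- r) = - ?F2 xp r" for xp r by simp_all
  fix xp r \<omega> assume xp: "xp \<in> Rp1 v p" and \<omega>: "\<omega> \<in> sphereS v p m" and x: "xp + r *\<^sub>R \<omega> \<in> \<Omega>"
  show "(lap v m ^^ j) f (xp + r *\<^sub>R \<omega>) = ?F1 xp r + mul \<omega> (?F2 xp r)"
    using slice_coords(1,2)[OF xp \<omega>[folded S_def], of r]
    by (simp add: lap_power[OF x] \<Phi>_def mul.scaleR_left mul.scaleR_right algebra_simps)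
qed

section \<open>Restriction to the points of radius 0\<close>

definition Z :: "'a set" where "Z = \<Omega> \<inter> Rp1 v p"

lemma line_Z: "x \<in> Z \<Longrightarrow> s \<le> p \<Longrightarrow> \<forall>\<^sub>F t in nhds 0. x + t *\<^sub>R v s \<in> Z"
proof -
  assume x: "x \<in> Z" and s: "s \<le> p"
  have "x + t *\<^sub>R v s \<in> Rp1 v p" for t
    using x s unfolding Z_def Rp1_def by (intro span_add span_scale) (auto intro: span_base)
  then show ?thesis using line_\<Omega>[of x s] x s pm by (simp add: Z_def)
qed

lemma Z_coords: "x \<in> Z \<Longrightarrow> rd x = 0" "x \<in> Z \<Longrightarrow> X x = 0" "x \<in> Z \<Longrightarrow> x \<in> \<Omega>"
  using slice_coords(3,4)[OF _ \<omega>0_S] by (auto simp: Z_def)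

lemma has_dd_Z:
  assumes "smooth_on U G" "x \<in> Z" "s \<le> p"
  shows "has_dd (v s) (\<lambda>x. c *\<^sub>R G (B x)) (c *\<^sub>R dd (b s) G (B x)) x"
  using assms pm Z_coords(3)
  by (intro has_dd_cmul has_dd_B_low smooth_on_has_dd[OF assms(1)] b_Basis B_in_U) auto

lemma lap_Z:
  assumes F: "\<And>x. x \<in> Z \<Longrightarrow> F x = c *\<^sub>R G (B x)" and G: "smooth_on U G" and x: "x \<in> Z"
  shows "lap v p F x = c *\<^sub>R (\<Sum>s\<le>p. dd (b s) (dd (b s) G) (B x))"
proof -
  have "lap v p F x = (\<Sum>s\<le>p. c *\<^sub>R dd (b s) (dd (b s) G) (B x))"
  proof (rule lap_eq_on[where Z = Z and G = "\<lambda>x. c *\<^sub>R G (B x)" and ?G1.0 = "\<lambda>s x. c *\<^sub>R dd (b s) G (B x)"])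
    show "has_dd (v s) (\<lambda>x. c *\<^sub>R dd (b s) G (B x)) (c *\<^sub>R dd (b s) (dd (b s) G) (B x)) x"
      if "x \<in> Z" "s \<le> p" for x s
      using that pm by (intro has_dd_Z smooth_on_dd G b_Basis) auto
  qed (use line_Z F has_dd_Z[OF G] x in auto)
  then show ?thesis by (simp add: scaleR_sum_right)
qed

text \<open>At radius 0 the r^2 terms drop out, so each application of \<open>lap v p\<close> raises
  the index by one and contributes a negative odd factor.\<close>

lemma lap_power_Z1:
  assumes F: "\<And>x. x \<in> Z \<Longrightarrow> F x = c *\<^sub>R ax.H1 k (B x)"
  shows "x \<in> Z \<Longrightarrow> (lap v p ^^ i) F x = (c * (\<Prod>l<i. - real (2 * (k + l) + 1))) *\<^sub>R ax.H1 (k + i) (B x)"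
proof (induction i arbitrary: x)
  case (Suc i)
  have "lap v p ((lap v p ^^ i) F) x = (c * (\<Prod>l<i. - real (2 * (k + l) + 1))) *\<^sub>R
      (\<Sum>s\<le>p. dd (b s) (dd (b s) (ax.H1 (k + i))) (B x))"
    by (rule lap_Z[OF Suc.IH ax.smooth_H1 Suc.prems])
  also have "\<dots> = (c * (\<Prod>l<i. - real (2 * (k + l) + 1))) *\<^sub>R (- real (2 * (k + i) + 1) *\<^sub>R ax.H1 (Suc (k + i)) (B x))"
    unfolding lap_Hsum(1)[OF Z_coords(3)[OF Suc.prems]] Z_coords(1)[OF Suc.prems]
    by (simp del: of_nat_add of_nat_mult of_nat_Suc)
  finally show ?case
    by (simp only: funpow.simps o_apply prod.lessThan_Suc scaleR_scaleR mult.assoc add_Suc_right)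
qed (use F in simp)

lemma lap_power_Z2:
  assumes F: "\<And>x. x \<in> Z \<Longrightarrow> F x = c *\<^sub>R ax.H2 k (B x)"
  shows "x \<in> Z \<Longrightarrow> (lap v p ^^ i) F x = (c * (\<Prod>l<i. - real (2 * (k + l) + 3))) *\<^sub>R ax.H2 (k + i) (B x)"
proof (induction i arbitrary: x)
  case (Suc i)
  have "lap v p ((lap v p ^^ i) F) x = (c * (\<Prod>l<i. - real (2 * (k + l) + 3))) *\<^sub>R
      (\<Sum>s\<le>p. dd (b s) (dd (b s) (ax.H2 (k + i))) (B x))"
    by (rule lap_Z[OF Suc.IH ax.smooth_H2 Suc.prems])
  also have "\<dots> = (c * (\<Prod>l<i. - real (2 * (k + l) + 3))) *\<^sub>R (- real (2 * (k + i) + 3) *\<^sub>R ax.H2 (Suc (k + i)) (B x))"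
    unfolding lap_Hsum(2)[OF Z_coords(3)[OF Suc.prems]] Z_coords(1)[OF Suc.prems]
    by (simp del: of_nat_add of_nat_mult of_nat_Suc)
  finally show ?case
    by (simp only: funpow.simps o_apply prod.lessThan_Suc scaleR_scaleR mult.assoc add_Suc_right)
qed (use F in simp)

text \<open>\<open>D_H1\<close> at radius 0. Its factor 2k + 1 will match the shifted Gamma function
  in the second series.\<close>

lemma dirac_Z:
  assumes F: "\<And>x. x \<in> Z \<Longrightarrow> F x = c *\<^sub>R ax.H1 k (B x)" and x: "x \<in> Z"
  shows "dirac mul v p F x = (c * real (2 * k + 1)) *\<^sub>R ax.H2 k (B x)"
proof -
  have "dd (v s) F x = c *\<^sub>R dd (b s) (ax.H1 k) (B x)" if s: "s \<le> p" for s
  proof (rule has_dd_imp_dd, rule has_dd_transform[OF has_dd_Z[OF ax.smooth_H1 x s]])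
    show "\<forall>\<^sub>F t in nhds 0. c *\<^sub>R ax.H1 k (B (x + t *\<^sub>R v s)) = F (x + t *\<^sub>R v s)"
      using line_Z[OF x s] by eventually_elim (simp add: F)
  qed
  then have "dirac mul v p F x = c *\<^sub>R (\<Sum>s\<le>p. mul (v s) (dd (b s) (ax.H1 k) (B x)))"
    unfolding dirac_def scaleR_sum_right by (intro sum.cong) (auto simp: mul.scaleR_right)
  also have "(\<Sum>s\<le>p. mul (v s) (dd (b s) (ax.H1 k) (B x))) = ax.opD (\<lambda>\<beta>. mul (ws \<omega>0 \<beta>)) (ax.H1 k) (B x)"
    by (simp add: ax.opD_def sum_Pb ws_b)
  also have "\<dots> = real (2 * k + 1) *\<^sub>R ax.H2 k (B x)"
    using ax.D_H1[OF B_in_U[OF Z_coords(3)[OF x]], of k] Z_coords(1)[OF x] by (simp add: B_e)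
  finally show ?thesis by simp
qed

end

section \<open>Power series and the generalized CK coefficients\<close>

text \<open>Abel's limit theorem. Summation by parts with the tails \<open>R n\<close> extracts a
  factor 1 - u; finitely many tails are then negligible near u = 1, and the others contribute at
  most \<epsilon>/2.\<close>

lemma Abel_sum:
  fixes a :: "nat \<Rightarrow> real"
  assumes a: "summable a"
  shows "((\<lambda>u. \<Sum>n. a n * u ^ n) \<longlongrightarrow> suminf a) (at_left 1)"
proof -
  define R where "R n = (\<Sum>i. a (i + n))" for n
  have R0: "R 0 = suminf a" by (simp add: R_def)
  have aR: "a n = R n - R (Suc n)" for n
    using suminf_split_head[of "\<lambda>i. a (i + n)"] summable_ignore_initial_segment[OF a, of n]
    by (simp add: R_def)
  have Rlim: "R \<longlonglongrightarrow> 0"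
  proof -
    have "R = (\<lambda>n. suminf a - sum a {..<n})"
      using suminf_minus_initial_segment[OF a] by (simp add: R_def fun_eq_iff)
    moreover have "(\<lambda>n. suminf a - sum a {..<n}) \<longlonglongrightarrow> suminf a - suminf a"
      by (intro tendsto_intros summable_LIMSEQ[OF a])
    ultimately show ?thesis by simp
  qed
  have "Bseq R" using Rlim by (intro convergent_imp_Bseq) (auto simp: convergent_def)
  then obtain K where K: "\<And>n. \<bar>R n\<bar> \<le> K" unfolding Bseq_def by auto
  have key: "(\<Sum>n. a n * u ^ n) = suminf a - (1 - u) * (\<Sum>n. R (Suc n) * u ^ n)"
    and sR: "summable (\<lambda>n. R (Suc n) * u ^ n)" if u: "0 < u" "u < 1" for u
  proof -
    have s: "summable (\<lambda>n. R (n + l) * u ^ n)" for l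
    proof (rule summable_comparison_test')
      show "summable (\<lambda>n. K * u ^ n)" using u by (intro summable_mult summable_geometric) simp
      show "norm (R (n + l) * u ^ n) \<le> K * u ^ n" if "n \<ge> 0" for n
        using K[of "n + l"] u by (simp add: abs_mult mult_right_mono)
    qed
    show s1: "summable (\<lambda>n. R (Suc n) * u ^ n)" using s[of 1] by simp
    have s0: "summable (\<lambda>n. R n * u ^ n)" using s[of 0] by simp
    have "(\<Sum>n. R n * u ^ n) = R 0 + (\<Sum>n. R (Suc n) * u ^ Suc n)"
      using suminf_split_head[OF s0] by simp
    also have "(\<Sum>n. R (Suc n) * u ^ Suc n) = u * (\<Sum>n. R (Suc n) * u ^ n)"
      using suminf_mult[OF s1, of u] by (simp add: mult_ac)
    finally have "(\<Sum>n. R n * u ^ n) = R 0 + u * (\<Sum>n. R (Suc n) * u ^ n)" .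
    moreover have "(\<Sum>n. a n * u ^ n) = (\<Sum>n. R n * u ^ n) - (\<Sum>n. R (Suc n) * u ^ n)"
      unfolding suminf_diff[OF s0 s1] by (simp add: aR left_diff_distrib)
    ultimately show "(\<Sum>n. a n * u ^ n) = suminf a - (1 - u) * (\<Sum>n. R (Suc n) * u ^ n)"
      by (simp add: R0 algebra_simps)
  qed
  show ?thesis
  proof (rule tendstoI)
    fix \<epsilon> :: real assume \<epsilon>: "\<epsilon> > 0"
    obtain N where N: "\<And>n. n \<ge> N \<Longrightarrow> \<bar>R n\<bar> < \<epsilon>/2"
      using LIMSEQ_D[OF Rlim, of "\<epsilon>/2"] \<epsilon> by auto
    define M where "M = (\<Sum>n<N. \<bar>R (Suc n)\<bar>)"
    have M: "M \<ge> 0" by (simp add: M_def sum_nonneg)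
    have bound: "\<bar>(\<Sum>n. a n * u ^ n) - suminf a\<bar> \<le> (1 - u) * M + \<epsilon>/2" if u: "0 < u" "u < 1" for u
    proof -
      have geo: "(\<lambda>n. u ^ n) sums (1 / (1 - u))" using u by (intro geometric_sums) simp
      have fin: "(\<lambda>n. if n < N then \<bar>R (Suc n)\<bar> else 0) sums M"
        unfolding M_def using sums_If_finite_set[of "{..<N}" "\<lambda>n. \<bar>R (Suc n)\<bar>"] by simp
      have tot: "(\<lambda>n. (if n < N then \<bar>R (Suc n)\<bar> else 0) + \<epsilon>/2 * u ^ n) sums (M + \<epsilon>/2 * (1 / (1 - u)))"
        by (intro sums_add fin sums_mult geo)
      have "norm (\<Sum>n. R (Suc n) * u ^ n) \<le> M + \<epsilon>/2 * (1 / (1 - u))"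
      proof (rule order_trans[OF norm_suminf_le[OF _ sums_summable[OF tot]]])
        fix n
        have un: "0 \<le> u ^ n" "u ^ n \<le> 1" using u by (simp_all add: power_le_one)
        show "norm (R (Suc n) * u ^ n) \<le> (if n < N then \<bar>R (Suc n)\<bar> else 0) + \<epsilon>/2 * u ^ n"
        proof (cases "n < N")
          case True
          have "\<bar>R (Suc n)\<bar> * u ^ n \<le> \<bar>R (Suc n)\<bar> * 1" using un by (intro mult_left_mono) auto
          moreover have "0 \<le> \<epsilon>/2 * u ^ n" using \<epsilon> un by simp
          ultimately show ?thesis using True un by (simp add: abs_mult)
        next
          case False
          then have "\<bar>R (Suc n)\<bar> * u ^ n \<le> \<epsilon>/2 * u ^ n" using N[of "Suc n"] un by (intro mult_right_mono) auto
          then show ?thesis using False un by (simp add: abs_mult)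
        qed
      qed (use sums_unique[OF tot] in simp)
      then have "(1 - u) * \<bar>\<Sum>n. R (Suc n) * u ^ n\<bar> \<le> (1 - u) * (M + \<epsilon>/2 * (1 / (1 - u)))"
        using u by (intro mult_left_mono) auto
      also have "\<dots> = (1 - u) * M + \<epsilon>/2" using u by (simp add: field_simps)
      finally show ?thesis unfolding key[OF u] using u by (simp add: abs_mult)
    qed
    have "\<forall>\<^sub>F u in at_left 1. 1 - \<epsilon> / (2 * (M + 1)) < u"
      using \<epsilon> M by (intro eventually_at_left_real[THEN eventually_mono]) auto
    moreover have "\<forall>\<^sub>F u in at_left 1. u \<in> {0<..<1::real}"
      by (rule eventually_at_left_real) simp
    ultimately show "\<forall>\<^sub>F u in at_left 1. dist (\<Sum>n. a n * u ^ n) (suminf a) < \<epsilon>"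
    proof eventually_elim
      case (elim u)
      have "(1 - u) * M \<le> (1 - u) * (M + 1)" using elim by (intro mult_left_mono) auto
      also have "\<dots> < \<epsilon>/2" using elim M by (simp add: field_simps)
      finally show ?case using bound[of u] elim by (simp add: dist_real_def)
    qed
  qed
qed

text \<open>Expansion about a new centre: the series is read as a holomorphic function on a complex
  disc, expanded about \<open>t0\<close> there, and real parts are taken.\<close>

lemma powser_real_analytic:
  assumes c: "\<And>t. \<bar>t\<bar> < r \<Longrightarrow> (\<lambda>n. c n * t ^ n) sums \<phi> t" and t0: "\<bar>t0\<bar> < r"
  shows "real_analytic_at \<phi> t0"
proof -
  define F where "F z = (\<Sum>n. complex_of_real (c n) * z ^ n)" for z
  have sums: "(\<lambda>n. complex_of_real (c n) * (z - 0) ^ n) sums F z" if z: "z \<in> ball 0 r" for z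
  proof -
    obtain x where x: "norm z < x" "x < r" using z dense by (auto simp: dist_norm)
    have x0: "x > 0" using x(1) norm_ge_zero[of z] by linarith
    have "summable (\<lambda>n. c n * x ^ n)" using c[of x] x x0 sums_summable by auto
    then have "summable (\<lambda>n. complex_of_real (c n * x ^ n))" by (rule summable_of_real)
    then have "summable (\<lambda>n. complex_of_real (c n) * complex_of_real x ^ n)" by simp
    from powser_inside[OF this] have "summable (\<lambda>n. complex_of_real (c n) * z ^ n)" using x x0 by simp
    then show ?thesis unfolding F_def using summable_sums by simp
  qed
  have F\<phi>: "F (complex_of_real t) = complex_of_real (\<phi> t)" if "\<bar>t\<bar> < r" for t
  proof -
    have "(\<lambda>n. complex_of_real (c n * t ^ n)) sums complex_of_real (\<phi> t)"
      using c[OF that] by (simp only: sums_of_real_iff)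
    then show ?thesis unfolding F_def by (simp add: sums_unique[symmetric])
  qed
  have hol: "F holomorphic_on ball 0 r" by (rule power_series_holomorphic[OF sums])
  define \<rho> where "\<rho> = r - \<bar>t0\<bar>"
  have \<rho>: "\<rho> > 0" using t0 by (simp add: \<rho>_def)
  have sub: "ball (complex_of_real t0) \<rho> \<subseteq> ball 0 r"
  proof
    fix z assume "z \<in> ball (complex_of_real t0) \<rho>"
    then have "norm (z - complex_of_real t0) < \<rho>" by (simp add: dist_norm norm_minus_commute)
    moreover have "norm z \<le> norm (z - complex_of_real t0) + norm (complex_of_real t0)"
      by (metis diff_add_cancel norm_triangle_ineq)
    ultimately show "z \<in> ball 0 r" by (simp add: \<rho>_def)
  qed
  define d where "d n = Re ((deriv ^^ n) F (complex_of_real t0) / fact n)" for n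
  have "(\<lambda>n. d n * (t - t0) ^ n) sums \<phi> t" if t: "\<bar>t - t0\<bar> < \<rho>" for t
  proof -
    have tb: "complex_of_real t \<in> ball (complex_of_real t0) \<rho>"
      using t by (simp add: dist_norm norm_minus_commute flip: of_real_diff)
    have tr: "\<bar>t\<bar> < r" using t by (simp add: \<rho>_def)
    from holomorphic_power_series[OF holomorphic_on_subset[OF hol sub] tb]
    have "(\<lambda>n. Re ((deriv ^^ n) F (complex_of_real t0) / fact n * (complex_of_real t - complex_of_real t0) ^ n))
        sums Re (F (complex_of_real t))" by (rule sums_Re)
    moreover have "Re ((deriv ^^ n) F (complex_of_real t0) / fact n * (complex_of_real t - complex_of_real t0) ^ n)
        = d n * (t - t0) ^ n" for n
    proof -
      have "(complex_of_real t - complex_of_real t0) ^ n = complex_of_real ((t - t0) ^ n)" by simp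
      then show ?thesis unfolding d_def by (simp only: Re_complex_of_real times_complex.sel Im_complex_of_real mult_zero_right diff_zero)
    qed
    ultimately show ?thesis using F\<phi>[OF tr] by simp
  qed
  then show ?thesis unfolding real_analytic_at_def using \<rho> by blast
qed

lemma real_analytic_diff:
  assumes "real_analytic_at \<phi> t0" "real_analytic_at \<psi> t0"
  shows "real_analytic_at (\<lambda>t. \<phi> t - \<psi> t) t0"
proof -
  obtain \<epsilon>1 c1 where 1: "\<epsilon>1 > 0" "\<And>t. \<bar>t - t0\<bar> < \<epsilon>1 \<Longrightarrow> (\<lambda>n. c1 n * (t - t0) ^ n) sums \<phi> t"
    using assms(1) unfolding real_analytic_at_def by blast
  obtain \<epsilon>2 c2 where 2: "\<epsilon>2 > 0" "\<And>t. \<bar>t - t0\<bar> < \<epsilon>2 \<Longrightarrow> (\<lambda>n. c2 n * (t - t0) ^ n) sums \<psi> t"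
    using assms(2) unfolding real_analytic_at_def by blast
  have "(\<lambda>n. (c1 n - c2 n) * (t - t0) ^ n) sums (\<phi> t - \<psi> t)" if "\<bar>t - t0\<bar> < min \<epsilon>1 \<epsilon>2" for t
    using sums_diff[OF 1(2) 2(2), of t t] that by (simp add: left_diff_distrib)
  then show ?thesis unfolding real_analytic_at_def using 1(1) 2(1)
    by (intro exI[of _ "min \<epsilon>1 \<epsilon>2"] conjI exI[of _ "\<lambda>n. c1 n - c2 n"]) auto
qed

text \<open>Once the lower coefficients vanish, division by t^i leaves a series with limit a_i at 0,
  while the assumed bound forces the limit 0.\<close>

lemma powser_flat_coeffs:
  fixes a :: "nat \<Rightarrow> real"
  assumes \<epsilon>: "\<epsilon> > 0" and a: "\<And>t. \<bar>t\<bar> < \<epsilon> \<Longrightarrow> (\<lambda>n. a n * t ^ n) sums D t"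
    and \<tau>: "\<tau> > 0" and D: "\<And>t. \<bar>t\<bar> < \<tau> \<Longrightarrow> \<bar>D t\<bar> \<le> K * \<bar>t\<bar> ^ M"
  shows "i < M \<Longrightarrow> a i = 0"
proof (induction i rule: less_induct)
  case (less i)
  define E where "E t = (if t = 0 then a i else D t / t ^ i)" for t
  have "(\<lambda>n. a (n + i) * t ^ n) sums E t" if t: "norm t < \<epsilon>" for t :: real
  proof (cases "t = 0")
    case True
    then show ?thesis using sums_If_finite_set[of "{0}" "\<lambda>n. a (n + i)"] powser_sums_zero[of "\<lambda>n. a (n + i)"]
      by (simp add: E_def)
  next
    case False
    have "(\<lambda>n. a (n + i) * t ^ (n + i)) sums (D t - (\<Sum>n<i. a n * t ^ n))"
      using a[of t] t by (subst sums_iff_shift) auto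
    moreover have "(\<Sum>n<i. a n * t ^ n) = 0" using less by (intro sum.neutral) auto
    ultimately have "(\<lambda>n. a (n + i) * t ^ (n + i) / t ^ i) sums (D t / t ^ i)"
      by (intro sums_divide) simp
    then show ?thesis using False by (simp add: E_def power_add)
  qed
  from powser_limit_0[OF \<epsilon> this] have 1: "(E \<longlongrightarrow> a i) (at 0)" by simp
  have "(E \<longlongrightarrow> 0) (at 0)"
  proof (rule Lim_null_comparison)
    have "norm (E t) \<le> K * \<bar>t\<bar> ^ (M - i)" if "t \<noteq> 0" "\<bar>t\<bar> < \<tau>" for t
    proof -
      have "\<bar>t\<bar> ^ M = \<bar>t\<bar> ^ (M - i) * \<bar>t\<bar> ^ i" using less.prems by (simp flip: power_add)
      then have "\<bar>D t\<bar> \<le> K * \<bar>t\<bar> ^ (M - i) * \<bar>t\<bar> ^ i" using D[OF that(2)] by simp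
      then show ?thesis using that(1) by (simp add: E_def power_abs pos_divide_le_eq)
    qed
    then show "\<forall>\<^sub>F t in at 0. norm (E t) \<le> K * \<bar>t\<bar> ^ (M - i)"
      unfolding eventually_at using \<tau> by (intro exI[of _ \<tau>]) auto
    have "((\<lambda>t. K * \<bar>t\<bar> ^ (M - i)) \<longlongrightarrow> K * \<bar>0\<bar> ^ (M - i)) (at (0::real))" by (intro tendsto_intros)
    moreover have "K * \<bar>0\<bar> ^ (M - i) = 0" using less.prems by (simp add: power_0_left)
    ultimately show "((\<lambda>t. K * \<bar>t\<bar> ^ (M - i)) \<longlongrightarrow> 0) (at (0::real))" by metis
  qed
  then show ?case using 1 tendsto_unique by (metis at_neq_bot)
qed

text \<open>The bounds compare \<phi> only with partial sums, so they express an asymptotic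
  expansion. Analyticity of \<phi> turns it into equality of all coefficients and hence of the
  functions near 0.\<close>

lemma real_analytic_Taylor_unique:
  assumes ra: "real_analytic_at \<phi> 0"
    and c: "\<And>t. \<bar>t\<bar> < r \<Longrightarrow> (\<lambda>n. c n * t ^ n) sums \<psi> t" and r: "r > 0"
    and T: "\<And>N. \<exists>K \<tau>. \<tau> > 0 \<and> (\<forall>t. \<bar>t\<bar> < \<tau> \<longrightarrow> \<bar>\<phi> t - (\<Sum>n<2 * N. c n * t ^ n)\<bar> \<le> K * \<bar>t\<bar> ^ (2 * N))"
  shows "\<forall>\<^sub>F t in nhds 0. \<phi> t - \<psi> t = 0"
proof -
  obtain \<epsilon> d where \<epsilon>: "\<epsilon> > 0" "\<And>t. \<bar>t - 0\<bar> < \<epsilon> \<Longrightarrow> (\<lambda>n. d n * (t - 0) ^ n) sums \<phi> t"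
    using ra unfolding real_analytic_at_def by blast
  have "d n = c n" for n
  proof -
    define N where "N = Suc n"
    obtain K \<tau> where K: "\<tau> > 0" "\<And>t. \<bar>t\<bar> < \<tau> \<Longrightarrow> \<bar>\<phi> t - (\<Sum>n<2 * N. c n * t ^ n)\<bar> \<le> K * \<bar>t\<bar> ^ (2 * N)"
      using T by blast
    have "d n - (if n < 2 * N then c n else 0) = 0"
    proof (rule powser_flat_coeffs[OF \<epsilon>(1) _ K])
      fix t :: real assume t: "\<bar>t\<bar> < \<epsilon>"
      have "(\<lambda>n. if n \<in> {..<2 * N} then c n * t ^ n else 0) sums (\<Sum>n<2 * N. c n * t ^ n)"
        by (rule sums_If_finite_set) simp
      from sums_diff[OF \<epsilon>(2) this] t
      have "(\<lambda>n. d n * t ^ n - (if n \<in> {..<2 * N} then c n * t ^ n else 0)) sums (\<phi> t - (\<Sum>n<2 * N. c n * t ^ n))"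
        by simp
      moreover have "d n * t ^ n - (if n \<in> {..<2 * N} then c n * t ^ n else 0)
          = (d n - (if n < 2 * N then c n else 0)) * t ^ n" for n
        by (simp add: left_diff_distrib)
      ultimately show "(\<lambda>n. (d n - (if n < 2 * N then c n else 0)) * t ^ n) sums (\<phi> t - (\<Sum>n<2 * N. c n * t ^ n))"
        by simp
    qed (simp_all add: N_def)
    then show ?thesis by (simp add: N_def)
  qed
  then have "\<phi> t - \<psi> t = 0" if "\<bar>t\<bar> < min \<epsilon> r" for t
    using \<epsilon>(2)[of t] c[of t] that sums_unique2 by fastforce
  then show ?thesis unfolding eventually_nhds_metric dist_real_def
    using \<epsilon>(1) r by (intro exI[of _ "min \<epsilon> r"]) auto
qed

section \<open>Double factorials and Gamma quotients\<close>

lemma dfact_even: "dfact (2 * int k) = (\<Prod>l<k. 2 * (int l + 1))"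
proof -
  have "{j \<in> {1..2 * int k}. even (2 * int k - j)} = (\<lambda>l. 2 * (int l + 1)) ` {..<k}"
  proof (intro equalityI subsetI)
    fix j assume j: "j \<in> {j \<in> {1..2 * int k}. even (2 * int k - j)}"
    then obtain i where "j = 2 * i" by auto
    then show "j \<in> (\<lambda>l. 2 * (int l + 1)) ` {..<k}"
      using j by (intro image_eqI[of _ _ "nat (i - 1)"]) auto
  qed auto
  moreover have "inj_on (\<lambda>l. 2 * (int l + 1)) {..<k}" by (auto simp: inj_on_def)
  ultimately show ?thesis unfolding dfact_def by (simp add: prod.reindex)
qed

lemma dfact_odd: "dfact (2 * int k - 1) = (\<Prod>l<k. 2 * int l + 1)"
proof -
  have "{j \<in> {1..2 * int k - 1}. even (2 * int k - 1 - j)} = (\<lambda>l. 2 * int l + 1) ` {..<k}"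
  proof (intro equalityI subsetI)
    fix j assume j: "j \<in> {j \<in> {1..2 * int k - 1}. even (2 * int k - 1 - j)}"
    then have "odd j" by auto
    then obtain i where "j = 2 * i + 1" by (elim oddE)
    then show "j \<in> (\<lambda>l. 2 * int l + 1) ` {..<k}"
      using j by (intro image_eqI[of _ _ "nat i"]) auto
  qed auto
  moreover have "inj_on (\<lambda>l. 2 * int l + 1) {..<k}" by (auto simp: inj_on_def)
  ultimately show ?thesis unfolding dfact_def by (simp add: prod.reindex)
qed

text \<open>The sign and (q - 2)!! cancel against the product of the -(2l + 1), which leaves (q -
  1)!!; read backwards, this is the product of the q - 1 - 2i. For q = 1 the convention (-1)!! = 1
  is used.\<close>

lemma gamma_q_prod:
  assumes "q = 2 * k + 1"
  shows "gamma_q q * (\<Prod>l<k. - real (2 * l + 1)) = (\<Prod>i<k. real q - 1 - 2 * real i)"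
proof -
  have "int q - 1 = 2 * int k" "int q - 2 = 2 * int k - 1" "(q - 1) div 2 = k" using assms by auto
  then have g: "gamma_q q = (- 1) ^ k * (\<Prod>l<k. 2 * (real l + 1)) / (\<Prod>l<k. 2 * real l + 1)"
    by (simp add: gamma_q_def dfact_even dfact_odd)
  have "(\<Prod>l<k. - real (2 * l + 1)) = (\<Prod>l<k. - 1 * (2 * real l + 1))" by (intro prod.cong) auto
  also have "\<dots> = (- 1) ^ k * (\<Prod>l<k. 2 * real l + 1)" by (simp only: prod.distrib prod_constant card_lessThan)
  finally have m: "(\<Prod>l<k. - real (2 * l + 1)) = (- 1) ^ k * (\<Prod>l<k. 2 * real l + 1)" .
  have nz: "(\<Prod>l<k. 2 * real l + 1) \<noteq> 0" by (simp add: add_pos_nonneg less_imp_neq[THEN not_sym])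
  have "(- 1 :: real) ^ k * (- 1) ^ k = 1" by (simp flip: power_mult_distrib)
  then have "gamma_q q * (\<Prod>l<k. - real (2 * l + 1)) = (\<Prod>l<k. 2 * (real l + 1))"
    unfolding g m using nz by (simp add: field_simps)
  also have "\<dots> = (\<Prod>i<k. 2 * (real (k - Suc i) + 1))"
    by (rule prod.nat_diff_reindex[symmetric])
  also have "\<dots> = (\<Prod>i<k. real q - 1 - 2 * real i)"
    by (intro prod.cong refl) (simp add: assms of_nat_diff)
  finally show ?thesis .
qed

text \<open>The functional equation of Gamma, applied j times with the denominators 2 cleared. The
  values a = q and a = q + 2 cover the two series.\<close>

lemma Gamma_half_shift:
  fixes a :: real
  assumes "a > 0"
  shows "Gamma (real j + a / 2) * 2 ^ j = Gamma (a / 2) * (\<Prod>l<j. a + 2 * real l)"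
proof (induction j)
  case (Suc j)
  have "real j + a / 2 > 0" using assms by simp
  then have "real j + a / 2 \<notin> \<int>\<^sub>\<le>\<^sub>0" using nonpos_Ints_nonpos by fastforce
  then have "Gamma (real (Suc j) + a / 2) = (real j + a / 2) * Gamma (real j + a / 2)"
    using Gamma_plus1[of "real j + a / 2"] by (simp add: add_ac)
  then have "Gamma (real (Suc j) + a / 2) * 2 ^ Suc j = (real j + a / 2) * Gamma (real j + a / 2) * 2 ^ Suc j"
    by (rule arg_cong)
  also have "\<dots> = (a + 2 * real j) * (Gamma (real j + a / 2) * 2 ^ j)"
    by (simp only: power_Suc) (simp add: algebra_simps)
  also have "\<dots> = Gamma (a / 2) * (\<Prod>l<Suc j. a + 2 * real l)"
    unfolding Suc prod.lessThan_Suc by (simp only: mult_ac)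
  finally show ?case .
qed simp

text \<open>Up to powers of 2 the Gamma quotient is the reciprocal of the product of the q + 2l =
  2(k + l) + 1. The factors of the iterated Laplacian cancel it, and the Taylor coefficient in the
  variable r^2/2 remains.\<close>

lemma gck_c1_prod:
  assumes q: "q = 2 * k + 1"
  shows "gck_c1 q j * (\<Prod>l<j. - real (2 * (k + l) + 1)) = 1 / (2 ^ j * fact j)"
proof -
  let ?G = "Gamma (real q / 2)" and ?P = "\<Prod>l<j. real q + 2 * real l"
  have q0: "real q > 0" using q by simp
  have G: "?G > 0" using q0 by (intro Gamma_real_pos) simp
  have P: "?P > 0" using q0 by (intro prod_pos) auto
  have m: "(\<Prod>l<j. - real (2 * (k + l) + 1)) = (- 1) ^ j * ?P"
  proof -
    have "(\<Prod>l<j. - real (2 * (k + l) + 1)) = (\<Prod>l<j. - 1 * (real q + 2 * real l))"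
      by (intro prod.cong) (auto simp: q)
    then show ?thesis by (simp only: prod.distrib prod_constant card_lessThan)
  qed
  have s: "(- 1 :: real) ^ j * (- 1) ^ j = 1" by (simp flip: power_mult_distrib)
  have fin: "1 * x / (t * x) = 1 / t" if "x \<noteq> 0" for x t :: real using that by simp
  have cancel: "x / ((t * t) * f * (y / t)) = x / (t * f * y)" if "t \<noteq> 0" for x t f y :: real
    using that by simp
  have *: "Gamma (real j + real q / 2) = ?G * ?P / 2 ^ j"
    using Gamma_half_shift[OF q0, of j] by (simp add: eq_divide_eq)
  have "gck_c1 q j = ?G * (- 1) ^ j / ((2 ^ j * 2 ^ j) * fact j * (?G * ?P / 2 ^ j))"
    unfolding gck_c1_def * mult_2[of j] power_add ..
  also have "\<dots> = ?G * (- 1) ^ j / (2 ^ j * fact j * (?G * ?P))"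
    by (rule cancel) simp
  finally have "gck_c1 q j = ?G * (- 1) ^ j / (2 ^ j * fact j * (?G * ?P))" .
  then have "gck_c1 q j * (\<Prod>l<j. - real (2 * (k + l) + 1)) = ((- 1) ^ j * (- 1) ^ j) * (?G * ?P) / (2 ^ j * fact j * (?G * ?P))"
    unfolding m by (simp add: mult_ac)
  then show ?thesis
    unfolding s by (simp only: fin[OF less_imp_neq[OF mult_pos_pos[OF G P], THEN not_sym]])
qed

text \<open>The shifted Gamma function contributes a further q/2: its denominator meets the
  additional power of 2 in \<open>gck_c2\<close>, and q meets the factor 2k + 1 of the Dirac
  operator.\<close>

lemma gck_c2_prod:
  assumes q: "q = 2 * k + 1"
  shows "gck_c2 q j * (real (2 * k + 1) * (\<Prod>l<j. - real (2 * (k + l) + 3))) = 1 / (2 ^ j * fact j)"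
proof -
  let ?G = "Gamma (real q / 2)" and ?P = "\<Prod>l<j. real q + 2 + 2 * real l"
  have q0: "real q > 0" "real q + 2 > 0" using q by simp_all
  have G: "?G > 0" using q0 by (intro Gamma_real_pos) simp
  have P: "?P > 0" using q0 by (intro prod_pos) auto
  have m: "(\<Prod>l<j. - real (2 * (k + l) + 3)) = (- 1) ^ j * ?P"
  proof -
    have "(\<Prod>l<j. - real (2 * (k + l) + 3)) = (\<Prod>l<j. - 1 * (real q + 2 + 2 * real l))"
      by (intro prod.cong) (auto simp: q)
    then show ?thesis by (simp only: prod.distrib prod_constant card_lessThan)
  qed
  have s: "(- 1 :: real) ^ j * (- 1) ^ j = 1" by (simp flip: power_mult_distrib)
  have fin: "1 * x / (t * x) = 1 / t" if "x \<noteq> 0" for x t :: real using that by simp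
  have cancel: "x / ((t * t) * f * (y / t)) = x / (t * f * y)" if "t \<noteq> 0" for x t f y :: real
    using that by simp
  have "(real q + 2) / 2 = real 1 + real q / 2" by simp
  then have "Gamma ((real q + 2) / 2) = real q / 2 * ?G"
    using Gamma_half_shift[OF q0(1), of 1] by (simp only:) simp
  moreover have "real j + real q / 2 + 1 = real j + (real q + 2) / 2" by simp
  ultimately have *: "Gamma (real j + real q / 2 + 1) = real q / 2 * ?G * ?P / 2 ^ j"
    using Gamma_half_shift[OF q0(2), of j] by (simp only: eq_divide_eq) simp
  have "gck_c2 q j = ?G * (- 1) ^ j / ((2 ^ j * 2 ^ j) * (2 * fact j) * (real q / 2 * ?G * ?P / 2 ^ j))"
    unfolding gck_c2_def * mult_2[of j] power_add by (simp only: power_one_right mult_ac)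
  also have "\<dots> = ?G * (- 1) ^ j / (2 ^ j * (2 * fact j) * (real q / 2 * ?G * ?P))"
    by (rule cancel) simp
  finally have "gck_c2 q j = ?G * (- 1) ^ j / (2 ^ j * fact j * (?G * ?P * real q))"
    by (simp add: mult_ac)
  then have "gck_c2 q j * (real (2 * k + 1) * (\<Prod>l<j. - real (2 * (k + l) + 3)))
      = ((- 1) ^ j * (- 1) ^ j) * (?G * ?P * real q) / (2 ^ j * fact j * (?G * ?P * real q))"
    unfolding m by (simp add: q mult_ac)
  then show ?thesis
    unfolding s
    by (simp only: fin[OF less_imp_neq[OF mult_pos_pos[OF mult_pos_pos[OF G P] q0(1)], THEN not_sym]])
qed

section \<open>Identification with the generalized CK-extension\<close>

context gps_setup
begin

text \<open>The analogue of \<open>A\<close> for all of M: it sends \<open>b s\<close> to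
  \<open>v s\<close> for every s up to m and turns a monogenic function on \<Omega> into a solution
  of a Dirac system on an open set of the ambient type.\<close>

definition AM :: "'a \<Rightarrow> 'a" where "AM y = (\<Sum>s\<le>m. (y \<bullet> b s) *\<^sub>R v s)"

lemma linear_AM: "linear AM"
  by (rule linearI) (simp_all add: AM_def inner_add_left scaleR_add_left sum.distrib scaleR_sum_right)

lemma AM_b: "s \<le> m \<Longrightarrow> AM (b s) = v s"
proof -
  assume s: "s \<le> m"
  have "(\<Sum>t\<le>m. (b s \<bullet> b t) *\<^sub>R v t) = (\<Sum>t\<le>m. if t = s then v s else 0)"
    using s by (intro sum.cong) (auto simp: b_inner)
  then show ?thesis using s by (simp add: AM_def)
qed

lemma AM_other: "\<beta> \<in> Basis \<Longrightarrow> \<beta> \<notin> b ` {..m} \<Longrightarrow> AM \<beta> = 0"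
proof -
  assume \<beta>: "\<beta> \<in> Basis" "\<beta> \<notin> b ` {..m}"
  have "\<beta> \<bullet> b s = 0" if "s \<le> m" for s
    using \<beta> that b_Basis[of s] by (subst inner_Basis) auto
  then show ?thesis by (simp add: AM_def)
qed

lemma AM_M: "AM y \<in> Mspace v m"
  unfolding AM_def Mspace_def by (intro span_sum span_scale span_base) auto

lemma AM_surj: "x \<in> Mspace v m \<Longrightarrow> AM (\<Sum>s\<le>m. \<xi> s x *\<^sub>R b s) = x"
  using M_expand[of x] linear_sum[OF linear_AM, of "\<lambda>s. \<xi> s x *\<^sub>R b s"] linear_scale[OF linear_AM]
  by (simp add: AM_b)

text \<open>Analyticity on lines is inherited from the composite with \<open>AM\<close>. It holds at
  each parameter whose point is in \<Omega>, including the end point of a segment there.\<close>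

lemma monogenic_on_line_analytic:
  assumes h: "monogenic_on mul v m \<Omega> h" and x: "x0 + t0 *\<^sub>R \<omega> \<in> \<Omega>"
    and M: "x0 \<in> Mspace v m" "\<omega> \<in> Mspace v m"
  shows "real_analytic_at (\<lambda>t. h (x0 + t *\<^sub>R \<omega>) \<bullet> \<beta>) t0"
proof -
  define w where "w \<beta> = v (\<iota> \<beta>)" for \<beta>
  have wb: "w (b s) = v s" if "s \<le> m" for s using \<iota>_b[OF that] by (simp add: w_def)
  interpret ds: dirac_system "b ` {..m}" "\<lambda>\<beta>. mul (w \<beta>)" "cl w"
  proof (rule dirac_system_cl)
    show "b ` {..m} \<subseteq> Basis" using b_Basis by auto
    show "w (b 0) = one" using wb[of 0] v0 by simp
    fix \<beta> \<beta>' x assume "\<beta> \<in> b ` {..m}" "\<beta>' \<in> b ` {..m}" "\<beta> \<noteq> b 0" "\<beta>' \<noteq> b 0"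
    then obtain s t where st: "s \<le> m" "t \<le> m" "\<beta> = b s" "\<beta>' = b t" "s \<noteq> 0" "t \<noteq> 0" by auto
    then have "b s = b t \<longleftrightarrow> s = t" using b_inj by (auto simp: inj_on_def)
    then show "mul (w \<beta>) (mul (w \<beta>') x) + mul (w \<beta>') (mul (w \<beta>) x) = (if \<beta> = \<beta>' then - 2 else 0) *\<^sub>R x"
      using clifford_v[of s t x] st by (simp add: wb)
  qed
  define V where "V = {y. AM y \<in> \<Omega>}"
  have V: "open V"
  proof -
    obtain W where W: "open W" "\<Omega> = Mspace v m \<inter> W" using \<Omega>_open openin_open by metis
    have "AM y \<in> \<Omega> \<longleftrightarrow> AM y \<in> W" for y using AM_M W(2) by blast
    then have "V = AM -` W" by (auto simp: V_def)
    moreover have "continuous_on UNIV AM"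
      by (rule linear_continuous_on[OF linear_AM[unfolded linear_conv_bounded_linear]])
    ultimately show ?thesis using W(1) open_vimage by metis
  qed
  have hh: "continuous_on \<Omega> h" "\<And>s y. s \<le> m \<Longrightarrow> y \<in> \<Omega> \<Longrightarrow> dd_exists (v s) h y"
    "\<And>s. s \<le> m \<Longrightarrow> continuous_on \<Omega> (dd (v s) h)" "\<And>y. y \<in> \<Omega> \<Longrightarrow> dirac mul v m h y = 0"
    using h unfolding monogenic_on_def by blast+
  have comp: "continuous_on V (\<lambda>y. F (AM y))" if "continuous_on \<Omega> F" for F :: "'a \<Rightarrow> 'a"
    by (rule continuous_on_compose2[OF that linear_continuous_on[OF linear_AM[unfolded linear_conv_bounded_linear]]])
       (auto simp: V_def)
  have dd0: "has_dd 0 F 0 y" "dd 0 F y = 0" for F :: "'a \<Rightarrow> 'a" and y :: 'a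
    using has_dd_imp_dd[of 0 F 0 y] by (simp_all add: has_dd_def)
  have cases: "(\<exists>s\<le>m. \<beta> = b s \<and> AM \<beta> = v s) \<or> AM \<beta> = 0" if "\<beta> \<in> Basis" for \<beta>
    using AM_b AM_other[OF that] by auto
  have mon: "ds.monog V (\<lambda>y. h (AM y))"
  proof (rule ds.monogI[where g' = "\<lambda>\<beta> y. dd (AM \<beta>) h (AM y)"])
    show "continuous_on V (\<lambda>y. h (AM y))" by (rule comp[OF hh(1)])
    fix \<beta> :: 'a assume \<beta>: "\<beta> \<in> Basis"
    show "continuous_on V (\<lambda>y. dd (AM \<beta>) h (AM y))"
      using cases[OF \<beta>] comp[OF hh(3)] by (auto simp: dd0)
    fix y assume y: "y \<in> V"
    have "has_dd (AM \<beta>) h (dd (AM \<beta>) h (AM y)) (AM y)"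
      using cases[OF \<beta>] dd_exists_has_dd[OF hh(2), of _ "AM y"] y by (auto simp: dd0 V_def)
    then show "has_dd \<beta> (\<lambda>y. h (AM y)) (dd (AM \<beta>) h (AM y)) y"
      by (simp add: has_dd_comp_linear[OF linear_AM])
  next
    fix y assume y: "y \<in> V"
    have "(\<Sum>\<beta>\<in>b ` {..m}. mul (w \<beta>) (dd (AM \<beta>) h (AM y))) = (\<Sum>s\<le>m. mul (v s) (dd (v s) h (AM y)))"
      using b_inj by (simp add: sum.reindex wb AM_b)
    then show "(\<Sum>\<beta>\<in>b ` {..m}. mul (w \<beta>) (dd (AM \<beta>) h (AM y))) = 0"
      using hh(4) y by (simp add: dirac_def V_def)
    fix \<beta> :: 'a assume "\<beta> \<in> Basis - b ` {..m}"
    then show "dd (AM \<beta>) h (AM y) = 0" using AM_other by (simp add: dd0)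
  qed
  define y0 w0 where "y0 = (\<Sum>s\<le>m. \<xi> s x0 *\<^sub>R b s)" and "w0 = (\<Sum>s\<le>m. \<xi> s \<omega> *\<^sub>R b s)"
  have line: "AM (y0 + t *\<^sub>R w0) = x0 + t *\<^sub>R \<omega>" for t
    using AM_surj[OF M(1)] AM_surj[OF M(2)] linear_add[OF linear_AM] linear_scale[OF linear_AM]
    by (simp add: y0_def w0_def)
  have "y0 + t0 *\<^sub>R w0 \<in> V" using x by (simp add: V_def line)
  from ds.monog_real_analytic[OF V this mon, of \<beta>] show ?thesis by (simp add: line)
qed

lemma C_pos: "2 * k + 1 = q \<Longrightarrow> C k > 0"
  unfolding C_def by (intro prod_pos) auto

text \<open>Reflection of the model point and evenness of \<open>H1 k\<close> and
  \<open>H2 k\<close> replace the radius |t| by the signed parameter t. Negative t are needed for a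
  two-sided expansion at 0.\<close>

lemma \<Phi>_slice:
  assumes x0: "x0 \<in> Z" and \<omega>: "\<omega> \<in> S" and x: "x0 + t *\<^sub>R \<omega> \<in> \<Omega>"
  shows "B x0 + t *\<^sub>R e \<in> U"
    "\<Phi> k (x0 + t *\<^sub>R \<omega>) = ax.H1 k (B x0 + t *\<^sub>R e) + mul (t *\<^sub>R \<omega>) (ax.H2 k (B x0 + t *\<^sub>R e))"
proof -
  have xp: "x0 \<in> Rp1 v p" using x0 by (simp add: Z_def)
  note sl = slice_coords(1,2)[OF xp \<omega>, of t] slice_coords(3)[OF xp \<omega>]
  have BU: "B x0 + \<bar>t\<bar> *\<^sub>R e \<in> U" using B_in_U[OF x] sl by simp
  have rf: "sym.refl (B x0 + s *\<^sub>R e) = B x0 - s *\<^sub>R e" for s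
    using sl(3) by (simp add: sym.refl_def inner_add_left B_e algebra_simps) (simp flip: scaleR_add_left)
  show "B x0 + t *\<^sub>R e \<in> U"
    using sym.refl_in[OF BU] BU rf[of "\<bar>t\<bar>"] by (cases "t \<ge> 0") auto
  have ev: "G (B x0 + \<bar>t\<bar> *\<^sub>R e) = G (B x0 + t *\<^sub>R e)" if "sym.evenf G" for G :: "'a \<Rightarrow> 'a"
  proof -
    have "G (sym.refl (B x0 + \<bar>t\<bar> *\<^sub>R e)) = G (B x0 + \<bar>t\<bar> *\<^sub>R e)"
      using that BU by (simp add: sym.evenf_def)
    then show ?thesis unfolding rf by (cases "t \<ge> 0") auto
  qed
  show "\<Phi> k (x0 + t *\<^sub>R \<omega>) = ax.H1 k (B x0 + t *\<^sub>R e) + mul (t *\<^sub>R \<omega>) (ax.H2 k (B x0 + t *\<^sub>R e))"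
    unfolding \<Phi>_def sl(1,2) ev[OF ax.even_H1] ev[OF ax.even_H2] ..
qed

text \<open>Smoothness of \<open>H1 k\<close> and \<open>H2 k\<close> yields only an asymptotic
  expansion at radius 0. Analyticity along the ray comes from \<Phi>_k being a constant multiple of
  a monogenic function, and the two together identify the sum.\<close>

lemma \<Phi>_Taylor_sum:
  assumes k: "2 * k + 1 = q" and x0: "x0 \<in> Z" and \<omega>: "\<omega> \<in> S" and r: "r > 0"
    and seg: "\<And>t. 0 \<le> t \<Longrightarrow> t \<le> r \<Longrightarrow> x0 + t *\<^sub>R \<omega> \<in> \<Omega>"
    and sa: "summable (\<lambda>j. ((r\<^sup>2 / 2) ^ j / fact j) *\<^sub>R ax.H1 (k + j) (B x0))"
    and sb: "summable (\<lambda>j. ((r\<^sup>2 / 2) ^ j / fact j) *\<^sub>R ax.H2 (k + j) (B x0))"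
  shows "\<Phi> k (x0 + r *\<^sub>R \<omega>) \<bullet> \<beta> = ((\<Sum>j. ((r\<^sup>2 / 2) ^ j / fact j) *\<^sub>R ax.H1 (k + j) (B x0))
    + mul (r *\<^sub>R \<omega>) (\<Sum>j. ((r\<^sup>2 / 2) ^ j / fact j) *\<^sub>R ax.H2 (k + j) (B x0))) \<bullet> \<beta>"
proof -
  define y0 where "y0 = B x0"
  have x0\<Omega>: "x0 \<in> \<Omega>" by (rule Z_coords(3)[OF x0])
  have y0U: "y0 \<in> U" unfolding y0_def by (rule B_in_U[OF x0\<Omega>])
  have y0e: "y0 \<bullet> e = 0" using Z_coords(1)[OF x0] by (simp add: y0_def B_e)
  define L where "L z = mul \<omega> z \<bullet> \<beta>" for z
  have blL: "bounded_linear L"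
    unfolding L_def[abs_def] using bounded_linear_compose[OF bounded_linear_inner_left linear_mul] by simp
  define a where "a j = (1 / (2 ^ j * fact j)) * (ax.H1 (k + j) y0 \<bullet> \<beta>)" for j
  define a' where "a' j = (1 / (2 ^ j * fact j)) * L (ax.H2 (k + j) y0)" for j
  have a_eq: "(((t\<^sup>2 / 2) ^ j / fact j) *\<^sub>R ax.H1 (k + j) y0) \<bullet> \<beta> = a j * (t\<^sup>2) ^ j"
    "L (((t\<^sup>2 / 2) ^ j / fact j) *\<^sub>R ax.H2 (k + j) y0) = a' j * (t\<^sup>2) ^ j" for t j
    using linear_scale[OF bounded_linear.linear[OF blL]] by (simp_all add: a_def a'_def power_divide)
  have sumA: "summable (\<lambda>j. a j * (r\<^sup>2) ^ j)" "suminf (\<lambda>j. a j * (r\<^sup>2) ^ j)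
      = (\<Sum>j. ((r\<^sup>2 / 2) ^ j / fact j) *\<^sub>R ax.H1 (k + j) y0) \<bullet> \<beta>"
    using bounded_linear.summable[OF bounded_linear_inner_left sa, of \<beta>]
      bounded_linear.suminf[OF bounded_linear_inner_left sa, of \<beta>] by (simp_all only: a_eq y0_def[symmetric])
  have sumB: "summable (\<lambda>j. a' j * (r\<^sup>2) ^ j)" "suminf (\<lambda>j. a' j * (r\<^sup>2) ^ j)
      = L (\<Sum>j. ((r\<^sup>2 / 2) ^ j / fact j) *\<^sub>R ax.H2 (k + j) y0)"
    using bounded_linear.summable[OF blL sb] bounded_linear.suminf[OF blL sb] by (simp_all only: a_eq y0_def[symmetric])
  \<comment> \<open>The two series in t^2 are merged into one power series in t: even coefficients
    from \<open>H1\<close>, odd ones from \<open>H2\<close>, which carries the factor t.\<close>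
  define c where "c n = (if even n then a (n div 2) else a' ((n - 1) div 2))" for n
  define \<psi> where "\<psi> t = (\<Sum>j. a j * (t\<^sup>2) ^ j) + t * (\<Sum>j. a' j * (t\<^sup>2) ^ j)" for t
  have c_sums: "(\<lambda>n. c n * t ^ n) sums \<psi> t" if t: "\<bar>t\<bar> < r" for t
  proof -
    have "\<bar>t\<bar>\<^sup>2 < r\<^sup>2" using t by (intro power_strict_mono) auto
    then have t2: "norm (t\<^sup>2) < norm (r\<^sup>2)" by simp
    have 1: "(\<lambda>j. a j * (t\<^sup>2) ^ j) sums (\<Sum>j. a j * (t\<^sup>2) ^ j)"
      by (rule summable_sums[OF powser_inside[OF sumA(1) t2]])
    have 2: "(\<lambda>j. t * (a' j * (t\<^sup>2) ^ j)) sums (t * (\<Sum>j. a' j * (t\<^sup>2) ^ j))"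
      by (rule sums_mult[OF summable_sums[OF powser_inside[OF sumB(1) t2]]])
    have "(if even n then a (n div 2) * (t\<^sup>2) ^ (n div 2) else t * (a' ((n - 1) div 2) * (t\<^sup>2) ^ ((n - 1) div 2))) = c n * t ^ n" for n
    proof (cases "even n")
      case True
      then show ?thesis by (auto simp: c_def power_mult[symmetric])
    next
      case False
      then obtain i where "n = 2 * i + 1" by (elim oddE)
      then show ?thesis by (simp add: c_def power_mult[symmetric])
    qed
    then show ?thesis using sums_if[OF 2 1] by (simp add: \<psi>_def add.commute)
  qed
  define h where "h = (lap v m ^^ k) f"
  \<comment> \<open>Division by \<open>C k\<close> undoes the constant of \<open>lap_power\<close>:
    \<phi> is \<Phi>_k paired with \<beta>, while its analyticity is that of a monogenic
    function.\<close>
  define \<phi> where "\<phi> t = h (x0 + t *\<^sub>R \<omega>) \<bullet> ((1 / C k) *\<^sub>R \<beta>)" for t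
  have \<phi>_eq: "\<phi> t = ax.H1 k (y0 + t *\<^sub>R e) \<bullet> \<beta> + t * L (ax.H2 k (y0 + t *\<^sub>R e))" "y0 + t *\<^sub>R e \<in> U"
    if "x0 + t *\<^sub>R \<omega> \<in> \<Omega>" for t
  proof -
    show "y0 + t *\<^sub>R e \<in> U" using \<Phi>_slice(1)[OF x0 \<omega> that] by (simp add: y0_def)
    have "\<phi> t = \<Phi> k (x0 + t *\<^sub>R \<omega>) \<bullet> \<beta>"
      using lap_power[OF that, of k] C_pos[OF k] by (simp add: \<phi>_def h_def)
    then show "\<phi> t = ax.H1 k (y0 + t *\<^sub>R e) \<bullet> \<beta> + t * L (ax.H2 k (y0 + t *\<^sub>R e))"
      by (simp add: \<Phi>_slice(2)[OF x0 \<omega> that] inner_add_left mul.scaleR_left L_def y0_def)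
  qed
  have x0M: "x0 \<in> Mspace v m" using x0\<Omega> \<Omega>_sub by blast
  have ra: "real_analytic_at \<phi> t" if "0 \<le> t" "t \<le> r" for t
    unfolding \<phi>_def h_def
    by (rule monogenic_on_line_analytic[OF monogenic_lap_power[OF k] seg[OF that] x0M S_M[OF \<omega>]])
  have near0: "\<forall>\<^sub>F t in nhds 0. \<phi> t - \<psi> t = 0"
  proof (rule real_analytic_Taylor_unique[OF ra c_sums r])
    fix N
    obtain K1 \<tau>1 where 1: "\<tau>1 > 0" "\<And>t. \<bar>t\<bar> < \<tau>1 \<Longrightarrow>
      norm (ax.H1 k (y0 + t *\<^sub>R e) - (\<Sum>j<N. ((t\<^sup>2 / 2) ^ j / fact j) *\<^sub>R ax.H1 (k + j) y0)) \<le> K1 * \<bar>t\<bar> ^ (2 * N)"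
      using radial_taylor[where K = ax.H1, OF e_Basis open_U y0U y0e smooth_on_continuous[OF ax.smooth_H1] ax.has_dd_H1] by blast
    obtain K2 \<tau>2 where 2: "\<tau>2 > 0" "\<And>t. \<bar>t\<bar> < \<tau>2 \<Longrightarrow>
      norm (ax.H2 k (y0 + t *\<^sub>R e) - (\<Sum>j<N. ((t\<^sup>2 / 2) ^ j / fact j) *\<^sub>R ax.H2 (k + j) y0)) \<le> K2 * \<bar>t\<bar> ^ (2 * N)"
      using radial_taylor[where K = ax.H2, OF e_Basis open_U y0U y0e smooth_on_continuous[OF ax.smooth_H2] ax.has_dd_H2] by blast
    obtain KL where KL: "KL > 0" "\<And>z. norm (L z) \<le> norm z * KL"
      using bounded_linear.pos_bounded[OF blL] by blast
    \<comment> \<open>The segment covers t \<ge> 0 only; openness of \<Omega> relative to M supplies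
      a two-sided interval around 0.\<close>
    obtain \<tau>3 where \<tau>3: "\<tau>3 > 0" "\<And>t. \<bar>t\<bar> < \<tau>3 \<Longrightarrow> x0 + t *\<^sub>R \<omega> \<in> \<Omega>"
    proof -
      obtain W where W: "open W" "\<Omega> = Mspace v m \<inter> W" using \<Omega>_open openin_open by metis
      have M: "x0 + t *\<^sub>R \<omega> \<in> Mspace v m" for t
        using x0M S_M[OF \<omega>] unfolding Mspace_def by (intro span_add span_scale)
      have "x0 \<in> W" using x0\<Omega> W by blast
      from eventually_line[OF W(1) this, of \<omega>] obtain d where "d > 0" "\<And>t. dist t 0 < d \<Longrightarrow> x0 + t *\<^sub>R \<omega> \<in> W"
        unfolding eventually_nhds_metric by blast
      then show ?thesis using that[of d] M W(2) by (auto simp: dist_real_def)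
    qed
    have part: "(\<Sum>n<2 * N. c n * t ^ n) = (\<Sum>j<N. ((t\<^sup>2 / 2) ^ j / fact j) *\<^sub>R ax.H1 (k + j) y0) \<bullet> \<beta>
        + t * L (\<Sum>j<N. ((t\<^sup>2 / 2) ^ j / fact j) *\<^sub>R ax.H2 (k + j) y0)" for t
    proof -
      have "(\<Sum>n<2 * N. c n * t ^ n) = (\<Sum>j<N. a j * (t\<^sup>2) ^ j + t * (a' j * (t\<^sup>2) ^ j))"
        by (induction N) (simp_all add: c_def power_mult[symmetric])
      then show ?thesis
        by (simp add: inner_sum_left linear_sum[OF bounded_linear.linear[OF blL]] a_eq sum.distrib sum_distrib_left
            del: inner_scaleR_left)
    qed
    \<comment> \<open>The bound 1 on |t| absorbs the factor t in front of \<open>L\<close>.\<close>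
    have "\<bar>\<phi> t - (\<Sum>n<2 * N. c n * t ^ n)\<bar> \<le> (K1 * norm \<beta> + K2 * KL) * \<bar>t\<bar> ^ (2 * N)"
      if t: "\<bar>t\<bar> < min (min \<tau>1 \<tau>2) (min \<tau>3 1)" for t
    proof -
      define d1 where "d1 = ax.H1 k (y0 + t *\<^sub>R e) - (\<Sum>j<N. ((t\<^sup>2 / 2) ^ j / fact j) *\<^sub>R ax.H1 (k + j) y0)"
      define d2 where "d2 = ax.H2 k (y0 + t *\<^sub>R e) - (\<Sum>j<N. ((t\<^sup>2 / 2) ^ j / fact j) *\<^sub>R ax.H2 (k + j) y0)"
      have in_\<Omega>: "x0 + t *\<^sub>R \<omega> \<in> \<Omega>" using t \<tau>3(2) by simp
      have "\<phi> t - (\<Sum>n<2 * N. c n * t ^ n) = d1 \<bullet> \<beta> + t * L d2"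
        unfolding \<phi>_eq(1)[OF in_\<Omega>] part
        by (simp add: d1_def d2_def linear_diff[OF bounded_linear.linear[OF blL]] algebra_simps)
      moreover have "\<bar>d1 \<bullet> \<beta>\<bar> \<le> K1 * \<bar>t\<bar> ^ (2 * N) * norm \<beta>"
      proof -
        have "\<bar>d1 \<bullet> \<beta>\<bar> \<le> norm d1 * norm \<beta>" by (rule Cauchy_Schwarz_ineq2)
        also have "\<dots> \<le> K1 * \<bar>t\<bar> ^ (2 * N) * norm \<beta>"
          using 1(2)[of t] t by (intro mult_right_mono) (auto simp: d1_def)
        finally show ?thesis .
      qed
      moreover have "\<bar>t * L d2\<bar> \<le> K2 * \<bar>t\<bar> ^ (2 * N) * KL"
      proof -
        have "\<bar>t * L d2\<bar> \<le> 1 * \<bar>L d2\<bar>" unfolding abs_mult using t by (intro mult_right_mono) auto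
        also have "\<dots> \<le> norm d2 * KL" using KL(2)[of d2] by simp
        also have "\<dots> \<le> K2 * \<bar>t\<bar> ^ (2 * N) * KL"
          using 2(2)[of t] t KL(1) by (intro mult_right_mono) (auto simp: d2_def)
        finally show ?thesis .
      qed
      ultimately show ?thesis by (simp add: algebra_simps)
    qed
    then show "\<exists>K \<tau>. \<tau> > 0 \<and> (\<forall>t. \<bar>t\<bar> < \<tau> \<longrightarrow> \<bar>\<phi> t - (\<Sum>n<2 * N. c n * t ^ n)\<bar> \<le> K * \<bar>t\<bar> ^ (2 * N))"
      using 1(1) 2(1) \<tau>3(1)
      by (intro exI[of _ "K1 * norm \<beta> + K2 * KL"] exI[of _ "min (min \<tau>1 \<tau>2) (min \<tau>3 1)"]) auto
  qed (use r in auto)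
  have eq: "\<phi> t = \<psi> t" if t: "t \<in> {0..<r}" for t
  proof -
    have "\<forall>\<^sub>F t in nhds t. \<phi> t - \<psi> t = 0"
    proof (rule real_analytic_identity[OF _ _ t _ near0])
      show "real_analytic_at (\<lambda>t. \<phi> t - \<psi> t) s" if "s \<in> {0..<r}" for s
        using that by (intro real_analytic_diff ra powser_real_analytic[OF c_sums]) auto
    qed (use r in auto)
    then have "\<phi> t - \<psi> t = 0" by (rule eventually_nhds_x_imp_x)
    then show ?thesis by simp
  qed
  have ev_r: "\<forall>\<^sub>F t in at_left r. t \<in> {0<..<r}" by (rule eventually_at_left_real[OF r])
  \<comment> \<open>The identity with \<psi> holds on [0, r) so far. \<open>F\<close> is an explicit
    formula for \<phi> that is visibly continuous at r.\<close>
  define F where "F t = ax.H1 k (y0 + t *\<^sub>R e) \<bullet> \<beta> + t * L (ax.H2 k (y0 + t *\<^sub>R e))" for t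
  have "isCont F r"
  proof -
    have yU: "y0 + r *\<^sub>R e \<in> U" by (rule \<phi>_eq(2)) (use seg r in auto)
    have "isCont (ax.H1 k) (y0 + r *\<^sub>R e)" "isCont (ax.H2 k) (y0 + r *\<^sub>R e)"
      using smooth_on_continuous[OF ax.smooth_H1] smooth_on_continuous[OF ax.smooth_H2] yU open_U
      by (simp_all add: continuous_on_eq_continuous_at)
    moreover have "isCont (\<lambda>t. y0 + t *\<^sub>R e) r" by (intro continuous_intros)
    ultimately have "isCont (\<lambda>t. ax.H1 k (y0 + t *\<^sub>R e)) r" "isCont (\<lambda>t. ax.H2 k (y0 + t *\<^sub>R e)) r"
      using isCont_o2[where f = "\<lambda>t. y0 + t *\<^sub>R e"] by blast+
    then show ?thesis unfolding F_def
      by (intro continuous_intros bounded_linear.continuous[OF blL])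
  qed
  then have "(F \<longlongrightarrow> F r) (at_left r)"
    unfolding isCont_def by (rule tendsto_within_subset) simp
  moreover have "\<forall>\<^sub>F t in at_left r. F t = \<psi> t"
    using ev_r by eventually_elim (use eq \<phi>_eq(1) seg in \<open>auto simp: F_def\<close>)
  ultimately have lim1: "(\<psi> \<longlongrightarrow> F r) (at_left r)" using tendsto_cong by fast
  \<comment> \<open>Abel's theorem is stated for a variable u tending to 1 from the left; here u =
    (t / r)^2.\<close>
  have fl: "filterlim (\<lambda>t. (t / r)\<^sup>2) (at_left 1) (at_left r)"
    unfolding filterlim_at
  proof
    have "((\<lambda>t. (t / r)\<^sup>2) \<longlongrightarrow> (r / r)\<^sup>2) (at_left r)" by (intro tendsto_intros) (use r in auto)
    then show "((\<lambda>t. (t / r)\<^sup>2) \<longlongrightarrow> 1) (at_left r)" using r by simp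
    show "\<forall>\<^sub>F t in at_left r. (t / r)\<^sup>2 \<in> {..<1} \<and> (t / r)\<^sup>2 \<noteq> 1"
      using ev_r
    proof eventually_elim
      case (elim t)
      then have "(t / r)\<^sup>2 < 1\<^sup>2" by (intro power_strict_mono) auto
      then show ?case by simp
    qed
  qed
  have abel: "((\<lambda>t. \<Sum>j. d j * (t\<^sup>2) ^ j) \<longlongrightarrow> (\<Sum>j. d j * (r\<^sup>2) ^ j)) (at_left r)"
    if d: "summable (\<lambda>j. d j * (r\<^sup>2) ^ j)" for d :: "nat \<Rightarrow> real"
  proof -
    have "d j * (r\<^sup>2) ^ j * ((t / r)\<^sup>2) ^ j = d j * (t\<^sup>2) ^ j" for t j
      using r by (simp add: power_divide)
    then show ?thesis using filterlim_compose[OF Abel_sum[OF d] fl] by (simp only:)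
  qed
  have "(\<psi> \<longlongrightarrow> (\<Sum>j. a j * (r\<^sup>2) ^ j) + r * (\<Sum>j. a' j * (r\<^sup>2) ^ j)) (at_left r)"
    unfolding \<psi>_def by (intro tendsto_intros abel sumA(1) sumB(1))
  then have "F r = (\<Sum>j. a j * (r\<^sup>2) ^ j) + r * (\<Sum>j. a' j * (r\<^sup>2) ^ j)"
    using tendsto_unique[OF _ lim1] by simp
  moreover have "\<Phi> k (x0 + r *\<^sub>R \<omega>) \<bullet> \<beta> = F r"
    using \<Phi>_slice(2)[OF x0 \<omega>, of r k] seg[of r] r
    by (simp add: F_def inner_add_left mul.scaleR_left L_def y0_def)
  ultimately show ?thesis
    by (simp add: sumA(2) sumB(2) inner_add_left mul.scaleR_left L_def y0_def)
qed

lemma GCK_lap_power: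
  assumes k: "2 * k + 1 = q" and x: "x \<in> \<Omega>" and seg: "closed_segment (xpart v p m x) x \<subseteq> \<Omega>"
    and def: "GCK_defined mul v p q m ((lap v p ^^ k) f) x"
  shows "(lap v m ^^ k) f x = gamma_q q *\<^sub>R GCK mul v p q m ((lap v p ^^ k) f) x"
proof -
  define g where "g = (lap v p ^^ k) f"
  have xM: "x \<in> Mspace v m" using x \<Omega>_sub by blast
  define x0 where "x0 = xpart v p m x"
  have x0_eq: "x0 = (\<Sum>s\<le>p. \<xi> s x *\<^sub>R v s)" by (simp add: x0_def parts_eq(1)[OF xM])
  have xp: "x0 \<in> Rp1 v p" unfolding x0_eq Rp1_def by (intro span_sum span_scale span_base) auto
  have x0: "x0 \<in> Z" using seg xp by (auto simp: Z_def x0_def)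
  define r where "r = rd x"
  have r: "r \<ge> 0" by (simp add: r_def rd_nonneg)
  obtain \<omega> where \<omega>: "\<omega> \<in> S" "X x = r *\<^sub>R \<omega>" using X_direction[of x] by (auto simp: r_def)
  have x_eq: "x = x0 + r *\<^sub>R \<omega>" using M_split[OF xM] \<omega>(2) by (simp add: x0_eq)
  have x0\<omega>: "x0 + t *\<^sub>R \<omega> \<in> \<Omega>" if "0 \<le> t" "t \<le> r" "r > 0" for t
  proof -
    have "x0 + t *\<^sub>R \<omega> = (1 - t / r) *\<^sub>R x0 + (t / r) *\<^sub>R x"
      using that by (simp add: x_eq algebra_simps)
    then have "x0 + t *\<^sub>R \<omega> \<in> closed_segment x0 x"
      unfolding in_segment using that by (intro exI[of _ "t / r"]) auto
    then show ?thesis using seg by (auto simp: x0_def)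
  qed
  \<comment> \<open>The factor in front of H1_k when \<open>lap v p\<close> is applied k times at
    radius 0. It is common to both series and, being nonzero, can be removed from the convergence
    hypotheses.\<close>
  define \<gamma> where "\<gamma> = (\<Prod>l<k. - real (2 * l + 1))"
  have \<gamma>0: "\<gamma> \<noteq> 0" unfolding \<gamma>_def by (simp add: add_pos_nonneg less_imp_neq[THEN not_sym] del: of_nat_add of_nat_mult of_nat_Suc)
  have f0: "f z = 1 *\<^sub>R ax.H1 0 (B z)" if "z \<in> Z" for z
    using f_eq[of z] Z_coords[OF that] by simp
  have gZ: "g z = \<gamma> *\<^sub>R ax.H1 k (B z)" if "z \<in> Z" for z
    using lap_power_Z1[OF f0 that, of k] by (simp add: g_def \<gamma>_def)
  define a where "a j = ((r\<^sup>2 / 2) ^ j / fact j) *\<^sub>R ax.H1 (k + j) (B x0)" for j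
  define a' where "a' j = ((r\<^sup>2 / 2) ^ j / fact j) *\<^sub>R ax.H2 (k + j) (B x0)" for j
  have t1: "gck_term1 v p q m g x j = \<gamma> *\<^sub>R a j" for j
  proof -
    have "gck_term1 v p q m g x j = (gck_c1 q j * r ^ (2 * j)) *\<^sub>R ((\<gamma> * (\<Prod>l<j. - real (2 * (k + l) + 1))) *\<^sub>R ax.H1 (k + j) (B x0))"
      using lap_power_Z1[OF gZ x0, of j] by (simp add: gck_term1_def parts_eq(3)[OF xM] x0_def[symmetric] r_def)
    also have "\<dots> = ((gck_c1 q j * (\<Prod>l<j. - real (2 * (k + l) + 1))) * \<gamma> * r ^ (2 * j)) *\<^sub>R ax.H1 (k + j) (B x0)"
      by (simp only: scaleR_scaleR mult_ac)
    also have "\<dots> = \<gamma> *\<^sub>R a j"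
      unfolding gck_c1_prod[OF k[symmetric]] by (simp add: a_def power_mult power_divide)
    finally show ?thesis .
  qed
  have dZ: "dirac mul v p g z = (\<gamma> * real (2 * k + 1)) *\<^sub>R ax.H2 k (B z)" if "z \<in> Z" for z
    by (rule dirac_Z[OF gZ that])
  have t2: "gck_term2 mul v p q m g x j = \<gamma> *\<^sub>R a' j" for j
  proof -
    have "gck_term2 mul v p q m g x j = (gck_c2 q j * r ^ (2 * j)) *\<^sub>R
        ((\<gamma> * real (2 * k + 1) * (\<Prod>l<j. - real (2 * (k + l) + 3))) *\<^sub>R ax.H2 (k + j) (B x0))"
      using lap_power_Z2[OF dZ x0, of j] by (simp add: gck_term2_def parts_eq(3)[OF xM] x0_def[symmetric] r_def)
    also have "\<dots> = ((gck_c2 q j * (real (2 * k + 1) * (\<Prod>l<j. - real (2 * (k + l) + 3)))) * \<gamma> * r ^ (2 * j)) *\<^sub>R ax.H2 (k + j) (B x0)"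
      by (simp only: scaleR_scaleR mult_ac)
    also have "\<dots> = \<gamma> *\<^sub>R a' j"
      unfolding gck_c2_prod[OF k[symmetric]] by (simp add: a'_def power_mult power_divide)
    finally show ?thesis .
  qed
  have "summable (\<lambda>j. \<gamma> *\<^sub>R a j)" "summable (\<lambda>j. \<gamma> *\<^sub>R a' j)"
    using def unfolding GCK_defined_def g_def[symmetric] by (simp_all add: t1[abs_def, symmetric] t2[abs_def, symmetric] eta_contract_eq)
  from this[THEN summable_scaleR_right, of "inverse \<gamma>"]
  have sa: "summable a" and sb: "summable a'" using \<gamma>0 by simp_all
  have GCK: "GCK mul v p q m g x = \<gamma> *\<^sub>R (suminf a + mul (X x) (suminf a'))"
    unfolding GCK_def t1 t2 parts_eq(2)[OF xM] suminf_scaleR_right[OF sa, symmetric] suminf_scaleR_right[OF sb, symmetric]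
    by (simp add: mul.scaleR_right scaleR_add_right)
  have "\<Phi> k x = suminf a + mul (X x) (suminf a')"
  proof (cases "r = 0")
    case True
    then have "x = x0" "X x = 0" using x_eq \<omega>(2) by simp_all
    \<comment> \<open>At radius 0 only the term j = 0 survives, with 0^0 = 1.\<close>
    moreover have "a = (\<lambda>j. if j = 0 then ax.H1 k (B x0) else 0)" using True by (auto simp: a_def fun_eq_iff)
    then have "suminf a = ax.H1 k (B x0)" using sums_single[of 0 "\<lambda>_. ax.H1 k (B x0)"] sums_unique by fastforce
    ultimately show ?thesis by (simp add: \<Phi>_def)
  next
    case False
    then have rp: "r > 0" using r by simp
    have "\<Phi> k (x0 + r *\<^sub>R \<omega>) \<bullet> \<beta> = (suminf a + mul (r *\<^sub>R \<omega>) (suminf a')) \<bullet> \<beta>" for \<beta>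
      using \<Phi>_Taylor_sum[OF k x0 \<omega>(1) rp x0\<omega> sa[unfolded a_def[abs_def]] sb[unfolded a'_def[abs_def]]] rp
      unfolding a_def[abs_def] a'_def[abs_def] by blast
    then have "\<Phi> k (x0 + r *\<^sub>R \<omega>) = suminf a + mul (r *\<^sub>R \<omega>) (suminf a')"
      by (rule euclidean_eqI)
    then show ?thesis by (simp only: \<omega>(2) x_eq[symmetric])
  qed
  then have "(lap v m ^^ k) f x = C k *\<^sub>R (suminf a + mul (X x) (suminf a'))"
    using lap_power[OF x, of k] by simp
  also have "C k = gamma_q q * \<gamma>"
    unfolding C_def \<gamma>_def using gamma_q_prod[OF k[symmetric]] by simp
  finally show ?thesis by (simp add: GCK[unfolded g_def])
qed

end

theorem theorem5p1:
  fixes mul :: "'a::euclidean_space \<Rightarrow> 'a \<Rightarrow> 'a" and one :: 'a and cj :: "'a \<Rightarrow> 'a"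
    and v :: "nat \<Rightarrow> 'a" and m p q :: nat and \<Omega> :: "'a set" and f :: "'a \<Rightarrow> 'a"
  assumes "DIM('a) > 1"
    and "alt_algebra mul one"
    and "anti_involution mul one cj"
    and "sphere_A mul one cj \<noteq> {}"
    and "1 \<le> m" and "p < m" and "q = m - p"
    and "adapted_basis mul one cj v m"
    and "slice_domain v p m \<Omega>" and "p_symmetric v p m \<Omega>"
    and "gps_monogenic mul v p m \<Omega> f"
    and "odd q"
  shows "(\<forall>x\<in>\<Omega>. closed_segment (xpart v p m x) x \<subseteq> \<Omega> \<longrightarrow>
            GCK_defined mul v p q m ((lap v p ^^ ((q - 1) div 2)) f) x \<longrightarrow>
            (lap v m ^^ ((q - 1) div 2)) f x
              = gamma_q q *\<^sub>R GCK mul v p q m ((lap v p ^^ ((q - 1) div 2)) f) x)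
       \<and> monogenic_on mul v m \<Omega> ((lap v m ^^ ((q - 1) div 2)) f)
       \<and> gps_function mul v p m \<Omega> ((lap v m ^^ ((q - 1) div 2)) f)"
proof -
  have ind: "independent (v ` {0..m})" and inj: "inj_on v {0..m}"
    using assms(8) by (simp_all add: adapted_basis_def)
  \<comment> \<open>The m + 1 independent vectors bound m + 1 by the dimension, so enough standard
    basis vectors exist for the model coordinates.\<close>
  have "card {..m} \<le> card (Basis :: 'a set)"
    using independent_bound[OF ind] card_image[OF inj] by simp
  then obtain b where b: "b ` {..m} \<subseteq> (Basis :: 'a set)" "inj_on b {..m}"
    using card_le_inj[of "{..m}" "Basis :: 'a set"] by auto
  \<comment> \<open>A linear map on the whole algebra taking v_t to b_t; its components along the
    b_s are the coordinate functionals \<xi>.\<close>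
  obtain \<Lambda> where \<Lambda>: "linear \<Lambda>" "\<And>z. z \<in> v ` {0..m} \<Longrightarrow> \<Lambda> z = b (inv_into {0..m} v z)"
    using linear_independent_extend[OF ind, of "\<lambda>z. b (inv_into {0..m} v z)"] by blast
  have \<Lambda>_v: "\<Lambda> (v t) = b t" if "t \<le> m" for t
    using \<Lambda>(2)[of "v t"] inv_into_f_f[OF inj, of t] that by simp
  interpret gps_setup mul one cj v m p q \<Omega> f b "\<lambda>s x. \<Lambda> x \<bullet> b s"
  proof (rule gps_setup.intro)
    show "linear (\<lambda>x. \<Lambda> x \<bullet> b s)" for s
      by (rule linearI) (simp_all add: linear_add[OF \<Lambda>(1)] linear_scale[OF \<Lambda>(1)] inner_add_left)
    show "\<Lambda> (v t) \<bullet> b s = (if s = t then 1 else 0)" if "s \<le> m" "t \<le> m" for s t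
    proof -
      have "b s \<in> Basis" "b t \<in> Basis" "b s = b t \<longleftrightarrow> s = t"
        using b that by (auto simp: inj_on_def)
      then show ?thesis using that by (auto simp: \<Lambda>_v inner_Basis)
    qed
  qed (use assms b in auto)
  \<comment> \<open>Oddness of q makes the truncating division exact.\<close>
  have k: "2 * ((q - 1) div 2) + 1 = q" using assms(12) by (auto elim: oddE)
  show ?thesis
    using GCK_lap_power[OF k] monogenic_lap_power[OF k] gps_function_lap_power by blast
qed

end
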